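(* Let $V,U\ge 0$ be independent random variables with $\mathbb{E}[V]=\mathbb{E}[U]=1$, variances satisfying $0<\sigma_V^2+\sigma_U^2<\infty$, and such that for some $\delta_0>0$ the functions $z\mapsto \mathbb{E}[e^{zV}]$ and $z\mapsto\mathbb{E}[e^{zU}]$ are analytic in an open strip containing $-\delta_0\le \mathrm{Re}(z)\le\delta_0$. Assume moreover that the separation assumption (A) of the context holds. Let $\rho_n\in(0,1)$, $n=1,2,\dots$, be such that there are fixed $0<\beta_1\le\beta_2<\infty$ with $(1-\rho_n)\sqrt n\in[\beta_1,\beta_2]$ for all $n$. Let $W_n$ be the steady-state waiting time of the nearly deterministic $\mathrm{GI}_n/\mathrm{G}_n/1$ queue built from $V,U,\rho_n$. For $n$ sufficiently large, let $\zeta_{sp}$ be the saddle point on the negative real axis of $h(\zeta)=\log\psi(-\zeta;\rho_n)$, and put $$\sigma_n=\big(h''(\zeta_{sp})\big)^{1/2},\quad \beta_n=-\zeta_{sp}\,\sigma_n\sqrt n,\quad d_2=-\frac{h'''(\zeta_{sp})}{6h''(\zeta_{sp})},\quad \varphi_n=\frac{d_2}{\sigma_n\sqrt n},$$ $$B_n=\frac{\beta_n}{1+\beta_n\varphi_n},\qquad R_n(s)=\frac{s}{(1+\beta_n\varphi_n)(1+(s+\beta_n)\varphi_n)} .$$ Then for every fixed $k=1,2,\dots$, as $n\to\infty$, $$\mathbb{E}\Big[\Big(\frac{\sqrt n}{\sigma_n}W_n\Big)^k\Big]=(-1)^k\Big(\frac{d}{ds}\Big)^k\Big(\mathbb{E}\big[e^{-R_n(s)M_{B_n}}\big]\Big)\Big|_{s=0}+O\Big(\frac1n\Big)$$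 $$=\frac{m_k(B_n)}{(1+\beta_n\varphi_n)^{2k}}+\frac{k(k-1)\,m_{k-1}(B_n)\,\varphi_n}{(1+\beta_n\varphi_n)^{2k-1}}+O\Big(\frac1n\Big),$$ where $m_k(B_n)=\mathbb{E}[M_{B_n}^k]$.
   Context: Nearly deterministic $\mathrm{GI}_n/\mathrm{G}_n/1$ queue: $V_n=\frac1n\sum_{k=1}^n V_{n,k}$ and $U_n=\frac1n\sum_{k=1}^nU_{n,k}$, where the $V_{n,k}$ are i.i.d. copies of $V$, the $U_{n,k}$ are i.i.d. copies of $U$, and all of these are independent. The steady-state waiting time $W_n\ge0$ is the (finite) random variable whose distribution is the stationary solution of $W_n\stackrel{d}{=}\big(W_n+V_n-\frac1{\rho_n}U_n\big)^+$, where $x^+=\max\{0,x\}$ and on the right-hand side $W_n,V_n,U_n$ are independent. For $\rho\in(0,1]$ let $\psi(s)=\psi(s;\rho)=\mathbb{E}\big[e^{s(V-\frac1\rho U)}\big]$. Assumption (A): there are $\delta>0$ (with $\mathbb{E}[e^{\delta V}]<\infty$, so that the quantities below are defined) and $\varepsilon>0$ such that for all $\rho\in[\frac12,1)$, all $x\in[-\delta,0)$ and all $y\in\mathbb{R}$ with $|y|>\delta$ one has $|\psi(-x+iy;\rho)|<\psi(-x;\rho)-\varepsilon$. Saddle point: $h(\zeta)=\log\psi(-\zeta;\rho_n)$ is, on a sufficiently small fixed interval $[-\delta',0]$, a convex function with $h(0)=0$, $h'(0)=\frac1{\rho_n}-1>0$; for $\rho_n$ sufficiently close to 1 (hence $n$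 sufficiently large) it has a unique point $\zeta_{sp}\in[-\delta',0]$ with $h'(\zeta_{sp})=0$. This $\zeta_{sp}$ (depending on $n$) is the saddle point. Gaussian random walk: for $\beta>0$, $M_\beta=\max_{k\ge0}S_k$, where $S_0=0$ and $S_k$ is the sum of $k$ i.i.d. normal random variables with mean $-\beta$ and variance 1. *)

theory Defs
  imports "HOL-Probability.Probability" "HOL-Library.Landau_Symbols"
begin

text \<open>Integrability is required separately because the Bochner integral of a non-integrable
  function is 0.\<close>

definition mgf_analytic_on_strip :: "'a measure \<Rightarrow> ('a \<Rightarrow> real) \<Rightarrow> real \<Rightarrow> bool" where
  "mgf_analytic_on_strip M X d \<longleftrightarrow>
     (\<exists>a b. a < - d \<and> d < b \<and>
        (\<forall>z::complex. a < Re z \<and> Re z < b \<longrightarrow> integrable M (\<lambda>\<omega>. exp (z * of_real (X \<omega>)))) \<and>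
        (\<lambda>z::complex. \<integral>\<omega>. exp (z * of_real (X \<omega>)) \<partial>M) analytic_on {z. a < Re z \<and> Re z < b})"

definition psi :: "'a measure \<Rightarrow> ('a \<Rightarrow> real) \<Rightarrow> ('a \<Rightarrow> real) \<Rightarrow> real \<Rightarrow> complex \<Rightarrow> complex" where
  "psi M V U \<rho> s = (\<integral>\<omega>. exp (s * of_real (V \<omega> - U \<omega> / \<rho>)) \<partial>M)"

text \<open>On the real axis \<open>psi\<close> is real-valued, so \<open>Re\<close> only changes the type.\<close>

definition separation_assumption :: "'a measure \<Rightarrow> ('a \<Rightarrow> real) \<Rightarrow> ('a \<Rightarrow> real) \<Rightarrow> bool" where
  "separation_assumption M V U \<longleftrightarrow>
     (\<exists>\<delta>>0. \<exists>\<epsilon>>0. integrable M (\<lambda>\<omega>. exp (\<delta> * V \<omega>)) \<and>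
        (\<forall>\<rho>\<in>{1/2..<1}. \<forall>x\<in>{-\<delta>..<0}. \<forall>y::real. \<bar>y\<bar> > \<delta> \<longrightarrow>
           cmod (psi M V U \<rho> (Complex (- x) y)) < Re (psi M V U \<rho> (of_real (- x))) - \<epsilon>))"

definition log_psi :: "'a measure \<Rightarrow> ('a \<Rightarrow> real) \<Rightarrow> ('a \<Rightarrow> real) \<Rightarrow> real \<Rightarrow> real \<Rightarrow> real" where
  "log_psi M V U \<rho> \<zeta> = ln (Re (psi M V U \<rho> (of_real (- \<zeta>))))"

definition is_saddle_point :: "(real \<Rightarrow> real) \<Rightarrow> real \<Rightarrow> real \<Rightarrow> bool" where
  "is_saddle_point h \<delta>' \<zeta> \<longleftrightarrow> \<zeta> \<in> {-\<delta>'..0} \<and> deriv h \<zeta> = 0"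

definition sample_mean_law :: "real measure \<Rightarrow> nat \<Rightarrow> real measure" where
  "sample_mean_law P n = distr (Pi\<^sub>M {1..n} (\<lambda>_. P)) borel (\<lambda>x. (\<Sum>k=1..n. x k) / real n)"

text \<open>\<open>W\<close> is nonnegative and has the same law as \<open>(W' + A - B / \<rho>)\<^sup>+\<close>, where \<open>W'\<close>, \<open>A\<close>, \<open>B\<close> are
  independent, \<open>W'\<close> is distributed as \<open>W\<close>, and \<open>A\<close>, \<open>B\<close> are averages of \<open>n\<close> independent samples
  from \<open>PV\<close> and \<open>PU\<close>; independence is expressed by the product measure.\<close>

definition steady_state_waiting_time ::
  "real measure \<Rightarrow> real measure \<Rightarrow> nat \<Rightarrow> real \<Rightarrow> 'b measure \<Rightarrow> ('b \<Rightarrow> real) \<Rightarrow> bool" where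
  "steady_state_waiting_time PV PU n \<rho> N W \<longleftrightarrow>
     prob_space N \<and> W \<in> borel_measurable N \<and> (AE \<omega> in N. 0 \<le> W \<omega>) \<and>
     distr N borel W =
       distr (distr N borel W \<Otimes>\<^sub>M (sample_mean_law PV n \<Otimes>\<^sub>M sample_mean_law PU n)) borel
         (\<lambda>(w, v, u). max 0 (w + v - u / \<rho>))"

definition gauss_steps :: "real \<Rightarrow> (nat \<Rightarrow> real) measure" where
  "gauss_steps \<beta> = Pi\<^sub>M UNIV (\<lambda>_. density lborel (\<lambda>x. ennreal (normal_density (- \<beta>) 1 x)))"

text \<open>For \<open>\<beta> > 0\<close> the walk tends to \<open>-\<infinity>\<close> almost surely under \<open>gauss_steps \<beta>\<close>, so the
  supremum is almost surely finite and attained.\<close>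

definition walk_max :: "(nat \<Rightarrow> real) \<Rightarrow> real" where
  "walk_max x = (SUP k. \<Sum>i<k. x i)"

definition gauss_max_moment :: "nat \<Rightarrow> real \<Rightarrow> real" where
  "gauss_max_moment k \<beta> = (\<integral>x. walk_max x ^ k \<partial>gauss_steps \<beta>)"

definition gauss_max_laplace :: "real \<Rightarrow> real \<Rightarrow> real" where
  "gauss_max_laplace \<beta> r = (\<integral>x. exp (- r * walk_max x) \<partial>gauss_steps \<beta>)"

end

theory Submission
  imports Defs "HOL-Complex_Analysis.Complex_Analysis" "HOL-Real_Asymp.Real_Asymp"
begin

text \<open>Baxter's identity for the positive part gives Spitzer's formula: the Laplace transform of a
  stationary waiting time is the exponential of \<open>\<Sum>k\<ge>1. E[exp (u S\<^sub>k\<^sup>+) - 1] / k\<close>. Fourier inversion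
  along the vertical line through the saddle point turns the exponent into an integral of
  \<open>- ln (1 - z(t))\<close> against \<open>1/(a + it) - 1/(b + it)\<close>, where \<open>z\<close> is the tilted transform of a step of
  the walk and \<open>a = b - u\<close>. For the queue, \<open>z\<close> agrees up to \<open>O(1/n)\<close>, uniformly on the line, with a
  Gaussian transform times \<open>1 - i \<phi> t\<^sup>3\<close>. After an integration by parts the cubic term amounts to
  the substitution \<open>a \<mapsto> a / (1 + \<phi> a)\<close>, which yields exactly the parameters \<open>B\<^sub>n\<close> and \<open>R\<^sub>n\<close> of the maximum
  of a Gaussian random walk. Both transforms are analytic near \<open>0\<close>, so Cauchy's estimates carry the
  error \<open>O(1/n)\<close> over to all moments.\<close>

text \<open>The weight exp (c x) with c at the saddle point, where the step transform is below 1,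
  makes Lindley's recursion, Spitzer's sum and the logarithm series geometric at once. No moment of
  the stationary waiting time is given, so its exponential moment has first to be extracted from
  stationarity. An error O(1/n) rules out a plain central limit comparison: \<phi> has order
  n^(-1/2), so the cubic term must be kept and only \<phi>^2 may be dropped. The map a \<mapsto> a /
  (1 + \<phi> a) adds \<phi> to 1 / a and changes 1 / (a + it) by \<phi> a^2 / (a + it)^2 to first
  order. The cubic term, integrated by parts, gives the same expression up to a part free of a,
  which cancels in a difference of two resolvents. Neither transform is expanded in n: both are
  exponentials of integrals of one kind, and close exponents give a small relative error. Bounds
  must be uniform in the traffic intensity, hence the step is dominated by V + 2 U. Assumption (A)
  is silent about frequencies up to \<delta>; decay there is obtained by doubling the frequency
  until it exceeds \<delta>.\<close>

section \<open>Laws with an exponential upper tail, and Baxter's identity\<close>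

definition pos_law :: "real measure \<Rightarrow> real measure" where
  "pos_law A = distr A borel (max 0)"

text \<open>Only the upper tail is weighted, since the transforms see positive parts; the lower tail
  is arbitrary. For c = 0 nothing remains but a probability law on the Borel sets.\<close>

definition exp_law :: "real \<Rightarrow> real measure \<Rightarrow> bool" where
  "exp_law c A \<longleftrightarrow> prob_space A \<and> sets A = sets borel \<and> integrable A (\<lambda>x. exp (c * max 0 x))"

text \<open>Test functions that every \<open>exp_law c\<close> integrates. Values lie in an
  arbitrary Banach space, so that real weights and complex exponentials are handled
  together.\<close>

definition exp_bounded :: "real \<Rightarrow> (real \<Rightarrow> 'b::{banach, second_countable_topology}) \<Rightarrow> bool" where
  "exp_bounded c f \<longleftrightarrow>
     f \<in> borel_measurable borel \<and> (\<exists>C. \<forall>x. norm (f x) \<le> C * exp (c * max 0 x))"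

lemma exp_lawD:
  assumes "exp_law c A"
  shows "prob_space A" "sets A = sets borel" "finite_measure A" "sigma_finite_measure A"
    "space A = UNIV" "emeasure A (space A) = 1"
  using assms sets_eq_imp_space_eq[of A borel] prob_space.emeasure_space_1[of A]
  by (auto simp: exp_law_def
      intro: prob_space.finite_measure finite_measure.sigma_finite_measure)

lemma exp_bounded_mono: "exp_bounded 0 f \<Longrightarrow> 0 \<le> c \<Longrightarrow> exp_bounded c f"
  unfolding exp_bounded_def
proof safe
  fix C assume "\<forall>x. norm (f x) \<le> C * exp (0 * max 0 x)" "0 \<le> c"
  then have "norm (f x) \<le> C * 1" for x by simp
  moreover have "C * 1 \<le> \<bar>C\<bar> * exp (c * max 0 x)" for x
    using \<open>0 \<le> c\<close> by (intro mult_mono) auto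
  ultimately have "norm (f x) \<le> \<bar>C\<bar> * exp (c * max 0 x)" for x
    by (meson order_trans)
  then show "\<exists>C. \<forall>x. norm (f x) \<le> C * exp (c * max 0 x)" by blast
qed

lemma integrable_exp_law:
  assumes A: "exp_law c A" and f: "exp_bounded c f"
  shows "integrable A f"
proof -
  obtain C where C: "\<And>x. norm (f x) \<le> C * exp (c * max 0 x)"
    using f by (auto simp: exp_bounded_def)
  have "f \<in> borel_measurable A"
    using f measurable_cong_sets[OF exp_lawD(2)[OF A] refl] by (auto simp: exp_bounded_def)
  moreover have "integrable A (\<lambda>x. C * exp (c * max 0 x))"
    using A by (auto simp: exp_law_def)
  moreover have "AE x in A. norm (f x) \<le> norm (C * exp (c * max 0 x))"
    using C by (auto intro: order_trans[OF C abs_ge_self[folded real_norm_def]])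
  ultimately show ?thesis
    by (metis Bochner_Integration.integrable_bound)
qed

lemma integrable_pair_mult:
  fixes f g :: "real \<Rightarrow> real"
  assumes "sigma_finite_measure A" "sigma_finite_measure B"
    and f: "integrable A f" and g: "integrable B g"
  shows "integrable (A \<Otimes>\<^sub>M B) (\<lambda>(x, y). f x * g y)"
proof -
  interpret B: sigma_finite_measure B by fact
  interpret A: sigma_finite_measure A by fact
  interpret pair_sigma_finite A B ..
  have [measurable]: "f \<in> borel_measurable A" "g \<in> borel_measurable B" using f g by auto
  show ?thesis
    by (rule Fubini_integrable) (use f g in \<open>auto simp: norm_mult abs_mult intro!: integrable_mult_left\<close>)
qed

text \<open>By \<open>g_le\<close> the weight of \<open>g (x, y)\<close> is at most the product of
  the weights of x and y. The combinations of sums and positive parts to which this is applied all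
  satisfy \<open>g_le\<close>.\<close>

lemma integrable_pair_exp_law:
  fixes f :: "real \<Rightarrow> 'b::{banach, second_countable_topology}"
  assumes A: "exp_law c A" and B: "exp_law c B" and f: "exp_bounded c f"
    and c: "0 \<le> c"
    and g: "g \<in> borel_measurable (borel \<Otimes>\<^sub>M borel)"
    and g_le: "\<And>x y. max 0 (g (x, y)) \<le> max 0 x + max 0 y"
  shows "integrable (A \<Otimes>\<^sub>M B) (\<lambda>p. f (g p))"
proof -
  interpret B: sigma_finite_measure B using exp_lawD[OF B] by simp
  interpret A: sigma_finite_measure A using exp_lawD[OF A] by simp
  interpret pair_sigma_finite A B ..
  note [measurable_cong] = exp_lawD(2)[OF A] exp_lawD(2)[OF B]
  obtain C where C: "\<And>x. norm (f x) \<le> C * exp (c * max 0 x)"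
    using f by (auto simp: exp_bounded_def)
  have C0: "C \<ge> 0" using order_trans[OF norm_ge_zero C, of 0] by simp
  have "f \<in> borel_measurable borel" using f by (auto simp: exp_bounded_def)
  moreover have "g \<in> borel_measurable (A \<Otimes>\<^sub>M B)" using g by simp
  ultimately have meas: "(\<lambda>p. f (g p)) \<in> borel_measurable (A \<Otimes>\<^sub>M B)"
    by (rule measurable_compose[rotated])
  have "integrable (A \<Otimes>\<^sub>M B) (\<lambda>(x, y). exp (c * max 0 x) * exp (c * max 0 y))"
    using A B by (intro integrable_pair_mult exp_lawD[OF A] exp_lawD[OF B]) (auto simp: exp_law_def)
  then have "integrable (A \<Otimes>\<^sub>M B) (\<lambda>p. C * (case p of (x, y) \<Rightarrow> exp (c * max 0 x) * exp (c * max 0 y)))"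
    by simp
  then show ?thesis
  proof (rule Bochner_Integration.integrable_bound)
    have "norm (f (g (x, y))) \<le> C * (exp (c * max 0 x) * exp (c * max 0 y))" for x y
    proof -
      have "norm (f (g (x, y))) \<le> C * exp (c * max 0 (g (x, y)))" by (rule C)
      also have "\<dots> \<le> C * exp (c * (max 0 x + max 0 y))"
        using C0 c g_le by (intro mult_left_mono) (auto intro!: mult_left_mono)
      finally show ?thesis by (simp add: exp_add distrib_left)
    qed
    then show "AE p in A \<Otimes>\<^sub>M B. norm (f (g p)) \<le>
        norm (C * (case p of (x, y) \<Rightarrow> exp (c * max 0 x) * exp (c * max 0 y)))"
      using C0 by auto
  qed (rule meas)
qed

lemma exp_bounded_exp: "exp_bounded c (\<lambda>x. exp (c * max 0 x))"
  by (auto simp: exp_bounded_def intro!: exI[of _ 1])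

lemma exp_law_convolution:
  assumes A: "exp_law c A" and B: "exp_law c B" and c: "0 \<le> c"
  shows "exp_law c (A \<star> B)"
proof -
  note [measurable_cong] = exp_lawD(2)[OF A] exp_lawD(2)[OF B]
  interpret A: prob_space A using exp_lawD[OF A] by simp
  interpret B: prob_space B using exp_lawD[OF B] by simp
  interpret pair_prob_space A B ..
  have "prob_space (A \<star> B)"
    unfolding convolution_def by (rule prob_space_distr) simp
  moreover have "integrable (A \<star> B) (\<lambda>x. exp (c * max 0 x))"
    unfolding convolution_def
    using integrable_pair_exp_law[OF A B exp_bounded_exp c, of "\<lambda>(x, y). x + y"]
    by (subst integrable_distr_eq) (auto simp: split_beta')
  ultimately show ?thesis by (simp add: exp_law_def)
qed

lemma exp_law_pos_law:
  assumes A: "exp_law c A"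
  shows "exp_law c (pos_law A)"
proof -
  note [measurable_cong] = exp_lawD(2)[OF A]
  interpret A: prob_space A using exp_lawD[OF A] by simp
  have "prob_space (pos_law A)"
    unfolding pos_law_def by (rule A.prob_space_distr) simp
  moreover have "integrable (pos_law A) (\<lambda>x. exp (c * max 0 x))"
    unfolding pos_law_def using A
    by (subst integrable_distr_eq) (auto simp: exp_law_def)
  ultimately show ?thesis by (simp add: exp_law_def pos_law_def)
qed

lemma exp_law_return: "exp_law c (return borel x)"
  unfolding exp_law_def
  by (auto intro!: prob_space_return integrableI_bounded simp: nn_integral_return)

lemma integral_convolution_exp_law:
  fixes f :: "real \<Rightarrow> 'b::{banach, second_countable_topology}"
  assumes A: "exp_law c A" and B: "exp_law c B" and f: "exp_bounded c f"
  shows "(\<integral>x. f x \<partial>(A \<star> B)) = (\<integral>p. f (fst p + snd p) \<partial>(A \<Otimes>\<^sub>M B))"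
proof -
  note [measurable_cong] = exp_lawD(2)[OF A] exp_lawD(2)[OF B]
  have [measurable]: "f \<in> borel_measurable borel" using f by (auto simp: exp_bounded_def)
  show ?thesis unfolding convolution_def
    by (subst integral_distr) (auto simp: split_beta')
qed

lemma integral_pos_law:
  fixes f :: "real \<Rightarrow> 'b::{banach, second_countable_topology}"
  assumes A: "exp_law c A" and f: "exp_bounded c f"
  shows "(\<integral>x. f x \<partial>pos_law A) = (\<integral>x. f (max 0 x) \<partial>A)"
proof -
  note [measurable_cong] = exp_lawD(2)[OF A]
  have [measurable]: "f \<in> borel_measurable borel" using f by (auto simp: exp_bounded_def)
  show ?thesis unfolding pos_law_def
    by (subst integral_distr) auto
qed

lemma exp_bounded_comp_max: "exp_bounded c f \<Longrightarrow> exp_bounded c (\<lambda>x. f (max 0 x))"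
  unfolding exp_bounded_def
proof safe
  assume [measurable]: "f \<in> borel_measurable borel"
  show "(\<lambda>x. f (max 0 x)) \<in> borel_measurable borel" by measurable
  fix C assume "\<forall>x. norm (f x) \<le> C * exp (c * max 0 x)"
  then have "\<forall>x. norm (f (max 0 x)) \<le> C * exp (c * max 0 x)" by (metis max.left_idem)
  then show "\<exists>C. \<forall>x. norm (f (max 0 x)) \<le> C * exp (c * max 0 x)" by blast
qed

text \<open>All three laws become images of the one product space of A and B, so that identities
  between them can be checked pointwise.\<close>

lemma convolution_pos_law:
  assumes A: "exp_law c A" and B: "exp_law c B"
  shows "A \<star> pos_law B = distr (A \<Otimes>\<^sub>M B) borel (\<lambda>p. fst p + max 0 (snd p))"
    and "pos_law A \<star> B = distr (A \<Otimes>\<^sub>M B) borel (\<lambda>p. max 0 (fst p) + snd p)"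
    and "pos_law A \<star> pos_law B = distr (A \<Otimes>\<^sub>M B) borel (\<lambda>p. max 0 (fst p) + max 0 (snd p))"
proof -
  note [measurable_cong] = exp_lawD(2)[OF A] exp_lawD(2)[OF B]
  have sA: "sigma_finite_measure (pos_law A)" and sB: "sigma_finite_measure (pos_law B)"
    and sB': "sigma_finite_measure B"
    using exp_lawD[OF exp_law_pos_law[OF A]] exp_lawD[OF exp_law_pos_law[OF B]] exp_lawD[OF B]
    by auto
  have idA: "distr A borel (\<lambda>x. x) = A" and idB: "distr B borel (\<lambda>x. x) = B"
    using distr_id2[OF exp_lawD(2)[OF A, symmetric]] distr_id2[OF exp_lawD(2)[OF B, symmetric]] by auto
  have mA: "max 0 \<in> borel_measurable A" and mB: "max 0 \<in> borel_measurable B"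
    and iA: "(\<lambda>x. x) \<in> borel_measurable A" and iB: "(\<lambda>x. x) \<in> borel_measurable B"
    by simp_all
  have "A \<Otimes>\<^sub>M pos_law B = distr (A \<Otimes>\<^sub>M B) (borel \<Otimes>\<^sub>M borel) (\<lambda>(x, y). (x, max 0 y))"
    using pair_measure_distr[OF iA mB] sB by (simp only: idA pos_law_def)
  then show "A \<star> pos_law B = distr (A \<Otimes>\<^sub>M B) borel (\<lambda>p. fst p + max 0 (snd p))"
    unfolding convolution_def by (simp add: distr_distr comp_def split_beta')
  have "pos_law A \<Otimes>\<^sub>M B = distr (A \<Otimes>\<^sub>M B) (borel \<Otimes>\<^sub>M borel) (\<lambda>(x, y). (max 0 x, y))"
    using pair_measure_distr[OF mA iB] sB' by (simp only: idB pos_law_def)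
  then show "pos_law A \<star> B = distr (A \<Otimes>\<^sub>M B) borel (\<lambda>p. max 0 (fst p) + snd p)"
    unfolding convolution_def by (simp add: distr_distr comp_def split_beta')
  have "pos_law A \<Otimes>\<^sub>M pos_law B = distr (A \<Otimes>\<^sub>M B) (borel \<Otimes>\<^sub>M borel) (\<lambda>(x, y). (max 0 x, max 0 y))"
    using pair_measure_distr[OF mA mB] sB by (simp only: pos_law_def)
  then show "pos_law A \<star> pos_law B = distr (A \<Otimes>\<^sub>M B) borel (\<lambda>p. max 0 (fst p) + max 0 (snd p))"
    unfolding convolution_def by (simp add: distr_distr comp_def split_beta')
qed

text \<open>True pointwise on the product space: whatever the signs of x and y, the values x^+ + y^+
  and (x + y)^+ on the left are the values (x + y^+)^+ and (x^+ + y)^+ on the right in some order.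
  Integrability lets the integrals be added.\<close>

lemma baxter_identity:
  fixes f :: "real \<Rightarrow> 'b::{banach, second_countable_topology}"
  assumes A: "exp_law c A" and B: "exp_law c B" and f: "exp_bounded c f" and c: "0 \<le> c"
  shows "(\<integral>x. f x \<partial>(pos_law A \<star> pos_law B)) + (\<integral>x. f x \<partial>pos_law (A \<star> B)) =
    (\<integral>x. f x \<partial>pos_law (A \<star> pos_law B)) + (\<integral>x. f x \<partial>pos_law (pos_law A \<star> B))"
proof -
  note [measurable_cong] = exp_lawD(2)[OF A] exp_lawD(2)[OF B]
  have [measurable]: "f \<in> borel_measurable borel" using f by (auto simp: exp_bounded_def)
  let ?P = "A \<Otimes>\<^sub>M B"
  have int: "integrable ?P (\<lambda>p. f (max 0 (fst p) + max 0 (snd p)))"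
     "integrable ?P (\<lambda>p. f (max 0 (fst p + snd p)))"
     "integrable ?P (\<lambda>p. f (max 0 (fst p + max 0 (snd p))))"
     "integrable ?P (\<lambda>p. f (max 0 (max 0 (fst p) + snd p)))"
    by (rule integrable_pair_exp_law[OF A B f c]; simp)+
  have 1: "(\<integral>x. f x \<partial>(pos_law A \<star> pos_law B)) = (\<integral>p. f (max 0 (fst p) + max 0 (snd p)) \<partial>?P)"
    unfolding convolution_pos_law[OF A B] by (subst integral_distr) auto
  have 2: "(\<integral>x. f x \<partial>pos_law (A \<star> B)) = (\<integral>p. f (max 0 (fst p + snd p)) \<partial>?P)"
    by (simp add: integral_pos_law[OF exp_law_convolution[OF A B c] f]
        integral_convolution_exp_law[OF A B exp_bounded_comp_max[OF f]])
  have 3: "(\<integral>x. f x \<partial>pos_law (A \<star> pos_law B)) = (\<integral>p. f (max 0 (fst p + max 0 (snd p))) \<partial>?P)"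
    by (subst integral_pos_law[OF exp_law_convolution[OF A exp_law_pos_law[OF B] c] f],
        subst convolution_pos_law[OF A B], subst integral_distr) auto
  have 4: "(\<integral>x. f x \<partial>pos_law (pos_law A \<star> B)) = (\<integral>p. f (max 0 (max 0 (fst p) + snd p)) \<partial>?P)"
    by (subst integral_pos_law[OF exp_law_convolution[OF exp_law_pos_law[OF A] B c] f],
        subst convolution_pos_law[OF A B], subst integral_distr) auto
  have pt: "f (max 0 x + max 0 y) + f (max 0 (x + y)) =
      f (max 0 (x + max 0 y)) + f (max 0 (max 0 x + y))" for x y
    by (cases "x \<ge> 0"; cases "y \<ge> 0") (auto simp: max_def add.commute)
  show ?thesis
    unfolding 1 2 3 4 using int
    by (simp flip: Bochner_Integration.integral_add add: pt)
qed

section \<open>Spitzer's identity\<close>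

text \<open>The recursion is the coefficient form of F' = E' F for the power series F with
  coefficients q n and E with coefficients d k / k, hence F = exp E. The geometric bounds push both
  radii of convergence beyond 1, so the identity may be evaluated at 1.\<close>

lemma exp_power_series_recursion:
  fixes q d :: "nat \<Rightarrow> complex"
  assumes r: "0 < r" "r < 1"
    and d_bound: "\<And>k. norm (d k) \<le> C * r ^ k" and q_bound: "\<And>n. norm (q n) \<le> D * r ^ n"
    and q0: "q 0 = 1"
    and rec: "\<And>n. of_nat n * q n = (\<Sum>k=1..n. d k * q (n - k))"
  shows "q sums exp (\<Sum>k. d (Suc k) / of_nat (Suc k))"
proof -
  define F where "F = Abs_fps q"
  define E where "E = Abs_fps (\<lambda>k. d k / of_nat k)"
  have deriv: "fps_deriv F = fps_deriv E * F"
  proof (rule fps_ext)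
    fix n
    have "fps_nth (fps_deriv F) n = of_nat (Suc n) * q (Suc n)"
      by (simp add: F_def)
    also have "\<dots> = (\<Sum>k=1..Suc n. d k * q (Suc n - k))" by (rule rec)
    also have "\<dots> = (\<Sum>k=0..n. d (Suc k) * q (n - k))"
      unfolding One_nat_def by (subst sum.shift_bounds_cl_Suc_ivl) simp
    also have "\<dots> = (\<Sum>k=0..n. fps_nth (fps_deriv E) k * fps_nth F (n - k))"
    proof (rule sum.cong)
      fix k
      have "(of_nat (Suc k) :: complex) \<noteq> 0" by (rule of_nat_neq_0)
      then show "d (Suc k) * q (n - k) = fps_nth (fps_deriv E) k * fps_nth F (n - k)"
        unfolding E_def F_def fps_deriv_nth by (simp add: field_simps)
    qed simp
    finally show "fps_nth (fps_deriv F) n = fps_nth (fps_deriv E * F) n"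
      by (simp add: fps_mult_nth)
  qed
  \<comment> \<open>Any point strictly between 1 and 1 / r serves; this is the midpoint.\<close>
  define R where "R = (1 + 1 / r) / 2"
  have R: "1 < R" "r * R < 1" "R > 0"
    using r by (auto simp: R_def field_simps)
  have radius: "ereal R \<le> fps_conv_radius (Abs_fps a)" if a: "\<And>n. norm (a n) \<le> K * r ^ n" for a :: "nat \<Rightarrow> complex" and K
  proof -
    have "summable (\<lambda>n. a n * of_real R ^ n)"
    proof (rule summable_comparison_test)
      show "summable (\<lambda>n. K * (r * R) ^ n)"
        using R r by (intro summable_mult summable_geometric) auto
      have "norm (a n * of_real R ^ n) \<le> K * (r * R) ^ n" for n
        using mult_right_mono[OF a, of "R ^ n" n] R
        by (simp add: norm_mult norm_power power_mult_distrib mult.assoc)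
      then show "\<exists>N. \<forall>n\<ge>N. norm (a n * of_real R ^ n) \<le> K * (r * R) ^ n" by blast
    qed
    from conv_radius_geI[OF this] show ?thesis
      using R by (simp add: fps_conv_radius_def)
  qed
  have rF: "ereal R \<le> fps_conv_radius F" unfolding F_def by (rule radius[OF q_bound])
  have "norm (d k / of_nat k) \<le> \<bar>C\<bar> * r ^ k" for k
  proof (cases "k = 0")
    case False
    then have "norm (d k / of_nat k) \<le> norm (d k)"
      by (simp add: norm_divide divide_le_eq mult_le_cancel_left1)
    also have "\<dots> \<le> \<bar>C\<bar> * r ^ k"
      using r by (intro order_trans[OF d_bound[of k]] mult_right_mono) auto
    finally show ?thesis .
  qed simp
  then have rE: "ereal R \<le> fps_conv_radius E" unfolding E_def by (rule radius)
  have rE': "ereal R \<le> fps_conv_radius (fps_deriv E)"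
    by (rule order_trans[OF rE fps_conv_radius_deriv])
  \<comment> \<open>F exp (-E) has derivative 0 on the disc, and its value at 0 is q 0 = 1.\<close>
  define g where "g = (\<lambda>z. eval_fps F z * exp (- eval_fps E z))"
  have dg: "(g has_field_derivative 0) (at z)" if z: "norm z < R" for z
  proof -
    have zF: "ereal (norm z) < fps_conv_radius F" and zE: "ereal (norm z) < fps_conv_radius E"
      and zE': "ereal (norm z) < fps_conv_radius (fps_deriv E)"
      using z rF rE rE' by (auto intro: less_le_trans[of _ "ereal R"])
    have "(g has_field_derivative
      (eval_fps (fps_deriv F) z * exp (- eval_fps E z)
        + eval_fps F z * (exp (- eval_fps E z) * - eval_fps (fps_deriv E) z))) (at z)"
      unfolding g_def
      by (rule derivative_eq_intros has_field_derivative_eval_fps[OF zF] has_field_derivative_eval_fps[OF zE] refl)+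
        (simp add: algebra_simps)
    moreover have "eval_fps (fps_deriv F) z = eval_fps (fps_deriv E) z * eval_fps F z"
      unfolding deriv by (rule eval_fps_mult[OF zE' zF])
    ultimately show ?thesis by simp
  qed
  have "g 1 = g 0"
  proof (rule DERIV_zero_connected_constant[of "ball 0 R" "{}"])
    show "continuous_on (ball 0 R) g"
      by (intro DERIV_continuous_on) (auto intro: has_field_derivative_at_within dg)
  qed (use R in \<open>auto intro: dg\<close>)
  then have "eval_fps F 1 * exp (- eval_fps E 1) = 1"
    by (simp add: g_def eval_fps_at_0 F_def E_def q0)
  then have val: "eval_fps F 1 = exp (eval_fps E 1)"
    by (simp add: exp_minus field_simps)
  have n1F: "ereal (norm (1::complex)) < fps_conv_radius F" and n1E: "ereal (norm (1::complex)) < fps_conv_radius E"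
    using R rF rE by (auto intro: less_le_trans[of _ "ereal R"])
  have "q sums eval_fps F 1"
    using sums_eval_fps[OF n1F] by (simp add: F_def)
  have "(\<lambda>k. d k / of_nat k) sums eval_fps E 1"
    using sums_eval_fps[OF n1E] by (simp add: E_def)
  \<comment> \<open>The coefficient of E at index 0 is \<open>d 0 / 0\<close>, that is 0, so the
    index shift loses nothing.\<close>
  then have "(\<lambda>k. d (Suc k) / of_nat (Suc k)) sums eval_fps E 1"
    by (subst sums_Suc_iff) simp
  with val \<open>q sums eval_fps F 1\<close> show ?thesis by (simp add: sums_iff)
qed

section \<open>Random walk and Lindley's recursion\<close>

primrec walk_law :: "real measure \<Rightarrow> nat \<Rightarrow> real measure" where
  "walk_law \<mu> 0 = return borel 0"
| "walk_law \<mu> (Suc k) = (\<mu> \<star> walk_law \<mu> k)"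

primrec wait_law :: "real measure \<Rightarrow> nat \<Rightarrow> real measure" where
  "wait_law \<mu> 0 = return borel 0"
| "wait_law \<mu> (Suc n) = pos_law (wait_law \<mu> n \<star> \<mu>)"

text \<open>Transition operator of Lindley's recursion on test functions, dual to the passage from
  one \<open>wait_law\<close> to the next.\<close>

definition lindley_op ::
  "real measure \<Rightarrow> (real \<Rightarrow> 'b::{banach, second_countable_topology}) \<Rightarrow> real \<Rightarrow> 'b" where
  "lindley_op \<mu> f y = (\<integral>x. f (max 0 (y + x)) \<partial>\<mu>)"

lemma exp_law_walk_law: "exp_law c \<mu> \<Longrightarrow> 0 \<le> c \<Longrightarrow> exp_law c (walk_law \<mu> k)"
  by (induction k) (auto intro: exp_law_return exp_law_convolution)

lemma exp_law_wait_law: "exp_law c \<mu> \<Longrightarrow> 0 \<le> c \<Longrightarrow> exp_law c (wait_law \<mu> k)"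
  by (induction k) (auto intro: exp_law_return exp_law_convolution exp_law_pos_law)

lemma exp_law_0:
  assumes "prob_space A" "sets A = sets borel"
  shows "exp_law 0 A"
  using assms finite_measure.integrable_const[OF prob_space.finite_measure[OF assms(1)]]
  by (auto simp: exp_law_def)

lemma pos_law_return: "pos_law (return borel 0) = return borel 0"
  unfolding pos_law_def by (subst distr_return) auto

lemma pos_law_idem: "pos_law (pos_law A) = pos_law A" if "sets A = sets borel"
proof -
  note [measurable_cong] = that
  show ?thesis unfolding pos_law_def by (subst distr_distr) (auto simp: comp_def intro!: distr_cong)
qed

lemma pos_law_wait_law: "pos_law (wait_law \<mu> n) = wait_law \<mu> n"
  by (cases n) (simp_all add: pos_law_return pos_law_idem)

lemma convolution_return:
  assumes A: "exp_law c A"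
  shows "A \<star> return borel 0 = A"
proof (rule measure_eqI)
  fix S assume "S \<in> sets (A \<star> return borel 0)"
  then have S [measurable]: "S \<in> sets borel" by simp
  have "emeasure (A \<star> return borel 0) S = (\<integral>\<^sup>+x. emeasure (return borel (0::real)) {a. a + x \<in> S} \<partial>A)"
    using exp_lawD[OF A] exp_lawD[OF exp_law_return[of c 0]]
    by (intro convolution_emeasure S) auto
  also have "\<dots> = (\<integral>\<^sup>+x. indicator S x \<partial>A)"
  proof (rule nn_integral_cong)
    fix x :: real
    have "{a. a + x \<in> S} \<in> sets borel" by measurable
    then show "emeasure (return borel (0::real)) {a. a + x \<in> S} = indicator S x"
      by (auto simp: indicator_def)
  qed
  also have "\<dots> = emeasure A S"
    using S exp_lawD(2)[OF A] by (subst nn_integral_indicator) auto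
  finally show "emeasure (A \<star> return borel 0) S = emeasure A S" .
qed (simp add: exp_lawD[OF A])

text \<open>Besides duality, the weighted class is preserved: (y + x)^+ \<le> y^+ + x^+ costs only a
  constant factor, the exponential moment of \<mu>. This is what allows the operator to be
  iterated.\<close>

lemma integral_lindley_op:
  fixes f :: "real \<Rightarrow> 'b::{banach, second_countable_topology}"
  assumes A: "exp_law c A" and \<mu>: "exp_law c \<mu>" and f: "exp_bounded c f" and c: "0 \<le> c"
  shows "(\<integral>x. f x \<partial>pos_law (A \<star> \<mu>)) = (\<integral>y. lindley_op \<mu> f y \<partial>A)"
    and "exp_bounded c (lindley_op \<mu> f)"
proof -
  note [measurable_cong] = exp_lawD(2)[OF A] exp_lawD(2)[OF \<mu>]
  have [measurable]: "f \<in> borel_measurable borel" using f by (auto simp: exp_bounded_def)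
  interpret A: sigma_finite_measure A using exp_lawD[OF A] by simp
  interpret m: prob_space \<mu> using exp_lawD[OF \<mu>] by simp
  interpret pair_sigma_finite A \<mu> ..
  have "(\<integral>x. f x \<partial>pos_law (A \<star> \<mu>)) = (\<integral>p. f (max 0 (fst p + snd p)) \<partial>(A \<Otimes>\<^sub>M \<mu>))"
    by (simp add: integral_pos_law[OF exp_law_convolution[OF A \<mu> c] f]
        integral_convolution_exp_law[OF A \<mu> exp_bounded_comp_max[OF f]])
  also have "\<dots> = (\<integral>y. lindley_op \<mu> f y \<partial>A)"
    unfolding lindley_op_def
    using integrable_pair_exp_law[OF A \<mu> f c, of "\<lambda>p. max 0 (fst p + snd p)"]
    by (subst integral_fst'[symmetric]) auto
  finally show "(\<integral>x. f x \<partial>pos_law (A \<star> \<mu>)) = (\<integral>y. lindley_op \<mu> f y \<partial>A)" .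
  have meas: "lindley_op \<mu> f \<in> borel_measurable borel"
    unfolding lindley_op_def by measurable
  obtain C where C: "\<And>x. norm (f x) \<le> C * exp (c * max 0 x)"
    using f by (auto simp: exp_bounded_def)
  have C0: "C \<ge> 0" using order_trans[OF norm_ge_zero C, of 0] by simp
  let ?K = "C * (\<integral>x. exp (c * max 0 x) \<partial>\<mu>)"
  have "norm (lindley_op \<mu> f y) \<le> ?K * exp (c * max 0 y)" for y
  proof -
    have "norm (lindley_op \<mu> f y) \<le> (\<integral>x. C * exp (c * max 0 y) * exp (c * max 0 x) \<partial>\<mu>)"
      unfolding lindley_op_def
    proof (rule Bochner_Integration.integral_norm_bound_integral)
      show "integrable \<mu> (\<lambda>x. f (max 0 (y + x)))"
      proof (rule Bochner_Integration.integrable_bound)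
        show "integrable \<mu> (\<lambda>x. C * exp (c * max 0 y) * exp (c * max 0 x))"
          using \<mu> by (auto simp: exp_law_def)
        show "AE x in \<mu>. norm (f (max 0 (y + x))) \<le> norm (C * exp (c * max 0 y) * exp (c * max 0 x))"
        proof (rule AE_I2)
          fix x
          have "norm (f (max 0 (y + x))) \<le> C * exp (c * max 0 (y + x))"
            using C[of "max 0 (y + x)"] by simp
          also have "\<dots> \<le> C * exp (c * (max 0 y + max 0 x))"
            using C0 c by (intro mult_left_mono) (auto intro!: mult_left_mono)
          finally show "norm (f (max 0 (y + x))) \<le> norm (C * exp (c * max 0 y) * exp (c * max 0 x))"
            using C0 by (simp add: exp_add distrib_left mult.assoc)
        qed
      qed simp
      show "integrable \<mu> (\<lambda>x. C * exp (c * max 0 y) * exp (c * max 0 x))"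
        using \<mu> by (auto simp: exp_law_def)
      fix x
      have "norm (f (max 0 (y + x))) \<le> C * exp (c * max 0 (y + x))"
        using C[of "max 0 (y + x)"] by simp
      also have "\<dots> \<le> C * exp (c * (max 0 y + max 0 x))"
        using C0 c by (intro mult_left_mono) (auto intro!: mult_left_mono)
      finally show "norm (f (max 0 (y + x))) \<le> C * exp (c * max 0 y) * exp (c * max 0 x)"
        by (simp add: exp_add distrib_left mult.assoc)
    qed
    then show ?thesis by (simp add: mult_ac)
  qed
  with meas show "exp_bounded c (lindley_op \<mu> f)"
    by (auto simp: exp_bounded_def)
qed

text \<open>This is n E f(W_n) = E f(S_1^+ + W_(n-1)) + ... + E f(S_n^+ + W_0), with independent
  summands, before any multiplicativity of f enters. The induction must run over all f at once,
  because its hypothesis is applied to \<open>lindley_op \<mu> f\<close>.\<close>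

lemma spitzer_recursion:
  fixes f :: "real \<Rightarrow> 'b::{banach, second_countable_topology}"
  assumes \<mu>: "exp_law c \<mu>" and f: "exp_bounded c f" and c: "0 \<le> c"
  shows "real n *\<^sub>R (\<integral>x. f x \<partial>wait_law \<mu> n) =
    (\<Sum>k=1..n. \<integral>x. f x \<partial>(pos_law (walk_law \<mu> k) \<star> wait_law \<mu> (n - k)))"
  using f
proof (induction n arbitrary: f)
  case (Suc n)
  define I where "I = (\<lambda>A. \<integral>x. f x \<partial>A)"
  define a where "a = (\<lambda>k. pos_law (walk_law \<mu> k))"
  \<comment> \<open>Baxter's identity for S_k and W_(n-k) + X leaves two terms with an outer
    positive part; collected in \<open>g\<close> they telescope, from W_(n+1) at k = 1 to S_(n+1)^+
    at k = n + 1.\<close>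
  define g where "g = (\<lambda>k. I (pos_law (walk_law \<mu> k \<star> wait_law \<mu> (Suc n - k))))"
  note wk = exp_law_walk_law[OF \<mu> c] and wt = exp_law_wait_law[OF \<mu> c]
  have el: "exp_law c (a k)" for k unfolding a_def by (intro exp_law_pos_law wk)
  have step: "I (a k \<star> wait_law \<mu> (Suc n - k)) =
      (g k - g (Suc k)) + (\<integral>y. lindley_op \<mu> f y \<partial>(a k \<star> wait_law \<mu> (n - k)))"
    if k: "k \<in> {1..n}" for k
  proof -
    have eq: "wait_law \<mu> (Suc n - k) = pos_law (wait_law \<mu> (n - k) \<star> \<mu>)"
      using k by (simp add: Suc_diff_le)
    have "I (a k \<star> wait_law \<mu> (Suc n - k)) + I (pos_law (walk_law \<mu> k \<star> (wait_law \<mu> (n - k) \<star> \<mu>)))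
      = g k + I (pos_law (a k \<star> (wait_law \<mu> (n - k) \<star> \<mu>)))"
      unfolding I_def a_def g_def eq
      by (rule baxter_identity[OF wk exp_law_convolution[OF wt \<mu> c] Suc.prems c])
    \<comment> \<open>The extra step is moved from the waiting time to the walk, which turns index k
      of \<open>g\<close> into k + 1.\<close>
    moreover have "walk_law \<mu> k \<star> (wait_law \<mu> (n - k) \<star> \<mu>) = (walk_law \<mu> (Suc k) \<star> wait_law \<mu> (n - k))"
    proof -
      have "walk_law \<mu> k \<star> (wait_law \<mu> (n - k) \<star> \<mu>) = ((wait_law \<mu> (n - k) \<star> \<mu>) \<star> walk_law \<mu> k)"
        by (rule convolution_commutative)
          (use exp_lawD[OF wk[of k]] exp_lawD[OF exp_law_convolution[OF wt \<mu> c]] in auto)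
      also have "\<dots> = (wait_law \<mu> (n - k) \<star> (\<mu> \<star> walk_law \<mu> k))"
        by (rule convolution_associative[symmetric])
          (use exp_lawD[OF wk[of k]] exp_lawD[OF wt] exp_lawD[OF \<mu>] in auto)
      also have "\<dots> = ((\<mu> \<star> walk_law \<mu> k) \<star> wait_law \<mu> (n - k))"
        by (rule convolution_commutative)
          (use exp_lawD[OF exp_law_convolution[OF \<mu> wk c, of k]] exp_lawD[OF wt] in auto)
      finally show ?thesis by simp
    qed
    then have "I (pos_law (walk_law \<mu> k \<star> (wait_law \<mu> (n - k) \<star> \<mu>))) = g (Suc k)"
      by (simp add: g_def)
    moreover have "a k \<star> (wait_law \<mu> (n - k) \<star> \<mu>) = ((a k \<star> wait_law \<mu> (n - k)) \<star> \<mu>)"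
      by (rule convolution_associative)
        (use exp_lawD[OF el[of k]] exp_lawD[OF wt] exp_lawD[OF \<mu>] in auto)
    then have "I (pos_law (a k \<star> (wait_law \<mu> (n - k) \<star> \<mu>))) =
        (\<integral>y. lindley_op \<mu> f y \<partial>(a k \<star> wait_law \<mu> (n - k)))"
      unfolding I_def
      using integral_lindley_op(1)[OF exp_law_convolution[OF el wt c] \<mu> Suc.prems c, of k "n - k"]
      by simp
    ultimately show ?thesis by (simp add: algebra_simps)
  qed
  have "(\<Sum>k=1..Suc n. I (a k \<star> wait_law \<mu> (Suc n - k))) =
      (\<Sum>k=1..n. I (a k \<star> wait_law \<mu> (Suc n - k))) + I (a (Suc n) \<star> return borel 0)"
    by simp
  also have "(\<Sum>k=1..n. I (a k \<star> wait_law \<mu> (Suc n - k))) =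
      (\<Sum>k=1..n. g k - g (Suc k)) + (\<Sum>k=1..n. \<integral>y. lindley_op \<mu> f y \<partial>(a k \<star> wait_law \<mu> (n - k)))"
    by (simp only: step sum.distrib cong: sum.cong)
  also have "(\<Sum>k=1..n. g k - g (Suc k)) = g 1 - g (Suc n)"
    by (induction n) auto
  also have "(\<Sum>k=1..n. \<integral>y. lindley_op \<mu> f y \<partial>(a k \<star> wait_law \<mu> (n - k)))
      = real n *\<^sub>R (\<integral>y. lindley_op \<mu> f y \<partial>wait_law \<mu> n)"
    unfolding a_def
    by (rule Suc.IH[symmetric]) (rule integral_lindley_op(2)[OF \<mu> \<mu> Suc.prems c])
  also have "(\<integral>y. lindley_op \<mu> f y \<partial>wait_law \<mu> n) = I (wait_law \<mu> (Suc n))"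
    unfolding I_def wait_law.simps by (rule integral_lindley_op(1)[OF wt \<mu> Suc.prems c, symmetric])
  also have "g 1 = I (wait_law \<mu> (Suc n))"
  proof -
    have "\<mu> \<star> wait_law \<mu> n = (wait_law \<mu> n \<star> \<mu>)"
      by (rule convolution_commutative) (use exp_lawD[OF wt[of n]] exp_lawD[OF \<mu>] in auto)
    then show ?thesis by (simp add: g_def convolution_return[OF \<mu>])
  qed
  also have "I (a (Suc n) \<star> return borel 0) = g (Suc n)"
    unfolding g_def using convolution_return[OF wk, of "Suc n"] convolution_return[OF el, of "Suc n"]
    by (simp add: a_def)
  finally show ?case unfolding I_def a_def by (simp add: algebra_simps)
qed simp

section \<open>Stationary waiting times\<close>

lemma lindley_op_iterate:
  fixes f :: "real \<Rightarrow> 'b::{banach, second_countable_topology}"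
  assumes \<mu>: "exp_law c \<mu>" and f: "exp_bounded c f" and c: "0 \<le> c"
  shows "exp_bounded c ((lindley_op \<mu> ^^ n) f)"
    and "(\<integral>x. f x \<partial>wait_law \<mu> (n + m)) = (\<integral>x. (lindley_op \<mu> ^^ n) f x \<partial>wait_law \<mu> m)"
  using f
proof (induction n arbitrary: f)
  case (Suc n)
  { case 1
    have b: "exp_bounded c (lindley_op \<mu> f)"
      by (rule integral_lindley_op(2)[OF \<mu> \<mu> 1 c])
    show ?case unfolding funpow_Suc_right comp_def by (rule Suc.IH(1)[OF b]) }
  { case 2
    have b: "exp_bounded c (lindley_op \<mu> f)"
      by (rule integral_lindley_op(2)[OF \<mu> \<mu> 2 c])
    have "(\<integral>x. f x \<partial>wait_law \<mu> (Suc n + m)) = (\<integral>x. lindley_op \<mu> f x \<partial>wait_law \<mu> (n + m))"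
      using integral_lindley_op(1)[OF exp_law_wait_law[OF \<mu> c] \<mu> 2 c] by simp
    also have "\<dots> = (\<integral>x. (lindley_op \<mu> ^^ Suc n) f x \<partial>wait_law \<mu> m)"
      unfolding funpow_Suc_right comp_def by (rule Suc.IH(2)[OF b])
    finally show ?case . }
qed auto

lemma integral_return_exp_bounded:
  fixes f :: "real \<Rightarrow> 'b::{banach, second_countable_topology}"
  assumes "exp_bounded c f"
  shows "(\<integral>x. f x \<partial>return borel y) = f y"
  using assms by (intro integral_return) (auto simp: exp_bounded_def)

lemma integrable_exp_of_exp_law:
  assumes "exp_law c \<mu>" "0 \<le> c"
  shows "integrable \<mu> (\<lambda>x. exp (c * x))"
proof (rule integrable_exp_law[OF assms(1)])
  have "c * x \<le> c * max 0 x" for x using assms(2) by (intro mult_left_mono) auto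
  then show "exp_bounded c (\<lambda>x. exp (c * x))"
    by (auto simp: exp_bounded_def intro!: exI[of _ 1])
qed

text \<open>Lindley's recursion contracts in the weight \<open>exp (c x)\<close>, which gives uniqueness of the stationary law.\<close>

lemma lindley_op_contraction:
  fixes f :: "real \<Rightarrow> 'b::{banach, second_countable_topology}"
  assumes \<mu>: "exp_law c \<mu>" and f: "exp_bounded c f" and c: "0 \<le> c"
    and con: "\<And>x y. 0 \<le> y \<Longrightarrow> y \<le> x \<Longrightarrow> norm (f x - f y) \<le> C * exp (c * x)"
    and xy: "0 \<le> y" "y \<le> x"
  shows "norm ((lindley_op \<mu> ^^ n) f x - (lindley_op \<mu> ^^ n) f y)
    \<le> C * (\<integral>x. exp (c * x) \<partial>\<mu>) ^ n * exp (c * x)"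
  using xy
proof (induction n arbitrary: x y)
  case 0
  then show ?case using con by simp
next
  case (Suc n)
  let ?q = "\<integral>x. exp (c * x) \<partial>\<mu>"
  define g where "g = (lindley_op \<mu> ^^ n) f"
  have g: "exp_bounded c g" unfolding g_def by (rule lindley_op_iterate(1)[OF \<mu> f c])
  interpret m: prob_space \<mu> using exp_lawD[OF \<mu>] by simp
  note [measurable_cong] = exp_lawD(2)[OF \<mu>]
  have [measurable]: "g \<in> borel_measurable borel" using g by (auto simp: exp_bounded_def)
  have C0: "C \<ge> 0" using con[of 0 0] by simp
  have q0: "?q \<ge> 0" by (rule integral_nonneg_AE) auto
  have int: "integrable \<mu> (\<lambda>z. g (max 0 (a + z)))" for a
  proof -
    obtain K where K: "\<And>x. norm (g x) \<le> K * exp (c * max 0 x)"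
      using g by (auto simp: exp_bounded_def)
    have K0: "K \<ge> 0" using order_trans[OF norm_ge_zero K, of 0] by simp
    show ?thesis
    proof (rule Bochner_Integration.integrable_bound)
      show "integrable \<mu> (\<lambda>z. K * exp (c * max 0 a) * exp (c * max 0 z))"
        using \<mu> by (auto simp: exp_law_def)
      show "AE z in \<mu>. norm (g (max 0 (a + z))) \<le> norm (K * exp (c * max 0 a) * exp (c * max 0 z))"
      proof (rule AE_I2)
        fix z
        have "norm (g (max 0 (a + z))) \<le> K * exp (c * max 0 (a + z))"
          using K[of "max 0 (a + z)"] by simp
        also have "\<dots> \<le> K * exp (c * (max 0 a + max 0 z))"
          using K0 c by (intro mult_left_mono) (auto intro!: mult_left_mono)
        finally show "norm (g (max 0 (a + z))) \<le> norm (K * exp (c * max 0 a) * exp (c * max 0 z))"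
          using K0 by (simp add: exp_add distrib_left mult.assoc)
      qed
    qed simp
  qed
  have "norm (lindley_op \<mu> g x - lindley_op \<mu> g y) =
      norm (\<integral>z. g (max 0 (x + z)) - g (max 0 (y + z)) \<partial>\<mu>)"
    unfolding lindley_op_def using int by simp
  also have "\<dots> \<le> (\<integral>z. (C * ?q ^ n * exp (c * x)) * exp (c * z) \<partial>\<mu>)"
  proof (rule Bochner_Integration.integral_norm_bound_integral)
    show "integrable \<mu> (\<lambda>z. g (max 0 (x + z)) - g (max 0 (y + z)))"
      using int by auto
    show "integrable \<mu> (\<lambda>z. (C * ?q ^ n * exp (c * x)) * exp (c * z))"
      using integrable_exp_of_exp_law[OF \<mu> c] by simp
    fix z
    show "norm (g (max 0 (x + z)) - g (max 0 (y + z))) \<le> (C * ?q ^ n * exp (c * x)) * exp (c * z)"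
    \<comment> \<open>If the higher of the two coupled paths is reset to 0, so is the lower one and
      the difference vanishes. Otherwise the higher path is at x + z, the weight factorises, and the
      step costs the factor exp (c z).\<close>
    proof (cases "x + z \<le> 0")
      case True
      then have "max 0 (x + z) = 0" "max 0 (y + z) = 0" using Suc.prems by auto
      then show ?thesis using C0 q0 by simp
    next
      case False
      then have "norm (g (max 0 (x + z)) - g (max 0 (y + z))) \<le> C * ?q ^ n * exp (c * max 0 (x + z))"
        unfolding g_def using Suc.prems by (intro Suc.IH) auto
      then show ?thesis using False by (simp add: distrib_left exp_add mult_ac)
    qed
  qed
  also have "\<dots> = C * ?q ^ Suc n * exp (c * x)" by simp
  finally show ?case by (simp add: g_def)
qed

lemma lindley_op_contraction_integral:
  fixes f :: "real \<Rightarrow> 'b::{banach, second_countable_topology}"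
  assumes \<mu>: "exp_law c \<mu>" and f: "exp_bounded c f" and c: "0 \<le> c"
    and con: "\<And>x y. 0 \<le> y \<Longrightarrow> y \<le> x \<Longrightarrow> norm (f x - f y) \<le> C * exp (c * x)"
    and A: "exp_law c A" and nonneg: "AE x in A. 0 \<le> x"
  shows "norm ((\<integral>x. (lindley_op \<mu> ^^ n) f x \<partial>A) - (lindley_op \<mu> ^^ n) f 0)
    \<le> C * (\<integral>x. exp (c * x) \<partial>\<mu>) ^ n * (\<integral>x. exp (c * max 0 x) \<partial>A)"
proof -
  interpret A: prob_space A using exp_lawD[OF A] by simp
  let ?g = "(lindley_op \<mu> ^^ n) f" and ?q = "\<integral>x. exp (c * x) \<partial>\<mu>"
  have int: "integrable A ?g"
    by (rule integrable_exp_law[OF A lindley_op_iterate(1)[OF \<mu> f c]])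
  have "norm ((\<integral>x. ?g x \<partial>A) - ?g 0) = norm (\<integral>x. ?g x - ?g 0 \<partial>A)"
    using int by (simp add: A.prob_space)
  also have "\<dots> \<le> (\<integral>x. norm (?g x - ?g 0) \<partial>A)" by (rule integral_norm_bound)
  also have "\<dots> \<le> (\<integral>x. C * ?q ^ n * exp (c * max 0 x) \<partial>A)"
  proof (rule integral_mono_AE)
    show "integrable A (\<lambda>x. norm (?g x - ?g 0))" using int by auto
    show "integrable A (\<lambda>x. C * ?q ^ n * exp (c * max 0 x))"
      using A by (auto simp: exp_law_def)
    show "AE x in A. norm (?g x - ?g 0) \<le> C * ?q ^ n * exp (c * max 0 x)"
      using nonneg
    proof eventually_elim
      case (elim x)
      then show ?case using lindley_op_contraction[OF \<mu> f c con, of 0 x n] by simp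
    qed
  qed
  finally show ?thesis by simp
qed

text \<open>Of \<open>w\<close> only stationarity and nonnegativity are known; its exponential
  moment and its identification as a limit come out of \<open>drift\<close>, which says that the
  weight exp (c x) contracts on average.\<close>

locale stationary_wait = prob_space \<mu> for \<mu> :: "real measure" +
  fixes w :: "real measure" and c :: real
  assumes law: "exp_law c \<mu>" and c_nonneg: "0 \<le> c"
    and drift: "(\<integral>x. exp (c * x) \<partial>\<mu>) < 1"
    and prob_w: "prob_space w" and sets_w: "sets w = sets borel"
    and w_nonneg: "AE x in w. 0 \<le> x"
    and stationary: "pos_law (w \<star> \<mu>) = w"
begin

definition q :: real where "q = (\<integral>x. exp (c * x) \<partial>\<mu>)"

lemma q_nonneg: "0 \<le> q"
  unfolding q_def by (rule integral_nonneg_AE) auto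

lemma q_less_1: "q < 1" using drift by (simp add: q_def)

lemma law_0: "exp_law 0 \<mu>"
  by (rule exp_law_0) (use exp_lawD[OF law] in auto)

lemma integral_iterate:
  fixes f :: "real \<Rightarrow> 'b::{banach, second_countable_topology}"
  assumes w: "exp_law d w" and m: "exp_law d \<mu>" and d: "0 \<le> d" and f: "exp_bounded d f"
  shows "(\<integral>x. (lindley_op \<mu> ^^ n) f x \<partial>w) = (\<integral>x. f x \<partial>w)"
  using f
proof (induction n arbitrary: f)
  case (Suc n)
  have "(\<integral>x. (lindley_op \<mu> ^^ Suc n) f x \<partial>w) = (\<integral>x. lindley_op \<mu> f x \<partial>w)"
    unfolding funpow_Suc_right comp_def
    by (rule Suc.IH) (rule integral_lindley_op(2)[OF m m Suc.prems d])
  also have "\<dots> = (\<integral>x. f x \<partial>w)"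
    using integral_lindley_op(1)[OF w m Suc.prems d] by (simp add: stationary)
  finally show ?case .
qed simp

text \<open>A Foster-Lyapunov bound: exp (c (y + x)^+) \<le> 1 + exp (c y^+) exp (c x) makes the
  moments satisfy e_(n+1) \<le> 1 + q e_n, and 1 / (1 - q) is the fixed point of this
  recursion.\<close>

lemma exp_moment_wait_law: "(\<integral>x. exp (c * max 0 x) \<partial>wait_law \<mu> n) \<le> 1 / (1 - q)"
proof (induction n)
  case 0
  then show ?case using q_nonneg q_less_1
    by (subst wait_law.simps, subst integral_return) (auto simp: field_simps)
next
  case (Suc n)
  let ?f = "\<lambda>x. exp (c * max 0 x)"
  note el = exp_law_wait_law[OF law c_nonneg, of n]
  interpret A: prob_space "wait_law \<mu> n" using exp_lawD[OF el] by simp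
  note [measurable_cong] = exp_lawD(2)[OF law]
  have le: "lindley_op \<mu> ?f y \<le> 1 + q * ?f y" for y
  proof -
    have "lindley_op \<mu> ?f y \<le> (\<integral>x. 1 + ?f y * exp (c * x) \<partial>\<mu>)"
      unfolding lindley_op_def
    proof (rule integral_mono_AE')
      show "integrable \<mu> (\<lambda>x. 1 + ?f y * exp (c * x))"
        using integrable_exp_of_exp_law[OF law c_nonneg] by simp
      show "AE x in \<mu>. exp (c * max 0 (max 0 (y + x))) \<le> 1 + ?f y * exp (c * x)"
      proof (rule AE_I2)
        fix x
        show "exp (c * max 0 (max 0 (y + x))) \<le> 1 + ?f y * exp (c * x)"
        proof (cases "y + x \<le> 0")
          case False
          have "c * (y + x) \<le> c * max 0 y + c * x"
            using c_nonneg by (simp add: distrib_left mult_left_mono)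
          then have "exp (c * (y + x)) \<le> ?f y * exp (c * x)"
            by (simp flip: exp_add)
          then show ?thesis using False by simp
        qed simp
      qed
    qed simp
    also have "\<dots> = 1 + q * ?f y"
      using integrable_exp_of_exp_law[OF law c_nonneg] by (simp add: q_def prob_space)
    finally show ?thesis .
  qed
  have "(\<integral>x. ?f x \<partial>wait_law \<mu> (Suc n)) = (\<integral>x. lindley_op \<mu> ?f x \<partial>wait_law \<mu> n)"
    using integral_lindley_op(1)[OF el law exp_bounded_exp c_nonneg] by simp
  also have "\<dots> \<le> (\<integral>x. 1 + q * ?f x \<partial>wait_law \<mu> n)"
  proof (rule integral_mono_AE)
    show "integrable (wait_law \<mu> n) (lindley_op \<mu> ?f)"
      by (rule integrable_exp_law[OF el integral_lindley_op(2)[OF law law exp_bounded_exp c_nonneg]])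
    show "integrable (wait_law \<mu> n) (\<lambda>x. 1 + q * ?f x)"
      using el by (auto simp: exp_law_def)
  qed (use le in auto)
  also have "\<dots> = 1 + q * (\<integral>x. ?f x \<partial>wait_law \<mu> n)"
    using el by (simp add: exp_law_def A.prob_space)
  also have "\<dots> \<le> 1 + q * (1 / (1 - q))"
    using Suc q_nonneg by (intro add_left_mono mult_left_mono)
  also have "\<dots> = 1 / (1 - q)" using q_less_1 by (simp add: field_simps)
  finally show ?case .
qed

text \<open>The contraction cannot yet be integrated against \<open>w\<close>, so the weight is cut
  off at K. For the bounded function stationarity replaces f by its n-th iterate, which differs from
  its value at 0 by at most q^n exp (c x). Letting n and then K tend to infinity leaves the bound
  for the chain started at 0.\<close>

lemma exp_law_w: "exp_law c w" and exp_moment_w: "(\<integral>x. exp (c * max 0 x) \<partial>w) \<le> 1 / (1 - q)"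
proof -
  interpret w: prob_space w by (rule prob_w)
  note [measurable_cong] = sets_w
  define f where "f = (\<lambda>(K::nat) x. min (exp (c * max 0 x)) (real K))"
  have w0: "exp_law 0 w" by (rule exp_law_0[OF prob_w sets_w])
  have fm [measurable]: "f K \<in> borel_measurable borel" for K unfolding f_def by measurable
  have f0: "exp_bounded 0 (f K)" for K
    using fm by (auto simp: exp_bounded_def f_def intro!: exI[of _ "real K"])
  have fc: "exp_bounded c (f K)" for K
    by (rule exp_bounded_mono[OF f0 c_nonneg])
  have f_nonneg: "f K x \<ge> 0" for K x by (simp add: f_def)
  have con: "norm (f K x - f K y) \<le> 1 * exp (c * x)" if "0 \<le> y" "y \<le> x" for K x y
  proof -
    have "exp (c * y) \<le> exp (c * x)" using that c_nonneg by (simp add: mult_left_mono)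
    moreover have mm: "\<bar>min a k - min b k\<bar> \<le> a" if "0 \<le> b" "b \<le> a" "0 \<le> k" for a b k :: real
      using that by (auto simp: min_def)
    ultimately show ?thesis using that mm[of "exp (c * y)" "exp (c * x)" "real K"] by (simp add: f_def)
  qed
  have bound: "(\<integral>x. f K x \<partial>w) \<le> 1 / (1 - q)" for K
  proof -
    \<comment> \<open>The cap K provides the dominating function, so the term with q^n disappears in
      the limit although the weight is not yet known to be integrable under
      \<open>w\<close>.\<close>
    let ?h = "\<lambda>n x. min (real K) (1 / (1 - q) + q ^ n * exp (c * max 0 x))"
    have "(\<lambda>n. \<integral>x. ?h n x \<partial>w) \<longlonglongrightarrow> (\<integral>x. min (real K) (1 / (1 - q)) \<partial>w)"
    proof (rule integral_dominated_convergence[where w = "\<lambda>_. real K"])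
      show "AE x in w. (\<lambda>n. ?h n x) \<longlonglongrightarrow> min (real K) (1 / (1 - q))"
      proof (rule AE_I2)
        fix x
        have "(\<lambda>n. ?h n x) \<longlonglongrightarrow> min (real K) (1 / (1 - q) + 0 * exp (c * max 0 x))"
          using q_nonneg q_less_1 by (intro tendsto_intros LIMSEQ_realpow_zero)
        then show "(\<lambda>n. ?h n x) \<longlonglongrightarrow> min (real K) (1 / (1 - q))" by simp
      qed
      show "AE x in w. norm (?h n x) \<le> real K" for n
        using q_nonneg q_less_1 by (auto simp: min_def)
    qed auto
    then have lim: "(\<lambda>n. \<integral>x. ?h n x \<partial>w) \<longlonglongrightarrow> min (real K) (1 / (1 - q))"
      by (simp add: w.prob_space)
    have "(\<integral>x. f K x \<partial>w) \<le> min (real K) (1 / (1 - q))"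
      proof (rule LIMSEQ_le_const[OF lim], intro exI allI impI)
        fix n
        let ?g = "(lindley_op \<mu> ^^ n) (f K)"
        have g_le_K: "(lindley_op \<mu> ^^ m) (f K) x \<le> real K" for m x
        proof (induction m arbitrary: x)
          case (Suc m)
          have "(\<integral>z. (lindley_op \<mu> ^^ m) (f K) (max 0 (x + z)) \<partial>\<mu>) \<le> (\<integral>z. real K \<partial>\<mu>)"
            by (rule integral_mono_AE') (use Suc in auto)
          moreover have "(lindley_op \<mu> ^^ Suc m) (f K) x =
              (\<integral>z. (lindley_op \<mu> ^^ m) (f K) (max 0 (x + z)) \<partial>\<mu>)"
            by (simp add: lindley_op_def[of \<mu> "(lindley_op \<mu> ^^ m) (f K)"])
          ultimately show ?case by (simp add: prob_space)
        qed (simp add: f_def)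
        have "?g 0 = (\<integral>x. f K x \<partial>wait_law \<mu> n)"
          using lindley_op_iterate(2)[OF law fc[of K] c_nonneg, of n 0]
            integral_return_exp_bounded[OF lindley_op_iterate(1)[OF law fc[of K] c_nonneg]]
          by simp
        also have "\<dots> \<le> (\<integral>x. exp (c * max 0 x) \<partial>wait_law \<mu> n)"
          by (rule integral_mono_AE)
            (use exp_law_wait_law[OF law c_nonneg, of n] integrable_exp_law[OF _ fc] in
              \<open>auto simp: exp_law_def f_def\<close>)
        also have "\<dots> \<le> 1 / (1 - q)" by (rule exp_moment_wait_law)
        finally have g0: "?g 0 \<le> 1 / (1 - q)" .
        have "(\<integral>x. f K x \<partial>w) = (\<integral>x. ?g x \<partial>w)"
          by (rule integral_iterate[OF w0 law_0 _ f0, symmetric]) simp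
        also have "\<dots> \<le> (\<integral>x. ?h n x \<partial>w)"
        proof (rule integral_mono_AE)
          show "integrable w ?g"
            by (rule integrable_exp_law[OF w0 lindley_op_iterate(1)[OF law_0 f0]]) simp
          show "integrable w (?h n)"
          proof (rule w.integrable_const_bound[where B = "real K"])
            show "AE x in w. norm (?h n x) \<le> real K"
              using q_nonneg q_less_1 by (auto simp: min_def)
          qed measurable
          show "AE x in w. ?g x \<le> ?h n x"
            using w_nonneg
          proof eventually_elim
            case (elim x)
            have "norm (?g x - ?g 0) \<le> 1 * q ^ n * exp (c * x)"
              unfolding q_def using elim by (intro lindley_op_contraction[OF law fc c_nonneg con]) auto
            then have "?g x \<le> 1 / (1 - q) + q ^ n * exp (c * x)" using g0 by (auto simp: abs_le_iff)
            then show ?case using elim g_le_K[of n x] by simp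
          qed
        qed
        finally show "(\<integral>x. f K x \<partial>w) \<le> (\<integral>x. ?h n x \<partial>w)" .
      qed
    then show ?thesis by simp
  qed
  have "(\<integral>\<^sup>+x. ennreal (exp (c * max 0 x)) \<partial>w) = (\<integral>\<^sup>+x. liminf (\<lambda>K. ennreal (f K x)) \<partial>w)"
  proof (rule nn_integral_cong)
    fix x
    have "\<forall>\<^sub>F K in sequentially. f K x = exp (c * max 0 x)"
      using eventually_ge_at_top[of "nat \<lceil>exp (c * max 0 x)\<rceil>"]
      by eventually_elim (simp add: f_def nat_ceiling_le_eq)
    then have "(\<lambda>K. ennreal (f K x)) \<longlonglongrightarrow> ennreal (exp (c * max 0 x))"
      by (intro tendsto_eventually) (auto elim: eventually_mono)
    from lim_imp_Liminf[OF _ this] show "ennreal (exp (c * max 0 x)) = liminf (\<lambda>K. ennreal (f K x))"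
      by simp
  qed
  \<comment> \<open>Fatou's lemma; at each x the truncations have reached the weight once K exceeds
    it.\<close>
  also have "\<dots> \<le> liminf (\<lambda>K. \<integral>\<^sup>+x. ennreal (f K x) \<partial>w)"
    by (rule nn_integral_liminf) simp
  also have "\<dots> \<le> ennreal (1 / (1 - q))"
  proof (rule Liminf_le)
    show "\<forall>\<^sub>F K in sequentially. (\<integral>\<^sup>+x. ennreal (f K x) \<partial>w) \<le> ennreal (1 / (1 - q))"
      using bound f_nonneg integrable_exp_law[OF w0 f0]
      by (intro always_eventually allI) (subst nn_integral_eq_integral, auto intro: ennreal_leI)
  qed simp
  finally have le: "(\<integral>\<^sup>+x. ennreal (exp (c * max 0 x)) \<partial>w) \<le> ennreal (1 / (1 - q))" .
  then have int: "integrable w (\<lambda>x. exp (c * max 0 x))"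
    by (intro integrableI_bounded) (auto intro: le_less_trans)
  then show "exp_law c w" using prob_w sets_w by (simp add: exp_law_def)
  have "ennreal (\<integral>x. exp (c * max 0 x) \<partial>w) \<le> ennreal (1 / (1 - q))"
    using le by (subst (asm) nn_integral_eq_integral[OF int]) auto
  then show "(\<integral>x. exp (c * max 0 x) \<partial>w) \<le> 1 / (1 - q)"
    using q_less_1 by (subst (asm) ennreal_le_iff) auto
qed

text \<open>The first claim compares the chain started at 0 with the one started from
  \<open>w\<close>. For the increments the second start is \<open>wait_law \<mu> 1\<close>, since n
  steps from there end in \<open>wait_law \<mu> (Suc n)\<close>.\<close>

lemma wait_law_converges:
  fixes f :: "real \<Rightarrow> 'b::{banach, second_countable_topology}"
  assumes f: "exp_bounded c f"
    and con: "\<And>x y. 0 \<le> y \<Longrightarrow> y \<le> x \<Longrightarrow> norm (f x - f y) \<le> C * exp (c * x)"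
  shows "(\<lambda>n. \<integral>x. f x \<partial>wait_law \<mu> n) \<longlonglongrightarrow> (\<integral>x. f x \<partial>w)"
    and "\<exists>D. \<forall>n. norm ((\<integral>x. f x \<partial>wait_law \<mu> (Suc n)) - (\<integral>x. f x \<partial>wait_law \<mu> n)) \<le> D * q ^ n"
proof -
  have start: "(lindley_op \<mu> ^^ n) f 0 = (\<integral>x. f x \<partial>wait_law \<mu> n)" for n
    using lindley_op_iterate(2)[OF law f c_nonneg, of n 0]
      integral_return_exp_bounded[OF lindley_op_iterate(1)[OF law f c_nonneg]]
    by simp
  define E where "E = (\<integral>x. exp (c * max 0 x) \<partial>w)"
  have "norm ((\<integral>x. f x \<partial>wait_law \<mu> n) - (\<integral>x. f x \<partial>w)) \<le> C * E * q ^ n" for n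
    using lindley_op_contraction_integral[OF law f c_nonneg con exp_law_w w_nonneg, of n]
    unfolding integral_iterate[OF exp_law_w law c_nonneg f] start q_def[symmetric] E_def[symmetric]
    by (simp add: norm_minus_commute mult_ac)
  then have ev: "\<forall>\<^sub>F n in sequentially. norm ((\<integral>x. f x \<partial>wait_law \<mu> n) - (\<integral>x. f x \<partial>w)) \<le> C * E * q ^ n"
    by simp
  have "(\<lambda>n. C * E * q ^ n) \<longlonglongrightarrow> C * E * 0"
    using q_nonneg q_less_1 by (intro tendsto_intros LIMSEQ_realpow_zero)
  then have "(\<lambda>n. C * E * q ^ n) \<longlonglongrightarrow> 0" by simp
  from Lim_null_comparison[OF ev this] show "(\<lambda>n. \<integral>x. f x \<partial>wait_law \<mu> n) \<longlonglongrightarrow> (\<integral>x. f x \<partial>w)"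
    by (rule LIM_zero_cancel)
  have "AE x in wait_law \<mu> 1. 0 \<le> x"
    unfolding One_nat_def wait_law.simps pos_law_def
    by (subst AE_distr_iff) auto
  then have "norm ((\<integral>x. f x \<partial>wait_law \<mu> (Suc n)) - (\<integral>x. f x \<partial>wait_law \<mu> n))
      \<le> (C * (\<integral>x. exp (c * max 0 x) \<partial>wait_law \<mu> 1)) * q ^ n" for n
    using lindley_op_contraction_integral[OF law f c_nonneg con exp_law_wait_law[OF law c_nonneg, of 1], of n]
      lindley_op_iterate(2)[OF law f c_nonneg, of n 1]
    unfolding start q_def[symmetric] by (simp add: mult_ac)
  then show "\<exists>D. \<forall>n. norm ((\<integral>x. f x \<partial>wait_law \<mu> (Suc n)) - (\<integral>x. f x \<partial>wait_law \<mu> n)) \<le> D * q ^ n"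
    by blast
qed

lemma integral_walk_law_power:
  fixes f :: "real \<Rightarrow> 'b::{real_normed_field, banach, second_countable_topology}"
  assumes f: "exp_bounded c f" and f0: "f 0 = 1" and f_add: "\<And>x y. f (x + y) = f x * f y"
  shows "(\<integral>x. f x \<partial>walk_law \<mu> k) = (\<integral>x. f x \<partial>\<mu>) ^ k"
proof (induction k)
  case 0
  then show ?case using integral_return_exp_bounded[OF f] by (simp add: f0)
next
  case (Suc k)
  let ?B = "walk_law \<mu> k"
  have B: "exp_law c ?B" by (rule exp_law_walk_law[OF law c_nonneg])
  interpret B: prob_space ?B using exp_lawD[OF B] by simp
  interpret pair_sigma_finite \<mu> ?B ..
  have int: "integrable (\<mu> \<Otimes>\<^sub>M ?B) (\<lambda>p. f (fst p + snd p))"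
    by (rule integrable_pair_exp_law[OF law B f c_nonneg]) auto
  have "(\<integral>x. f x \<partial>walk_law \<mu> (Suc k)) = (\<integral>p. f (fst p + snd p) \<partial>(\<mu> \<Otimes>\<^sub>M ?B))"
    by (simp add: integral_convolution_exp_law[OF law B f])
  also have "\<dots> = (\<integral>x. (\<integral>y. f x * f y \<partial>?B) \<partial>\<mu>)"
    using integral_fst'[OF int] by (simp add: f_add)
  also have "\<dots> = (\<integral>x. f x \<partial>\<mu>) * (\<integral>x. f x \<partial>?B)" by simp
  finally show ?case using Suc.IH by simp
qed

lemma exp_bounded_complex_exp:
  assumes "0 \<le> Re u" "Re u \<le> d"
  shows "exp_bounded d (\<lambda>x. exp (u * complex_of_real x))"
proof -
  have "Re u * x \<le> d * max 0 x" for x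
    using assms by (cases "x \<ge> 0") (auto simp: mult_right_mono max_def mult_nonneg_nonpos)
  then show ?thesis by (auto simp: exp_bounded_def intro!: exI[of _ 1])
qed

text \<open>For an exponential f the terms of Spitzer's recursion become products a_k p_(n-k), but
  p_n converges without tending to 0 in general, so its generating function cannot be evaluated at
  1. Passing to the increments of p_n multiplies it by 1 - z and turns a_k into d_k = a_k - 1, which
  decays geometrically. The increments sum to the limit of p_n.\<close>

lemma spitzer_transform:
  fixes u :: complex
  assumes u: "Re u \<le> c"
  defines "d \<equiv> (\<lambda>k. \<integral>x. exp (u * of_real (max 0 x)) - 1 \<partial>walk_law \<mu> k)"
  shows "(\<integral>x. exp (u * of_real x) \<partial>w) = exp (\<Sum>k. d (Suc k) / of_nat (Suc k))"
    and "norm (d k) \<le> 2 * q ^ k"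
proof -
  define f where "f = (\<lambda>x. exp (u * complex_of_real (max 0 x)))"
  have norm_f: "norm (f x) \<le> exp (c * max 0 x)" for x
    using u by (auto simp: f_def intro: mult_right_mono)
  have fb: "exp_bounded c f"
    using norm_f by (auto simp: exp_bounded_def f_def intro!: exI[of _ 1])
  have con: "norm (f x - f y) \<le> 2 * exp (c * x)" if "0 \<le> y" "y \<le> x" for x y
  proof -
    have "norm (f x - f y) \<le> norm (f x) + norm (f y)" by (rule norm_triangle_ineq4)
    also have "\<dots> \<le> exp (c * x) + exp (c * y)"
      using norm_f[of x] norm_f[of y] that by auto
    also have "\<dots> \<le> 2 * exp (c * x)"
      using that c_nonneg by (simp add: mult_left_mono)
    finally show ?thesis .
  qed
  define p where "p = (\<lambda>n. \<integral>x. f x \<partial>wait_law \<mu> n)"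
  define a where "a = (\<lambda>n. \<integral>x. f x \<partial>walk_law \<mu> n)"
  define s where "s = (\<lambda>n. case n of 0 \<Rightarrow> 1 | Suc m \<Rightarrow> p (Suc m) - p m)"
  note wk = exp_law_walk_law[OF law c_nonneg] and wt = exp_law_wait_law[OF law c_nonneg]
  have p0: "p 0 = 1"
    unfolding p_def wait_law.simps integral_return_exp_bounded[OF fb] by (simp add: f_def)
  have da: "d k = a k - 1" for k
  proof -
    interpret A: prob_space "walk_law \<mu> k" using exp_lawD[OF wk] by simp
    show ?thesis
      using integrable_exp_law[OF wk fb] by (simp add: d_def a_def f_def A.prob_space)
  qed
  have prod: "(\<integral>x. f x \<partial>(pos_law (walk_law \<mu> k) \<star> wait_law \<mu> m)) = a k * p m" for k m
  proof -
    let ?A = "walk_law \<mu> k" and ?B = "wait_law \<mu> m"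
    interpret A: prob_space ?A using exp_lawD[OF wk] by simp
    interpret B: prob_space ?B using exp_lawD[OF wt] by simp
    interpret pair_sigma_finite ?A ?B ..
    note [measurable_cong] = exp_lawD(2)[OF wk] exp_lawD(2)[OF wt]
    have [measurable]: "f \<in> borel_measurable borel" using fb by (auto simp: exp_bounded_def)
    have int: "integrable (?A \<Otimes>\<^sub>M ?B) (\<lambda>p. f (max 0 (fst p) + max 0 (snd p)))"
      by (rule integrable_pair_exp_law[OF wk wt fb c_nonneg]) auto
    have "(\<integral>x. f x \<partial>(pos_law ?A \<star> ?B)) = (\<integral>x. f x \<partial>(pos_law ?A \<star> pos_law ?B))"
      by (simp add: pos_law_wait_law)
    also have "\<dots> = (\<integral>p. f (max 0 (fst p) + max 0 (snd p)) \<partial>(?A \<Otimes>\<^sub>M ?B))"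
      unfolding convolution_pos_law(3)[OF wk wt] by (subst integral_distr) auto
    also have "\<dots> = (\<integral>x. (\<integral>y. f (max 0 x + max 0 y) \<partial>?B) \<partial>?A)"
      using integral_fst'[OF int] by simp
    \<comment> \<open>\<open>f\<close> reads only the positive part, so multiplicativity on the
      nonnegative reals suffices.\<close>
    also have "\<dots> = (\<integral>x. (\<integral>y. f x * f y \<partial>?B) \<partial>?A)"
      by (intro Bochner_Integration.integral_cong refl) (simp add: f_def max_def distrib_left exp_add)
    finally show ?thesis by (simp add: a_def p_def)
  qed
  have sp: "of_nat n * p n = (\<Sum>k=1..n. a k * p (n - k))" for n
    using spitzer_recursion[OF law fb c_nonneg, of n]
    by (simp only: prod) (simp add: p_def scaleR_conv_of_real)
  have rec: "of_nat n * s n = (\<Sum>k=1..n. d k * s (n - k))" for n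
  proof (cases n)
    case (Suc m)
    have tele: "(\<Sum>k=1..j. p (Suc j - k) - p (j - k)) = p j - p 0" for j
    proof (induction j)
      case (Suc j)
      have "(\<Sum>k=1..Suc j. p (Suc (Suc j) - k) - p (Suc j - k)) =
          (\<Sum>k=Suc 0..Suc j. p (Suc (Suc j) - k) - p (Suc j - k))" by simp
      also have "\<dots> = (p (Suc j) - p j) + (\<Sum>k=Suc (Suc 0)..Suc j. p (Suc (Suc j) - k) - p (Suc j - k))"
        by (subst sum.atLeast_Suc_atMost) auto
      also have "(\<Sum>k=Suc (Suc 0)..Suc j. p (Suc (Suc j) - k) - p (Suc j - k)) =
          (\<Sum>k=Suc 0..j. p (Suc j - k) - p (j - k))"
        by (subst sum.shift_bounds_cl_Suc_ivl) simp
      finally show ?case using Suc.IH by simp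
    qed simp
    have "(\<Sum>k=1..Suc m. d k * s (Suc m - k)) = (\<Sum>k=1..m. d k * s (Suc m - k)) + d (Suc m)"
      by (simp add: s_def)
    also have "(\<Sum>k=1..m. d k * s (Suc m - k)) =
        (\<Sum>k=1..m. a k * p (Suc m - k) - a k * p (m - k) - (p (Suc m - k) - p (m - k)))"
      by (intro sum.cong) (auto simp: s_def da Suc_diff_le algebra_simps)
    also have "\<dots> = (\<Sum>k=1..m. a k * p (Suc m - k)) - (\<Sum>k=1..m. a k * p (m - k)) - (p m - p 0)"
      using tele[of m] by (simp only: sum_subtractf)
    also have "(\<Sum>k=1..m. a k * p (m - k)) = of_nat m * p m" by (rule sp[symmetric])
    also have "(\<Sum>k=1..m. a k * p (Suc m - k)) = of_nat (Suc m) * p (Suc m) - a (Suc m)"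
      unfolding sp by (simp add: p0)
    finally show ?thesis
      unfolding Suc by (simp add: s_def p0 da algebra_simps)
  qed simp
  \<comment> \<open>\<open>q\<close> is only known to be nonnegative, while the power series
    argument asks for a positive ratio; the midpoint of q and 1 is positive and still below
    1.\<close>
  define r where "r = (1 + q) / 2"
  have r: "0 < r" "r < 1" "q \<le> r" using q_nonneg q_less_1 by (auto simp: r_def)
  have qr: "q ^ n \<le> r ^ n" for n using r q_nonneg by (intro power_mono) auto
  \<comment> \<open>exp (u x^+) - 1 vanishes for x \<le> 0, so the weight exp (c x) without positive
    part dominates it up to the factor 2; the moment of that weight under the walk is exactly
    q^k.\<close>
  have d_bound: "norm (d k) \<le> 2 * q ^ k" for k
  proof -
    have eb: "exp_bounded c (\<lambda>x. exp (c * x))"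
      using mult_left_mono[OF max.cobounded2 c_nonneg]
      by (auto simp: exp_bounded_def intro!: exI[of _ 1])
    have "norm (d k) \<le> (\<integral>x. 2 * exp (c * x) \<partial>walk_law \<mu> k)"
      unfolding d_def
    proof (rule Bochner_Integration.integral_norm_bound_integral)
      interpret A: prob_space "walk_law \<mu> k" using exp_lawD[OF wk] by simp
      show "integrable (walk_law \<mu> k) (\<lambda>x. exp (u * of_real (max 0 x)) - 1)"
        using integrable_exp_law[OF wk fb] by (auto simp: f_def)
      show "integrable (walk_law \<mu> k) (\<lambda>x. 2 * exp (c * x))"
        using integrable_exp_law[OF wk eb] by simp
      fix x
      show "norm (exp (u * complex_of_real (max 0 x)) - 1) \<le> 2 * exp (c * x)"
        using con[of 0 x] by (cases "x \<ge> 0") (auto simp: f_def)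
    qed
    also have "\<dots> = 2 * q ^ k"
      using integral_walk_law_power[OF eb] by (simp add: q_def distrib_left exp_add)
    finally show ?thesis .
  qed
  then show "norm (d k) \<le> 2 * q ^ k" .
  have d_bound': "norm (d k) \<le> 2 * r ^ k" for k
    using d_bound[of k] qr[of k] by linarith
  obtain D where D: "\<And>n. norm (p (Suc n) - p n) \<le> D * q ^ n"
    using wait_law_converges(2)[OF fb con] unfolding p_def by blast
  define D' where "D' = \<bar>D\<bar> / r + 1"
  have s_bound: "norm (s n) \<le> D' * r ^ n" for n
  proof (cases n)
    case 0
    then show ?thesis using r by (simp add: s_def D'_def)
  next
    case (Suc m)
    have "norm (s n) \<le> D * q ^ m" using D[of m] by (simp add: s_def Suc)
    also have "\<dots> \<le> \<bar>D\<bar> * r ^ m"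
      using qr[of m] q_nonneg by (intro mult_mono) auto
    also have "\<dots> = (\<bar>D\<bar> / r) * r ^ n" using r by (simp add: Suc)
    also have "\<dots> \<le> D' * r ^ n" using r by (simp add: D'_def distrib_right)
    finally show ?thesis .
  qed
  have "s sums exp (\<Sum>k. d (Suc k) / of_nat (Suc k))"
    by (rule exp_power_series_recursion[OF r(1,2) d_bound' s_bound _ rec]) (simp add: s_def)
  moreover have "s sums (\<integral>x. f x \<partial>w)"
  proof -
    have "(\<Sum>k<Suc n. s k) = p n" for n by (induction n) (auto simp: s_def p0)
    moreover have "p \<longlonglongrightarrow> (\<integral>x. f x \<partial>w)"
      unfolding p_def by (rule wait_law_converges(1)[OF fb]) (rule con)
    ultimately have "(\<lambda>n. \<Sum>k<Suc n. s k) \<longlonglongrightarrow> (\<integral>x. f x \<partial>w)"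
      by presburger
    then show ?thesis
      unfolding sums_def by (rule filterlim_sequentially_Suc[THEN iffD1])
  qed
  ultimately have "(\<integral>x. f x \<partial>w) = exp (\<Sum>k. d (Suc k) / of_nat (Suc k))"
    by (rule sums_unique2[symmetric])
  moreover have "(\<integral>x. f x \<partial>w) = (\<integral>x. exp (u * of_real x) \<partial>w)"
  proof -
    note [measurable_cong] = sets_w
    have [measurable]: "f \<in> borel_measurable borel" using fb by (auto simp: exp_bounded_def)
    show ?thesis
      by (rule integral_cong_AE) (use w_nonneg in \<open>auto simp: f_def\<close>)
  qed
  ultimately show "(\<integral>x. exp (u * of_real x) \<partial>w) = exp (\<Sum>k. d (Suc k) / of_nat (Suc k))"
    by simp
qed

end

section \<open>Fourier inversion\<close>

text \<open>The Fourier transform of exp (-a x) - exp (-b x) on the half line x > 0. It decays like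
  1 / t^2 and is absolutely integrable, which a single resolvent is not.\<close>

definition resolvent_diff :: "complex \<Rightarrow> complex \<Rightarrow> real \<Rightarrow> complex" where
  "resolvent_diff a b t = 1 / (a + \<i> * of_real t) - 1 / (b + \<i> * of_real t)"

text \<open>The constant involves only a0 and A, so that the resolvent bounds built on it are
  uniform in the parameter a.\<close>

lemma one_plus_square_le_norm:
  assumes "0 < a0" "a0 \<le> Re a" "norm a \<le> A"
  shows "1 + t\<^sup>2 \<le> (2 + (1 + 2 * A\<^sup>2) / a0\<^sup>2) * (norm (a + \<i> * of_real t))\<^sup>2"
proof -
  let ?n = "norm (a + \<i> * of_real t)"
  have "a0 \<le> \<bar>Re (a + \<i> * of_real t)\<bar>" using assms by simp
  also have "\<dots> \<le> ?n" by (rule abs_Re_le_cmod)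
  finally have n: "a0 \<le> ?n" .
  then have n2: "a0\<^sup>2 \<le> ?n\<^sup>2" using assms by (intro power_mono) auto
  have "\<bar>t\<bar> = norm ((a + \<i> * of_real t) - a)" by (simp add: norm_mult)
  also have "\<dots> \<le> ?n + A" using norm_triangle_ineq4[of "a + \<i> * of_real t" a] assms by linarith
  finally have "\<bar>t\<bar>\<^sup>2 \<le> (?n + A)\<^sup>2" by (intro power_mono) auto
  also have "\<dots> \<le> 2 * ?n\<^sup>2 + 2 * A\<^sup>2"
    using sum_squares_bound[of ?n A] by (simp add: power2_sum)
  finally have "1 + t\<^sup>2 \<le> 2 * ?n\<^sup>2 + (1 + 2 * A\<^sup>2) * 1" by simp
  also have "(1 + 2 * A\<^sup>2) * 1 \<le> (1 + 2 * A\<^sup>2) * (?n\<^sup>2 / a0\<^sup>2)"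
    using n2 assms by (intro mult_left_mono) (auto simp: field_simps)
  finally show ?thesis by (simp add: algebra_simps)
qed

lemma norm_resolvent_le:
  assumes "0 < a0" "a0 \<le> Re a" "norm a \<le> A"
  shows "norm (1 / (a + \<i> * of_real t)) \<le> sqrt (2 + (1 + 2 * A\<^sup>2) / a0\<^sup>2) / sqrt (1 + t\<^sup>2)"
proof -
  let ?n = "norm (a + \<i> * of_real t)" and ?K = "2 + (1 + 2 * A\<^sup>2) / a0\<^sup>2"
  have "sqrt (1 + t\<^sup>2) \<le> sqrt (?K * ?n\<^sup>2)"
    using one_plus_square_le_norm[OF assms] by (rule real_sqrt_le_mono)
  also have "\<dots> = sqrt ?K * ?n" by (simp add: real_sqrt_mult)
  finally have *: "sqrt (1 + t\<^sup>2) \<le> sqrt ?K * ?n" .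
  have s: "sqrt (1 + t\<^sup>2) > 0" by (simp add: add_pos_nonneg)
  then have "?n \<noteq> 0" using * by auto
  then have n: "0 < ?n" by simp
  show ?thesis using * s n by (simp add: norm_divide field_simps)
qed

lemma norm_resolvent_diff_le:
  assumes "0 < a0" "a0 \<le> Re a" "norm a \<le> A" "a0 \<le> Re b" "norm b \<le> A"
  shows "norm (resolvent_diff a b t) \<le> (2 + (1 + 2 * A\<^sup>2) / a0\<^sup>2) * norm (b - a) / (1 + t\<^sup>2)"
proof -
  let ?K = "2 + (1 + 2 * A\<^sup>2) / a0\<^sup>2"
  have ne: "a + \<i> * of_real t \<noteq> 0" "b + \<i> * of_real t \<noteq> 0"
    using assms by (auto simp: complex_eq_iff)
  have K: "0 \<le> ?K" by auto
  have "resolvent_diff a b t = (b - a) * (1 / (a + \<i> * of_real t) * (1 / (b + \<i> * of_real t)))"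
    unfolding resolvent_diff_def using ne by (simp add: field_simps)
  then have "norm (resolvent_diff a b t) =
      norm (b - a) * (norm (1 / (a + \<i> * of_real t)) * norm (1 / (b + \<i> * of_real t)))"
    by (simp only: norm_mult)
  also have "\<dots> \<le> norm (b - a) * ((sqrt ?K / sqrt (1 + t\<^sup>2)) * (sqrt ?K / sqrt (1 + t\<^sup>2)))"
    using assms by (intro mult_left_mono mult_mono norm_resolvent_le) auto
  also have "\<dots> = ?K * norm (b - a) / (1 + t\<^sup>2)"
    using K by (simp add: field_simps flip: real_sqrt_mult)
  finally show ?thesis .
qed

lemma integrable_inverse_one_plus_square: "integrable lborel (\<lambda>t::real. K / (1 + t\<^sup>2))"
proof -
  have "integrable lborel (\<lambda>t::real. inverse (1 + t\<^sup>2))"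
    using integrable_inverse_1_plus_square by (simp add: set_integrable_def)
  then have "integrable lborel (\<lambda>t::real. K * inverse (1 + t\<^sup>2))" by simp
  then show ?thesis by (simp add: field_simps)
qed

lemma integral_inverse_one_plus_square: "(\<integral>t. K / (1 + t\<^sup>2) \<partial>lborel) = K * pi"
proof -
  have "(\<integral>t. inverse (1 + t\<^sup>2) \<partial>lborel) = pi"
    using LBINT_inverse_1_plus_square
    by (simp add: interval_lebesgue_integral_def set_lebesgue_integral_def)
  then have "(\<integral>t. K * inverse (1 + t\<^sup>2) \<partial>lborel) = K * pi" by simp
  then show ?thesis by (simp add: field_simps)
qed

lemma borel_measurable_resolvent_diff [measurable]: "resolvent_diff a b \<in> borel_measurable borel"
  unfolding resolvent_diff_def by measurable

lemma integrable_resolvent_diff: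
  assumes "0 < Re a" "0 < Re b"
  shows "integrable lborel (resolvent_diff a b)"
proof (rule Bochner_Integration.integrable_bound)
  let ?A = "max (norm a) (norm b)" and ?a0 = "min (Re a) (Re b)"
  show "integrable lborel (\<lambda>t::real. (2 + (1 + 2 * ?A\<^sup>2) / ?a0\<^sup>2) * norm (b - a) / (1 + t\<^sup>2))"
    by (rule integrable_inverse_one_plus_square)
  show "AE t in lborel. norm (resolvent_diff a b t) \<le>
      norm ((2 + (1 + 2 * ?A\<^sup>2) / ?a0\<^sup>2) * norm (b - a) / (1 + t\<^sup>2))"
    by (intro AE_I2 order_trans[OF norm_resolvent_diff_le[of ?a0 a ?A b]])
      (use assms in auto)
qed simp

lemma exp_half_line:
  fixes a :: complex
  assumes "0 < Re a"
  shows "integrable lborel (\<lambda>x. indicator {0<..} x *\<^sub>R exp (- (a * of_real x)))"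
    and "(\<integral>x. indicator {0<..} x *\<^sub>R exp (- (a * of_real x)) \<partial>lborel) = 1 / a"
proof -
  have a: "a \<noteq> 0" using assms by auto
  show int: "integrable lborel (\<lambda>x. indicator {0<..} x *\<^sub>R exp (- (a * of_real x)))"
  proof (rule Bochner_Integration.integrable_bound)
    show "integrable lborel (\<lambda>x. indicator {0<..} x *\<^sub>R exp (- (x * Re a)))"
      using integrable_I0i_exp_mscale[OF assms] by (simp add: set_integrable_def)
  qed (auto simp: indicator_def mult.commute)
  have lim: "((\<lambda>x. exp (- (a * of_real x))) \<longlongrightarrow> 0) at_top"
  proof (rule tendsto_norm_zero_cancel)
    have "((\<lambda>x. exp (- (Re a * x))) \<longlongrightarrow> 0) at_top"
      using assms by real_asymp
    then show "((\<lambda>x. norm (exp (- (a * of_real x)))) \<longlongrightarrow> 0) at_top" by simp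
  qed
  have "(LBINT x=0..\<infinity>. exp (- (a * of_real x))) = 0 - (- 1 / a)"
  proof (rule interval_integral_FTC_integrable[where F = "\<lambda>x. - exp (- (a * of_real x)) / a"])
    fix x :: real
    show "((\<lambda>x. - exp (- (a * of_real x)) / a) has_vector_derivative exp (- (a * of_real x))) (at x)"
      using a by (auto intro!: derivative_eq_intros has_vector_derivative_real_field simp: field_simps)
    show "isCont (\<lambda>x. exp (- (a * complex_of_real x))) x"
      by (intro continuous_intros)
  next
    show "set_integrable lborel (einterval 0 \<infinity>) (\<lambda>x. exp (- (a * of_real x)))"
      using int by (simp add: set_integrable_def zero_ereal_def einterval_def greaterThan_def)
    have "((\<lambda>x. - exp (- (a * of_real x)) / a) \<longlongrightarrow> - exp (- (a * of_real 0)) / a) (at_right 0)"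
      using a by (intro tendsto_intros)
    then show "(((\<lambda>x. - exp (- (a * of_real x)) / a) \<circ> real_of_ereal) \<longlongrightarrow> - 1 / a) (at_right 0)"
      by (simp add: zero_ereal_def ereal_tendsto_simps)
    have "((\<lambda>x. - exp (- (a * of_real x)) / a) \<longlongrightarrow> - 0 / a) at_top"
      using a by (intro tendsto_intros lim)
    then show "(((\<lambda>x. - exp (- (a * of_real x)) / a) \<circ> real_of_ereal) \<longlongrightarrow> 0) (at_left \<infinity>)"
      by (simp add: ereal_tendsto_simps)
  qed simp
  then show "(\<integral>x. indicator {0<..} x *\<^sub>R exp (- (a * of_real x)) \<partial>lborel) = 1 / a"
    by (simp add: interval_lebesgue_integral_0_infty set_lebesgue_integral_def)
qed

lemma fourier_gaussian:
  assumes e: "0 < e"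
  shows "(\<integral>t. exp (\<i> * of_real (t * s)) * of_real (exp (- (e * t)\<^sup>2 / 2)) \<partial>lborel) =
      of_real (sqrt (2 * pi) / e * exp (- (s / e)\<^sup>2 / 2))"
proof -
  let ?f = "\<lambda>t. exp (\<i> * of_real (t * s)) * of_real (exp (- (e * t)\<^sup>2 / 2))"
  have "(\<integral>t. ?f t \<partial>lborel) = \<bar>1 / e\<bar> *\<^sub>R (\<integral>\<tau>. ?f (0 + 1 / e * \<tau>) \<partial>lborel)"
    using e by (intro lborel_integral_real_affine) auto
  also have "(\<integral>\<tau>. ?f (0 + 1 / e * \<tau>) \<partial>lborel) =
      (\<integral>\<tau>. of_real (sqrt (2 * pi)) * (std_normal_density \<tau> *\<^sub>R iexp ((s / e) * \<tau>)) \<partial>lborel)"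
    using e by (intro Bochner_Integration.integral_cong refl)
      (simp add: std_normal_density_def scaleR_conv_of_real field_simps)
  also have "\<dots> = of_real (sqrt (2 * pi)) * (\<integral>\<tau>. std_normal_density \<tau> *\<^sub>R iexp ((s / e) * \<tau>) \<partial>lborel)"
    by (rule integral_mult_right_zero)
  also have "(\<integral>\<tau>. std_normal_density \<tau> *\<^sub>R iexp ((s / e) * \<tau>) \<partial>lborel) = char std_normal_distribution (s / e)"
    unfolding char_def by (subst integral_density) auto
  also have "\<dots> = of_real (exp (- (s / e)\<^sup>2 / 2))"
    by (simp add: char_std_normal_distribution)
  finally show ?thesis using e by (simp add: scaleR_conv_of_real)
qed

text \<open>Fourier inversion by Gaussian regularisation.\<close>

lemma exp_pos_part_inversion:
  fixes u :: complex
  assumes c: "0 < c" and u: "Re u < c"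
  shows "(\<integral>t. exp ((of_real c + \<i> * of_real t) * of_real x) * resolvent_diff (of_real c - u) (of_real c) t \<partial>lborel)
    = 2 * pi * (exp (u * of_real (max 0 x)) - 1)"
proof -
  \<comment> \<open>Damping by exp (-c y) gives integrability. The function vanishes for y \<le> 0
    and is a difference of two half-line exponentials that agree at 0, hence continuous.\<close>
  define f where "f = (\<lambda>y::real. exp (- (of_real c * of_real y)) * (exp (u * of_real (max 0 y)) - 1))"
  let ?k = "resolvent_diff (of_real c - u) (of_real c)"
  have f_eq: "f y = indicator {0<..} y *\<^sub>R exp (- ((of_real c - u) * of_real y))
      - indicator {0<..} y *\<^sub>R exp (- (of_real c * of_real y))" for y
    by (auto simp: f_def indicator_def algebra_simps simp flip: exp_add)
  have fm [measurable]: "f \<in> borel_measurable borel" unfolding f_def by measurable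
  have fi: "integrable lborel f"
    unfolding f_eq[abs_def] using c u by (intro Bochner_Integration.integrable_diff exp_half_line) auto
  have fc: "continuous_on UNIV f" unfolding f_def by (intro continuous_intros)
  have f_bound: "norm (f y) \<le> 2" for y
  proof (cases "y > 0")
    case True
    have "f y = exp (- ((of_real c - u) * of_real y)) - exp (- (of_real c * complex_of_real y))"
      using True unfolding f_eq by simp
    then have "norm (f y) \<le> norm (exp (- ((of_real c - u) * of_real y))) + norm (exp (- (of_real c * complex_of_real y)))"
      by (simp only: norm_triangle_ineq4)
    also have "\<dots> \<le> 1 + 1" using True c u by (intro add_mono) (auto simp: mult_nonneg_nonneg)
    finally show ?thesis by simp
  qed (simp add: f_eq)
  have k_eq: "(\<integral>y. f y * exp (- (\<i> * of_real (t * y))) \<partial>lborel) = ?k t" for t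
  proof -
    have "(\<integral>y. f y * exp (- (\<i> * of_real (t * y))) \<partial>lborel) =
       (\<integral>y. indicator {0<..} y *\<^sub>R exp (- ((of_real c - u + \<i> * of_real t) * of_real y))
        - indicator {0<..} y *\<^sub>R exp (- ((of_real c + \<i> * of_real t) * of_real y)) \<partial>lborel)"
      by (intro Bochner_Integration.integral_cong refl)
        (auto simp: f_eq indicator_def algebra_simps simp flip: exp_add)
    also have "\<dots> = ?k t"
      using c u by (subst Bochner_Integration.integral_diff) (auto intro!: exp_half_line simp: exp_half_line resolvent_diff_def)
    finally show ?thesis .
  qed
  have ki: "integrable lborel ?k" using c u by (intro integrable_resolvent_diff) auto
  \<comment> \<open>With the Gaussian factor the double integral converges absolutely; carrying out
    the t-integral first smooths f at x by a normal kernel of width e.\<close>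
  have reg: "(\<integral>t. exp (\<i> * of_real (t * x)) * ?k t * of_real (exp (- (e * t)\<^sup>2 / 2)) \<partial>lborel) =
      of_real (sqrt (2 * pi)) * (\<integral>\<tau>. f (x - e * \<tau>) * of_real (exp (- \<tau>\<^sup>2 / 2)) \<partial>lborel)" if e: "0 < e" for e
  proof -
    let ?g = "\<lambda>t. complex_of_real (exp (- (e * t)\<^sup>2 / 2))"
    have gi: "integrable lborel (\<lambda>t. exp (- (e * t)\<^sup>2 / 2))"
    proof -
      have "integrable lborel (\<lambda>t. sqrt (2 * pi) * std_normal_density (0 + e * t))"
        using e by (intro integrable_mult_right lborel_integrable_real_affine) auto
      then show ?thesis by (simp add: std_normal_density_def)
    qed
    have int2: "integrable (lborel \<Otimes>\<^sub>M lborel) (\<lambda>(y, t). f y * (exp (\<i> * of_real (t * (x - y))) * ?g t))"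
    proof (rule Bochner_Integration.integrable_bound)
      show "integrable (lborel \<Otimes>\<^sub>M lborel) (\<lambda>(y, t). norm (f y) * exp (- (e * t)\<^sup>2 / 2))"
        by (rule integrable_pair_mult) (use fi gi in \<open>auto intro: lborel.sigma_finite_measure_axioms\<close>)
    qed (auto simp: norm_mult split_beta')
    have "(\<integral>t. exp (\<i> * of_real (t * x)) * ?k t * ?g t \<partial>lborel) =
        (\<integral>t. (\<integral>y. f y * (exp (\<i> * of_real (t * (x - y))) * ?g t) \<partial>lborel) \<partial>lborel)"
    proof (intro Bochner_Integration.integral_cong refl)
      fix t
      have "(\<integral>y. f y * (exp (\<i> * of_real (t * (x - y))) * ?g t) \<partial>lborel) =
          (\<integral>y. (exp (\<i> * of_real (t * x)) * ?g t) * (f y * exp (- (\<i> * of_real (t * y)))) \<partial>lborel)"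
        by (intro Bochner_Integration.integral_cong refl)
          (simp add: algebra_simps exp_diff exp_minus field_simps)
      also have "\<dots> = (exp (\<i> * of_real (t * x)) * ?g t) * ?k t"
        by (simp only: integral_mult_right_zero k_eq)
      finally show "exp (\<i> * of_real (t * x)) * ?k t * ?g t =
          (\<integral>y. f y * (exp (\<i> * of_real (t * (x - y))) * ?g t) \<partial>lborel)"
        by (simp add: mult_ac)
    qed
    also have "\<dots> = (\<integral>y. (\<integral>t. f y * (exp (\<i> * of_real (t * (x - y))) * ?g t) \<partial>lborel) \<partial>lborel)"
      by (rule lborel_pair.Fubini_integral[OF int2])
    also have "\<dots> = (\<integral>y. f y * of_real (sqrt (2 * pi) / e * exp (- ((x - y) / e)\<^sup>2 / 2)) \<partial>lborel)"
      by (simp only: integral_mult_right_zero fourier_gaussian[OF e])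
    also have "\<dots> = \<bar>- e\<bar> *\<^sub>R (\<integral>\<tau>. f (x + - e * \<tau>) * of_real (sqrt (2 * pi) / e * exp (- ((x - (x + - e * \<tau>)) / e)\<^sup>2 / 2)) \<partial>lborel)"
      using e by (intro lborel_integral_real_affine) auto
    also have "(\<integral>\<tau>. f (x + - e * \<tau>) * of_real (sqrt (2 * pi) / e * exp (- ((x - (x + - e * \<tau>)) / e)\<^sup>2 / 2)) \<partial>lborel) =
       (\<integral>\<tau>. of_real (sqrt (2 * pi) / e) * (f (x - e * \<tau>) * of_real (exp (- \<tau>\<^sup>2 / 2))) \<partial>lborel)"
      using e by (intro Bochner_Integration.integral_cong refl) (simp add: mult_ac)
    also have "\<bar>- e\<bar> *\<^sub>R \<dots> = of_real (sqrt (2 * pi)) * (\<integral>\<tau>. f (x - e * \<tau>) * of_real (exp (- \<tau>\<^sup>2 / 2)) \<partial>lborel)"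
      using e by (subst integral_mult_right_zero) (simp add: scaleR_conv_of_real)
    finally show ?thesis .
  qed
  define \<epsilon> where "\<epsilon> = (\<lambda>m. 1 / real (Suc m))"
  have \<epsilon>: "\<epsilon> m > 0" for m by (simp add: \<epsilon>_def)
  have \<epsilon>0: "\<epsilon> \<longlonglongrightarrow> 0" unfolding \<epsilon>_def by (rule LIMSEQ_Suc[OF lim_1_over_n])
  have gauss_int: "integrable lborel (\<lambda>\<tau>::real. exp (- \<tau>\<^sup>2 / 2))"
    "(\<integral>\<tau>. exp (- \<tau>\<^sup>2 / 2) \<partial>lborel) = sqrt (2 * pi)"
  proof -
    have "integrable lborel (\<lambda>t. sqrt (2 * pi) * std_normal_density t)" by simp
    then show "integrable lborel (\<lambda>\<tau>::real. exp (- \<tau>\<^sup>2 / 2))" by (simp add: std_normal_density_def)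
    have "(\<integral>t. sqrt (2 * pi) * std_normal_density t \<partial>lborel) = sqrt (2 * pi)" by simp
    then show "(\<integral>\<tau>. exp (- \<tau>\<^sup>2 / 2) \<partial>lborel) = sqrt (2 * pi)" by (simp add: std_normal_density_def)
  qed
  have lim1: "(\<lambda>m. \<integral>t. exp (\<i> * of_real (t * x)) * ?k t * of_real (exp (- (\<epsilon> m * t)\<^sup>2 / 2)) \<partial>lborel)
      \<longlonglongrightarrow> (\<integral>t. exp (\<i> * of_real (t * x)) * ?k t \<partial>lborel)"
  proof (rule integral_dominated_convergence[where w = "\<lambda>t. norm (?k t)"])
    show "AE t in lborel. (\<lambda>m. exp (\<i> * of_real (t * x)) * ?k t * of_real (exp (- (\<epsilon> m * t)\<^sup>2 / 2)))
        \<longlonglongrightarrow> exp (\<i> * of_real (t * x)) * ?k t"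
    proof (rule AE_I2)
      fix t
      have "(\<lambda>m. exp (\<i> * of_real (t * x)) * ?k t * of_real (exp (- (\<epsilon> m * t)\<^sup>2 / 2)))
        \<longlonglongrightarrow> exp (\<i> * of_real (t * x)) * ?k t * of_real (exp (- (0 * t)\<^sup>2 / 2))"
        by (intro tendsto_intros \<epsilon>0) simp
      then show "(\<lambda>m. exp (\<i> * of_real (t * x)) * ?k t * of_real (exp (- (\<epsilon> m * t)\<^sup>2 / 2)))
        \<longlonglongrightarrow> exp (\<i> * of_real (t * x)) * ?k t" by simp
    qed
    show "AE t in lborel. norm (exp (\<i> * of_real (t * x)) * ?k t * of_real (exp (- (\<epsilon> m * t)\<^sup>2 / 2))) \<le> norm (?k t)" for m
      by (auto simp: norm_mult mult_left_le)
  qed (use ki in auto)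
  \<comment> \<open>Boundedness of f dominates the integrand, and continuity of f identifies the
    limit at the single point x.\<close>
  have lim2: "(\<lambda>m. \<integral>\<tau>. f (x - \<epsilon> m * \<tau>) * of_real (exp (- \<tau>\<^sup>2 / 2)) \<partial>lborel)
      \<longlonglongrightarrow> (\<integral>\<tau>. f x * of_real (exp (- \<tau>\<^sup>2 / 2)) \<partial>lborel)"
  proof (rule integral_dominated_convergence[where w = "\<lambda>\<tau>. 2 * exp (- \<tau>\<^sup>2 / 2)"])
    show "AE \<tau> in lborel. (\<lambda>m. f (x - \<epsilon> m * \<tau>) * of_real (exp (- \<tau>\<^sup>2 / 2))) \<longlonglongrightarrow> f x * of_real (exp (- \<tau>\<^sup>2 / 2))"
    proof (rule AE_I2)
      fix \<tau> :: real
      have "(\<lambda>m. x - \<epsilon> m * \<tau>) \<longlonglongrightarrow> x - 0 * \<tau>" by (intro tendsto_intros \<epsilon>0)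
      then have "(\<lambda>m. f (x - \<epsilon> m * \<tau>)) \<longlonglongrightarrow> f x"
        by (intro continuous_on_tendsto_compose[OF fc]) auto
      then show "(\<lambda>m. f (x - \<epsilon> m * \<tau>) * of_real (exp (- \<tau>\<^sup>2 / 2))) \<longlonglongrightarrow> f x * of_real (exp (- \<tau>\<^sup>2 / 2))"
        by (intro tendsto_intros)
    qed
    show "AE \<tau> in lborel. norm (f (x - \<epsilon> m * \<tau>) * of_real (exp (- \<tau>\<^sup>2 / 2))) \<le> 2 * exp (- \<tau>\<^sup>2 / 2)" for m
      using f_bound by (auto simp: norm_mult)
  qed (use gauss_int in auto)
  have "(\<integral>t. exp (\<i> * of_real (t * x)) * ?k t \<partial>lborel) =
      of_real (sqrt (2 * pi)) * (\<integral>\<tau>. f x * of_real (exp (- \<tau>\<^sup>2 / 2)) \<partial>lborel)"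
    using lim1 unfolding reg[OF \<epsilon>]
    by (rule LIMSEQ_unique) (intro tendsto_intros lim2)
  also have "\<dots> = of_real (sqrt (2 * pi)) * (f x * of_real (sqrt (2 * pi)))"
    by (simp only: integral_mult_right_zero integral_complex_of_real gauss_int(2))
  also have "\<dots> = 2 * pi * f x"
    by (simp add: mult_ac flip: of_real_mult)
  finally have main: "(\<integral>t. exp (\<i> * of_real (t * x)) * ?k t \<partial>lborel) = 2 * pi * f x" .
  have "(\<integral>t. exp ((of_real c + \<i> * of_real t) * of_real x) * ?k t \<partial>lborel) =
      (\<integral>t. exp (of_real c * of_real x) * (exp (\<i> * of_real (t * x)) * ?k t) \<partial>lborel)"
    by (intro Bochner_Integration.integral_cong refl) (simp add: distrib_right exp_add mult.assoc)
  also have "\<dots> = exp (of_real c * of_real x) * (2 * pi * f x)"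
    by (simp only: integral_mult_right_zero main)
  also have "\<dots> = 2 * pi * (exp (u * of_real (max 0 x)) - 1)"
    by (simp add: f_def exp_minus)
  finally show ?thesis .
qed

section \<open>The waiting-time transform as a Fourier integral\<close>

context stationary_wait
begin

definition tilted :: "real \<Rightarrow> complex" where
  "tilted t = (\<integral>x. exp ((of_real c + \<i> * of_real t) * of_real x) \<partial>\<mu>)"

lemma exp_bounded_tilt: "exp_bounded c (\<lambda>x. exp ((of_real c + \<i> * of_real t) * complex_of_real x))"
  by (rule exp_bounded_complex_exp) (use c_nonneg in auto)

lemma integral_tilt_walk_law:
  "(\<integral>x. exp ((of_real c + \<i> * of_real t) * of_real x) \<partial>walk_law \<mu> k) = tilted t ^ k"
  unfolding tilted_def
  by (rule integral_walk_law_power[OF exp_bounded_tilt]) (auto simp: distrib_left exp_add)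

lemma norm_tilted_le: "norm (tilted t) \<le> q"
proof -
  have "norm (tilted t) \<le> (\<integral>x. norm (exp ((of_real c + \<i> * of_real t) * complex_of_real x)) \<partial>\<mu>)"
    unfolding tilted_def by (rule integral_norm_bound)
  then show ?thesis by (simp add: q_def)
qed

lemma borel_measurable_tilted [measurable]: "tilted \<in> borel_measurable borel"
proof -
  note [measurable_cong] = exp_lawD(2)[OF law]
  show ?thesis unfolding tilted_def by measurable
qed

lemma pos_part_moment:
  assumes c: "0 < c" and u: "Re u < c"
  shows "(\<integral>x. exp (u * of_real (max 0 x)) - 1 \<partial>walk_law \<mu> k) =
    (\<integral>t. tilted t ^ k * resolvent_diff (of_real c - u) (of_real c) t \<partial>lborel) / (2 * pi)"
proof -
  let ?A = "walk_law \<mu> k" and ?r = "resolvent_diff (of_real c - u) (of_real c)"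
  let ?E = "\<lambda>x t. exp ((of_real c + \<i> * of_real t) * complex_of_real x)"
  have A: "exp_law c ?A" by (rule exp_law_walk_law[OF law c_nonneg])
  interpret A: prob_space ?A using exp_lawD[OF A] by simp
  interpret pair_sigma_finite ?A lborel ..
  note [measurable_cong] = exp_lawD(2)[OF A]
  have ri: "integrable lborel ?r" using c u by (intro integrable_resolvent_diff) auto
  have int: "integrable (?A \<Otimes>\<^sub>M lborel) (\<lambda>(x, t). ?E x t * ?r t)"
  proof (rule Bochner_Integration.integrable_bound)
    show "integrable (?A \<Otimes>\<^sub>M lborel) (\<lambda>(x, t). exp (c * x) * norm (?r t))"
      by (rule integrable_pair_mult) (use ri integrable_exp_of_exp_law[OF A c_nonneg] in
          \<open>auto intro: lborel.sigma_finite_measure_axioms A.sigma_finite_measure_axioms\<close>)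
  qed (auto simp: norm_mult split_beta')
  have "(\<integral>t. tilted t ^ k * ?r t \<partial>lborel) = (\<integral>t. (\<integral>x. ?E x t * ?r t \<partial>?A) \<partial>lborel)"
    by (simp add: integral_tilt_walk_law)
  also have "\<dots> = (\<integral>x. (\<integral>t. ?E x t * ?r t \<partial>lborel) \<partial>?A)"
    by (rule Fubini_integral[OF int])
  also have "\<dots> = (\<integral>x. 2 * pi * (exp (u * of_real (max 0 x)) - 1) \<partial>?A)"
    by (simp only: exp_pos_part_inversion[OF c u])
  also have "\<dots> = 2 * pi * (\<integral>x. exp (u * of_real (max 0 x)) - 1 \<partial>?A)"
    by (rule integral_mult_right_zero)
  finally show ?thesis by simp
qed

text \<open>Summing the inversion formula over k with weight 1 / k produces - Ln (1 - z). On the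
  whole line |z| \<le> q < 1, which keeps z in the disc of the logarithm series and, together with
  the integrable resolvent difference, justifies exchanging sum and integral.\<close>

lemma transform_eq:
  assumes c: "0 < c" and u: "Re u < c"
  shows "(\<integral>x. exp (u * of_real x) \<partial>w) =
    exp ((\<integral>t. - Ln (1 - tilted t) * resolvent_diff (of_real c - u) (of_real c) t \<partial>lborel) / (2 * pi))"
proof -
  let ?r = "resolvent_diff (of_real c - u) (of_real c)"
  have ri: "integrable lborel ?r" using c u by (intro integrable_resolvent_diff) auto
  define g where "g = (\<lambda>k t. tilted t ^ Suc k / of_nat (Suc k) * ?r t)"
  have norm_g: "norm (g k t) \<le> q ^ Suc k * norm (?r t)" for k t
  proof -
    have "norm (tilted t) ^ Suc k / real (Suc k) \<le> q ^ Suc k / 1"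
      using norm_tilted_le[of t] q_nonneg by (intro frac_le power_mono) auto
    then have "norm (tilted t) ^ Suc k / real (Suc k) * norm (?r t) \<le> q ^ Suc k / 1 * norm (?r t)"
      by (rule mult_right_mono) simp
    then show ?thesis
      by (simp only: g_def norm_mult norm_divide norm_power norm_of_nat div_by_1)
  qed
  have gi: "integrable lborel (g k)" for k
  proof (rule Bochner_Integration.integrable_bound)
    show "integrable lborel (\<lambda>t. q ^ Suc k * norm (?r t))" using ri by auto
    show "AE t in lborel. norm (g k t) \<le> norm (q ^ Suc k * norm (?r t))"
      by (intro AE_I2 order_trans[OF norm_g]) auto
  qed (simp add: g_def)
  have geo: "summable (\<lambda>k. q ^ Suc k * a)" for a
    using q_nonneg q_less_1 by (intro summable_mult2) (simp add: summable_geometric summable_mult)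
  have sums_g: "(\<lambda>k. g k t) sums (- Ln (1 - tilted t) * ?r t)" for t
  proof -
    have lt: "norm (- tilted t) < 1" using norm_tilted_le[of t] q_less_1 by simp
    have "(\<lambda>k. - ((- (- tilted t)) ^ k) / of_nat k) sums Ln (1 + - tilted t)"
      by (rule Ln_series'[OF lt])
    then have "(\<lambda>k. - (tilted t ^ Suc k) / of_nat (Suc k)) sums Ln (1 - tilted t)"
      by (subst sums_Suc_iff) simp
    from sums_mult2[OF sums_minus[OF this], of "?r t"] show ?thesis
      by (simp add: g_def)
  qed
  have "(\<lambda>k. \<integral>t. g k t \<partial>lborel) sums (\<integral>t. (\<Sum>k. g k t) \<partial>lborel)"
  proof (rule sums_integral[OF gi])
    show "AE t in lborel. summable (\<lambda>k. norm (g k t))"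
      by (intro AE_I2 summable_comparison_test'[OF geo]) (use norm_g in auto)
    show "summable (\<lambda>k. \<integral>t. norm (g k t) \<partial>lborel)"
    proof (rule summable_comparison_test'[OF geo])
      fix k
      have "(\<integral>t. norm (g k t) \<partial>lborel) \<le> (\<integral>t. q ^ Suc k * norm (?r t) \<partial>lborel)"
        using ri gi norm_g by (intro integral_mono) auto
      then show "norm (\<integral>t. norm (g k t) \<partial>lborel) \<le> q ^ Suc k * (\<integral>t. norm (?r t) \<partial>lborel)"
        by simp
    qed
  qed
  then have "(\<lambda>k. \<integral>t. g k t \<partial>lborel) sums (\<integral>t. - Ln (1 - tilted t) * ?r t \<partial>lborel)"
    using sums_g by (simp add: sums_iff)
  then have *: "(\<lambda>k. (\<integral>t. g k t \<partial>lborel) / (2 * pi)) sums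
      ((\<integral>t. - Ln (1 - tilted t) * ?r t \<partial>lborel) / (2 * pi))"
    by (rule sums_divide)
  have "(\<integral>x. exp (u * of_real (max 0 x)) - 1 \<partial>walk_law \<mu> (Suc k)) / of_nat (Suc k) =
      (\<integral>t. g k t \<partial>lborel) / (2 * pi)" for k
  proof -
    have "(\<integral>t. g k t \<partial>lborel) = (\<integral>t. (tilted t ^ Suc k * ?r t) / of_nat (Suc k) \<partial>lborel)"
      unfolding g_def by (intro Bochner_Integration.integral_cong refl) simp
    also have "\<dots> = (\<integral>t. tilted t ^ Suc k * ?r t \<partial>lborel) / of_nat (Suc k)"
      by (rule integral_divide_zero)
    finally show ?thesis unfolding pos_part_moment[OF c u] by (simp add: field_simps)
  qed
  then have "(\<Sum>k. (\<integral>x. exp (u * of_real (max 0 x)) - 1 \<partial>walk_law \<mu> (Suc k)) / of_nat (Suc k)) =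
      (\<integral>t. - Ln (1 - tilted t) * ?r t \<partial>lborel) / (2 * pi)"
    using * by (simp only: sums_iff)
  then show ?thesis using spitzer_transform(1)[of u] u by simp
qed

end

section \<open>The maximum of the Gaussian random walk\<close>

abbreviation shifted_normal :: "real \<Rightarrow> real measure" where
  "shifted_normal \<beta> \<equiv> density lborel (\<lambda>x. ennreal (normal_density (- \<beta>) 1 x))"

definition partial_sum :: "(nat \<Rightarrow> real) \<Rightarrow> nat \<Rightarrow> real" where
  "partial_sum x k = (\<Sum>i<k. x i)"

lemma partial_sum_case_nat: "partial_sum (case_nat s x) (Suc k) = s + partial_sum x k"
  unfolding partial_sum_def by (subst sum.lessThan_Suc_shift) simp

text \<open>A prepended step turns the partial sums into 0 and s plus the old ones. The supremum is
  moved through this under a boundedness condition, because the real supremum of an unbounded set is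
  only a default value.\<close>

lemma walk_max_case_nat:
  assumes "bdd_above (range (partial_sum x))"
  shows "walk_max (case_nat s x) = max 0 (s + walk_max x)"
    and "bdd_above (range (partial_sum (case_nat s x)))"
proof -
  let ?P = "partial_sum (case_nat s x)"
  have P: "range ?P = insert 0 ((+) s ` range (partial_sum x))"
  proof -
    have "range ?P = insert (?P 0) (range (\<lambda>k. ?P (Suc k)))"
      by (auto simp: image_iff) (metis not0_implies_Suc)
    then show ?thesis
      by (simp add: partial_sum_case_nat image_image) (simp add: partial_sum_def)
  qed
  have b: "bdd_above ((+) s ` range (partial_sum x))"
    using assms by (intro bdd_above_image_mono[of "(+) s"]) (auto simp: mono_def)
  then show "bdd_above (range ?P)" unfolding P by simp
  have "Sup (range ?P) = max 0 (Sup ((+) s ` range (partial_sum x)))"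
    unfolding P using b by (subst cSup_insert) (auto simp: sup_max)
  also have "Sup ((+) s ` range (partial_sum x)) = s + Sup (range (partial_sum x))"
  proof (rule cSup_eq_non_empty)
    show "s + Sup (range (partial_sum x)) \<le> y"
      if "\<And>z. z \<in> (+) s ` range (partial_sum x) \<Longrightarrow> z \<le> y" for y
    proof -
      have "Sup (range (partial_sum x)) \<le> y - s"
      proof (rule cSUP_least)
        fix k
        have "s + partial_sum x k \<le> y" by (rule that) auto
        then show "partial_sum x k \<le> y - s" by simp
      qed simp
      then show ?thesis by simp
    qed
  qed (use assms in \<open>auto intro!: cSUP_upper\<close>)
  finally show "walk_max (case_nat s x) = max 0 (s + walk_max x)"
    by (simp add: walk_max_def partial_sum_def[abs_def])
qed

lemma prob_space_shifted_normal: "prob_space (shifted_normal \<beta>)"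
  by (rule prob_space_normal_density) simp

lemma sets_PiM_shifted_normal: "sets (Pi\<^sub>M UNIV (\<lambda>_::nat. shifted_normal \<beta>)) = sets (Pi\<^sub>M UNIV (\<lambda>_::nat. borel))"
  by (rule sets_PiM_cong) auto

lemma borel_measurable_partial_sum [measurable]:
  "(\<lambda>x. partial_sum x k) \<in> borel_measurable (Pi\<^sub>M UNIV (\<lambda>_::nat. borel))"
  unfolding partial_sum_def by measurable

text \<open>Where the walk is unbounded the supremum is one and the same constant for all x. Hence
  measurability holds on the whole sequence space and not just up to a null set.\<close>

lemma walk_max_cases:
  "walk_max x = (if bdd_above (range (partial_sum x)) then Sup (range (partial_sum x)) else (LEAST z. False))"
proof -
  have "(\<lambda>z. \<forall>y\<in>range (partial_sum x). y \<le> z) = (\<lambda>_. False)" if "\<not> bdd_above (range (partial_sum x))"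
    using that by (auto simp: bdd_above_def fun_eq_iff)
  moreover have "walk_max x = Sup (range (partial_sum x))"
    unfolding walk_max_def by (simp add: partial_sum_def[abs_def])
  ultimately show ?thesis by (auto simp: Sup_real_def)
qed

lemma borel_measurable_walk_max [measurable]:
  "walk_max \<in> borel_measurable (Pi\<^sub>M UNIV (\<lambda>_::nat. borel))"
proof -
  let ?B = "\<lambda>x. \<exists>n::nat. \<forall>k. partial_sum x k \<le> real n"
  \<comment> \<open>\<open>borel_measurable_cSUP\<close> asks for a bounded family at every x, so
    unbounded walks are set to 0 before the supremum is taken.\<close>
  let ?g = "\<lambda>k x. if ?B x then partial_sum x k else 0"
  have B: "bdd_above (range (partial_sum x)) \<longleftrightarrow> ?B x" for x
  proof
    assume "bdd_above (range (partial_sum x))"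
    then obtain M where M: "\<And>k. partial_sum x k \<le> M" by (auto simp: bdd_above_def)
    obtain n where "M \<le> real n" using real_arch_simple by blast
    then show "?B x" using M order_trans by blast
  next
    assume "?B x"
    then show "bdd_above (range (partial_sum x))" by (auto simp: bdd_above_def)
  qed
  have "(\<lambda>x. SUP k. ?g k x) \<in> borel_measurable (Pi\<^sub>M UNIV (\<lambda>_::nat. borel))"
  proof (rule borel_measurable_cSUP)
    fix x show "bdd_above (range (\<lambda>k. ?g k x))"
      by (auto simp: B[symmetric])
  qed auto
  then have "(\<lambda>x. if ?B x then (SUP k. ?g k x) else (LEAST z. False)) \<in> borel_measurable (Pi\<^sub>M UNIV (\<lambda>_::nat. borel))"
    by measurable
  moreover have "walk_max = (\<lambda>x. if ?B x then (SUP k. ?g k x) else (LEAST z. False))"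
    by (rule ext) (auto simp: walk_max_cases B)
  ultimately show ?thesis by simp
qed

text \<open>Tilting by exp (\<beta> x) centres the normal law of mean -\<beta>: its density becomes
  exp (-\<beta>^2 / 2) times the standard normal one. So \<beta> is the saddle point of the Gaussian
  step.\<close>

lemma tilted_shifted_normal:
  "(\<integral>x. exp ((of_real \<beta> + \<i> * of_real t) * complex_of_real x) \<partial>shifted_normal \<beta>) =
     of_real (exp (- \<beta>\<^sup>2 / 2 - t\<^sup>2 / 2))"
  and integral_exp_shifted_normal: "(\<integral>x. exp (\<beta> * x) \<partial>shifted_normal \<beta>) = exp (- \<beta>\<^sup>2 / 2)"
  and integrable_exp_shifted_normal: "integrable (shifted_normal \<beta>) (\<lambda>x. exp (\<beta> * x))"
proof -
  have dens: "normal_density (- \<beta>) 1 x * exp (\<beta> * x) = exp (- \<beta>\<^sup>2 / 2) * std_normal_density x" for x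
    by (simp add: normal_density_def power2_sum add_divide_distrib diff_divide_distrib algebra_simps flip: exp_add)
  have "(\<integral>x. exp ((of_real \<beta> + \<i> * of_real t) * complex_of_real x) \<partial>shifted_normal \<beta>) =
      (\<integral>x. of_real (exp (- \<beta>\<^sup>2 / 2)) * (std_normal_density x *\<^sub>R iexp (t * x)) \<partial>lborel)"
  proof (subst integral_density, simp, simp, simp, intro Bochner_Integration.integral_cong refl)
    fix x
    have "normal_density (- \<beta>) 1 x *\<^sub>R exp ((of_real \<beta> + \<i> * of_real t) * complex_of_real x) =
        of_real (normal_density (- \<beta>) 1 x * exp (\<beta> * x)) * iexp (t * x)"
      by (simp add: scaleR_conv_of_real distrib_right exp_add mult.assoc flip: exp_of_real)
    then show "normal_density (- \<beta>) 1 x *\<^sub>R exp ((of_real \<beta> + \<i> * of_real t) * complex_of_real x) =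
        of_real (exp (- \<beta>\<^sup>2 / 2)) * (std_normal_density x *\<^sub>R iexp (t * x))"
      unfolding dens by (simp add: scaleR_conv_of_real mult.assoc)
  qed
  also have "\<dots> = of_real (exp (- \<beta>\<^sup>2 / 2)) * (\<integral>x. std_normal_density x *\<^sub>R iexp (t * x) \<partial>lborel)"
    by (rule integral_mult_right_zero)
  also have "(\<integral>x. std_normal_density x *\<^sub>R iexp (t * x) \<partial>lborel) = char std_normal_distribution t"
    unfolding char_def by (subst integral_density) auto
  also have "of_real (exp (- \<beta>\<^sup>2 / 2)) * \<dots> = of_real (exp (- \<beta>\<^sup>2 / 2 - t\<^sup>2 / 2))"
    by (simp add: char_std_normal_distribution flip: exp_add of_real_mult)
  finally show "(\<integral>x. exp ((of_real \<beta> + \<i> * of_real t) * complex_of_real x) \<partial>shifted_normal \<beta>) =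
     of_real (exp (- \<beta>\<^sup>2 / 2 - t\<^sup>2 / 2))" .
  show "(\<integral>x. exp (\<beta> * x) \<partial>shifted_normal \<beta>) = exp (- \<beta>\<^sup>2 / 2)"
    by (subst integral_density) (simp_all add: dens)
  show "integrable (shifted_normal \<beta>) (\<lambda>x. exp (\<beta> * x))"
    by (subst integrable_density) (simp_all add: dens)
qed

lemma exp_law_shifted_normal: "exp_law \<beta> (shifted_normal \<beta>)" if "0 \<le> \<beta>"
proof -
  interpret prob_space "shifted_normal \<beta>" by (rule prob_space_shifted_normal)
  have "integrable (shifted_normal \<beta>) (\<lambda>x. exp (\<beta> * max 0 x))"
  proof (rule Bochner_Integration.integrable_bound)
    show "integrable (shifted_normal \<beta>) (\<lambda>x. 1 + exp (\<beta> * x))"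
      using integrable_exp_shifted_normal by simp
    show "AE x in shifted_normal \<beta>. norm (exp (\<beta> * max 0 x)) \<le> norm (1 + exp (\<beta> * x))"
      by (rule AE_I2) (auto simp: max_def abs_of_nonneg add_nonneg_nonneg)
  qed simp
  then show ?thesis by (simp add: exp_law_def prob_space_shifted_normal)
qed

definition gauss_max_law :: "real \<Rightarrow> real measure" where
  "gauss_max_law \<beta> = distr (gauss_steps \<beta>) borel walk_max"

lemma gauss_max_integrals:
  "gauss_max_moment k \<beta> = (\<integral>x. x ^ k \<partial>gauss_max_law \<beta>)"
  "gauss_max_laplace \<beta> r = (\<integral>x. exp (- r * x) \<partial>gauss_max_law \<beta>)"
proof -
  note [measurable_cong] = sets_PiM_shifted_normal
  show "gauss_max_moment k \<beta> = (\<integral>x. x ^ k \<partial>gauss_max_law \<beta>)"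
    "gauss_max_laplace \<beta> r = (\<integral>x. exp (- r * x) \<partial>gauss_max_law \<beta>)"
    unfolding gauss_max_moment_def gauss_max_laplace_def gauss_max_law_def gauss_steps_def
    by (subst integral_distr; simp)+
qed

text \<open>The sum of exp (\<beta> S_k) over all k has a geometric series in exp (-\<beta>^2 / 2)
  as its expectation. It is therefore almost surely finite, and its value bounds all partial sums at
  once.\<close>

lemma AE_bdd_above_partial_sum:
  assumes \<beta>: "0 < \<beta>"
  shows "AE x in gauss_steps \<beta>. bdd_above (range (partial_sum x))"
proof -
  interpret N: prob_space "shifted_normal \<beta>" by (rule prob_space_shifted_normal)
  interpret product_prob_space "\<lambda>_. shifted_normal \<beta>" "UNIV :: nat set" ..
  interpret sequence_space "shifted_normal \<beta>" ..
  note [measurable_cong] = sets_PiM_shifted_normal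
  define q where "q = exp (- \<beta>\<^sup>2 / 2)"
  have q: "0 < q" "q < 1" using \<beta> by (auto simp: q_def)
  let ?e = "\<lambda>k x. ennreal (exp (\<beta> * partial_sum x k))"
  have step: "(\<integral>\<^sup>+x. ?e k x \<partial>S) = ennreal (q ^ k)" for k
  proof (induction k)
    case 0
    then show ?case by (simp add: partial_sum_def P.emeasure_space_1)
  next
    case (Suc k)
    have "(\<integral>\<^sup>+x. ?e (Suc k) x \<partial>S) = (\<integral>\<^sup>+x. ?e (Suc k) x \<partial>distr (shifted_normal \<beta> \<Otimes>\<^sub>M S) S (\<lambda>(s, \<omega>). case_nat s \<omega>))"
      by (simp only: PiM_iter)
    also have "\<dots> = (\<integral>\<^sup>+p. ennreal (exp (\<beta> * fst p)) * ?e k (snd p) \<partial>(shifted_normal \<beta> \<Otimes>\<^sub>M S))"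
      by (subst nn_integral_distr)
        (auto simp: partial_sum_case_nat split_beta' distrib_left exp_add ennreal_mult' measurable_split_conv
          intro!: nn_integral_cong)
    also have "\<dots> = (\<integral>\<^sup>+s. \<integral>\<^sup>+x. ennreal (exp (\<beta> * s)) * ?e k x \<partial>S \<partial>shifted_normal \<beta>)"
      by (subst P.nn_integral_fst[symmetric]) auto
    also have "\<dots> = (\<integral>\<^sup>+s. ennreal (exp (\<beta> * s)) * ennreal (q ^ k) \<partial>shifted_normal \<beta>)"
      by (subst nn_integral_cmult) (auto simp: Suc.IH)
    also have "\<dots> = (\<integral>\<^sup>+s. ennreal (exp (\<beta> * s)) \<partial>shifted_normal \<beta>) * ennreal (q ^ k)"
      by (subst nn_integral_multc) auto
    also have "(\<integral>\<^sup>+s. ennreal (exp (\<beta> * s)) \<partial>shifted_normal \<beta>) = ennreal q"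
      using integral_exp_shifted_normal integrable_exp_shifted_normal
      by (subst nn_integral_eq_integral) (auto simp: q_def)
    also have "ennreal q * ennreal (q ^ k) = ennreal (q ^ Suc k)"
      using q by (simp add: ennreal_mult')
    finally show ?case .
  qed
  have "(\<integral>\<^sup>+x. (\<Sum>k. ?e k x) \<partial>S) = (\<Sum>k. ennreal (q ^ k))"
    by (subst nn_integral_suminf) (simp_all add: step)
  also have "\<dots> = ennreal (1 / (1 - q))"
    using q by (intro suminf_ennreal_eq geometric_sums) auto
  also have "\<dots> < \<infinity>" by simp
  finally have "(\<integral>\<^sup>+x. (\<Sum>k. ?e k x) \<partial>S) \<noteq> \<infinity>" by simp
  then have "AE x in S. (\<Sum>k. ?e k x) \<noteq> \<infinity>"
    by (intro nn_integral_PInf_AE) auto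
  then show ?thesis
    unfolding gauss_steps_def
  proof eventually_elim
    case (elim x)
    then have "(\<Sum>k. ?e k x) < top" by (simp only: less_top infinity_ennreal_def not_False_eq_True simp_thms)
    from ennreal_enn2real[OF this] obtain R where R: "(\<Sum>k. ?e k x) = ennreal R" "R \<ge> 0"
      by (metis enn2real_nonneg)
    have "partial_sum x k \<le> R / \<beta>" for k
    proof -
      have "?e k x = (\<Sum>j\<in>{k}. ?e j x)" by simp
      also have "\<dots> \<le> (\<Sum>k. ?e k x)" by (rule sum_le_suminf) simp_all
      finally have "exp (\<beta> * partial_sum x k) \<le> R"
        unfolding R(1) by (rule ennreal_le_iff[OF R(2), THEN iffD1])
      then have "\<beta> * partial_sum x k \<le> R"
        using exp_ge_add_one_self[of "\<beta> * partial_sum x k"] by linarith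
      then show ?thesis using \<beta> by (simp add: field_simps)
    qed
    then show ?case by (auto simp: bdd_above_def)
  qed
qed

text \<open>Prepending an independent step leaves the law of the step sequence unchanged, which
  makes M and (X + M)^+ equal in law. The maximum is thereby a stationary waiting time, and queue
  and Gaussian walk share one transform formula.\<close>

lemma stationary_wait_gauss:
  assumes \<beta>: "0 < \<beta>"
  shows "stationary_wait (shifted_normal \<beta>) (gauss_max_law \<beta>) \<beta>"
proof -
  interpret N: prob_space "shifted_normal \<beta>" by (rule prob_space_shifted_normal)
  interpret product_prob_space "\<lambda>_. shifted_normal \<beta>" "UNIV :: nat set" ..
  interpret sequence_space "shifted_normal \<beta>" ..
  note [measurable_cong] = sets_PiM_shifted_normal
  interpret pp: pair_prob_space "shifted_normal \<beta>" S ..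
  have prob: "prob_space (gauss_max_law \<beta>)"
    unfolding gauss_max_law_def gauss_steps_def by (rule P.prob_space_distr) measurable
  have bdd: "AE x in S. bdd_above (range (partial_sum x))"
    using AE_bdd_above_partial_sum[OF \<beta>] unfolding gauss_steps_def .
  have nonneg: "AE x in gauss_max_law \<beta>. 0 \<le> x"
  proof -
    have "AE x in S. 0 \<le> walk_max x"
      using bdd
    proof eventually_elim
      case (elim x)
      then have "partial_sum x 0 \<le> Sup (range (partial_sum x))" by (intro cSUP_upper) auto
      then show ?case using elim by (simp add: walk_max_cases partial_sum_def[of x 0])
    qed
    then show ?thesis
      unfolding gauss_max_law_def gauss_steps_def by (subst AE_distr_iff) auto
  qed
  have idN: "distr (shifted_normal \<beta>) borel (\<lambda>x. x) = shifted_normal \<beta>"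
    by (rule distr_id2) simp
  have "sigma_finite_measure (gauss_max_law \<beta>)"
    using prob by (intro finite_measure.sigma_finite_measure prob_space.finite_measure)
  then have pair: "shifted_normal \<beta> \<Otimes>\<^sub>M gauss_max_law \<beta> =
      distr (shifted_normal \<beta> \<Otimes>\<^sub>M S) (borel \<Otimes>\<^sub>M borel) (\<lambda>(x, y). (x, walk_max y))"
    using pair_measure_distr[of "\<lambda>x. x" "shifted_normal \<beta>" borel walk_max S borel]
    unfolding idN gauss_max_law_def gauss_steps_def by simp
  \<comment> \<open>The sequence space splits off its first step on the left, so the convolution is
    reordered to match.\<close>
  have "(gauss_max_law \<beta> \<star> shifted_normal \<beta>) = (shifted_normal \<beta> \<star> gauss_max_law \<beta>)"
    by (rule convolution_commutative)
      (use prob in \<open>auto simp: gauss_max_law_def intro: prob_space.finite_measure N.finite_measure_axioms\<close>)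
  then have "pos_law (gauss_max_law \<beta> \<star> shifted_normal \<beta>) =
      distr (shifted_normal \<beta> \<Otimes>\<^sub>M S) borel (\<lambda>p. max 0 (fst p + walk_max (snd p)))"
    unfolding pos_law_def convolution_def[of "shifted_normal \<beta>"] pair
    by (simp add: distr_distr comp_def split_beta')
  also have "\<dots> = distr (shifted_normal \<beta> \<Otimes>\<^sub>M S) borel (\<lambda>p. walk_max (case_nat (fst p) (snd p)))"
  proof (rule distr_cong_AE)
    \<comment> \<open>The almost sure boundedness concerns sequences alone and is transported to the
      product along \<open>snd\<close>.\<close>
    have "AE p in shifted_normal \<beta> \<Otimes>\<^sub>M S. bdd_above (range (partial_sum (snd p)))"
    proof -
      have "distr (shifted_normal \<beta> \<Otimes>\<^sub>M S) S snd =
          distr (distr (S \<Otimes>\<^sub>M shifted_normal \<beta>) (shifted_normal \<beta> \<Otimes>\<^sub>M S) (\<lambda>(x, y). (y, x))) S snd"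
        by (simp only: pp.distr_pair_swap[symmetric])
      also have "\<dots> = distr (S \<Otimes>\<^sub>M shifted_normal \<beta>) S fst"
        by (subst distr_distr) (auto simp: comp_def split_beta' intro!: distr_cong)
      also have "\<dots> = S" by (rule N.distr_pair_fst)
      finally have "AE x in distr (shifted_normal \<beta> \<Otimes>\<^sub>M S) S snd. bdd_above (range (partial_sum x))"
        using bdd by (simp only:)
      then show ?thesis by (rule AE_distrD[rotated]) simp
    qed
    then show "AE p in shifted_normal \<beta> \<Otimes>\<^sub>M S.
        max 0 (fst p + walk_max (snd p)) = walk_max (case_nat (fst p) (snd p))"
      by eventually_elim (simp add: walk_max_case_nat)
  qed auto
  also have "\<dots> = distr (distr (shifted_normal \<beta> \<Otimes>\<^sub>M S) S (\<lambda>(s, \<omega>). case_nat s \<omega>)) borel walk_max"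
    by (subst distr_distr) (auto simp: comp_def split_beta' intro!: distr_cong)
  also have "\<dots> = gauss_max_law \<beta>" by (simp only: PiM_iter gauss_max_law_def gauss_steps_def)
  finally have stat: "pos_law (gauss_max_law \<beta> \<star> shifted_normal \<beta>) = gauss_max_law \<beta>" .
  show ?thesis
  proof (intro stationary_wait.intro stationary_wait_axioms.intro)
    show "(\<integral>x. exp (\<beta> * x) \<partial>shifted_normal \<beta>) < 1"
      using \<beta> by (simp add: integral_exp_shifted_normal)
    show "exp_law \<beta> (shifted_normal \<beta>)" using \<beta> by (intro exp_law_shifted_normal) simp
    show "sets (gauss_max_law \<beta>) = sets borel" by (simp add: gauss_max_law_def)
  qed (fact prob_space_shifted_normal prob nonneg stat less_imp_le[OF \<beta>])+
qed

lemma gauss_max_transform: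
  assumes \<beta>: "0 < \<beta>" and u: "Re u < \<beta>"
  shows "(\<integral>x. exp (u * of_real x) \<partial>gauss_max_law \<beta>) =
    exp ((\<integral>t. - Ln (1 - of_real (exp (- \<beta>\<^sup>2 / 2 - t\<^sup>2 / 2))) *
        resolvent_diff (of_real \<beta> - u) (of_real \<beta>) t \<partial>lborel) / (2 * pi))"
proof -
  interpret stationary_wait "shifted_normal \<beta>" "gauss_max_law \<beta>" \<beta>
    by (rule stationary_wait_gauss[OF \<beta>])
  show ?thesis
    using transform_eq[OF \<beta> u] by (simp add: tilted_def tilted_shifted_normal)
qed

section \<open>The waiting time of the queue\<close>

lemma sample_mean_transform:
  fixes z :: complex
  assumes P: "prob_space P" "sets P = sets borel" and n: "n \<ge> 1"
    and int: "integrable P (\<lambda>x. exp (z / of_nat n * of_real x))"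
  shows "integrable (sample_mean_law P n) (\<lambda>x. exp (z * of_real x))"
    and "(\<integral>x. exp (z * of_real x) \<partial>sample_mean_law P n) = (\<integral>x. exp (z / of_nat n * of_real x) \<partial>P) ^ n"
proof -
  interpret P: prob_space P by (rule P)
  interpret product_sigma_finite "\<lambda>_::nat. P" ..
  note [measurable_cong] = P(2)
  have m: "(\<lambda>x. (\<Sum>k=1..n. x k) / real n) \<in> borel_measurable (Pi\<^sub>M {1..n} (\<lambda>_. P))"
    by measurable
  have eq: "exp (z * of_real ((\<Sum>k=1..n. x k) / real n)) = (\<Prod>k\<in>{1..n}. exp (z / of_nat n * of_real (x k)))" for x :: "nat \<Rightarrow> real"
    by (simp add: exp_sum[symmetric] sum_distrib_left sum_divide_distrib)
  have "integrable (Pi\<^sub>M {1..n} (\<lambda>_. P)) (\<lambda>x. \<Prod>k\<in>{1..n}. exp (z / of_nat n * of_real (x k)))"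
    by (rule product_integrable_prod) (use int in auto)
  then show "integrable (sample_mean_law P n) (\<lambda>x. exp (z * of_real x))"
    unfolding sample_mean_law_def by (subst integrable_distr_eq[OF m]) (simp_all only: eq, measurable)
  have "(\<integral>x. (\<Prod>k\<in>{1..n}. exp (z / of_nat n * of_real (x k))) \<partial>Pi\<^sub>M {1..n} (\<lambda>_. P)) =
      (\<Prod>k\<in>{1..n}. \<integral>x. exp (z / of_nat n * of_real x) \<partial>P)"
    by (rule product_integral_prod) (use int in auto)
  then show "(\<integral>x. exp (z * of_real x) \<partial>sample_mean_law P n) = (\<integral>x. exp (z / of_nat n * of_real x) \<partial>P) ^ n"
    unfolding sample_mean_law_def by (subst integral_distr[OF m], measurable) (simp only: eq prod_constant card_atLeastAtMost diff_Suc_1)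
qed

lemma prob_space_sample_mean:
  assumes P: "prob_space P" "sets P = sets borel"
  shows "prob_space (sample_mean_law P n)" "sets (sample_mean_law P n) = sets borel"
proof -
  note [measurable_cong] = P(2)
  have "prob_space (Pi\<^sub>M {1..n} (\<lambda>_. P))" by (rule prob_space_PiM) (rule P)
  then show "prob_space (sample_mean_law P n)"
    unfolding sample_mean_law_def by (rule prob_space.prob_space_distr) measurable
qed (simp add: sample_mean_law_def)

section \<open>Transform of the rescaled queue\<close>

locale queue_input = prob_space M for M :: "'a measure" +
  fixes V U :: "'a \<Rightarrow> real" and \<delta>\<^sub>0 :: real
  assumes indep: "indep_var borel V borel U"
    and V_nonneg: "AE \<omega> in M. 0 \<le> V \<omega>" and U_nonneg: "AE \<omega> in M. 0 \<le> U \<omega>"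
    and EV: "expectation V = 1" and EU: "expectation U = 1"
    and V2: "integrable M (\<lambda>\<omega>. (V \<omega>)\<^sup>2)" and U2: "integrable M (\<lambda>\<omega>. (U \<omega>)\<^sup>2)"
    and var_pos: "0 < variance V + variance U"
    and \<delta>\<^sub>0_pos: "\<delta>\<^sub>0 > 0"
    and mgf_V: "mgf_analytic_on_strip M V \<delta>\<^sub>0" and mgf_U: "mgf_analytic_on_strip M U \<delta>\<^sub>0"
begin

lemma rv_V [measurable]: "V \<in> borel_measurable M" and rv_U [measurable]: "U \<in> borel_measurable M"
  using indep by (auto dest: indep_var_rv1 indep_var_rv2)

lemma integrable_exp_V: "integrable M (\<lambda>\<omega>. exp (z * of_real (V \<omega>)))" if "\<bar>Re z\<bar> \<le> \<delta>\<^sub>0" for z :: complex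
proof -
  obtain a b where "a < - \<delta>\<^sub>0" "\<delta>\<^sub>0 < b"
    and *: "\<And>z::complex. a < Re z \<Longrightarrow> Re z < b \<Longrightarrow> integrable M (\<lambda>\<omega>. exp (z * of_real (V \<omega>)))"
    using mgf_V unfolding mgf_analytic_on_strip_def by blast
  then show ?thesis using that by (intro *) (auto simp: abs_le_iff)
qed

lemma integrable_exp_U: "integrable M (\<lambda>\<omega>. exp (z * of_real (U \<omega>)))" if "\<bar>Re z\<bar> \<le> \<delta>\<^sub>0" for z :: complex
proof -
  obtain a b where "a < - \<delta>\<^sub>0" "\<delta>\<^sub>0 < b"
    and *: "\<And>z::complex. a < Re z \<Longrightarrow> Re z < b \<Longrightarrow> integrable M (\<lambda>\<omega>. exp (z * of_real (U \<omega>)))"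
    using mgf_U unfolding mgf_analytic_on_strip_def by blast
  then show ?thesis using that by (intro *) (auto simp: abs_le_iff)
qed

text \<open>This rests on the sign of U and not on the strip: the argument s / \<rho> may have a
  real part larger than \<open>\<delta>\<^sub>0\<close>.\<close>

lemma integrable_exp_neg_U: "integrable M (\<lambda>\<omega>. exp (- (z * of_real (U \<omega>))))" if "0 \<le> Re z" for z :: complex
proof (rule integrable_const_bound[where B = 1])
  show "AE \<omega> in M. norm (exp (- (z * of_real (U \<omega>)))) \<le> 1"
    using U_nonneg by eventually_elim (use that in auto)
qed measurable

definition net :: "real \<Rightarrow> 'a \<Rightarrow> real" where
  "net \<rho> \<omega> = V \<omega> - U \<omega> / \<rho>"

lemma measurable_net [measurable]: "net \<rho> \<in> borel_measurable M"
  unfolding net_def by measurable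

lemma psi_net: "psi M V U \<rho> s = (\<integral>\<omega>. exp (s * of_real (net \<rho> \<omega>)) \<partial>M)"
  by (simp add: psi_def net_def)

lemma psi_factor:
  assumes s: "0 \<le> Re s" "Re s \<le> \<delta>\<^sub>0" and \<rho>: "0 < \<rho>"
  shows "psi M V U \<rho> s = (\<integral>\<omega>. exp (s * of_real (V \<omega>)) \<partial>M) * (\<integral>\<omega>. exp (- (s / of_real \<rho> * of_real (U \<omega>))) \<partial>M)"
    and "integrable M (\<lambda>\<omega>. exp (s * of_real (net \<rho> \<omega>)))"
proof -
  have iV: "integrable M (\<lambda>\<omega>. exp (s * of_real (V \<omega>)))" using s by (intro integrable_exp_V) auto
  have iU: "integrable M (\<lambda>\<omega>. exp (- (s / of_real \<rho> * of_real (U \<omega>))))"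
    using s \<rho> by (intro integrable_exp_neg_U) (simp add: Re_divide_of_real)
  have ind: "indep_var borel (\<lambda>\<omega>. exp (s * of_real (V \<omega>))) borel (\<lambda>\<omega>. exp (- (s / of_real \<rho> * of_real (U \<omega>))))"
    using indep_var_compose[OF indep, of "\<lambda>x. exp (s * of_real x)" borel "\<lambda>x. exp (- (s / of_real \<rho> * of_real x))" borel]
    by (simp add: comp_def)
  have eq: "exp (s * of_real (V \<omega>)) * exp (- (s / of_real \<rho> * of_real (U \<omega>))) = exp (s * of_real (net \<rho> \<omega>))" for \<omega>
    by (simp add: net_def algebra_simps flip: exp_add)
  show "psi M V U \<rho> s = (\<integral>\<omega>. exp (s * of_real (V \<omega>)) \<partial>M) * (\<integral>\<omega>. exp (- (s / of_real \<rho> * of_real (U \<omega>))) \<partial>M)"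
    using indep_var_lebesgue_integral[OF ind iV iU] by (simp only: eq psi_net)
  show "integrable M (\<lambda>\<omega>. exp (s * of_real (net \<rho> \<omega>)))"
    using indep_var_integrable[OF ind iV iU] by (simp only: eq)
qed

definition mgf :: "real \<Rightarrow> real \<Rightarrow> real" where
  "mgf \<rho> x = (\<integral>\<omega>. exp (x * net \<rho> \<omega>) \<partial>M)"

lemma psi_of_real: "psi M V U \<rho> (of_real x) = of_real (mgf \<rho> x)"
proof -
  have "psi M V U \<rho> (of_real x) = (\<integral>\<omega>. of_real (exp (x * net \<rho> \<omega>)) \<partial>M)"
    by (simp add: psi_net flip: exp_of_real)
  then show ?thesis by (simp only: mgf_def integral_complex_of_real)
qed

text \<open>Increment law of the waiting time rescaled by \<open>s\<close>. The scale will be sqrt n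
  divided by the standard deviation of one tilted sample, so that increments have order 1.\<close>

definition step_law :: "nat \<Rightarrow> real \<Rightarrow> real \<Rightarrow> real measure" where
  "step_law n \<rho> s =
    distr (sample_mean_law (distr M borel V) n \<Otimes>\<^sub>M sample_mean_law (distr M borel U) n) borel
      (\<lambda>(v, u). s * (v - u / \<rho>))"

lemma step_law_transform:
  assumes n: "n \<ge> 1" and \<rho>: "0 < \<rho>" and s: "0 < s" and z: "0 \<le> Re z" "Re z * s / real n \<le> \<delta>\<^sub>0"
  shows "integrable (step_law n \<rho> s) (\<lambda>x. exp (z * of_real x))"
    and "(\<integral>x. exp (z * of_real x) \<partial>step_law n \<rho> s) = psi M V U \<rho> (z * of_real s / of_nat n) ^ n"
proof -
  let ?PV = "distr M borel V" and ?PU = "distr M borel U"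
  have PV: "prob_space ?PV" "sets ?PV = sets borel" and PU: "prob_space ?PU" "sets ?PU = sets borel"
    by (auto intro: prob_space_distr)
  let ?A = "sample_mean_law ?PV n" and ?B = "sample_mean_law ?PU n"
  note A = prob_space_sample_mean[OF PV, of n] and B = prob_space_sample_mean[OF PU, of n]
  note [measurable_cong] = A(2) B(2)
  interpret A: prob_space ?A by (rule A)
  interpret B: prob_space ?B by (rule B)
  interpret pair_sigma_finite ?A ?B ..
  define a where "a = z * of_real s"
  define b where "b = - (z * of_real s / of_real \<rho>)"
  have Ra: "0 \<le> Re (a / of_nat n)" "Re (a / of_nat n) \<le> \<delta>\<^sub>0"
    using z s n by (auto simp: a_def)
  have Rb: "0 \<le> Re (- (b / of_nat n))"
    using z s \<rho> n by (auto simp: b_def Re_divide_of_real)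
  have iV: "integrable ?PV (\<lambda>x. exp (a / of_nat n * of_real x))"
    using integrable_exp_V[of "a / of_nat n"] Ra by (subst integrable_distr_eq) auto
  have iU: "integrable ?PU (\<lambda>x. exp (b / of_nat n * of_real x))"
    using integrable_exp_neg_U[OF Rb] by (subst integrable_distr_eq) auto
  note tV = sample_mean_transform[OF PV n iV] and tU = sample_mean_transform[OF PU n iU]
  have m: "(\<lambda>(v, u). s * (v - u / \<rho>)) \<in> borel_measurable (?A \<Otimes>\<^sub>M ?B)" by measurable
  have eq: "exp (z * of_real (case p of (v, u) \<Rightarrow> s * (v - u / \<rho>))) =
      exp (a * of_real (fst p)) * exp (b * of_real (snd p))" for p :: "real \<times> real"
    by (simp add: a_def b_def split_beta' algebra_simps flip: exp_add)
  have int: "integrable (?A \<Otimes>\<^sub>M ?B) (\<lambda>p. exp (a * of_real (fst p)) * exp (b * of_real (snd p)))"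
  proof (rule Bochner_Integration.integrable_bound)
    show "integrable (?A \<Otimes>\<^sub>M ?B) (\<lambda>(x, y). norm (exp (a * complex_of_real x)) * norm (exp (b * complex_of_real y)))"
      by (rule integrable_pair_mult) (use tV(1) tU(1) in
          \<open>auto intro: A.sigma_finite_measure_axioms B.sigma_finite_measure_axioms simp del: norm_exp_eq_Re intro!: integrable_norm\<close>)
  qed (auto simp: norm_mult split_beta')
  then show "integrable (step_law n \<rho> s) (\<lambda>x. exp (z * of_real x))"
    unfolding step_law_def by (subst integrable_distr_eq[OF m]) (simp_all only: eq, measurable)
  have "(\<integral>x. exp (z * of_real x) \<partial>step_law n \<rho> s) =
      (\<integral>p. exp (a * of_real (fst p)) * exp (b * of_real (snd p)) \<partial>(?A \<Otimes>\<^sub>M ?B))"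
    unfolding step_law_def by (subst integral_distr[OF m]) (simp_all only: eq, measurable)
  also have "\<dots> = (\<integral>x. (\<integral>y. exp (a * of_real x) * exp (b * of_real y) \<partial>?B) \<partial>?A)"
    using integral_fst'[OF int] by simp
  also have "\<dots> = (\<integral>x. exp (a * of_real x) \<partial>?A) * (\<integral>y. exp (b * of_real y) \<partial>?B)"
    by (simp only: integral_mult_right_zero integral_mult_left_zero)
  also have "\<dots> = ((\<integral>x. exp (a / of_nat n * of_real x) \<partial>?PV) * (\<integral>x. exp (b / of_nat n * of_real x) \<partial>?PU)) ^ n"
    by (simp only: tV tU power_mult_distrib)
  also have "(\<integral>x. exp (a / of_nat n * of_real x) \<partial>?PV) * (\<integral>x. exp (b / of_nat n * of_real x) \<partial>?PU) =
      psi M V U \<rho> (a / of_nat n)"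
  proof -
    have "b / of_nat n = - (a / of_nat n / of_real \<rho>)" by (simp add: a_def b_def mult.commute)
    then show ?thesis
      using psi_factor(1)[OF Ra \<rho>] by (simp add: integral_distr)
  qed
  finally show "(\<integral>x. exp (z * of_real x) \<partial>step_law n \<rho> s) = psi M V U \<rho> (z * of_real s / of_nat n) ^ n"
    by (simp add: a_def)
qed

text \<open>Positive scaling commutes with the positive part, so Lindley's equation survives it. The
  exponential moment of the rescaled step is the n-th power of that of one sample, taken at c s /
  n.\<close>

lemma stationary_wait_queue:
  assumes n: "n \<ge> 1" and \<rho>: "0 < \<rho>" and s: "0 < s" and c: "0 \<le> c" "c * s / real n \<le> \<delta>\<^sub>0"
    and drift: "mgf \<rho> (c * s / real n) ^ n < 1"
    and W: "steady_state_waiting_time (distr M borel V) (distr M borel U) n \<rho> N W"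
  shows "stationary_wait (step_law n \<rho> s) (distr N borel (\<lambda>\<omega>. s * W \<omega>)) c"
proof -
  let ?PV = "distr M borel V" and ?PU = "distr M borel U"
  let ?A = "sample_mean_law ?PV n" and ?B = "sample_mean_law ?PU n" and ?w = "distr N borel W"
  let ?ws = "distr N borel (\<lambda>\<omega>. s * W \<omega>)"
  have PV: "prob_space ?PV" "sets ?PV = sets borel" and PU: "prob_space ?PU" "sets ?PU = sets borel"
    by (auto intro: prob_space_distr)
  note A = prob_space_sample_mean[OF PV, of n] and B = prob_space_sample_mean[OF PU, of n]
  note [measurable_cong] = A(2) B(2)
  interpret A: prob_space ?A by (rule A)
  interpret B: prob_space ?B by (rule B)
  interpret AB: pair_prob_space ?A ?B ..
  have N: "prob_space N" and [measurable]: "W \<in> borel_measurable N" and nonneg: "AE \<omega> in N. 0 \<le> W \<omega>"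
    and eq: "?w = distr (?w \<Otimes>\<^sub>M (?A \<Otimes>\<^sub>M ?B)) borel (\<lambda>(w, v, u). max 0 (w + v - u / \<rho>))"
    using W by (auto simp: steady_state_waiting_time_def)
  interpret N: prob_space N by (rule N)
  have prob_step: "prob_space (step_law n \<rho> s)"
    unfolding step_law_def by (rule AB.prob_space_distr) measurable
  have ws: "?ws = distr ?w borel (\<lambda>x. s * x)" by (simp add: distr_distr comp_def)
  have int_real: "integrable (step_law n \<rho> s) (\<lambda>x. exp (c * x))"
  proof -
    have "integrable (step_law n \<rho> s) (\<lambda>x. norm (exp (of_real c * complex_of_real x)))"
      using step_law_transform(1)[OF n \<rho> s, of "of_real c"] c by (intro integrable_norm) auto
    then show ?thesis by simp
  qed
  have val: "(\<integral>x. exp (c * x) \<partial>step_law n \<rho> s) = mgf \<rho> (c * s / real n) ^ n"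
  proof -
    have "complex_of_real (\<integral>x. exp (c * x) \<partial>step_law n \<rho> s) = (\<integral>x. exp (of_real c * complex_of_real x) \<partial>step_law n \<rho> s)"
      by (subst integral_complex_of_real[symmetric]) (simp add: exp_of_real[symmetric])
    also have "\<dots> = psi M V U \<rho> (of_real (c * s / real n)) ^ n"
      using step_law_transform(2)[OF n \<rho> s, of "of_real c"] c by simp
    also have "\<dots> = complex_of_real (mgf \<rho> (c * s / real n) ^ n)"
      by (simp only: psi_of_real of_real_power)
    finally show ?thesis by (simp only: of_real_eq_iff)
  qed
  have "integrable (step_law n \<rho> s) (\<lambda>x. exp (c * max 0 x))"
  proof (rule Bochner_Integration.integrable_bound)
    interpret S: prob_space "step_law n \<rho> s" by (rule prob_step)
    show "integrable (step_law n \<rho> s) (\<lambda>x. 1 + exp (c * x))" using int_real by simp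
    show "AE x in step_law n \<rho> s. norm (exp (c * max 0 x)) \<le> norm (1 + exp (c * x))"
      by (rule AE_I2) (auto simp: max_def abs_of_nonneg add_nonneg_nonneg)
  qed (simp add: step_law_def)
  then have el: "exp_law c (step_law n \<rho> s)"
    using prob_step by (simp add: exp_law_def step_law_def)
  have sf: "sigma_finite_measure (step_law n \<rho> s)"
    using prob_step by (intro finite_measure.sigma_finite_measure prob_space.finite_measure)
  have pair: "?ws \<Otimes>\<^sub>M step_law n \<rho> s = distr (?w \<Otimes>\<^sub>M (?A \<Otimes>\<^sub>M ?B)) (borel \<Otimes>\<^sub>M borel)
      (\<lambda>(x, y). (s * x, case y of (v, u) \<Rightarrow> s * (v - u / \<rho>)))"
    unfolding ws step_law_def
    by (rule pair_measure_distr) (use sf in \<open>simp_all add: step_law_def\<close>)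
  have mx: "max 0 (s * w + s * (v - u / \<rho>)) = s * max 0 (w + v - u / \<rho>)" for w v u
  proof -
    have "s * max 0 (w + v - u / \<rho>) = max (s * 0) (s * (w + v - u / \<rho>))"
      using s by (simp add: max_mult_distrib_left)
    then show ?thesis by (simp add: algebra_simps)
  qed
  have "pos_law (?ws \<star> step_law n \<rho> s) =
      distr (?w \<Otimes>\<^sub>M (?A \<Otimes>\<^sub>M ?B)) borel (\<lambda>(w, v, u). max 0 (s * w + s * (v - u / \<rho>)))"
    unfolding pos_law_def convolution_def pair by (simp add: distr_distr comp_def split_beta')
  also have "\<dots> = distr (?w \<Otimes>\<^sub>M (?A \<Otimes>\<^sub>M ?B)) borel (\<lambda>(w, v, u). s * max 0 (w + v - u / \<rho>))"
    by (simp only: mx)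
  also have "\<dots> = distr (distr (?w \<Otimes>\<^sub>M (?A \<Otimes>\<^sub>M ?B)) borel (\<lambda>(w, v, u). max 0 (w + v - u / \<rho>))) borel (\<lambda>x. s * x)"
    by (simp add: distr_distr comp_def split_beta')
  also have "\<dots> = ?ws" by (simp only: eq[symmetric] ws)
  finally have stat: "pos_law (?ws \<star> step_law n \<rho> s) = ?ws" .
  show ?thesis
  proof (intro stationary_wait.intro stationary_wait_axioms.intro)
    show "(\<integral>x. exp (c * x) \<partial>step_law n \<rho> s) < 1" using drift by (simp only: val)
    show "prob_space ?ws" by (rule N.prob_space_distr) simp
    show "AE x in ?ws. 0 \<le> x"
      using nonneg s by (subst AE_distr_iff) auto
    show "sets ?ws = sets borel" by (rule sets_distr)
    show "prob_space (step_law n \<rho> s)" by (rule prob_step)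
    show "exp_law c (step_law n \<rho> s)" by (rule el)
    show "pos_law (?ws \<star> step_law n \<rho> s) = ?ws" by (rule stat)
  qed (rule c)
qed

text \<open>All that the later comparison takes from the queue; c s / n is the amount by which a
  single sample is tilted.\<close>

lemma wait_transform:
  assumes n: "n \<ge> 1" and \<rho>: "0 < \<rho>" and s: "0 < s" and c: "0 < c" "c * s / real n \<le> \<delta>\<^sub>0"
    and drift: "mgf \<rho> (c * s / real n) ^ n < 1"
    and W: "steady_state_waiting_time (distr M borel V) (distr M borel U) n \<rho> N W"
    and u: "Re u < c"
  defines "z \<equiv> (\<lambda>t. psi M V U \<rho> ((of_real c + \<i> * of_real t) * of_real s / of_nat n) ^ n)"
  shows "(\<integral>\<omega>. exp (u * of_real (s * W \<omega>)) \<partial>N) =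
    exp ((\<integral>t. - Ln (1 - z t) * resolvent_diff (of_real c - u) (of_real c) t \<partial>lborel) / (2 * pi))"
    and "integrable N (\<lambda>\<omega>. exp (c * (s * W \<omega>)))"
    and "norm (z t) \<le> mgf \<rho> (c * s / real n) ^ n"
    and "z \<in> borel_measurable borel"
proof -
  interpret Q: stationary_wait "step_law n \<rho> s" "distr N borel (\<lambda>\<omega>. s * W \<omega>)" c
    by (rule stationary_wait_queue) (use assms in auto)
  have [measurable]: "W \<in> borel_measurable N" and nonneg: "AE \<omega> in N. 0 \<le> W \<omega>"
    using W by (auto simp: steady_state_waiting_time_def)
  have z: "Q.tilted = z"
    unfolding Q.tilted_def z_def by (rule ext, rule step_law_transform(2)[OF n \<rho> s]) (use c in auto)
  have "(\<integral>\<omega>. exp (u * of_real (s * W \<omega>)) \<partial>N) = (\<integral>x. exp (u * of_real x) \<partial>distr N borel (\<lambda>\<omega>. s * W \<omega>))"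
    by (subst integral_distr) auto
  then show "(\<integral>\<omega>. exp (u * of_real (s * W \<omega>)) \<partial>N) =
    exp ((\<integral>t. - Ln (1 - z t) * resolvent_diff (of_real c - u) (of_real c) t \<partial>lborel) / (2 * pi))"
    using Q.transform_eq[OF c(1) u] by (simp add: z)
  show "z \<in> borel_measurable borel" using Q.borel_measurable_tilted by (simp add: z)
  have "Q.q = mgf \<rho> (c * s / real n) ^ n"
  proof -
    have "complex_of_real Q.q = Q.tilted 0"
      unfolding Q.q_def Q.tilted_def
      by (subst integral_complex_of_real[symmetric]) (simp add: exp_of_real[symmetric])
    also have "\<dots> = psi M V U \<rho> (of_real (c * s / real n)) ^ n" by (simp add: z z_def)
    finally show ?thesis by (simp only: psi_of_real of_real_eq_iff flip: of_real_power)
  qed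
  then show "norm (z t) \<le> mgf \<rho> (c * s / real n) ^ n" using Q.norm_tilted_le[of t] by (simp add: z)
  have "integrable (distr N borel (\<lambda>\<omega>. s * W \<omega>)) (\<lambda>x. exp (c * max 0 x))"
    using Q.exp_law_w by (simp add: exp_law_def)
  then have "integrable N (\<lambda>\<omega>. exp (c * max 0 (s * W \<omega>)))"
    by (subst (asm) integrable_distr_eq) auto
  then show "integrable N (\<lambda>\<omega>. exp (c * (s * W \<omega>)))"
  proof (rule integrable_cong_AE_imp)
    show "AE \<omega> in N. exp (c * max 0 (s * W \<omega>)) = exp (c * (s * W \<omega>))"
      using nonneg by eventually_elim (use s in auto)
  qed simp
qed

end

section \<open>Exponential moments\<close>

lemma norm_integral_le:
  fixes f :: "'a \<Rightarrow> 'b::{banach, second_countable_topology}"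
  assumes "integrable M f" "integrable M g" "\<And>x. norm (f x) \<le> g x"
  shows "norm (\<integral>x. f x \<partial>M) \<le> (\<integral>x. g x \<partial>M)"
proof -
  have "(\<integral>x. norm (f x) \<partial>M) \<le> (\<integral>x. g x \<partial>M)"
    using assms by (intro integral_mono) auto
  then show ?thesis using integral_norm_bound[of M f] by linarith
qed

lemma norm_exp_minus_linear_le:
  fixes z :: "'b::{real_normed_field, banach}"
  shows "norm (exp z - 1 - z) \<le> (norm z)\<^sup>2 * exp (norm z)"
proof -
  have s: "summable (\<lambda>n. inverse (fact n) *\<^sub>R norm z ^ n)" by (rule summable_exp_generic)
  have le: "norm (inverse (fact (n + 2)) *\<^sub>R z ^ (n + 2)) \<le> (norm z)\<^sup>2 * (inverse (fact n) *\<^sub>R norm z ^ n)" for n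
  proof -
    have "inverse (fact (n + 2)) \<le> (inverse (fact n) :: real)"
      by (intro le_imp_inverse_le fact_mono) auto
    then have "inverse (fact (n + 2)) * norm z ^ (n + 2) \<le> (inverse (fact n) :: real) * norm z ^ (n + 2)"
      by (intro mult_right_mono) auto
    also have "\<dots> = (norm z)\<^sup>2 * (inverse (fact n) * norm z ^ n)"
      by (simp add: power_add power2_eq_square mult_ac)
    finally have "inverse (fact (n + 2)) * norm z ^ (n + 2) \<le> (norm z)\<^sup>2 * (inverse (fact n) * norm z ^ n)" .
    then show ?thesis by (simp add: norm_power del: fact_Suc power_Suc)
  qed
  have "exp z - 1 - z = (\<Sum>n. inverse (fact (n + 2)) *\<^sub>R z ^ (n + 2))"
    by (simp add: exp_first_two_terms[of z])
  also have "norm \<dots> \<le> (\<Sum>n. (norm z)\<^sup>2 * (inverse (fact n) *\<^sub>R norm z ^ n))"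
    by (intro norm_suminf_le le summable_mult s)
  also have "\<dots> = (norm z)\<^sup>2 * exp (norm z)"
    unfolding exp_def using s by (rule suminf_mult)
  finally show ?thesis .
qed

lemma power_le_fact_exp:
  fixes y :: real
  assumes "0 \<le> y"
  shows "y ^ j \<le> fact j * exp y"
proof -
  have "inverse (fact j) *\<^sub>R y ^ j = (\<Sum>n\<in>{j}. inverse (fact n) *\<^sub>R y ^ n)" by simp
  also have "\<dots> \<le> (\<Sum>n. inverse (fact n) *\<^sub>R y ^ n)"
    by (rule sum_le_suminf[OF summable_exp_generic]) (use assms in auto)
  also have "\<dots> = exp y" by (simp add: exp_def)
  finally show ?thesis by (simp add: field_simps)
qed

text \<open>A polynomial factor is paid for with part of the exponential rate, by y^j / j! \<le> exp
  y.\<close>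

lemma power_mult_exp_le:
  fixes y r s :: real
  assumes "0 \<le> y" "s < r"
  shows "y ^ j * exp (s * y) \<le> fact j / (r - s) ^ j * exp (r * y)"
proof -
  have "((r - s) * y) ^ j \<le> fact j * exp ((r - s) * y)"
    using assms by (intro power_le_fact_exp) auto
  then have "(r - s) ^ j * y ^ j * exp (s * y) \<le> fact j * exp ((r - s) * y) * exp (s * y)"
    by (intro mult_right_mono) (auto simp: power_mult_distrib)
  also have "\<dots> = fact j * exp (r * y)" by (simp add: algebra_simps flip: exp_add)
  finally show ?thesis using assms by (simp add: field_simps)
qed

text \<open>In the queue \<open>Y\<close> does not depend on the traffic intensity, so that all bounds are uniform in it.\<close>

locale exp_integrable =
  fixes M :: "'a measure" and X Y :: "'a \<Rightarrow> real" and r :: real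
  assumes measurable_X [measurable]: "X \<in> borel_measurable M"
    and dominated: "AE \<omega> in M. \<bar>X \<omega>\<bar> \<le> Y \<omega>"
    and int_Y: "integrable M (\<lambda>\<omega>. exp (r * Y \<omega>))"
    and r_pos: "0 < r"
begin

text \<open>The j-th derivative of the moment generating function. The argument ranges over any
  suitable normed field, so one derivation serves the real saddle point analysis and the complex
  transforms.\<close>

definition exp_mom :: "nat \<Rightarrow> 'b::{real_normed_field, banach, second_countable_topology} \<Rightarrow> 'b" where
  "exp_mom j u = (\<integral>\<omega>. of_real (X \<omega> ^ j) * exp (u * of_real (X \<omega>)) \<partial>M)"

lemma AE_power_exp_le:
  assumes "s < r"
  shows "AE \<omega> in M. \<bar>X \<omega>\<bar> ^ j * exp (s * \<bar>X \<omega>\<bar>) \<le> fact j / (r - s) ^ j * exp (r * Y \<omega>)"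
  using dominated
proof eventually_elim
  case (elim \<omega>)
  have "\<bar>X \<omega>\<bar> ^ j * exp (s * \<bar>X \<omega>\<bar>) \<le> fact j / (r - s) ^ j * exp (r * \<bar>X \<omega>\<bar>)"
    using assms by (intro power_mult_exp_le) auto
  also have "\<dots> \<le> fact j / (r - s) ^ j * exp (r * Y \<omega>)"
    using elim assms r_pos by (intro mult_left_mono) auto
  finally show ?case .
qed

lemma norm_integrand_le:
  fixes u :: "'b::{real_normed_field, banach}"
  assumes "norm u \<le> s"
  shows "norm (of_real (X \<omega> ^ j) * exp (u * of_real (X \<omega>))) \<le> \<bar>X \<omega>\<bar> ^ j * exp (s * \<bar>X \<omega>\<bar>)"
proof -
  have "norm (exp (u * of_real (X \<omega>))) \<le> exp (norm (u * of_real (X \<omega>)))" by (rule norm_exp)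
  also have "\<dots> \<le> exp (s * \<bar>X \<omega>\<bar>)" using assms by (simp add: norm_mult mult_right_mono)
  finally show ?thesis
    by (simp add: norm_mult power_abs mult_left_mono del: of_real_power)
qed

lemma integrable_abs_power_exp:
  assumes "s < r"
  shows "integrable M (\<lambda>\<omega>. \<bar>X \<omega>\<bar> ^ j * exp (s * \<bar>X \<omega>\<bar>))"
    and "(\<integral>\<omega>. \<bar>X \<omega>\<bar> ^ j * exp (s * \<bar>X \<omega>\<bar>) \<partial>M) \<le> fact j / (r - s) ^ j * (\<integral>\<omega>. exp (r * Y \<omega>) \<partial>M)"
proof -
  have i: "integrable M (\<lambda>\<omega>. fact j / (r - s) ^ j * exp (r * Y \<omega>))"
    using int_Y by (rule integrable_mult_right)
  show *: "integrable M (\<lambda>\<omega>. \<bar>X \<omega>\<bar> ^ j * exp (s * \<bar>X \<omega>\<bar>))"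
    by (rule Bochner_Integration.integrable_bound[OF i])
      (measurable, use AE_power_exp_le[OF assms, of j] assms in \<open>auto elim!: eventually_mono\<close>)
  have "(\<integral>\<omega>. \<bar>X \<omega>\<bar> ^ j * exp (s * \<bar>X \<omega>\<bar>) \<partial>M) \<le> (\<integral>\<omega>. fact j / (r - s) ^ j * exp (r * Y \<omega>) \<partial>M)"
    by (rule integral_mono_AE[OF * i AE_power_exp_le[OF assms]])
  then show "(\<integral>\<omega>. \<bar>X \<omega>\<bar> ^ j * exp (s * \<bar>X \<omega>\<bar>) \<partial>M) \<le> fact j / (r - s) ^ j * (\<integral>\<omega>. exp (r * Y \<omega>) \<partial>M)"
    by simp
qed

lemma integrable_exp_mom:
  fixes u :: "'b::{real_normed_field, banach, second_countable_topology}"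
  assumes "norm u < r"
  shows "integrable M (\<lambda>\<omega>. of_real (X \<omega> ^ j) * exp (u * of_real (X \<omega>)))"
  by (rule Bochner_Integration.integrable_bound[OF integrable_abs_power_exp(1)[OF assms, of j]])
    (measurable, use norm_integrand_le[OF order_refl] in auto)

lemma norm_exp_mom_le:
  fixes u :: "'b::{real_normed_field, banach, second_countable_topology}"
  assumes "norm u \<le> s" "s < r"
  shows "norm (exp_mom j u) \<le> fact j / (r - s) ^ j * (\<integral>\<omega>. exp (r * Y \<omega>) \<partial>M)"
proof -
  have "norm (exp_mom j u) \<le> (\<integral>\<omega>. \<bar>X \<omega>\<bar> ^ j * exp (s * \<bar>X \<omega>\<bar>) \<partial>M)"
    unfolding exp_mom_def
    by (intro norm_integral_le integrable_exp_mom
        integrable_abs_power_exp norm_integrand_le) (use assms in auto)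
  then show ?thesis using integrable_abs_power_exp(2)[OF assms(2), of j] by linarith
qed

text \<open>The integrand is that of \<open>exp_mom j u\<close> times exp (h x) - 1 - h x, which is
  at most |h x|^2 exp |h x|. The explicit remainder serves twice: for the derivative, and for the
  expansion of the Gaussian transform to first order in \<phi>.\<close>

lemma exp_mom_second_order:
  fixes u h :: "'b::{real_normed_field, banach, second_countable_topology}"
  assumes s: "norm u + norm h \<le> s" "s < r"
  shows "norm (exp_mom j (u + h) - exp_mom j u - h * exp_mom (Suc j) u) \<le>
    (norm h)\<^sup>2 * (fact (j + 2) / (r - s) ^ (j + 2) * (\<integral>\<omega>. exp (r * Y \<omega>) \<partial>M))"
proof -
  let ?e = "\<lambda>j u \<omega>. of_real (X \<omega> ^ j) * exp (u * of_real (X \<omega>)) :: 'b"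
  have u: "norm u < r" and uh: "norm (u + h) < r"
    using norm_triangle_ineq[of u h] norm_ge_zero[of h] s by linarith+
  have i1: "integrable M (?e j (u + h))" and i2: "integrable M (?e j u)" and i3: "integrable M (?e (Suc j) u)"
    by (rule integrable_exp_mom[OF uh] integrable_exp_mom[OF u])+
  have diff: "exp_mom j (u + h) - exp_mom j u - h * exp_mom (Suc j) u =
      (\<integral>\<omega>. ?e j (u + h) \<omega> - ?e j u \<omega> - h * ?e (Suc j) u \<omega> \<partial>M)"
    unfolding exp_mom_def
    using i1 i2 i3 by (simp add: Bochner_Integration.integral_diff)
  have "norm (exp_mom j (u + h) - exp_mom j u - h * exp_mom (Suc j) u) \<le>
      (\<integral>\<omega>. (norm h)\<^sup>2 * (\<bar>X \<omega>\<bar> ^ (j + 2) * exp (s * \<bar>X \<omega>\<bar>)) \<partial>M)"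
    unfolding diff
  proof (rule norm_integral_le)
    show "integrable M (\<lambda>\<omega>. ?e j (u + h) \<omega> - ?e j u \<omega> - h * ?e (Suc j) u \<omega>)"
      by (intro Bochner_Integration.integrable_diff integrable_mult_right i1 i2 i3)
    show "integrable M (\<lambda>\<omega>. (norm h)\<^sup>2 * (\<bar>X \<omega>\<bar> ^ (j + 2) * exp (s * \<bar>X \<omega>\<bar>)))"
      by (intro integrable_mult_right integrable_abs_power_exp s)
    fix \<omega>
    let ?x = "X \<omega>"
    have "?e j (u + h) \<omega> - ?e j u \<omega> - h * ?e (Suc j) u \<omega> =
        ?e j u \<omega> * (exp (h * of_real ?x) - 1 - h * of_real ?x)"
      by (simp add: distrib_right exp_add algebra_simps)
    also have "norm \<dots> \<le> (\<bar>?x\<bar> ^ j * exp (norm u * \<bar>?x\<bar>)) * ((norm (h * of_real ?x))\<^sup>2 * exp (norm (h * of_real ?x)))"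
      unfolding norm_mult[of "?e j u \<omega>"]
      by (intro mult_mono norm_integrand_le norm_exp_minus_linear_le) auto
    also have "\<dots> = (norm h)\<^sup>2 * (\<bar>?x\<bar> ^ (j + 2) * exp ((norm u + norm h) * \<bar>?x\<bar>))"
      by (simp add: norm_mult power_mult_distrib power_add distrib_right exp_add power2_eq_square)
    also have "\<dots> \<le> (norm h)\<^sup>2 * (\<bar>?x\<bar> ^ (j + 2) * exp (s * \<bar>?x\<bar>))"
      using s by (intro mult_left_mono) (auto intro!: mult_right_mono)
    finally show "norm (?e j (u + h) \<omega> - ?e j u \<omega> - h * ?e (Suc j) u \<omega>) \<le>
        (norm h)\<^sup>2 * (\<bar>?x\<bar> ^ (j + 2) * exp (s * \<bar>?x\<bar>))" .
  qed
  also have "\<dots> = (norm h)\<^sup>2 * (\<integral>\<omega>. \<bar>X \<omega>\<bar> ^ (j + 2) * exp (s * \<bar>X \<omega>\<bar>) \<partial>M)"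
    by (rule integral_mult_right_zero)
  also have "\<dots> \<le> (norm h)\<^sup>2 * (fact (j + 2) / (r - s) ^ (j + 2) * (\<integral>\<omega>. exp (r * Y \<omega>) \<partial>M))"
    by (intro mult_left_mono integrable_abs_power_exp(2) s) auto
  finally show ?thesis .
qed

lemma exp_mom_has_field_derivative:
  fixes u :: "'b::{real_normed_field, banach, second_countable_topology}"
  assumes u: "norm u < r"
  shows "(exp_mom j has_field_derivative exp_mom (Suc j) u) (at u)"
proof -
  define s where "s = (norm u + r) / 2"
  have s: "norm u < s" "s < r" using u by (auto simp: s_def field_simps)
  define K where "K = fact (j + 2) / (r - s) ^ (j + 2) * (\<integral>\<omega>. exp (r * Y \<omega>) \<partial>M)"
  have quot: "norm ((exp_mom j (u + h) - exp_mom j u) / h - exp_mom (Suc j) u) \<le> K * norm h"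
    if h: "h \<noteq> 0" "norm h \<le> s - norm u" for h :: 'b
  proof -
    have "norm (exp_mom j (u + h) - exp_mom j u - h * exp_mom (Suc j) u) \<le> (norm h)\<^sup>2 * K"
      unfolding K_def using h s by (intro exp_mom_second_order) auto
    moreover have "(exp_mom j (u + h) - exp_mom j u) / h - exp_mom (Suc j) u =
        (exp_mom j (u + h) - exp_mom j u - h * exp_mom (Suc j) u) / h"
      using h by (simp add: field_simps)
    ultimately show ?thesis
      using h by (simp add: norm_divide divide_le_eq power2_eq_square mult_ac)
  qed
  have ev: "\<forall>\<^sub>F h in at 0. norm ((exp_mom j (u + h) - exp_mom j u) / h - exp_mom (Suc j) u) \<le> K * norm h"
    unfolding eventually_at using s(1) quot by (intro exI[of _ "s - norm u"]) auto
  have "((\<lambda>h::'b. K * norm h) \<longlongrightarrow> K * norm (0::'b)) (at 0)" by (intro tendsto_intros)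
  then have "((\<lambda>h::'b. K * norm h) \<longlongrightarrow> 0) (at 0)" by simp
  from Lim_null_comparison[OF ev this] show ?thesis
    unfolding DERIV_def by (rule LIM_zero_cancel)
qed

lemma higher_deriv_exp_mom:
  fixes u :: "'b::{real_normed_field, banach, second_countable_topology}"
  assumes "norm u < r"
  shows "(deriv ^^ k) (exp_mom j) u = exp_mom (j + k) u"
  using assms
proof (induction k arbitrary: u)
  case (Suc k)
  have "\<forall>\<^sub>F v in nhds u. v \<in> ball 0 r"
    using Suc.prems by (intro eventually_nhds_in_open) auto
  then have "\<forall>\<^sub>F v in nhds u. (deriv ^^ k) (exp_mom j) v = exp_mom (j + k) v"
    by eventually_elim (use Suc.IH in auto)
  then have "deriv ((deriv ^^ k) (exp_mom j)) u = deriv (exp_mom (j + k)) u"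
    by (intro deriv_cong_ev) auto
  also have "\<dots> = exp_mom (Suc (j + k)) u"
    by (intro DERIV_imp_deriv exp_mom_has_field_derivative Suc.prems)
  finally show ?case by simp
qed simp

lemma exp_mom_0: "exp_mom j (0::complex) = of_real (\<integral>\<omega>. X \<omega> ^ j \<partial>M)"
  unfolding exp_mom_def by (subst integral_complex_of_real[symmetric]) simp

end

section \<open>The saddle point\<close>

context queue_input
begin

text \<open>For \<rho> \<ge> 1/2 the step is dominated by V + 2 U, so the rate is halved to keep the
  exponent of U within \<open>\<delta>\<^sub>0\<close>.\<close>

definition r\<^sub>0 :: real where "r\<^sub>0 = \<delta>\<^sub>0 / 2"

lemma r0_pos: "0 < r\<^sub>0" using \<delta>\<^sub>0_pos by (simp add: r\<^sub>0_def)

definition EY :: real where "EY = (\<integral>\<omega>. exp (r\<^sub>0 * (V \<omega> + 2 * U \<omega>)) \<partial>M)"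

lemma exp_integrable_net:
  assumes \<rho>: "\<rho> \<in> {1/2..1}"
  shows "exp_integrable M (net \<rho>) (\<lambda>\<omega>. V \<omega> + 2 * U \<omega>) r\<^sub>0"
proof
  show "AE \<omega> in M. \<bar>net \<rho> \<omega>\<bar> \<le> V \<omega> + 2 * U \<omega>"
    using V_nonneg U_nonneg
  proof eventually_elim
    case (elim \<omega>)
    have "U \<omega> / \<rho> \<le> U \<omega> / (1/2)"
      using \<rho> elim by (intro divide_left_mono) auto
    moreover have "0 \<le> U \<omega> / \<rho>" using \<rho> elim by auto
    ultimately show ?case using elim by (auto simp: net_def abs_le_iff)
  qed
  have iV: "integrable M (\<lambda>\<omega>. exp (r\<^sub>0 * V \<omega>))"
    using integrable_norm[OF integrable_exp_V[of "of_real r\<^sub>0"]] \<delta>\<^sub>0_pos by (simp add: r\<^sub>0_def)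
  have iU: "integrable M (\<lambda>\<omega>. exp (2 * r\<^sub>0 * U \<omega>))"
    using integrable_norm[OF integrable_exp_U[of "of_real (2 * r\<^sub>0)"]] \<delta>\<^sub>0_pos by (simp add: r\<^sub>0_def)
  have ind: "indep_var borel (\<lambda>\<omega>. exp (r\<^sub>0 * V \<omega>)) borel (\<lambda>\<omega>. exp (2 * r\<^sub>0 * U \<omega>))"
    using indep_var_compose[OF indep, of "\<lambda>x. exp (r\<^sub>0 * x)" borel "\<lambda>x. exp (2 * r\<^sub>0 * x)" borel]
    by (simp add: comp_def)
  show "integrable M (\<lambda>\<omega>. exp (r\<^sub>0 * (V \<omega> + 2 * U \<omega>)))"
    using indep_var_integrable[OF ind iV iU] by (simp add: distrib_left exp_add mult.assoc mult.left_commute)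
qed (simp_all add: r0_pos)

definition mom :: "real \<Rightarrow> nat \<Rightarrow> real \<Rightarrow> real" where
  "mom \<rho> j x = (\<integral>\<omega>. net \<rho> \<omega> ^ j * exp (x * net \<rho> \<omega>) \<partial>M)"

text \<open>Arguments are kept to half the radius \<open>r\<^sub>0\<close>, and the remaining gap of
  \<open>r\<^sub>0 / 2\<close> enters the bound. No \<rho> occurs in it.\<close>

definition mom_bound :: "nat \<Rightarrow> real" where
  "mom_bound j = fact j / (r\<^sub>0 / 2) ^ j * EY"

lemma EY_nonneg: "0 \<le> EY" unfolding EY_def by (rule integral_nonneg_AE) auto

lemma mom_bound_nonneg: "0 \<le> mom_bound j"
  using r0_pos EY_nonneg by (auto simp: mom_bound_def)

lemma mom_exp_mom:
  assumes "\<rho> \<in> {1/2..1}"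
  shows "mom \<rho> j = exp_integrable.exp_mom M (net \<rho>) j"
proof -
  interpret E: exp_integrable M "net \<rho>" "\<lambda>\<omega>. V \<omega> + 2 * U \<omega>" r\<^sub>0 by (rule exp_integrable_net[OF assms])
  show ?thesis by (rule ext) (simp add: mom_def E.exp_mom_def)
qed

lemma mom_has_real_derivative:
  assumes "\<rho> \<in> {1/2..1}" "\<bar>x\<bar> < r\<^sub>0"
  shows "(mom \<rho> j has_real_derivative mom \<rho> (Suc j) x) (at x)"
proof -
  interpret E: exp_integrable M "net \<rho>" "\<lambda>\<omega>. V \<omega> + 2 * U \<omega>" r\<^sub>0 by (rule exp_integrable_net[OF assms(1)])
  show ?thesis unfolding mom_exp_mom[OF assms(1)]
    using assms(2) by (intro E.exp_mom_has_field_derivative) simp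
qed

lemma abs_mom:
  assumes "\<rho> \<in> {1/2..1}" "\<bar>x\<bar> \<le> r\<^sub>0 / 2"
  shows "integrable M (\<lambda>\<omega>. net \<rho> \<omega> ^ j * exp (x * net \<rho> \<omega>))"
    and "integrable M (\<lambda>\<omega>. \<bar>net \<rho> \<omega>\<bar> ^ j * exp (x * net \<rho> \<omega>))"
    and "(\<integral>\<omega>. \<bar>net \<rho> \<omega>\<bar> ^ j * exp (x * net \<rho> \<omega>) \<partial>M) \<le> mom_bound j"
    and "\<bar>mom \<rho> j x\<bar> \<le> mom_bound j"
proof -
  interpret E: exp_integrable M "net \<rho>" "\<lambda>\<omega>. V \<omega> + 2 * U \<omega>" r\<^sub>0 by (rule exp_integrable_net[OF assms(1)])
  have lt: "r\<^sub>0 / 2 < r\<^sub>0" "norm x < r\<^sub>0" using r0_pos assms(2) by auto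
  show i: "integrable M (\<lambda>\<omega>. net \<rho> \<omega> ^ j * exp (x * net \<rho> \<omega>))"
    using E.integrable_exp_mom[OF lt(2), of j] by simp
  then have "integrable M (\<lambda>\<omega>. norm (net \<rho> \<omega> ^ j * exp (x * net \<rho> \<omega>)))" by (rule integrable_norm)
  then show ia: "integrable M (\<lambda>\<omega>. \<bar>net \<rho> \<omega>\<bar> ^ j * exp (x * net \<rho> \<omega>))"
    by (simp add: abs_mult power_abs)
  have "(\<integral>\<omega>. \<bar>net \<rho> \<omega>\<bar> ^ j * exp (x * net \<rho> \<omega>) \<partial>M) \<le>
      (\<integral>\<omega>. \<bar>net \<rho> \<omega>\<bar> ^ j * exp (r\<^sub>0 / 2 * \<bar>net \<rho> \<omega>\<bar>) \<partial>M)"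
  proof (rule integral_mono[OF ia E.integrable_abs_power_exp(1)[OF lt(1)]])
    fix \<omega>
    have "x * net \<rho> \<omega> \<le> \<bar>x\<bar> * \<bar>net \<rho> \<omega>\<bar>" by (metis abs_ge_self abs_mult)
    also have "\<dots> \<le> r\<^sub>0 / 2 * \<bar>net \<rho> \<omega>\<bar>" using assms(2) by (intro mult_right_mono) auto
    finally show "\<bar>net \<rho> \<omega>\<bar> ^ j * exp (x * net \<rho> \<omega>) \<le> \<bar>net \<rho> \<omega>\<bar> ^ j * exp (r\<^sub>0 / 2 * \<bar>net \<rho> \<omega>\<bar>)"
      by (intro mult_left_mono) auto
  qed
  also have "\<dots> \<le> mom_bound j"
    using E.integrable_abs_power_exp(2)[OF lt(1), of j] by (simp add: mom_bound_def EY_def)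
  finally show le: "(\<integral>\<omega>. \<bar>net \<rho> \<omega>\<bar> ^ j * exp (x * net \<rho> \<omega>) \<partial>M) \<le> mom_bound j" .
  have "\<bar>mom \<rho> j x\<bar> \<le> (\<integral>\<omega>. \<bar>net \<rho> \<omega> ^ j * exp (x * net \<rho> \<omega>)\<bar> \<partial>M)"
    unfolding mom_def by (rule integral_abs_bound)
  then show "\<bar>mom \<rho> j x\<bar> \<le> mom_bound j" using le by (simp add: abs_mult power_abs)
qed

lemma mgf_mom: "mgf \<rho> x = mom \<rho> 0 x"
  by (simp add: mgf_def mom_def)

text \<open>A non-integrable function would have Bochner integral 0, so the mean 1 forces
  integrability.\<close>

lemma integrable_V: "integrable M V" and integrable_U: "integrable M U"
  using EV EU not_integrable_integral_eq[of M V] not_integrable_integral_eq[of M U] by auto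

lemma mom_1_0: "mom \<rho> 1 0 = 1 - 1 / \<rho>"
  using integrable_V integrable_U EV EU by (simp add: mom_def net_def)

definition \<sigma>\<^sub>0 :: real where "\<sigma>\<^sub>0 = variance V + variance U"

lemma sigma0_pos: "0 < \<sigma>\<^sub>0" using var_pos by (simp add: \<sigma>\<^sub>0_def)

text \<open>With a = 1 / \<rho> \<ge> 1, independence and unit means give E (V - a U)^2 = var V +
  a^2 var U + (a - 1)^2.\<close>

lemma mom_2_0:
  assumes \<rho>: "0 < \<rho>" "\<rho> \<le> 1"
  shows "\<sigma>\<^sub>0 \<le> mom \<rho> 2 0"
proof -
  define a where "a = 1 / \<rho>"
  have a: "1 \<le> a" using \<rho> by (simp add: a_def)
  have net_a: "net \<rho> \<omega> = V \<omega> - a * U \<omega>" for \<omega> by (simp add: net_def a_def)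
  have iVU: "integrable M (\<lambda>\<omega>. V \<omega> * U \<omega>)" and eVU: "expectation (\<lambda>\<omega>. V \<omega> * U \<omega>) = 1"
    using indep_var_integrable[OF indep integrable_V integrable_U]
      indep_var_lebesgue_integral[OF indep integrable_V integrable_U] EV EU by auto
  have "mom \<rho> 2 0 = expectation (\<lambda>\<omega>. (V \<omega>)\<^sup>2 - 2 * a * (V \<omega> * U \<omega>) + a\<^sup>2 * (U \<omega>)\<^sup>2)"
    unfolding mom_def net_a
    by (intro Bochner_Integration.integral_cong refl) (simp add: power2_eq_square algebra_simps)
  also have "\<dots> = expectation (\<lambda>\<omega>. (V \<omega>)\<^sup>2) - 2 * a * 1 + a\<^sup>2 * expectation (\<lambda>\<omega>. (U \<omega>)\<^sup>2)"
    using V2 U2 iVU by (simp add: eVU)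
  also have "expectation (\<lambda>\<omega>. (V \<omega>)\<^sup>2) = variance V + 1"
    using variance_eq[OF integrable_V V2] EV by simp
  also have "expectation (\<lambda>\<omega>. (U \<omega>)\<^sup>2) = variance U + 1"
    using variance_eq[OF integrable_U U2] EU by simp
  finally have "mom \<rho> 2 0 = variance V + a\<^sup>2 * variance U + (a - 1)\<^sup>2"
    by (simp add: power2_eq_square algebra_simps)
  moreover have "1 * variance U \<le> a\<^sup>2 * variance U"
    using a by (intro mult_right_mono variance_positive one_le_power)
  moreover have "0 \<le> (a - 1)\<^sup>2" by simp
  ultimately show ?thesis unfolding \<sigma>\<^sub>0_def by linarith
qed

text \<open>The entry 1/2 keeps the transform at the saddle point at least 1/2,
  \<open>r\<^sub>0 / 2\<close> is the range of the moment bounds, and the third entry limits the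
  change of the second moment to half of \<open>\<sigma>\<^sub>0\<close>; the added 1 guards against
  a zero denominator.\<close>

definition \<delta>\<^sub>1 :: real where
  "\<delta>\<^sub>1 = min (1/2) (min (r\<^sub>0 / 2) (\<sigma>\<^sub>0 / (2 * (mom_bound 3 + 1))))"

lemma delta1_bounds: "0 < \<delta>\<^sub>1" "\<delta>\<^sub>1 \<le> r\<^sub>0 / 2" "\<delta>\<^sub>1 < r\<^sub>0" "\<delta>\<^sub>1 \<le> 1/2" "\<delta>\<^sub>1 * mom_bound 3 \<le> \<sigma>\<^sub>0 / 2"
proof -
  have b: "0 \<le> mom_bound 3" by (rule mom_bound_nonneg)
  show "0 < \<delta>\<^sub>1" using r0_pos sigma0_pos b by (auto simp: \<delta>\<^sub>1_def)
  show "\<delta>\<^sub>1 \<le> r\<^sub>0 / 2" "\<delta>\<^sub>1 \<le> 1/2"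
    unfolding \<delta>\<^sub>1_def by (meson min.cobounded1 min.cobounded2 order_trans)+
  then show "\<delta>\<^sub>1 < r\<^sub>0" using r0_pos by simp
  have "\<delta>\<^sub>1 * mom_bound 3 \<le> \<sigma>\<^sub>0 / (2 * (mom_bound 3 + 1)) * (mom_bound 3 + 1)"
    using b sigma0_pos by (intro mult_mono) (auto simp: \<delta>\<^sub>1_def)
  also have "\<dots> = \<sigma>\<^sub>0 / 2" using b by (simp add: field_simps)
  finally show "\<delta>\<^sub>1 * mom_bound 3 \<le> \<sigma>\<^sub>0 / 2" .
qed

lemma mom_2_lower:
  assumes \<rho>: "\<rho> \<in> {1/2..1}" and x: "0 \<le> x" "x \<le> \<delta>\<^sub>1"
  shows "\<sigma>\<^sub>0 / 2 \<le> mom \<rho> 2 x"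
proof (cases "x = 0")
  case True
  then show ?thesis using mom_2_0[of \<rho>] \<rho> sigma0_pos by auto
next
  case False
  have "\<exists>z. 0 < z \<and> z < x \<and> mom \<rho> 2 x - mom \<rho> 2 0 = (x - 0) * mom \<rho> (Suc 2) z"
    using False x delta1_bounds \<rho> by (intro MVT2 mom_has_real_derivative) auto
  then obtain z where z: "0 < z" "z < x" "mom \<rho> 2 x - mom \<rho> 2 0 = x * mom \<rho> 3 z"
    by (auto simp: numeral_3_eq_3 numeral_2_eq_2)
  have "\<bar>x * mom \<rho> 3 z\<bar> \<le> \<delta>\<^sub>1 * mom_bound 3"
    unfolding abs_mult using z x delta1_bounds \<rho> by (intro mult_mono abs_mom) auto
  then show ?thesis using z(3) delta1_bounds(5) mom_2_0[of \<rho>] \<rho> by (auto simp: abs_le_iff)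
qed

text \<open>The first moment increases with slope between two positive constants independent of
  \<rho>. Uniqueness and size of the saddle point both follow from this.\<close>

lemma mom_1_increment:
  assumes \<rho>: "\<rho> \<in> {1/2..1}" and xy: "0 \<le> x" "x < y" "y \<le> \<delta>\<^sub>1"
  shows "\<sigma>\<^sub>0 / 2 * (y - x) \<le> mom \<rho> 1 y - mom \<rho> 1 x" "mom \<rho> 1 y - mom \<rho> 1 x \<le> mom_bound 2 * (y - x)"
proof -
  have "\<exists>z. x < z \<and> z < y \<and> mom \<rho> 1 y - mom \<rho> 1 x = (y - x) * mom \<rho> (Suc 1) z"
    using xy delta1_bounds \<rho> by (intro MVT2 mom_has_real_derivative) auto
  then obtain z where z: "x < z" "z < y" "mom \<rho> 1 y - mom \<rho> 1 x = (y - x) * mom \<rho> 2 z"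
    by (auto simp: numeral_2_eq_2)
  have "\<sigma>\<^sub>0 / 2 \<le> mom \<rho> 2 z" using z xy \<rho> by (intro mom_2_lower) auto
  then show "\<sigma>\<^sub>0 / 2 * (y - x) \<le> mom \<rho> 1 y - mom \<rho> 1 x"
    unfolding z(3) using xy by (subst mult.commute) (intro mult_left_mono, auto)
  have "\<bar>mom \<rho> 2 z\<bar> \<le> mom_bound 2" using z xy \<rho> delta1_bounds by (intro abs_mom) auto
  then show "mom \<rho> 1 y - mom \<rho> 1 x \<le> mom_bound 2 * (y - x)"
    unfolding z(3) using xy by (subst mult.commute) (intro mult_right_mono, auto)
qed

text \<open>The first moment is 1 - 1 / \<rho> at 0 and vanishes at \<theta>, so the slope bounds
  make \<theta> comparable to 1 / \<rho> - 1. In heavy traffic this places \<theta> at order 1 /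
  sqrt n.\<close>

lemma saddle_bounds:
  assumes \<rho>: "\<rho> \<in> {1/2..<1}" and \<theta>: "0 \<le> \<theta>" "\<theta> \<le> \<delta>\<^sub>1" "mom \<rho> 1 \<theta> = 0"
  shows "0 < \<theta>" "\<sigma>\<^sub>0 / 2 * \<theta> \<le> 1 / \<rho> - 1" "1 / \<rho> - 1 \<le> mom_bound 2 * \<theta>"
proof -
  have neg: "mom \<rho> 1 0 < 0" unfolding mom_1_0 using \<rho> by (auto simp: field_simps)
  then have "\<theta> \<noteq> 0" using \<theta>(3) by auto
  then show pos: "0 < \<theta>" using \<theta> by simp
  show "\<sigma>\<^sub>0 / 2 * \<theta> \<le> 1 / \<rho> - 1" "1 / \<rho> - 1 \<le> mom_bound 2 * \<theta>"
    using mom_1_increment[of \<rho> 0 \<theta>] pos \<theta> \<rho> by (auto simp: mom_1_0[unfolded One_nat_def])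
qed

text \<open>The smallness condition is what the lower slope bound needs to lift the first moment
  from 1 - 1 / \<rho> above 0 before \<delta>' is reached.\<close>

lemma saddle_unique_existence:
  assumes \<rho>: "\<rho> \<in> {1/2..<1}" and \<delta>': "0 < \<delta>'" "\<delta>' \<le> \<delta>\<^sub>1" and small: "1 / \<rho> - 1 < \<sigma>\<^sub>0 / 2 * \<delta>'"
  shows "\<exists>!\<theta>. \<theta> \<in> {0..\<delta>'} \<and> mom \<rho> 1 \<theta> = 0"
proof -
  have \<rho>': "\<rho> \<in> {1/2..1}" using \<rho> by auto
  have lo: "mom \<rho> 1 0 \<le> 0" unfolding mom_1_0 using \<rho> by (auto simp: field_simps)
  have hi: "0 \<le> mom \<rho> 1 \<delta>'"
    using mom_1_increment(1)[of \<rho> 0 \<delta>'] \<rho>' \<delta>' small by (auto simp: mom_1_0[unfolded One_nat_def])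
  have cont: "continuous_on {0..\<delta>'} (mom \<rho> 1)"
  proof (rule DERIV_continuous_on)
    fix x assume "x \<in> {0..\<delta>'}"
    then have "\<bar>x\<bar> < r\<^sub>0" using \<delta>' delta1_bounds by auto
    then show "(mom \<rho> 1 has_real_derivative mom \<rho> (Suc 1) x) (at x within {0..\<delta>'})"
      by (rule has_field_derivative_at_within[OF mom_has_real_derivative[OF \<rho>']])
  qed
  obtain \<theta> where \<theta>: "0 \<le> \<theta>" "\<theta> \<le> \<delta>'" "mom \<rho> 1 \<theta> = 0"
    using IVT'[OF lo hi less_imp_le[OF \<delta>'(1)] cont] by blast
  show ?thesis
  proof (rule ex1I[of _ \<theta>])
    fix \<theta>' assume t: "\<theta>' \<in> {0..\<delta>'} \<and> mom \<rho> 1 \<theta>' = 0"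
    have "\<not> x < y" if "x \<in> {0..\<delta>'}" "y \<in> {0..\<delta>'}" "mom \<rho> 1 x = 0" "mom \<rho> 1 y = 0" for x y
    proof
      assume "x < y"
      then have "\<sigma>\<^sub>0 / 2 * (y - x) \<le> 0" using mom_1_increment(1)[of \<rho> x y] that \<rho>' \<delta>' by auto
      then show False using sigma0_pos \<open>x < y\<close> by (simp add: mult_le_0_iff)
    qed
    from this[of \<theta> \<theta>'] this[of \<theta>' \<theta>] show "\<theta>' = \<theta>" using t \<theta> by auto
  qed (use \<theta> in auto)
qed

lemma mom_0_pos:
  assumes "\<rho> \<in> {1/2..1}" "\<bar>x\<bar> < r\<^sub>0"
  shows "0 < mom \<rho> 0 x"
proof -
  interpret E: exp_integrable M "net \<rho>" "\<lambda>\<omega>. V \<omega> + 2 * U \<omega>" r\<^sub>0 by (rule exp_integrable_net[OF assms(1)])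
  have i: "integrable M (\<lambda>\<omega>. exp (x * net \<rho> \<omega>))"
    using E.integrable_exp_mom[of x 0] assms(2) by simp
  have "0 \<le> mom \<rho> 0 x" unfolding mom_def by (rule integral_nonneg_AE) auto
  moreover have "mom \<rho> 0 x \<noteq> 0"
  proof
    assume "mom \<rho> 0 x = 0"
    then have "AE \<omega> in M. exp (x * net \<rho> \<omega>) = 0"
      using i by (subst integral_nonneg_eq_0_iff_AE[symmetric]) (auto simp: mom_def)
    then have "AE \<omega> in M. False" by simp
    then show False by simp
  qed
  ultimately show ?thesis by simp
qed

lemma log_psi_mom: "log_psi M V U \<rho> \<zeta> = ln (mom \<rho> 0 (- \<zeta>))"
  unfolding log_psi_def psi_of_real by (simp add: mgf_mom)

text \<open>Derivatives in \<zeta> = - \<theta> alternate in sign. At a zero of the first moment the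
  product terms of the quotient rule vanish, so the second and third cumulants reduce to normalised
  moments.\<close>

lemma log_psi_derivs:
  assumes \<rho>: "\<rho> \<in> {1/2..1}" and \<zeta>: "\<bar>\<zeta>\<bar> < r\<^sub>0"
  shows "deriv (log_psi M V U \<rho>) \<zeta> = - mom \<rho> 1 (- \<zeta>) / mom \<rho> 0 (- \<zeta>)"
    and "mom \<rho> 1 (- \<zeta>) = 0 \<Longrightarrow> (deriv ^^ 2) (log_psi M V U \<rho>) \<zeta> = mom \<rho> 2 (- \<zeta>) / mom \<rho> 0 (- \<zeta>)"
    and "mom \<rho> 1 (- \<zeta>) = 0 \<Longrightarrow> (deriv ^^ 3) (log_psi M V U \<rho>) \<zeta> = - mom \<rho> 3 (- \<zeta>) / mom \<rho> 0 (- \<zeta>)"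
proof -
  let ?h = "log_psi M V U \<rho>"
  define h1 where "h1 = (\<lambda>\<zeta>. - mom \<rho> 1 (- \<zeta>) / mom \<rho> 0 (- \<zeta>))"
  define h2 where "h2 = (\<lambda>\<zeta>. mom \<rho> 2 (- \<zeta>) / mom \<rho> 0 (- \<zeta>) - (mom \<rho> 1 (- \<zeta>) / mom \<rho> 0 (- \<zeta>))\<^sup>2)"
  have ne: "mom \<rho> 0 (- z) > 0" if "\<bar>z\<bar> < r\<^sub>0" for z using mom_0_pos[OF \<rho>, of "- z"] that by simp
  have dm: "((\<lambda>z. mom \<rho> j (- z)) has_real_derivative - mom \<rho> (Suc j) (- z)) (at z)" if "\<bar>z\<bar> < r\<^sub>0" for z j
    using DERIV_chain'[OF DERIV_minus[OF DERIV_ident] mom_has_real_derivative[OF \<rho>, of "- z" j]] that by simp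
  have d1: "deriv ?h z = h1 z" if "\<bar>z\<bar> < r\<^sub>0" for z
  proof (rule DERIV_imp_deriv)
    have "((\<lambda>z. ln (mom \<rho> 0 (- z))) has_real_derivative h1 z) (at z)"
      using ne[OF that] by (auto intro!: derivative_eq_intros dm[OF that] simp: h1_def)
    then show "(?h has_real_derivative h1 z) (at z)" by (simp add: log_psi_mom[abs_def])
  qed
  then show "deriv ?h \<zeta> = - mom \<rho> 1 (- \<zeta>) / mom \<rho> 0 (- \<zeta>)" using \<zeta> by (simp add: h1_def)
  have ev: "\<forall>\<^sub>F w in nhds z. \<bar>w\<bar> < r\<^sub>0" if "\<bar>z\<bar> < r\<^sub>0" for z :: real
    using eventually_nhds_in_open[of "ball 0 r\<^sub>0" z] that by simp
  have d2: "deriv (deriv ?h) z = h2 z" if "\<bar>z\<bar> < r\<^sub>0" for z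
  proof -
    have "deriv (deriv ?h) z = deriv h1 z"
      by (intro deriv_cong_ev refl eventually_mono[OF ev[OF that]] d1)
    also have "\<dots> = h2 z"
      unfolding h1_def h2_def using ne[OF that]
      by (intro DERIV_imp_deriv)
        (auto intro!: derivative_eq_intros dm[OF that] simp: numeral_2_eq_2 field_simps)
    finally show ?thesis .
  qed
  have e2: "(deriv ^^ 2) ?h = deriv (deriv ?h)" by (simp add: numeral_2_eq_2)
  show "(deriv ^^ 2) ?h \<zeta> = mom \<rho> 2 (- \<zeta>) / mom \<rho> 0 (- \<zeta>)" if "mom \<rho> 1 (- \<zeta>) = 0"
    unfolding e2 d2[OF \<zeta>] using that by (simp add: h2_def)
  show "(deriv ^^ 3) ?h \<zeta> = - mom \<rho> 3 (- \<zeta>) / mom \<rho> 0 (- \<zeta>)" if "mom \<rho> 1 (- \<zeta>) = 0"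
  proof -
    have "(deriv ^^ 3) ?h \<zeta> = deriv (deriv (deriv ?h)) \<zeta>" by (simp add: numeral_3_eq_3)
    also have "\<dots> = deriv h2 \<zeta>"
      by (intro deriv_cong_ev refl eventually_mono[OF ev[OF \<zeta>]] d2)
    also have "\<dots> = - mom \<rho> 3 (- \<zeta>) / mom \<rho> 0 (- \<zeta>)"
      unfolding h2_def using ne[OF \<zeta>] that
      by (intro DERIV_imp_deriv)
        (auto intro!: derivative_eq_intros dm[OF \<zeta>] simp: numeral_2_eq_2 numeral_3_eq_3 field_simps)
    finally show ?thesis .
  qed
qed

lemma is_saddle_point_iff:
  assumes \<rho>: "\<rho> \<in> {1/2..1}" and \<delta>': "\<delta>' \<le> \<delta>\<^sub>1"
  shows "is_saddle_point (log_psi M V U \<rho>) \<delta>' \<zeta> \<longleftrightarrow> - \<zeta> \<in> {0..\<delta>'} \<and> mom \<rho> 1 (- \<zeta>) = 0"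
proof (cases "\<zeta> \<in> {- \<delta>'..0}")
  case True
  then have z: "\<bar>\<zeta>\<bar> < r\<^sub>0" using \<delta>' delta1_bounds by auto
  then have "mom \<rho> 0 (- \<zeta>) \<noteq> 0" using mom_0_pos[OF \<rho>, of "- \<zeta>"] by simp
  then show ?thesis
    unfolding is_saddle_point_def log_psi_derivs(1)[OF \<rho> z] using True by auto
qed (auto simp: is_saddle_point_def)

end

section \<open>Perturbation of the Gaussian transform\<close>

text \<open>The transform at B + i t of a normal step with mean -B and variance 1.\<close>

definition gauss_tilt :: "real \<Rightarrow> real \<Rightarrow> real" where
  "gauss_tilt B t = exp (- B\<^sup>2 / 2 - t\<^sup>2 / 2)"

definition gauss_log :: "real \<Rightarrow> real \<Rightarrow> real" where
  "gauss_log B t = - ln (1 - gauss_tilt B t)"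

lemma gauss_tilt_bounds:
  assumes "0 < B0" "B0 \<le> B"
  shows "0 < gauss_tilt B t" "gauss_tilt B t \<le> exp (- B0\<^sup>2 / 2)" "gauss_tilt B t < 1"
    "gauss_tilt B t \<le> exp (- t\<^sup>2 / 2)"
proof -
  have "B0\<^sup>2 \<le> B\<^sup>2" "0 < B0\<^sup>2" using assms by (auto intro: power_mono)
  then have "- B\<^sup>2 / 2 - t\<^sup>2 / 2 \<le> - B0\<^sup>2 / 2" "- B\<^sup>2 / 2 - t\<^sup>2 / 2 \<le> - t\<^sup>2 / 2"
    using zero_le_power2[of t] by linarith+
  then show "0 < gauss_tilt B t" "gauss_tilt B t \<le> exp (- B0\<^sup>2 / 2)" "gauss_tilt B t \<le> exp (- t\<^sup>2 / 2)"
    unfolding gauss_tilt_def exp_le_cancel_iff by auto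
  moreover have "exp (- B0\<^sup>2 / 2) < 1" using assms by simp
  ultimately show "gauss_tilt B t < 1" by linarith
qed

lemma gauss_log_bounds:
  assumes "0 < B0" "B0 \<le> B"
  shows "0 \<le> gauss_log B t" "gauss_log B t \<le> exp (- t\<^sup>2 / 2) / (1 - exp (- B0\<^sup>2 / 2))"
    "gauss_tilt B t / (1 - gauss_tilt B t) \<le> exp (- t\<^sup>2 / 2) / (1 - exp (- B0\<^sup>2 / 2))"
    "- Ln (1 - of_real (gauss_tilt B t)) = of_real (gauss_log B t)"
proof -
  let ?E = "gauss_tilt B t"
  note E = gauss_tilt_bounds[OF assms, of t]
  have q: "exp (- B0\<^sup>2 / 2) < 1" using assms by simp
  show le: "?E / (1 - ?E) \<le> exp (- t\<^sup>2 / 2) / (1 - exp (- B0\<^sup>2 / 2))"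
    using E q by (intro frac_le) auto
  show "0 \<le> gauss_log B t" using E by (simp add: gauss_log_def)
  have "gauss_log B t = ln (1 / (1 - ?E))" using E by (simp add: gauss_log_def ln_div)
  also have "\<dots> \<le> 1 / (1 - ?E) - 1" using E by (intro ln_le_minus_one) simp
  also have "\<dots> = ?E / (1 - ?E)" using E by (simp add: field_simps)
  finally show "gauss_log B t \<le> exp (- t\<^sup>2 / 2) / (1 - exp (- B0\<^sup>2 / 2))" using le by linarith
  have "Ln (of_real (1 - ?E)) = of_real (ln (1 - ?E))" using E by (intro Ln_of_real) simp
  then show "- Ln (1 - of_real ?E) = of_real (gauss_log B t)" by (simp add: gauss_log_def)
qed

lemma borel_measurable_gauss [measurable]:
  "gauss_tilt B \<in> borel_measurable borel" "gauss_log B \<in> borel_measurable borel"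
  unfolding gauss_log_def gauss_tilt_def by measurable

text \<open>Even powers come from x^j \<le> j! exp x at x = t^2 / 2, odd ones from |t|^3 \<le> 1 +
  t^4 and |t|^5 \<le> 1 + t^6. The constants are not meant to be sharp.\<close>

lemma gauss_power_le:
  fixes t :: real
  shows
  "\<bar>t\<bar> ^ 3 * exp (- t\<^sup>2 / 2) \<le> 9" "t ^ 4 * exp (- t\<^sup>2 / 2) \<le> 8" "t ^ 6 * exp (- t\<^sup>2 / 2) \<le> 48"
  "t\<^sup>2 * exp (- t\<^sup>2 / 2) \<le> 2" "\<bar>t\<bar> ^ 5 * exp (- t\<^sup>2 / 2) \<le> 50"
proof -
  have e: "exp (- t\<^sup>2 / 2) * exp (t\<^sup>2 / 2) = 1" "0 < exp (- t\<^sup>2 / 2)" by (simp_all flip: exp_add)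
  have p: "(t\<^sup>2 / 2) ^ j * exp (- t\<^sup>2 / 2) \<le> fact j" for j
  proof -
    have "(t\<^sup>2 / 2) ^ j * exp (- t\<^sup>2 / 2) \<le> fact j * exp (t\<^sup>2 / 2) * exp (- t\<^sup>2 / 2)"
      by (intro mult_right_mono power_le_fact_exp) auto
    also have "\<dots> = fact j * (exp (- t\<^sup>2 / 2) * exp (t\<^sup>2 / 2))" by (simp only: mult_ac)
    finally show ?thesis by (simp only: e(1) mult_1_right)
  qed
  have x: "exp (- t\<^sup>2 / 2) \<le> 1" by simp
  show 2: "t\<^sup>2 * exp (- t\<^sup>2 / 2) \<le> 2" using p[of 1] by simp
  show 4: "t ^ 4 * exp (- t\<^sup>2 / 2) \<le> 8"
    using p[of 2] by (simp add: power_divide fact_numeral flip: power_mult)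
  show 6: "t ^ 6 * exp (- t\<^sup>2 / 2) \<le> 48"
    using p[of 3] by (simp add: power_divide fact_numeral flip: power_mult)
  have "\<bar>t\<bar> ^ 3 \<le> 1 + \<bar>t\<bar> ^ 4"
  proof (cases "\<bar>t\<bar> \<le> 1")
    case True
    then have "\<bar>t\<bar> ^ 3 \<le> 1" by (intro power_le_one) auto
    then show ?thesis using zero_le_power[of "\<bar>t\<bar>" 4] by linarith
  next
    case False
    then have "\<bar>t\<bar> ^ 3 \<le> \<bar>t\<bar> ^ 4" by (intro power_increasing) auto
    then show ?thesis by simp
  qed
  then have "\<bar>t\<bar> ^ 3 * exp (- t\<^sup>2 / 2) \<le> (1 + t ^ 4) * exp (- t\<^sup>2 / 2)"
    by (intro mult_right_mono) auto
  then show "\<bar>t\<bar> ^ 3 * exp (- t\<^sup>2 / 2) \<le> 9" using 4 x unfolding distrib_right by linarith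
  have "\<bar>t\<bar> ^ 5 \<le> 1 + \<bar>t\<bar> ^ 6"
  proof (cases "\<bar>t\<bar> \<le> 1")
    case True
    then have "\<bar>t\<bar> ^ 5 \<le> 1" by (intro power_le_one) auto
    then show ?thesis using zero_le_power[of "\<bar>t\<bar>" 6] by linarith
  next
    case False
    then have "\<bar>t\<bar> ^ 5 \<le> \<bar>t\<bar> ^ 6" by (intro power_increasing) auto
    then show ?thesis by simp
  qed
  then have "\<bar>t\<bar> ^ 5 * exp (- t\<^sup>2 / 2) \<le> (1 + t ^ 6) * exp (- t\<^sup>2 / 2)"
    by (intro mult_right_mono) auto
  then show "\<bar>t\<bar> ^ 5 * exp (- t\<^sup>2 / 2) \<le> 50" using 6 x unfolding distrib_right by linarith
qed

lemma integrable_gauss_abs_power: "integrable lborel (\<lambda>t::real. \<bar>t\<bar> ^ k * exp (- t\<^sup>2 / 2))"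
proof -
  have "integrable lborel (\<lambda>t. sqrt (2 * pi) * (std_normal_density t * \<bar>t\<bar> ^ k))"
    by (intro integrable_mult_right integrable_std_normal_moment_abs)
  then show ?thesis by (simp add: std_normal_density_def mult_ac)
qed

lemma integral_gauss: "(\<integral>t. exp (- t\<^sup>2 / 2) \<partial>lborel) = sqrt (2 * pi)"
proof -
  have "(\<integral>t. sqrt (2 * pi) * std_normal_density t \<partial>lborel) = sqrt (2 * pi)" by simp
  then show ?thesis by (simp add: std_normal_density_def)
qed

lemma norm_line_ge:
  assumes "0 < a0" "a0 \<le> Re a"
  shows "a0 \<le> norm (a + \<i> * of_real t)" "a + \<i> * of_real t \<noteq> 0"
proof -
  have "a0 \<le> \<bar>Re (a + \<i> * of_real t)\<bar>" using assms by simp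
  also have "\<dots> \<le> norm (a + \<i> * of_real t)" by (rule abs_Re_le_cmod)
  finally show "a0 \<le> norm (a + \<i> * of_real t)" .
  then show "a + \<i> * of_real t \<noteq> 0" using assms by auto
qed

lemma integrable_gauss_line:
  fixes g :: "real \<Rightarrow> complex"
  assumes B: "0 < B0" "B0 \<le> B" and a: "0 < a0" "\<And>t. norm (g t) \<le> C * \<bar>t\<bar> ^ k" and [measurable]: "g \<in> borel_measurable borel"
  shows "integrable lborel (\<lambda>t. of_real (gauss_log B t) * g t)"
    and "integrable lborel (\<lambda>t. of_real (gauss_tilt B t / (1 - gauss_tilt B t)) * g t)"
proof -
  let ?D = "1 - exp (- B0\<^sup>2 / 2)"
  have D: "0 < ?D" using B by simp
  have int: "integrable lborel (\<lambda>t. C / ?D * (\<bar>t\<bar> ^ k * exp (- t\<^sup>2 / 2)))"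
    by (intro integrable_mult_right integrable_gauss_abs_power)
  have le: "norm (of_real x * g t) \<le> C / ?D * (\<bar>t\<bar> ^ k * exp (- t\<^sup>2 / 2))"
    if "0 \<le> x" "x \<le> exp (- t\<^sup>2 / 2) / ?D" for x t
  proof -
    have "norm (of_real x * g t) \<le> (exp (- t\<^sup>2 / 2) / ?D) * (C * \<bar>t\<bar> ^ k)"
      unfolding norm_mult using that D a(2)[of t] by (intro mult_mono) auto
    then show ?thesis by (simp add: mult_ac)
  qed
  show "integrable lborel (\<lambda>t. of_real (gauss_log B t) * g t)"
  proof (rule Bochner_Integration.integrable_bound[OF int])
    show "AE t in lborel. norm (of_real (gauss_log B t) * g t) \<le> norm (C / ?D * (\<bar>t\<bar> ^ k * exp (- t\<^sup>2 / 2)))"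
    proof (rule AE_I2)
      fix t
      have "norm (of_real (gauss_log B t) * g t) \<le> C / ?D * (\<bar>t\<bar> ^ k * exp (- t\<^sup>2 / 2))"
        by (rule le[OF gauss_log_bounds(1,2)[OF B]])
      also have "\<dots> \<le> norm \<dots>" unfolding real_norm_def by (rule abs_ge_self)
      finally show "norm (of_real (gauss_log B t) * g t) \<le> norm (C / ?D * (\<bar>t\<bar> ^ k * exp (- t\<^sup>2 / 2)))" .
    qed
  qed measurable
  show "integrable lborel (\<lambda>t. of_real (gauss_tilt B t / (1 - gauss_tilt B t)) * g t)"
  proof (rule Bochner_Integration.integrable_bound[OF int])
    show "AE t in lborel. norm (of_real (gauss_tilt B t / (1 - gauss_tilt B t)) * g t) \<le>
        norm (C / ?D * (\<bar>t\<bar> ^ k * exp (- t\<^sup>2 / 2)))"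
    proof (rule AE_I2)
      fix t
      have "0 \<le> gauss_tilt B t / (1 - gauss_tilt B t)"
        using gauss_tilt_bounds[OF B, of t] by simp
      then have "norm (of_real (gauss_tilt B t / (1 - gauss_tilt B t)) * g t) \<le> C / ?D * (\<bar>t\<bar> ^ k * exp (- t\<^sup>2 / 2))"
        by (rule le[OF _ gauss_log_bounds(3)[OF B]])
      also have "\<dots> \<le> norm \<dots>" unfolding real_norm_def by (rule abs_ge_self)
      finally show "norm (of_real (gauss_tilt B t / (1 - gauss_tilt B t)) * g t) \<le> norm (C / ?D * (\<bar>t\<bar> ^ k * exp (- t\<^sup>2 / 2)))" .
    qed
  qed measurable
qed

text \<open>Integration by parts against \<open>t\<^sup>2 / (a + \<i> t)\<close> turns the cubic correction of the tilted
  transform into a derivative of the resolvent, that is, into a shift of \<open>a\<close>.\<close>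

lemma cubic_correction:
  fixes a :: complex
  assumes B: "0 < B" and a: "0 < Re a"
  shows "(\<integral>t. of_real (gauss_tilt B t / (1 - gauss_tilt B t)) * (- \<i> * of_real (t ^ 3) / (a + \<i> * of_real t)) \<partial>lborel) =
    - (\<integral>t. of_real (gauss_log B t) * (1 - a\<^sup>2 / (a + \<i> * of_real t)\<^sup>2) \<partial>lborel)"
    and "integrable lborel (\<lambda>t. of_real (gauss_tilt B t / (1 - gauss_tilt B t)) * (- \<i> * of_real (t ^ 3) / (a + \<i> * of_real t)))"
    and "integrable lborel (\<lambda>t. of_real (gauss_log B t) * (1 - a\<^sup>2 / (a + \<i> * of_real t)\<^sup>2))"
proof -
  let ?L = "\<lambda>t. a + \<i> * of_real t"
  have ne: "?L t \<noteq> 0" and nge: "Re a \<le> norm (?L t)" for t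
    using norm_line_ge[of "Re a" a t] a by auto
  have inv: "norm (1 / ?L t) \<le> 1 / Re a" for t
    using nge[of t] a by (simp add: norm_divide frac_le)
  \<comment> \<open>The boundary term of the integration by parts: its derivative is - f1 - i f2,
    and it vanishes at both ends of the line because \<open>gauss_log\<close> has a Gaussian
    bound.\<close>
  define F where "F = (\<lambda>t. of_real (gauss_log B t) * (of_real (t\<^sup>2) / ?L t))"
  define f1 where "f1 = (\<lambda>t. of_real (gauss_tilt B t / (1 - gauss_tilt B t)) * (of_real (t ^ 3) / ?L t))"
  define f2 where "f2 = (\<lambda>t. of_real (gauss_log B t) * (1 - a\<^sup>2 / (?L t)\<^sup>2))"
  have i1: "integrable lborel f1"
    unfolding f1_def
  proof (rule integrable_gauss_line(2)[OF B order_refl zero_less_one, where C = "1 / Re a" and k = 3])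
    show "norm (of_real (t ^ 3) / ?L t) \<le> 1 / Re a * \<bar>t\<bar> ^ 3" for t
      using mult_right_mono[OF inv, of "\<bar>t\<bar> ^ 3" t] by (simp add: norm_divide norm_power power_abs)
  qed measurable
  have i2: "integrable lborel f2"
    unfolding f2_def
  proof (rule integrable_gauss_line(1)[OF B order_refl zero_less_one, where C = "1 + (norm a)\<^sup>2 * (1 / Re a)\<^sup>2" and k = 0])
    fix t
    have "norm (1 - a\<^sup>2 / (?L t)\<^sup>2) \<le> norm (1::complex) + norm (a\<^sup>2 * (1 / ?L t)\<^sup>2)"
      using norm_triangle_ineq4[of 1 "a\<^sup>2 * (1 / ?L t)\<^sup>2"] by (simp add: power_divide)
    also have "norm (a\<^sup>2 * (1 / ?L t)\<^sup>2) \<le> (norm a)\<^sup>2 * (1 / Re a)\<^sup>2"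
      unfolding norm_mult norm_power by (intro mult_left_mono power_mono inv) auto
    finally show "norm (1 - a\<^sup>2 / (?L t)\<^sup>2) \<le> (1 + (norm a)\<^sup>2 * (1 / Re a)\<^sup>2) * \<bar>t\<bar> ^ 0" by simp
  qed measurable
  have dlog: "(gauss_log B has_real_derivative - t * (gauss_tilt B t / (1 - gauss_tilt B t))) (at t)" for t
  proof -
    have dE: "(gauss_tilt B has_real_derivative - t * gauss_tilt B t) (at t)"
      unfolding gauss_tilt_def[abs_def] by (auto intro!: derivative_eq_intros)
    have "1 - gauss_tilt B t > 0" using gauss_tilt_bounds(3)[OF B order_refl, of t] by simp
    then have "((\<lambda>t. - ln (1 - gauss_tilt B t)) has_real_derivative
        - (1 / (1 - gauss_tilt B t) * (0 - - t * gauss_tilt B t))) (at t)"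
      by (intro DERIV_minus DERIV_chain2[OF DERIV_ln_divide] DERIV_diff DERIV_const dE)
    then show ?thesis
      by (simp add: gauss_log_def[abs_def])
  qed
  have dF: "(F has_vector_derivative - f1 t - \<i> * f2 t) (at t)" for t
  proof -
    have d1: "((\<lambda>t. complex_of_real (gauss_log B t)) has_vector_derivative
        of_real (- t * (gauss_tilt B t / (1 - gauss_tilt B t)))) (at t)"
      by (rule has_vector_derivative_of_real[OF dlog])
    define z where "z = complex_of_real t"
    define P where "P = a + \<i> * z"
    have P: "P \<noteq> 0" using ne[of t] by (simp add: P_def z_def)
    have "((\<lambda>z. z\<^sup>2 / (a + \<i> * z)) has_field_derivative (2 * z * P - z\<^sup>2 * \<i>) / (P * P)) (at z)"
      unfolding P_def by (rule derivative_eq_intros refl | use P in \<open>simp add: P_def\<close>)+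
    also have "2 * z * P - z\<^sup>2 * \<i> = - \<i> * (P\<^sup>2 - a\<^sup>2)"
      by (simp add: P_def power2_eq_square algebra_simps)
    also have "- \<i> * (P\<^sup>2 - a\<^sup>2) / (P * P) = - \<i> * (1 - a\<^sup>2 / P\<^sup>2)"
      using P by (simp add: field_simps power2_eq_square)
    finally have "((\<lambda>z. z\<^sup>2 / (a + \<i> * z)) has_field_derivative - \<i> * (1 - a\<^sup>2 / (?L t)\<^sup>2)) (at (of_real t))"
      by (simp add: P_def z_def)
    then have d2: "((\<lambda>t. (of_real t)\<^sup>2 / ?L t) has_vector_derivative - \<i> * (1 - a\<^sup>2 / (?L t)\<^sup>2)) (at t)"
      by (rule has_vector_derivative_real_field)
    show ?thesis
      unfolding F_def of_real_power
      by (rule has_vector_derivative_eq_rhs[OF has_vector_derivative_mult[OF d1 d2]])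
        (simp add: f1_def f2_def power2_eq_square power3_eq_cube algebra_simps)
  qed
  have int: "integrable lborel (\<lambda>t. - f1 t - \<i> * f2 t)" using i1 i2 by auto
  have cont: "isCont (\<lambda>t. - f1 t - \<i> * f2 t) t" for t
    unfolding f1_def f2_def gauss_log_def gauss_tilt_def
    using gauss_tilt_bounds(3)[OF B order_refl, of t, unfolded gauss_tilt_def] ne[of t]
    by (intro continuous_intros) auto
  have F_bound: "norm (F t) \<le> 1 / (1 - exp (- B\<^sup>2 / 2)) / Re a * (t\<^sup>2 * exp (- t\<^sup>2 / 2))" for t
  proof -
    have "norm (F t) = gauss_log B t * (t\<^sup>2 * norm (1 / ?L t))"
      using gauss_log_bounds(1)[OF B order_refl, of t] by (simp add: F_def norm_mult norm_divide norm_power)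
    also have "\<dots> \<le> (exp (- t\<^sup>2 / 2) / (1 - exp (- B\<^sup>2 / 2))) * (t\<^sup>2 * (1 / Re a))"
      using gauss_log_bounds[OF B order_refl, of t] inv[of t] B by (intro mult_mono mult_left_mono) auto
    finally show ?thesis by (simp add: mult_ac)
  qed
  have lim_top: "(F \<longlongrightarrow> 0) at_top"
  proof (rule Lim_null_comparison[OF always_eventually[OF allI[OF F_bound]]])
    have "((\<lambda>t::real. t\<^sup>2 * exp (- t\<^sup>2 / 2)) \<longlongrightarrow> 0) at_top" by real_asymp
    from tendsto_mult_left[OF this, of "1 / (1 - exp (- B\<^sup>2 / 2)) / Re a"]
    show "((\<lambda>t. 1 / (1 - exp (- B\<^sup>2 / 2)) / Re a * (t\<^sup>2 * exp (- t\<^sup>2 / 2))) \<longlongrightarrow> 0) at_top"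
      by (simp only: mult_zero_right)
  qed
  have lim_bot: "(F \<longlongrightarrow> 0) at_bot"
  proof (rule Lim_null_comparison[OF always_eventually[OF allI[OF F_bound]]])
    have "((\<lambda>t::real. t\<^sup>2 * exp (- t\<^sup>2 / 2)) \<longlongrightarrow> 0) at_bot" by real_asymp
    from tendsto_mult_left[OF this, of "1 / (1 - exp (- B\<^sup>2 / 2)) / Re a"]
    show "((\<lambda>t. 1 / (1 - exp (- B\<^sup>2 / 2)) / Re a * (t\<^sup>2 * exp (- t\<^sup>2 / 2))) \<longlongrightarrow> 0) at_bot"
      by (simp only: mult_zero_right)
  qed
  have "(LBINT t=-\<infinity>..\<infinity>. - f1 t - \<i> * f2 t) = 0 - 0"
    by (rule interval_integral_FTC_integrable[where F = F])
      (use dF cont int lim_top lim_bot in \<open>auto simp: set_integrable_def ereal_tendsto_simps\<close>)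
  then have "(\<integral>t. - f1 t - \<i> * f2 t \<partial>lborel) = 0"
    by (simp add: interval_lebesgue_integral_def set_lebesgue_integral_def)
  then have "- (\<integral>t. f1 t \<partial>lborel) = \<i> * (\<integral>t. f2 t \<partial>lborel)"
    using i1 i2 by simp
  then have eq: "(\<integral>t. f1 t \<partial>lborel) = - \<i> * (\<integral>t. f2 t \<partial>lborel)"
    by (metis minus_minus mult_minus_left)
  have f1': "(\<lambda>t. of_real (gauss_tilt B t / (1 - gauss_tilt B t)) * (- \<i> * of_real (t ^ 3) / ?L t)) = (\<lambda>t. - \<i> * f1 t)"
    by (rule ext) (simp add: f1_def)
  show "integrable lborel (\<lambda>t. of_real (gauss_tilt B t / (1 - gauss_tilt B t)) * (- \<i> * of_real (t ^ 3) / ?L t))"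
    unfolding f1' using i1 by simp
  show "integrable lborel (\<lambda>t. of_real (gauss_log B t) * (1 - a\<^sup>2 / (?L t)\<^sup>2))"
    using i2 by (simp add: f2_def)
  have "(\<integral>t. - \<i> * f1 t \<partial>lborel) = - \<i> * (\<integral>t. f1 t \<partial>lborel)" by (rule integral_mult_right_zero)
  also have "\<dots> = - (\<integral>t. f2 t \<partial>lborel)" unfolding eq by simp
  finally show "(\<integral>t. of_real (gauss_tilt B t / (1 - gauss_tilt B t)) * (- \<i> * of_real (t ^ 3) / ?L t) \<partial>lborel) =
      - (\<integral>t. of_real (gauss_log B t) * (1 - a\<^sup>2 / (?L t)\<^sup>2) \<partial>lborel)"
    unfolding f1' f2_def .
qed

text \<open>The hypothesis on a - a' says 1 / a' = 1 / a + \<phi> when both are nonzero. The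
  first-order effect on the resolvent is the a-dependent part of what integration by parts makes of
  the cubic term.\<close>

lemma resolvent_shift:
  fixes a a' :: complex
  assumes a0: "0 < a0" "a0 \<le> Re a" "norm a \<le> A" "a0 \<le> Re a'" "norm a' \<le> A"
    and a': "a - a' = of_real \<phi> * a * a'"
  shows "norm (1 / (a' + \<i> * of_real t) - 1 / (a + \<i> * of_real t) - of_real \<phi> * a\<^sup>2 / (a + \<i> * of_real t)\<^sup>2)
    \<le> A ^ 3 * (1 + A / a0) / a0\<^sup>2 * \<phi>\<^sup>2"
proof -
  let ?L = "a + \<i> * of_real t" and ?L' = "a' + \<i> * of_real t"
  note n = norm_line_ge[OF a0(1,2), of t] and n' = norm_line_ge[OF a0(1,4), of t]
  have A: "0 \<le> A" using a0(3) norm_ge_zero order_trans by blast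
  have combine: "x / (P' * P) - y / P\<^sup>2 = (x * P - y * P') / (P' * P\<^sup>2)" if "P \<noteq> 0" "P' \<noteq> 0" for x y P P' :: complex
    using that by (simp add: field_simps power2_eq_square)
  have "1 / ?L' - 1 / ?L = (a - a') / (?L' * ?L)" using n n' by (simp add: field_simps)
  then have "1 / ?L' - 1 / ?L - of_real \<phi> * a\<^sup>2 / ?L\<^sup>2 = of_real \<phi> * a * a' / (?L' * ?L) - of_real \<phi> * a\<^sup>2 / ?L\<^sup>2"
    by (simp only: a')
  also have "\<dots> = - (of_real \<phi> * a * (\<i> * of_real t) * (a - a')) / (?L' * ?L\<^sup>2)"
    unfolding combine[OF n(2) n'(2)] by (simp add: algebra_simps power2_eq_square)
  \<comment> \<open>In this exact remainder t enters only through the bounded quotient t / (a + i t)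
    and two bounded resolvents, so the estimate is uniform on the line.\<close>
  also have "\<dots> = - ((of_real \<phi>)\<^sup>2 * a\<^sup>2 * a' * (\<i> * (of_real t / ?L)) * (1 / (?L' * ?L)))"
    unfolding a' using n n' by (simp add: field_simps power2_eq_square)
  finally have "norm (1 / ?L' - 1 / ?L - of_real \<phi> * a\<^sup>2 / ?L\<^sup>2) =
      \<phi>\<^sup>2 * ((norm a)\<^sup>2 * norm a') * (\<bar>t\<bar> / norm ?L) * (1 / (norm ?L' * norm ?L))"
    by (simp add: norm_mult norm_divide norm_power)
  also have "\<dots> \<le> \<phi>\<^sup>2 * (A\<^sup>2 * A) * (1 + A / a0) * (1 / (a0 * a0))"
  proof (intro mult_mono)
    have "\<bar>t\<bar> = norm (?L - a)" by (simp add: norm_mult)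
    also have "\<dots> \<le> norm ?L + A" using norm_triangle_ineq4[of ?L a] a0(3) by linarith
    finally have "\<bar>t\<bar> / norm ?L \<le> (norm ?L + A) / norm ?L" by (intro divide_right_mono) auto
    also have "\<dots> = 1 + A / norm ?L" using n a0 by (simp add: field_simps)
    also have "\<dots> \<le> 1 + A / a0" using n a0 A by (intro add_left_mono divide_left_mono mult_pos_pos) auto
    finally show "\<bar>t\<bar> / norm ?L \<le> 1 + A / a0" .
    show "1 / (norm ?L' * norm ?L) \<le> 1 / (a0 * a0)"
      using n n' a0 by (intro divide_left_mono mult_mono mult_pos_pos) auto
  qed (use a0 A in \<open>auto intro!: power_mono\<close>)
  also have "\<dots> = A ^ 3 * (1 + A / a0) / a0\<^sup>2 * \<phi>\<^sup>2"
    by (simp add: power2_eq_square power3_eq_cube)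
  finally show ?thesis .
qed

text \<open>1 - z is factored as (1 - E)(1 - w) with a positive real first factor. The principal
  logarithm then splits without branch correction, and only Ln (1 - w) with |w| \<le> 1/2 is
  expanded.\<close>

lemma Ln_second_order:
  fixes z :: complex and E Q :: real
  assumes E: "0 \<le> E" "E \<le> Q" "Q < 1" and small: "norm (z - of_real E) \<le> (1 - Q) / 2"
  shows "norm (- Ln (1 - z) - of_real (- ln (1 - E)) - (z - of_real E) / of_real (1 - E))
    \<le> 2 * (norm (z - of_real E))\<^sup>2 / (1 - Q)\<^sup>2"
proof -
  define w where "w = (z - of_real E) / of_real (1 - E)"
  have nw: "norm w = norm (z - of_real E) / (1 - E)"
    using E by (simp add: w_def norm_divide del: of_real_diff)
  have nw_le: "norm w \<le> norm (z - of_real E) / (1 - Q)" unfolding nw using E by (intro divide_left_mono mult_pos_pos) auto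
  also have "\<dots> \<le> 1 / 2" using small E by (simp add: field_simps)
  finally have half: "norm w \<le> 1 / 2" .
  have ne: "1 - w \<noteq> 0" using half by auto
  have c: "complex_of_real (1 - E) \<noteq> 0" using E by simp
  have "1 - z = of_real (1 - E) * (1 - w)" using c by (simp add: w_def field_simps)
  then have "Ln (1 - z) = Ln (of_real (1 - E) * (1 - w))" by simp
  also have "\<dots> = of_real (ln (1 - E)) + Ln (1 - w)"
    using E ne Ln_times_of_real[of "1 - E" "1 - w"] Ln_of_real[of "1 - E"] by (simp del: of_real_diff)
  finally have "- Ln (1 - z) - of_real (- ln (1 - E)) - w = - (Ln (1 + (- w)) - (- w))" by simp
  also have "norm \<dots> \<le> norm (- w) ^ 2 / (1 - norm (- w))"
    unfolding norm_minus_cancel[of "Ln (1 + (- w)) - (- w)"] using half by (intro Ln_approx_linear) simp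
  also have "\<dots> \<le> (norm w)\<^sup>2 / (1 / 2)" using half by (intro frac_le) auto
  also have "\<dots> \<le> 2 * (norm (z - of_real E) / (1 - Q))\<^sup>2"
    using power_mono[OF nw_le norm_ge_zero, of 2] by simp
  finally show ?thesis by (simp add: w_def power_divide)
qed

text \<open>The first bound on \<phi> keeps the denominator away from 0; the second limits the
  displacement of a to b / 8, so that real parts stay bounded below.\<close>

lemma mobius_bounds:
  fixes a :: complex
  assumes A: "norm a \<le> A / 2" "0 < A" and \<phi>: "\<bar>\<phi>\<bar> \<le> 1 / (2 * A)" "\<bar>\<phi>\<bar> \<le> b / (4 * A\<^sup>2)"
  defines "a' \<equiv> a / (1 + of_real \<phi> * a)"
  shows "norm a' \<le> A" "norm (a - a') \<le> b / 8" "a - a' = of_real \<phi> * a * a'" "1 + of_real \<phi> * a \<noteq> 0"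
    "1 / 2 \<le> norm (1 + of_real \<phi> * a)"
proof -
  have "norm (of_real \<phi> * a) \<le> 1 / (2 * A) * (A / 2)"
    unfolding norm_mult using A \<phi> by (intro mult_mono) auto
  also have "\<dots> \<le> 1 / 2" using A by simp
  finally have half: "norm (of_real \<phi> * a) \<le> 1 / 2" .
  have "norm (1::complex) - norm (of_real \<phi> * a) \<le> norm (1 + of_real \<phi> * a)"
    using norm_diff_ineq[of 1 "of_real \<phi> * a"] by simp
  then show den: "1 / 2 \<le> norm (1 + of_real \<phi> * a)" using half by simp
  then show ne: "1 + of_real \<phi> * a \<noteq> 0" by auto
  have "norm a' \<le> (A / 2) / (1 / 2)"
    unfolding a'_def norm_divide using A den by (intro frac_le) auto
  then show a': "norm a' \<le> A" by simp
  show eq: "a - a' = of_real \<phi> * a * a'"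
    unfolding a'_def using ne by (simp add: field_simps)
  have "0 \<le> b / (4 * A\<^sup>2)" using \<phi>(2) abs_ge_zero order_trans by blast
  then have "0 \<le> b" using A by (simp add: zero_le_divide_iff)
  then have "norm (a - a') \<le> b / (4 * A\<^sup>2) * (A / 2) * A"
    unfolding eq norm_mult using A \<phi> a' by (intro mult_mono) (auto intro: order_trans[OF abs_ge_zero])
  also have "\<dots> = b / 8" using A by (simp add: power2_eq_square)
  finally show "norm (a - a') \<le> b / 8" .
qed

text \<open>Named so that the pair \<eta>, K can be fixed once for an interval of \<beta> and then
  used for every n. \<open>e\<close> is the uniform distance on the line from the Gaussian transform
  with cubic correction.\<close>

definition transform_perturbation_bound :: "real \<Rightarrow> real \<Rightarrow> real \<Rightarrow> real \<Rightarrow> bool" where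
  "transform_perturbation_bound b1 b2 \<eta> K \<longleftrightarrow> (\<forall>\<beta> \<phi> e z a.
      \<beta> \<in> {b1..b2} \<longrightarrow> \<bar>\<phi>\<bar> \<le> \<eta> \<longrightarrow> 0 \<le> e \<longrightarrow> e \<le> \<eta> \<longrightarrow> z \<in> borel_measurable borel \<longrightarrow>
      (\<forall>t. norm (z t - of_real (gauss_tilt (\<beta> / (1 + \<beta> * \<phi>)) t) * (1 - \<i> * of_real (\<phi> * t ^ 3))) \<le> e) \<longrightarrow>
      norm (a - of_real \<beta>) \<le> b1 / 2 \<longrightarrow>
      norm ((\<integral>t. - Ln (1 - z t) * resolvent_diff a (of_real \<beta>) t \<partial>lborel)
        - (\<integral>t. of_real (gauss_log (\<beta> / (1 + \<beta> * \<phi>)) t) *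
            resolvent_diff (a / (1 + of_real \<phi> * a)) (of_real (\<beta> / (1 + \<beta> * \<phi>))) t \<partial>lborel))
      \<le> K * (e + \<phi>\<^sup>2))"

text \<open>What integration by parts leaves over from the cubic term does not depend on the
  parameter and cancels between a and \<beta>. Two errors remain: the logarithm beyond first order,
  of size e + \<phi>^2, and the resolvent shift beyond first order, of size \<phi>^2.\<close>

lemma transform_perturbation:
  fixes b1 b2 :: real
  assumes b: "0 < b1" "b1 \<le> b2"
  obtains K \<eta> where "0 < \<eta>" "0 \<le> K"
    and "transform_perturbation_bound b1 b2 \<eta> K"
proof -
  \<comment> \<open>\<open>A\<close> is at least twice |a| and \<beta>, so that it also bounds the
    shifted parameters. \<open>a0\<close> and \<open>B0\<close> lie below the real parts, which
    start from at least b1 / 2 and b1 and move by at most b1 / 8.\<close>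
  define A where "A = 2 * (b2 + b1)"
  define a0 where "a0 = b1 / 4"
  define B0 where "B0 = b1 / 2"
  define Q where "Q = exp (- B0\<^sup>2 / 2)"
  \<comment> \<open>The first two entries are the thresholds of \<open>mobius_bounds\<close>; (1 -
    Q) / 20 gives e + 9 |\<phi>| \<le> (1 - Q) / 2, and 1 gives e^2 \<le> e.\<close>
  define \<eta> where "\<eta> = min (min (1 / (2 * A)) (b1 / (4 * A\<^sup>2))) (min ((1 - Q) / 20) 1)"
  have A: "0 < A" using b by (simp add: A_def)
  have a0: "0 < a0" using b by (simp add: a0_def)
  have B0: "0 < B0" using b by (simp add: B0_def)
  have Q: "0 < Q" "Q < 1" using B0 by (auto simp: Q_def)
  have \<eta>: "0 < \<eta>" "\<eta> \<le> 1 / (2 * A)" "\<eta> \<le> b1 / (4 * A\<^sup>2)" "\<eta> \<le> (1 - Q) / 20" "\<eta> \<le> 1"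
  proof -
    show "0 < \<eta>" using A b Q by (auto simp: \<eta>_def)
    show "\<eta> \<le> 1 / (2 * A)" "\<eta> \<le> b1 / (4 * A\<^sup>2)" "\<eta> \<le> (1 - Q) / 20" "\<eta> \<le> 1"
      unfolding \<eta>_def by (meson min.cobounded1 min.cobounded2 order_trans)+
  qed
  \<comment> \<open>324 is twice 162: the factor 2 comes from \<open>Ln_second_order\<close>, and
    162 from (e + 9 |\<phi>|)^2 \<le> 2 e^2 + 162 \<phi>^2.\<close>
  define K1 where "K1 = 324 / (1 - Q)\<^sup>2 + 1 / (1 - Q)"
  define K2 where "K2 = (2 + (1 + 2 * A\<^sup>2) / a0\<^sup>2) * (b1 / 2)"
  define K3 where "K3 = A ^ 3 * (1 + A / a0) / a0\<^sup>2"
  define K where "K = K1 * (K2 * pi) + 2 * K3 * (sqrt (2 * pi) / (1 - Q))"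
  have Ks: "0 \<le> K1" "0 \<le> K2" "0 \<le> K3" using Q A a0 b by (auto simp: K1_def K2_def K3_def)
  have K: "0 \<le> K" using Ks Q by (simp add: K_def)
  show thesis
  proof (rule that[OF \<eta>(1) K], unfold transform_perturbation_bound_def, intro allI impI)
    fix \<beta> \<phi> e :: real and z :: "real \<Rightarrow> complex" and a :: complex
    assume \<beta>: "\<beta> \<in> {b1..b2}" and \<phi>: "\<bar>\<phi>\<bar> \<le> \<eta>" and e: "0 \<le> e" "e \<le> \<eta>"
      and z [measurable]: "z \<in> borel_measurable borel"
      and z_near: "\<forall>t. norm (z t - of_real (gauss_tilt (\<beta> / (1 + \<beta> * \<phi>)) t) * (1 - \<i> * of_real (\<phi> * t ^ 3))) \<le> e"
      and a: "norm (a - of_real \<beta>) \<le> b1 / 2"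
    define B where "B = \<beta> / (1 + \<beta> * \<phi>)"
    define a' where "a' = a / (1 + of_real \<phi> * a)"
    define b where "b = complex_of_real \<beta>"
    define b' where "b' = complex_of_real B"
    let ?\<phi> = "complex_of_real \<phi>"
    have na: "norm a \<le> A / 2"
      using norm_triangle_ineq[of "a - of_real \<beta>" "of_real \<beta>"] a \<beta> assms by (simp add: A_def)
    have nb: "norm b \<le> A / 2" using \<beta> assms by (simp add: A_def b_def)
    have \<phi>': "\<bar>\<phi>\<bar> \<le> 1 / (2 * A)" "\<bar>\<phi>\<bar> \<le> b1 / (4 * A\<^sup>2)" using \<phi> \<eta> by auto
    note ma = mobius_bounds[OF na A \<phi>', folded a'_def]
    have b'_eq: "b' = b / (1 + ?\<phi> * b)" by (simp add: b'_def b_def B_def mult.commute)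
    note mb = mobius_bounds[OF nb A \<phi>', folded b'_eq]
    have Re_a: "b1 / 2 \<le> Re a"
    proof -
      have "\<bar>Re (a - of_real \<beta>)\<bar> \<le> b1 / 2" using abs_Re_le_cmod a order_trans by blast
      then show ?thesis using \<beta> by (auto simp: abs_if split: if_splits)
    qed
    have Re_a': "a0 \<le> Re a'"
    proof -
      have "\<bar>Re (a - a')\<bar> \<le> b1 / 8" using abs_Re_le_cmod ma(2) order_trans by blast
      then show ?thesis using Re_a assms by (auto simp: abs_if a0_def split: if_splits)
    qed
    have B: "B0 \<le> B"
    proof -
      have "\<bar>Re (b - b')\<bar> \<le> b1 / 8" using abs_Re_le_cmod mb(2) order_trans by blast
      then show ?thesis using \<beta> assms by (auto simp: abs_if B0_def b_def b'_def split: if_splits)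
    qed
    have Re: "a0 \<le> Re a" "a0 \<le> Re a'" "a0 \<le> Re b" "a0 \<le> Re b'"
      using Re_a Re_a' B \<beta> assms by (auto simp: a0_def b_def b'_def B0_def)
    have nA: "norm a \<le> A" "norm a' \<le> A" "norm b \<le> A" "norm b' \<le> A"
      using na nb ma(1) mb(1) A by auto
    \<comment> \<open>\<open>S\<close> is the remainder of the resolvent shift, \<open>I\<close> the
      cubic term against one resolvent, \<open>J\<close> the integrand that \<open>I\<close> becomes
      by parts up to sign, \<open>D\<close> the remainder of the logarithm, and \<open>G\<close> the
      error caused by \<open>S\<close>.\<close>
    define W where "W = (\<lambda>t. gauss_tilt B t / (1 - gauss_tilt B t))"
    define S where "S = (\<lambda>c c' t. 1 / (c' + \<i> * of_real t) - 1 / (c + \<i> * of_real t) - ?\<phi> * c\<^sup>2 / (c + \<i> * of_real t)\<^sup>2)"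
    define I where "I = (\<lambda>c t. of_real (W t) * (- \<i> * of_real (t ^ 3) / (c + \<i> * of_real t)))"
    define J where "J = (\<lambda>c t. of_real (gauss_log B t) * (1 - c\<^sup>2 / (c + \<i> * of_real t)\<^sup>2))"
    define D where "D = (\<lambda>t. - Ln (1 - z t) - of_real (gauss_log B t) - of_real (W t) * (- \<i> * of_real (\<phi> * t ^ 3)))"
    define G where "G = (\<lambda>t. of_real (gauss_log B t) * (S a a' t - S b b' t))"
    have B_pos: "0 < B" using B B0 by simp
    have D_bound: "norm (D t) \<le> K1 * (e + \<phi>\<^sup>2)" for t
    proof -
      let ?E = "gauss_tilt B t"
      note E = gauss_tilt_bounds[OF B0 B, of t, folded Q_def]
      let ?c = "complex_of_real ?E * (1 - \<i> * of_real (\<phi> * t ^ 3))"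
      have z_c: "norm (z t - ?c) \<le> e" using spec[OF z_near, of t] by (simp add: B_def)
      have "norm (z t - of_real ?E) \<le> norm (z t - ?c) + norm (of_real ?E * (\<i> * of_real (\<phi> * t ^ 3)))"
        using norm_triangle_ineq4[of "z t - ?c" "of_real ?E * (\<i> * of_real (\<phi> * t ^ 3))"]
        by (simp add: algebra_simps)
      also have "norm (complex_of_real ?E * (\<i> * of_real (\<phi> * t ^ 3))) = \<bar>\<phi>\<bar> * (\<bar>t\<bar> ^ 3 * ?E)"
        using E by (simp add: norm_mult norm_power)
      also have "\<dots> \<le> \<bar>\<phi>\<bar> * (\<bar>t\<bar> ^ 3 * exp (- t\<^sup>2 / 2))"
        using E by (intro mult_left_mono) auto
      also have "\<dots> \<le> \<bar>\<phi>\<bar> * 9" by (intro mult_left_mono gauss_power_le) auto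
      finally have z_E: "norm (z t - of_real ?E) \<le> e + 9 * \<bar>\<phi>\<bar>" using z_c by simp
      have "e + 9 * \<bar>\<phi>\<bar> \<le> (1 - Q) / 2" using e \<phi> \<eta>(4) by linarith
      then have small: "norm (z t - of_real ?E) \<le> (1 - Q) / 2" using z_E by linarith
      have "norm (z t - of_real ?E) ^ 2 \<le> (e + 9 * \<bar>\<phi>\<bar>)\<^sup>2" using z_E by (intro power_mono) auto
      also have "\<dots> \<le> 2 * e\<^sup>2 + 162 * \<phi>\<^sup>2"
        using sum_squares_bound[of e "9 * \<bar>\<phi>\<bar>"] by (simp add: power2_sum power_mult_distrib)
      also have "\<dots> \<le> 162 * (e + \<phi>\<^sup>2)"
      proof -
        have "e\<^sup>2 \<le> e" using e \<eta>(5) by (simp add: power2_eq_square mult_left_le)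
        then show ?thesis using e by simp
      qed
      finally have sq: "(norm (z t - of_real ?E))\<^sup>2 \<le> 162 * (e + \<phi>\<^sup>2)" .
      have "norm (- Ln (1 - z t) - of_real (gauss_log B t) - (z t - of_real ?E) / of_real (1 - ?E))
          \<le> 2 * (norm (z t - of_real ?E))\<^sup>2 / (1 - Q)\<^sup>2"
        using Ln_second_order[OF less_imp_le[OF E(1)] E(2) Q(2) small] by (simp add: gauss_log_def)
      also have "\<dots> \<le> 2 * (162 * (e + \<phi>\<^sup>2)) / (1 - Q)\<^sup>2"
        using sq by (intro divide_right_mono mult_left_mono) auto
      finally have first: "norm (- Ln (1 - z t) - of_real (gauss_log B t) - (z t - of_real ?E) / of_real (1 - ?E))
          \<le> 324 / (1 - Q)\<^sup>2 * (e + \<phi>\<^sup>2)" by simp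
      have Wm: "of_real (W t) * m = (of_real ?E * m) / of_real (1 - ?E)" for m :: complex
        by (simp add: W_def del: of_real_diff)
      have "(z t - of_real ?E) / of_real (1 - ?E) - of_real (W t) * (- \<i> * of_real (\<phi> * t ^ 3)) = (z t - ?c) / of_real (1 - ?E)"
        unfolding Wm diff_divide_distrib[symmetric] by (simp add: algebra_simps)
      then have "norm ((z t - of_real ?E) / of_real (1 - ?E) - of_real (W t) * (- \<i> * of_real (\<phi> * t ^ 3))) = norm (z t - ?c) / (1 - ?E)"
        using E(3) by (simp add: norm_divide del: of_real_diff)
      also have "\<dots> \<le> e / (1 - Q)" using z_c E Q e by (intro frac_le) auto
      also have "\<dots> \<le> (e + \<phi>\<^sup>2) / (1 - Q)" using Q by (intro divide_right_mono) auto
      also have "\<dots> = 1 / (1 - Q) * (e + \<phi>\<^sup>2)" by simp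
      finally have second: "norm ((z t - of_real ?E) / of_real (1 - ?E) - of_real (W t) * (- \<i> * of_real (\<phi> * t ^ 3))) \<le> 1 / (1 - Q) * (e + \<phi>\<^sup>2)" .
      have "D t = (- Ln (1 - z t) - of_real (gauss_log B t) - (z t - of_real ?E) / of_real (1 - ?E)) +
          ((z t - of_real ?E) / of_real (1 - ?E) - of_real (W t) * (- \<i> * of_real (\<phi> * t ^ 3)))"
        by (simp add: D_def)
      then have "norm (D t) \<le> norm (- Ln (1 - z t) - of_real (gauss_log B t) - (z t - of_real ?E) / of_real (1 - ?E)) +
          norm ((z t - of_real ?E) / of_real (1 - ?E) - of_real (W t) * (- \<i> * of_real (\<phi> * t ^ 3)))"
        by (simp only: norm_triangle_ineq)
      then show ?thesis using first second unfolding K1_def distrib_right by linarith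
    qed
    have D_meas [measurable]: "D \<in> borel_measurable borel" unfolding D_def W_def by measurable
    have kappa: "norm (resolvent_diff a b t) \<le> K2 / (1 + t\<^sup>2)" for t
    proof -
      have "norm (resolvent_diff a b t) \<le> (2 + (1 + 2 * A\<^sup>2) / a0\<^sup>2) * norm (b - a) / (1 + t\<^sup>2)"
        by (rule norm_resolvent_diff_le[OF a0 Re(1) nA(1) Re(3) nA(3)])
      also have "\<dots> \<le> K2 / (1 + t\<^sup>2)"
        unfolding K2_def using a by (intro divide_right_mono mult_left_mono) (auto simp: b_def norm_minus_commute)
      finally show ?thesis .
    qed
    have Dk_bound: "norm (D t * resolvent_diff a b t) \<le> K1 * (e + \<phi>\<^sup>2) * K2 / (1 + t\<^sup>2)" for t
    proof -
      have "norm (D t * resolvent_diff a b t) \<le> (K1 * (e + \<phi>\<^sup>2)) * (K2 / (1 + t\<^sup>2))"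
        unfolding norm_mult using D_bound kappa Ks e by (intro mult_mono) auto
      then show ?thesis by simp
    qed
    have iD: "integrable lborel (\<lambda>t. D t * resolvent_diff a b t)"
    proof (rule Bochner_Integration.integrable_bound)
      show "integrable lborel (\<lambda>t::real. K1 * (e + \<phi>\<^sup>2) * K2 / (1 + t\<^sup>2))" by (rule integrable_inverse_one_plus_square)
      show "AE t in lborel. norm (D t * resolvent_diff a b t) \<le> norm (K1 * (e + \<phi>\<^sup>2) * K2 / (1 + t\<^sup>2))"
        unfolding real_norm_def by (intro AE_I2 order_trans[OF Dk_bound abs_ge_self])
    qed measurable
    have iD_le: "norm (\<integral>t. D t * resolvent_diff a b t \<partial>lborel) \<le> K1 * (e + \<phi>\<^sup>2) * K2 * pi"
    proof -
      have "norm (\<integral>t. D t * resolvent_diff a b t \<partial>lborel) \<le> (\<integral>t. K1 * (e + \<phi>\<^sup>2) * K2 / (1 + t\<^sup>2) \<partial>lborel)"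
        by (rule norm_integral_le[OF iD integrable_inverse_one_plus_square Dk_bound])
      then show ?thesis by (simp add: integral_inverse_one_plus_square)
    qed
    have S_bound: "norm (S a a' t - S b b' t) \<le> 2 * K3 * \<phi>\<^sup>2" for t
    proof -
      have "norm (S a a' t) \<le> K3 * \<phi>\<^sup>2" "norm (S b b' t) \<le> K3 * \<phi>\<^sup>2"
        unfolding S_def K3_def
        using resolvent_shift[OF a0 Re(1) nA(1) Re(2) nA(2) ma(3)] resolvent_shift[OF a0 Re(3) nA(3) Re(4) nA(4) mb(3)]
        by auto
      then show ?thesis using norm_triangle_ineq4[of "S a a' t" "S b b' t"] by linarith
    qed
    have S_meas [measurable]: "S c c' \<in> borel_measurable borel" for c c' unfolding S_def by measurable
    have iG: "integrable lborel G"
      unfolding G_def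
      by (rule integrable_gauss_line(1)[OF B0 B zero_less_one, where C = "2 * K3 * \<phi>\<^sup>2" and k = 0]) (use S_bound in auto)
    have iG_le: "norm (\<integral>t. G t \<partial>lborel) \<le> 2 * K3 * \<phi>\<^sup>2 * (sqrt (2 * pi) / (1 - Q))"
    proof -
      have ig: "integrable lborel (\<lambda>t::real. (2 * K3 * \<phi>\<^sup>2 / (1 - Q)) * exp (- t\<^sup>2 / 2))"
        using integrable_gauss_abs_power[of 0] by simp
      have "norm (\<integral>t. G t \<partial>lborel) \<le> (\<integral>t. (2 * K3 * \<phi>\<^sup>2 / (1 - Q)) * exp (- t\<^sup>2 / 2) \<partial>lborel)"
      proof (rule norm_integral_le[OF iG ig])
        fix t
        have "norm (G t) \<le> (exp (- t\<^sup>2 / 2) / (1 - Q)) * (2 * K3 * \<phi>\<^sup>2)"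
          unfolding G_def norm_mult using gauss_log_bounds(1,2)[OF B0 B, of t] Q
          by (intro mult_mono S_bound) (auto simp: Q_def)
        then show "norm (G t) \<le> (2 * K3 * \<phi>\<^sup>2 / (1 - Q)) * exp (- t\<^sup>2 / 2)" by (simp add: mult_ac)
      qed
      also have "\<dots> = 2 * K3 * \<phi>\<^sup>2 * (sqrt (2 * pi) / (1 - Q))"
        unfolding integral_mult_right_zero integral_gauss by simp
      finally show ?thesis .
    qed
    have Rpos: "0 < Re a" "0 < Re b" using Re a0 by auto
    have cc: "(\<integral>t. I c t \<partial>lborel) = - (\<integral>t. J c t \<partial>lborel)" "integrable lborel (I c)" "integrable lborel (J c)"
      if "0 < Re c" for c
      unfolding I_def J_def W_def by (rule cubic_correction[OF B_pos that])+
    note ca = cc[OF Rpos(1)] and cb = cc[OF Rpos(2)]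
    have rmeas [measurable]: "resolvent_diff a' b' \<in> borel_measurable borel" by measurable
    have iL: "integrable lborel (\<lambda>t. of_real (gauss_log B t) * resolvent_diff a' b' t)"
    proof (rule integrable_gauss_line(1)[OF B0 B zero_less_one, where C = "2 / a0" and k = 0])
      fix t
      have "norm (1 / (a' + \<i> * of_real t)) \<le> 1 / a0" "norm (1 / (b' + \<i> * of_real t)) \<le> 1 / a0"
        using norm_line_ge[OF a0 Re(2), of t] norm_line_ge[OF a0 Re(4), of t] a0 by (auto simp: norm_divide frac_le)
      then show "norm (resolvent_diff a' b' t) \<le> 2 / a0 * \<bar>t\<bar> ^ 0"
        using norm_triangle_ineq4[of "1 / (a' + \<i> * of_real t)" "1 / (b' + \<i> * of_real t)"]
        by (simp add: resolvent_diff_def)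
    qed measurable
    have split: "- Ln (1 - z t) * resolvent_diff a b t =
        D t * resolvent_diff a b t + of_real (gauss_log B t) * resolvent_diff a' b' t - G t
        + ?\<phi> * ((I a t - I b t) + (J a t - J b t))" for t
    proof -
      have nn: "a + \<i> * of_real t \<noteq> 0" "b + \<i> * of_real t \<noteq> 0"
        using norm_line_ge[OF a0 Re(1), of t] norm_line_ge[OF a0 Re(3), of t] by auto
      have 1: "of_real (W t) * (- \<i> * of_real (\<phi> * t ^ 3)) * resolvent_diff a b t = ?\<phi> * (I a t - I b t)"
        by (simp add: I_def resolvent_diff_def algebra_simps)
      have 2: "of_real (gauss_log B t) * resolvent_diff a b t =
          of_real (gauss_log B t) * resolvent_diff a' b' t - G t + ?\<phi> * (J a t - J b t)"
        by (simp add: G_def S_def J_def resolvent_diff_def algebra_simps)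
      have "- Ln (1 - z t) * resolvent_diff a b t = D t * resolvent_diff a b t
          + of_real (gauss_log B t) * resolvent_diff a b t
          + of_real (W t) * (- \<i> * of_real (\<phi> * t ^ 3)) * resolvent_diff a b t"
        by (simp add: D_def algebra_simps)
      then show ?thesis unfolding 1 2 by (simp add: algebra_simps)
    qed
    have "(\<integral>t. - Ln (1 - z t) * resolvent_diff a b t \<partial>lborel) =
        (\<integral>t. D t * resolvent_diff a b t \<partial>lborel) + (\<integral>t. of_real (gauss_log B t) * resolvent_diff a' b' t \<partial>lborel)
        - (\<integral>t. G t \<partial>lborel) + ?\<phi> * (((\<integral>t. I a t \<partial>lborel) - (\<integral>t. I b t \<partial>lborel)) + ((\<integral>t. J a t \<partial>lborel) - (\<integral>t. J b t \<partial>lborel)))"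
      unfolding split
      using iD iL iG ca(2,3) cb(2,3) by simp
    \<comment> \<open>Here the cubic term disappears: \<open>I\<close> and \<open>J\<close> have
      opposite integrals at a and at b.\<close>
    also have "((\<integral>t. I a t \<partial>lborel) - (\<integral>t. I b t \<partial>lborel)) + ((\<integral>t. J a t \<partial>lborel) - (\<integral>t. J b t \<partial>lborel)) = 0"
      unfolding ca(1) cb(1) by simp
    finally have "(\<integral>t. - Ln (1 - z t) * resolvent_diff a b t \<partial>lborel) - (\<integral>t. of_real (gauss_log B t) * resolvent_diff a' b' t \<partial>lborel)
        = (\<integral>t. D t * resolvent_diff a b t \<partial>lborel) - (\<integral>t. G t \<partial>lborel)" by simp
    then have "norm ((\<integral>t. - Ln (1 - z t) * resolvent_diff a b t \<partial>lborel) - (\<integral>t. of_real (gauss_log B t) * resolvent_diff a' b' t \<partial>lborel))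
        \<le> norm (\<integral>t. D t * resolvent_diff a b t \<partial>lborel) + norm (\<integral>t. G t \<partial>lborel)"
      by (simp only: norm_triangle_ineq4)
    also have "\<dots> \<le> K1 * (e + \<phi>\<^sup>2) * K2 * pi + 2 * K3 * (e + \<phi>\<^sup>2) * (sqrt (2 * pi) / (1 - Q))"
    proof -
      have "2 * K3 * \<phi>\<^sup>2 * (sqrt (2 * pi) / (1 - Q)) \<le> 2 * K3 * (e + \<phi>\<^sup>2) * (sqrt (2 * pi) / (1 - Q))"
        using Ks e Q by (intro mult_right_mono mult_left_mono) auto
      then show ?thesis using iD_le iG_le by linarith
    qed
    also have "\<dots> = K * (e + \<phi>\<^sup>2)" unfolding K_def by (subst distrib_right) (simp only: mult_ac)
    finally show "norm ((\<integral>t. - Ln (1 - z t) * resolvent_diff a (of_real \<beta>) t \<partial>lborel)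
        - (\<integral>t. of_real (gauss_log (\<beta> / (1 + \<beta> * \<phi>)) t) *
            resolvent_diff (a / (1 + of_real \<phi> * a)) (of_real (\<beta> / (1 + \<beta> * \<phi>))) t \<partial>lborel)) \<le> K * (e + \<phi>\<^sup>2)"
      unfolding B_def b_def b'_def a'_def .
  qed
qed

section \<open>Expansion of the tilted step transform\<close>

text \<open>The factor r^n is kept instead of being estimated by 1: for r Gaussian in the frequency
  it supplies the decay that absorbs powers of that frequency.\<close>

lemma norm_power_diff_le:
  fixes a b :: "'a::{real_normed_field}"
  assumes "norm a \<le> r" "norm b \<le> r"
  shows "norm (a ^ Suc n - b ^ Suc n) \<le> real (Suc n) * norm (a - b) * r ^ n"
proof (induction n)
  case (Suc n)
  have r: "0 \<le> r" using assms(1) norm_ge_zero order_trans by blast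
  have "a ^ Suc (Suc n) - b ^ Suc (Suc n) = a * (a ^ Suc n - b ^ Suc n) + (a - b) * b ^ Suc n"
    by (simp add: algebra_simps)
  then have "norm (a ^ Suc (Suc n) - b ^ Suc (Suc n)) \<le> norm a * norm (a ^ Suc n - b ^ Suc n) + norm (a - b) * norm b ^ Suc n"
    by (metis norm_triangle_ineq norm_mult norm_power)
  also have "\<dots> \<le> r * (real (Suc n) * norm (a - b) * r ^ n) + norm (a - b) * r ^ Suc n"
    using assms Suc.IH r by (intro add_mono mult_mono power_mono) auto
  also have "\<dots> = real (Suc (Suc n)) * norm (a - b) * r ^ Suc n" by (simp add: algebra_simps)
  finally show ?case .
qed simp

text \<open>One queue at one traffic intensity, with \<theta> the negative of the saddle point.
  Separation is stated at this \<theta>, while \<delta> and \<epsilon> are parameters that can be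
  shared by all n.\<close>

locale tilted_walk = queue_input M V U \<delta>\<^sub>0
  for M :: "'a measure" and V U :: "'a \<Rightarrow> real" and \<delta>\<^sub>0 :: real +
  fixes \<rho> \<theta> \<delta> \<epsilon> :: real
  assumes \<rho>: "\<rho> \<in> {1/2..<1}" and \<theta>: "0 < \<theta>" "\<theta> \<le> \<delta>\<^sub>1" and saddle: "mom \<rho> 1 \<theta> = 0"
    and \<delta>: "0 < \<delta>" and \<epsilon>: "0 < \<epsilon>"
    and separated: "\<And>y. \<bar>y\<bar> > \<delta> \<Longrightarrow> cmod (psi M V U \<rho> (Complex \<theta> y)) < mom \<rho> 0 \<theta> - \<epsilon>"
begin

lemma \<rho>': "\<rho> \<in> {1/2..1}" using \<rho> by auto

lemma \<theta>_bounds: "\<bar>\<theta>\<bar> \<le> r\<^sub>0 / 2" "\<bar>\<theta>\<bar> < r\<^sub>0" using \<theta> delta1_bounds by auto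

definition m :: real where "m = mom \<rho> 0 \<theta>"

text \<open>The lower bound is exp x \<ge> 1 + x with \<theta> \<le> 1/2 and 1 / \<rho> \<le> 2. For
  the upper one, the saddle point equation allows \<theta> X exp (\<theta> X) to be subtracted under
  the expectation, and exp y (1 - y) \<le> 1.\<close>

lemma m_bounds: "1 / 2 \<le> m" "m \<le> 1"
proof -
  note int0 = abs_mom(1)[OF \<rho>' \<theta>_bounds(1), of 0] and int1 = abs_mom(1)[OF \<rho>' \<theta>_bounds(1), of 1]
  have i10: "integrable M (net \<rho>)" using abs_mom(1)[OF \<rho>', of 0 1] r0_pos by simp
  have "(\<integral>\<omega>. 1 + \<theta> * net \<rho> \<omega> \<partial>M) \<le> m"
    unfolding m_def mom_def
    by (rule integral_mono) (use i10 int0 in \<open>auto intro: exp_ge_add_one_self\<close>)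
  also have "(\<integral>\<omega>. 1 + \<theta> * net \<rho> \<omega> \<partial>M) = 1 + \<theta> * mom \<rho> 1 0"
    using i10 by (simp add: mom_def prob_space)
  finally have "1 + \<theta> * (1 - 1 / \<rho>) \<le> m" by (simp add: mom_1_0[unfolded One_nat_def])
  moreover have "- 1 \<le> 1 - 1 / \<rho>" using \<rho> by (simp add: field_simps)
  then have "\<theta> * - 1 \<le> \<theta> * (1 - 1 / \<rho>)" using \<theta> by (intro mult_left_mono) auto
  ultimately show "1 / 2 \<le> m" using \<theta> delta1_bounds(4) by simp
  have "m = m - \<theta> * mom \<rho> 1 \<theta>" by (simp add: saddle[unfolded One_nat_def])
  also have "\<dots> = (\<integral>\<omega>. exp (\<theta> * net \<rho> \<omega>) - \<theta> * (net \<rho> \<omega> ^ 1 * exp (\<theta> * net \<rho> \<omega>)) \<partial>M)"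
    using int0 int1 by (simp add: m_def mom_def)
  also have "\<dots> \<le> (\<integral>\<omega>. 1 \<partial>M)"
  proof (rule integral_mono)
    fix \<omega>
    let ?y = "\<theta> * net \<rho> \<omega>"
    have "exp ?y * (1 + - ?y) \<le> exp ?y * exp (- ?y)"
      by (intro mult_left_mono exp_ge_add_one_self) auto
    also have "\<dots> = 1" by (simp flip: exp_add)
    finally show "exp ?y - \<theta> * (net \<rho> \<omega> ^ 1 * exp ?y) \<le> 1" by (simp add: algebra_simps)
  qed (use int0 int1 in auto)
  finally show "m \<le> 1" by (simp add: prob_space)
qed

lemma m_pos: "0 < m" using m_bounds by simp

text \<open>Moments of the law tilted by exp (\<theta> X) / m. The saddle point equation centres
  that law, so \<open>s2\<close> and \<open>mu3\<close> are its variance and third cumulant, the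
  values of h'' and - h''' at the saddle point.\<close>

definition s2 :: real where "s2 = mom \<rho> 2 \<theta> / m"
definition mu3 :: real where "mu3 = mom \<rho> 3 \<theta> / m"

lemma abs_divide_m_le: "\<bar>x / m\<bar> \<le> 2 * \<bar>x\<bar>"
proof -
  have "\<bar>x / m\<bar> \<le> \<bar>x\<bar> / (1 / 2)"
    unfolding abs_divide using m_bounds by (intro frac_le) auto
  then show ?thesis by simp
qed

lemma s2_bounds: "\<sigma>\<^sub>0 / 2 \<le> s2" "s2 \<le> 2 * mom_bound 2" "0 < s2" and mu3_bound: "\<bar>mu3\<bar> \<le> 2 * mom_bound 3"
proof -
  have l: "\<sigma>\<^sub>0 / 2 \<le> mom \<rho> 2 \<theta>" using mom_2_lower[OF \<rho>', of \<theta>] \<theta> by simp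
  also have "mom \<rho> 2 \<theta> / 1 \<le> mom \<rho> 2 \<theta> / m"
    using m_bounds m_pos l sigma0_pos by (intro divide_left_mono) auto
  finally show l2: "\<sigma>\<^sub>0 / 2 \<le> s2" by (simp add: s2_def)
  then show "0 < s2" using sigma0_pos by simp
  show "s2 \<le> 2 * mom_bound 2"
    using abs_divide_m_le[of "mom \<rho> 2 \<theta>"] abs_mom(4)[OF \<rho>' \<theta>_bounds(1), of 2]
      abs_ge_self[of "mom \<rho> 2 \<theta> / m"] unfolding s2_def by linarith
  show "\<bar>mu3\<bar> \<le> 2 * mom_bound 3"
    using abs_divide_m_le[of "mom \<rho> 3 \<theta>"] abs_mom(4)[OF \<rho>' \<theta>_bounds(1), of 3] by (simp add: mu3_def)
qed

section \<open>Characteristic function of the tilted step\<close>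

definition cf :: "real \<Rightarrow> complex" where "cf y = psi M V U \<rho> (Complex \<theta> y) / of_real m"

lemma psi_tilt:
  "psi M V U \<rho> (Complex \<theta> y) = (\<integral>\<omega>. of_real (exp (\<theta> * net \<rho> \<omega>)) * iexp (y * net \<rho> \<omega>) \<partial>M)"
  unfolding psi_net
  by (intro Bochner_Integration.integral_cong refl)
    (simp add: complex_eq_iff Re_exp Im_exp)

lemma int_weight: "integrable M (\<lambda>\<omega>. exp (\<theta> * net \<rho> \<omega>))"
  using abs_mom(1)[OF \<rho>' \<theta>_bounds(1), of 0] by simp

lemma int_weighted:
  fixes f :: "'a \<Rightarrow> 'b::{real_normed_field, banach, second_countable_topology}"
  assumes [measurable]: "f \<in> borel_measurable M" and f: "\<And>\<omega>. norm (f \<omega>) \<le> C"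
  shows "integrable M (\<lambda>\<omega>. of_real (exp (\<theta> * net \<rho> \<omega>)) * f \<omega>)"
proof (rule Bochner_Integration.integrable_bound[OF integrable_mult_left[OF int_weight, of C]])
  show "AE \<omega> in M. norm (of_real (exp (\<theta> * net \<rho> \<omega>)) * f \<omega>) \<le> norm (exp (\<theta> * net \<rho> \<omega>) * C)"
  proof (rule AE_I2)
    fix \<omega>
    have "exp (\<theta> * net \<rho> \<omega>) * norm (f \<omega>) \<le> exp (\<theta> * net \<rho> \<omega>) * C"
      by (intro mult_left_mono f) auto
    also have "\<dots> \<le> \<bar>exp (\<theta> * net \<rho> \<omega>) * C\<bar>" by (rule abs_ge_self)
    finally show "norm (of_real (exp (\<theta> * net \<rho> \<omega>)) * f \<omega>) \<le> norm (exp (\<theta> * net \<rho> \<omega>) * C)"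
      by (simp add: norm_mult)
  qed
qed measurable

text \<open>The linear term is absent by the saddle point equation. The Taylor factor 1/24 is
  doubled by m \<ge> 1/2.\<close>

lemma cf_taylor:
  "norm (cf y - (1 - of_real (s2 * y\<^sup>2 / 2) - \<i> * of_real (mu3 * y ^ 3 / 6))) \<le> mom_bound 4 / 12 * y ^ 4"
proof -
  let ?X = "net \<rho>"
  let ?w = "\<lambda>\<omega>. exp (\<theta> * ?X \<omega>)"
  have i: "integrable M (\<lambda>\<omega>. ?X \<omega> ^ j * ?w \<omega>)" for j by (rule abs_mom(1)[OF \<rho>' \<theta>_bounds(1)])
  let ?p = "\<lambda>x::real. \<Sum>k\<le>3. (\<i> * of_real x) ^ k / fact k"
  have p: "?p x = 1 + \<i> * of_real x - of_real (x\<^sup>2 / 2) - \<i> * of_real (x ^ 3 / 6)" for x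
    by (simp add: numeral_3_eq_3 power2_eq_square field_simps)
  have icf: "integrable M (\<lambda>\<omega>. of_real (?w \<omega>) * iexp (y * ?X \<omega>))"
    by (rule int_weighted[where C = 1]) auto
  have e: "of_real (?w \<omega>) * ?p (y * ?X \<omega>) =
      of_real (?X \<omega> ^ 0 * ?w \<omega>) + \<i> * of_real y * of_real (?X \<omega> ^ 1 * ?w \<omega>)
      - of_real (y\<^sup>2 / 2) * of_real (?X \<omega> ^ 2 * ?w \<omega>) - \<i> * of_real (y ^ 3 / 6) * of_real (?X \<omega> ^ 3 * ?w \<omega>)" for \<omega>
    unfolding p by (simp add: algebra_simps power_mult_distrib)
  have ip: "integrable M (\<lambda>\<omega>. of_real (?w \<omega>) * ?p (y * ?X \<omega>))"
    unfolding e using i by (intro Bochner_Integration.integrable_add Bochner_Integration.integrable_diff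
        integrable_mult_right integrable_of_real)
  have "(\<integral>\<omega>. of_real (?w \<omega>) * ?p (y * ?X \<omega>) \<partial>M) =
      of_real (mom \<rho> 0 \<theta>) + \<i> * of_real y * of_real (mom \<rho> 1 \<theta>)
      - of_real (y\<^sup>2 / 2) * of_real (mom \<rho> 2 \<theta>) - \<i> * of_real (y ^ 3 / 6) * of_real (mom \<rho> 3 \<theta>)"
    unfolding e mom_def
    using i[of 0] i[of 1] i[of 2] i[of 3]
    by (simp only: Bochner_Integration.integral_add Bochner_Integration.integral_diff integral_mult_right_zero
        integral_complex_of_real integrable_mult_right integrable_of_real Bochner_Integration.integrable_add Bochner_Integration.integrable_diff)
  also have "\<dots> = of_real m * (1 - of_real (s2 * y\<^sup>2 / 2) - \<i> * of_real (mu3 * y ^ 3 / 6))"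
    unfolding saddle using m_pos by (simp add: s2_def mu3_def m_def[symmetric] algebra_simps)
  finally have P: "(\<integral>\<omega>. of_real (?w \<omega>) * ?p (y * ?X \<omega>) \<partial>M) = of_real m * (1 - of_real (s2 * y\<^sup>2 / 2) - \<i> * of_real (mu3 * y ^ 3 / 6))" .
  have diff: "psi M V U \<rho> (Complex \<theta> y) - (\<integral>\<omega>. of_real (?w \<omega>) * ?p (y * ?X \<omega>) \<partial>M) =
      (\<integral>\<omega>. of_real (?w \<omega>) * iexp (y * ?X \<omega>) - of_real (?w \<omega>) * ?p (y * ?X \<omega>) \<partial>M)"
    unfolding psi_tilt using icf ip by simp
  have "norm (psi M V U \<rho> (Complex \<theta> y) - (\<integral>\<omega>. of_real (?w \<omega>) * ?p (y * ?X \<omega>) \<partial>M))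
      \<le> (\<integral>\<omega>. y ^ 4 / 24 * (\<bar>?X \<omega>\<bar> ^ 4 * ?w \<omega>) \<partial>M)"
    unfolding diff
  proof (rule norm_integral_le)
    show "integrable M (\<lambda>\<omega>. y ^ 4 / 24 * (\<bar>?X \<omega>\<bar> ^ 4 * ?w \<omega>))"
      by (intro integrable_mult_right abs_mom(2)[OF \<rho>' \<theta>_bounds(1)])
    fix \<omega>
    have "norm (of_real (?w \<omega>) * iexp (y * ?X \<omega>) - of_real (?w \<omega>) * ?p (y * ?X \<omega>)) =
        ?w \<omega> * norm (iexp (y * ?X \<omega>) - ?p (y * ?X \<omega>))"
      by (simp add: norm_mult flip: right_diff_distrib)
    also have "\<dots> \<le> ?w \<omega> * (\<bar>y * ?X \<omega>\<bar> ^ Suc 3 / fact (Suc 3))"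
      by (intro mult_left_mono iexp_approx1) auto
    also have "\<dots> = y ^ 4 / 24 * (\<bar>?X \<omega>\<bar> ^ 4 * ?w \<omega>)"
    proof -
      have "\<bar>y * ?X \<omega>\<bar> ^ Suc 3 = y ^ 4 * \<bar>?X \<omega>\<bar> ^ 4"
        by (simp add: abs_mult power_mult_distrib)
      moreover have "fact (Suc 3) = (24::real)" by (simp add: fact_numeral)
      ultimately show ?thesis by simp
    qed
    finally show "norm (of_real (?w \<omega>) * iexp (y * ?X \<omega>) - of_real (?w \<omega>) * ?p (y * ?X \<omega>)) \<le>
        y ^ 4 / 24 * (\<bar>?X \<omega>\<bar> ^ 4 * ?w \<omega>)" .
  qed (rule Bochner_Integration.integrable_diff[OF icf ip])
  also have "\<dots> = y ^ 4 / 24 * (\<integral>\<omega>. \<bar>?X \<omega>\<bar> ^ 4 * ?w \<omega> \<partial>M)" by simp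
  also have "\<dots> \<le> y ^ 4 / 24 * mom_bound 4"
    by (intro mult_left_mono abs_mom(3)[OF \<rho>' \<theta>_bounds(1)]) auto
  finally have *: "norm (psi M V U \<rho> (Complex \<theta> y) - of_real m * (1 - of_real (s2 * y\<^sup>2 / 2) - \<i> * of_real (mu3 * y ^ 3 / 6)))
      \<le> y ^ 4 / 24 * mom_bound 4" unfolding P .
  have "cf y - c = (psi M V U \<rho> (Complex \<theta> y) - of_real m * c) / of_real m" for c
    using m_pos by (simp add: cf_def diff_divide_distrib)
  then have "norm (cf y - c) = norm (psi M V U \<rho> (Complex \<theta> y) - of_real m * c) / m" for c
    using m_pos by (simp add: norm_divide)
  then have "norm (cf y - (1 - of_real (s2 * y\<^sup>2 / 2) - \<i> * of_real (mu3 * y ^ 3 / 6))) \<le> (y ^ 4 / 24 * mom_bound 4) / (1 / 2)"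
    using frac_le[OF _ * _ m_bounds(1)] mom_bound_nonneg[of 4] by (simp only:) auto
  then show ?thesis by (simp add: mult.commute)
qed

lemma norm_cf_le_1: "norm (cf y) \<le> 1"
proof -
  have "norm (psi M V U \<rho> (Complex \<theta> y)) \<le> (\<integral>\<omega>. exp (\<theta> * net \<rho> \<omega>) \<partial>M)"
    unfolding psi_tilt by (rule norm_integral_le[OF int_weighted[where C = 1] int_weight]) (auto simp: norm_mult)
  then show ?thesis using m_pos by (simp add: cf_def norm_divide m_def mom_def divide_le_eq)
qed

text \<open>The proof uses \<open>cos (2 x) \<ge> 4 r cos x - (2 r\<^sup>2 + 1)\<close>. Iterating the bound carries the separation for
  \<open>\<bar>y\<bar> > \<delta>\<close> over to a quadratic bound near \<open>0\<close>.\<close>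

lemma cf_double: "1 - norm (cf (2 * y)) \<le> 4 * (1 - norm (cf y))"
proof -
  let ?X = "net \<rho>"
  let ?w = "\<lambda>\<omega>. exp (\<theta> * ?X \<omega>)"
  \<comment> \<open>After rotation by the argument of \<open>cf y\<close>, its modulus is the tilted
    mean of cos (y X - \<alpha>), and doubling that angle gives a lower bound for the modulus at 2
    y.\<close>
  define \<alpha> where "\<alpha> = Arg (cf y)"
  define r where "r = norm (cf y)"
  have polar: "cf y = of_real r * iexp \<alpha>"
    unfolding r_def \<alpha>_def using Arg_eq[of "cf y"] by (cases "cf y = 0") auto
  have int: "integrable M (\<lambda>\<omega>. of_real (?w \<omega>) * iexp (k * y * ?X \<omega>))" for k
    by (rule int_weighted[where C = 1]) auto
  have rot: "Re (cf (k * y) * iexp (- (k * \<alpha>))) = (\<integral>\<omega>. ?w \<omega> * cos (k * (y * ?X \<omega> - \<alpha>)) \<partial>M) / m" for k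
  proof -
    have "cf (k * y) * iexp (- (k * \<alpha>)) = (\<integral>\<omega>. (of_real (?w \<omega>) * iexp (k * y * ?X \<omega>)) * iexp (- (k * \<alpha>)) \<partial>M) / of_real m"
      unfolding cf_def psi_tilt by simp
    also have "\<dots> = (\<integral>\<omega>. of_real (?w \<omega>) * iexp (k * (y * ?X \<omega> - \<alpha>)) \<partial>M) / of_real m"
      by (intro arg_cong[where f = "\<lambda>x. x / of_real m"] Bochner_Integration.integral_cong refl)
        (simp add: mult.assoc right_diff_distrib flip: exp_add)
    finally have "Re (cf (k * y) * iexp (- (k * \<alpha>))) = Re (\<integral>\<omega>. of_real (?w \<omega>) * iexp (k * (y * ?X \<omega> - \<alpha>)) \<partial>M) / m"
      by simp
    also have "Re (\<integral>\<omega>. of_real (?w \<omega>) * iexp (k * (y * ?X \<omega> - \<alpha>)) \<partial>M) =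
        (\<integral>\<omega>. Re (of_real (?w \<omega>) * iexp (k * (y * ?X \<omega> - \<alpha>))) \<partial>M)"
      by (rule integral_Re[symmetric]) (rule int_weighted[where C = 1], auto)
    finally show ?thesis by (simp add: Re_exp)
  qed
  have cint: "integrable M (\<lambda>\<omega>. ?w \<omega> * cos (k * (y * ?X \<omega> - \<alpha>)))" for k
    using int_weighted[where f = "\<lambda>\<omega>. cos (k * (y * ?X \<omega> - \<alpha>))" and C = 1] by simp
  have "cf (1 * y) * iexp (- (1 * \<alpha>)) = of_real r"
    unfolding polar mult_1_left by (simp add: mult.assoc flip: exp_add)
  then have r1: "(\<integral>\<omega>. ?w \<omega> * cos (1 * (y * ?X \<omega> - \<alpha>)) \<partial>M) = m * r"
    using rot[of 1] m_pos by (simp add: field_simps)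
  have "m * (2 * r\<^sup>2 - 1) = 4 * r * (m * r) - (2 * r\<^sup>2 + 1) * m" by (simp add: power2_eq_square algebra_simps)
  also have "\<dots> = (\<integral>\<omega>. 4 * r * (?w \<omega> * cos (1 * (y * ?X \<omega> - \<alpha>))) - (2 * r\<^sup>2 + 1) * ?w \<omega> \<partial>M)"
    using cint[of 1] int_weight r1 by (simp add: m_def mom_def)
  also have "\<dots> \<le> (\<integral>\<omega>. ?w \<omega> * cos (2 * (y * ?X \<omega> - \<alpha>)) \<partial>M)"
  proof (rule integral_mono)
    fix \<omega>
    let ?c = "cos (y * ?X \<omega> - \<alpha>)"
    have "0 \<le> 2 * (?c - r)\<^sup>2" by simp
    then have "4 * r * ?c - (2 * r\<^sup>2 + 1) \<le> 2 * ?c\<^sup>2 - 1" by (simp add: power2_diff algebra_simps)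
    also have "\<dots> = cos (2 * (y * ?X \<omega> - \<alpha>))" by (rule cos_double_cos[symmetric])
    finally have "?w \<omega> * (4 * r * ?c - (2 * r\<^sup>2 + 1)) \<le> ?w \<omega> * cos (2 * (y * ?X \<omega> - \<alpha>))"
      by (intro mult_left_mono) auto
    then show "4 * r * (?w \<omega> * cos (1 * (y * ?X \<omega> - \<alpha>))) - (2 * r\<^sup>2 + 1) * ?w \<omega> \<le> ?w \<omega> * cos (2 * (y * ?X \<omega> - \<alpha>))"
      by (simp add: algebra_simps)
  qed (use cint[of 1] cint[of 2] int_weight in auto)
  finally have "2 * r\<^sup>2 - 1 \<le> (\<integral>\<omega>. ?w \<omega> * cos (2 * (y * ?X \<omega> - \<alpha>)) \<partial>M) / m"
    using m_pos by (simp add: field_simps)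
  also have "\<dots> = Re (cf (2 * y) * iexp (- (2 * \<alpha>)))" by (rule rot[symmetric])
  also have "\<dots> \<le> norm (cf (2 * y) * iexp (- (2 * \<alpha>)))" by (rule complex_Re_le_cmod)
  also have "\<dots> = norm (cf (2 * y))" by (simp add: norm_mult)
  finally have "1 - norm (cf (2 * y)) \<le> 2 * (1 - r\<^sup>2)" by simp
  also have "\<dots> = 2 * ((1 + r) * (1 - r))" by (simp add: power2_eq_square algebra_simps)
  also have "\<dots> \<le> 2 * (2 * (1 - r))"
    using norm_cf_le_1[of y] by (intro mult_left_mono mult_right_mono) (auto simp: r_def)
  finally show ?thesis by (simp add: r_def)
qed

lemma cf_far: "\<bar>y\<bar> > \<delta> \<Longrightarrow> norm (cf y) \<le> 1 - \<epsilon>"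
proof -
  assume "\<bar>y\<bar> > \<delta>"
  then have "cmod (psi M V U \<rho> (Complex \<theta> y)) \<le> m - \<epsilon>" using separated[of y] by (simp add: m_def)
  then have "norm (cf y) \<le> (m - \<epsilon>) / m" using m_pos by (simp add: cf_def norm_divide divide_right_mono)
  also have "\<dots> = 1 - \<epsilon> / m" using m_pos by (simp add: field_simps)
  also have "\<dots> \<le> 1 - \<epsilon> / 1" using m_pos m_bounds \<epsilon> by (intro diff_mono divide_left_mono) auto
  finally show ?thesis by simp
qed

lemma cf_near:
  assumes y: "\<bar>y\<bar> \<le> \<delta>"
  shows "norm (cf y) \<le> exp (- (\<epsilon> / (4 * \<delta>\<^sup>2) * y\<^sup>2))"
proof (cases "y = 0")
  case False
  have iter: "1 - norm (cf (2 ^ k * y)) \<le> 4 ^ k * (1 - norm (cf y))" for k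
  proof (induction k)
    case (Suc k)
    have "1 - norm (cf (2 ^ Suc k * y)) \<le> 4 * (1 - norm (cf (2 ^ k * y)))"
      using cf_double[of "2 ^ k * y"] by (simp add: mult.assoc)
    also have "\<dots> \<le> 4 * (4 ^ k * (1 - norm (cf y)))" using Suc.IH by simp
    finally show ?case by simp
  qed simp
  obtain k0 where "\<delta> / \<bar>y\<bar> < 2 ^ k0" using real_arch_pow[of 2 "\<delta> / \<bar>y\<bar>"] by auto
  then have ex: "\<exists>k. \<delta> < 2 ^ k * \<bar>y\<bar>" using False by (intro exI[of _ k0]) (simp add: field_simps)
  \<comment> \<open>The first doubling that leaves the interval puts 2^k |y| between \<delta> and 2
    \<delta>, so 4^k is at most 4 \<delta>^2 / y^2, while k doublings raise 1 - |cf| at most by the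
    factor 4^k.\<close>
  define k where "k = (LEAST k. \<delta> < 2 ^ k * \<bar>y\<bar>)"
  have k: "\<delta> < 2 ^ k * \<bar>y\<bar>" unfolding k_def by (rule LeastI_ex[OF ex])
  have "k \<noteq> 0" using k y by (cases k) auto
  then obtain j where j: "k = Suc j" by (cases k) auto
  have "\<not> \<delta> < 2 ^ j * \<bar>y\<bar>" using not_less_Least[of j "\<lambda>k. \<delta> < 2 ^ k * \<bar>y\<bar>"] j by (simp add: k_def)
  then have k2: "2 ^ k * \<bar>y\<bar> \<le> 2 * \<delta>" by (simp add: j)
  have "(2 ^ k * \<bar>y\<bar>)\<^sup>2 \<le> (2 * \<delta>)\<^sup>2" using k2 by (intro power_mono) auto
  then have k4: "4 ^ k * y\<^sup>2 \<le> 4 * \<delta>\<^sup>2"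
  proof -
    have "(2 ^ k)\<^sup>2 = (4::real) ^ k" by (simp add: power2_eq_square flip: power_mult_distrib)
    then show ?thesis using \<open>(2 ^ k * \<bar>y\<bar>)\<^sup>2 \<le> (2 * \<delta>)\<^sup>2\<close> by (simp add: power_mult_distrib)
  qed
  have "\<epsilon> \<le> 4 ^ k * (1 - norm (cf y))"
    using iter[of k] cf_far[of "2 ^ k * y"] k by (simp add: abs_mult)
  then have "\<epsilon> * y\<^sup>2 \<le> (4 ^ k * y\<^sup>2) * (1 - norm (cf y))"
    using mult_right_mono[of \<epsilon> "4 ^ k * (1 - norm (cf y))" "y\<^sup>2"] by (simp add: mult_ac)
  also have "\<dots> \<le> (4 * \<delta>\<^sup>2) * (1 - norm (cf y))"
    using k4 norm_cf_le_1[of y] by (intro mult_right_mono) auto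
  finally have "norm (cf y) \<le> 1 + - (\<epsilon> / (4 * \<delta>\<^sup>2) * y\<^sup>2)" using \<delta> by (simp add: field_simps)
  also have "\<dots> \<le> exp (- (\<epsilon> / (4 * \<delta>\<^sup>2) * y\<^sup>2))" by (rule exp_ge_add_one_self)
  finally show ?thesis .
qed (use norm_cf_le_1 in simp)

text \<open>These constants are built from moment bounds, \<delta> and \<epsilon>, never from \<rho>
  or \<theta>. \<open>\<kappa>\<close> is a Gaussian decay rate common to \<open>cf\<close> and its
  cubic model; in \<open>C2\<close> the first two summands come from low frequencies, the last two
  from high ones.\<close>

definition c1 :: real where "c1 = mom_bound 2 + mom_bound 3 * \<delta> / 3"
definition C1 :: real where "C1 = mom_bound 4 / 12 + c1\<^sup>2 * exp (c1 * \<delta>\<^sup>2)"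
definition \<kappa> :: real where "\<kappa> = min (\<epsilon> / (4 * \<delta>\<^sup>2)) (\<sigma>\<^sub>0 / 4)"
definition C\<phi> :: real where "C\<phi> = 2 * mom_bound 3 / (3 * \<sigma>\<^sub>0 * sqrt (\<sigma>\<^sub>0 / 2))"
definition C2 :: real where
  "C2 = 8 * C1 / \<kappa>\<^sup>2 + 24 * C\<phi>\<^sup>2 + 1 / \<epsilon> + (4 + 100 * C\<phi>) / (\<sigma>\<^sub>0 * \<delta>\<^sup>2)"

lemma const_nonneg: "0 \<le> c1" "0 \<le> C1" "0 < \<kappa>" "0 \<le> C\<phi>" "0 \<le> C2"
proof -
  show c1: "0 \<le> c1" using mom_bound_nonneg \<delta> by (simp add: c1_def)
  show C1: "0 \<le> C1" using mom_bound_nonneg[of 4] by (simp add: C1_def)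
  show \<kappa>: "0 < \<kappa>" using \<epsilon> \<delta> sigma0_pos by (simp add: \<kappa>_def)
  show C\<phi>: "0 \<le> C\<phi>" using mom_bound_nonneg[of 3] sigma0_pos by (simp add: C\<phi>_def)
  show "0 \<le> C2" using C1 \<kappa> C\<phi> \<epsilon> \<delta> sigma0_pos by (simp add: C2_def)
qed

text \<open>The cumulant form is chosen over the Taylor polynomial because its n-th power is again
  such an exponential and scales without error.\<close>

definition cubic_cf :: "real \<Rightarrow> complex" where
  "cubic_cf y = exp (- of_real (s2 * y\<^sup>2 / 2) - \<i> * of_real (mu3 * y ^ 3 / 6))"

lemma cf_cubic_cf:
  assumes y: "\<bar>y\<bar> \<le> \<delta>"
  shows "norm (cf y - cubic_cf y) \<le> C1 * y ^ 4"
proof -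
  define v where "v = - complex_of_real (s2 * y\<^sup>2 / 2) - \<i> * of_real (mu3 * y ^ 3 / 6)"
  have "norm v \<le> norm (complex_of_real (s2 * y\<^sup>2 / 2)) + norm (\<i> * complex_of_real (mu3 * y ^ 3 / 6))"
    using norm_triangle_ineq4[of "- complex_of_real (s2 * y\<^sup>2 / 2)" "\<i> * of_real (mu3 * y ^ 3 / 6)"]
    unfolding v_def norm_minus_cancel .
  also have "\<dots> = s2 / 2 * y\<^sup>2 + \<bar>mu3\<bar> / 6 * \<bar>y\<bar> * y\<^sup>2"
    using s2_bounds by (simp add: norm_mult norm_divide norm_power power3_eq_cube power2_eq_square)
  also have "\<dots> \<le> (2 * mom_bound 2) / 2 * y\<^sup>2 + (2 * mom_bound 3) / 6 * \<delta> * y\<^sup>2"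
    using s2_bounds mu3_bound y mom_bound_nonneg[of 3] by (intro add_mono mult_right_mono mult_mono divide_right_mono) auto
  also have "\<dots> = c1 * y\<^sup>2" by (simp add: c1_def algebra_simps)
  finally have nv: "norm v \<le> c1 * y\<^sup>2" .
  have "y\<^sup>2 \<le> \<delta>\<^sup>2" using y by (simp add: abs_le_square_iff[symmetric])
  then have nv': "norm v \<le> c1 * \<delta>\<^sup>2" using nv const_nonneg(1) mult_left_mono order_trans by blast
  have "norm (exp v - 1 - v) \<le> (norm v)\<^sup>2 * exp (norm v)" by (rule norm_exp_minus_linear_le)
  also have "\<dots> \<le> (c1 * y\<^sup>2)\<^sup>2 * exp (c1 * \<delta>\<^sup>2)" using nv nv' by (intro mult_mono power_mono) auto
  also have "\<dots> = c1\<^sup>2 * exp (c1 * \<delta>\<^sup>2) * y ^ 4" by (simp add: power_mult_distrib flip: power_mult)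
  finally have e: "norm (exp v - 1 - v) \<le> c1\<^sup>2 * exp (c1 * \<delta>\<^sup>2) * y ^ 4" .
  have t: "norm (cf y - (1 + v)) \<le> mom_bound 4 / 12 * y ^ 4"
    using cf_taylor[of y] by (simp add: v_def algebra_simps)
  have "norm (cf y - exp v) \<le> norm (cf y - (1 + v)) + norm (exp v - 1 - v)"
    using norm_triangle_ineq4[of "cf y - (1 + v)" "exp v - 1 - v"] by simp
  also have "\<dots> \<le> C1 * y ^ 4" using t e by (simp add: C1_def distrib_right)
  finally show ?thesis by (simp add: cubic_cf_def v_def)
qed

text \<open>The difference of powers is at most n C1 y^4 times r^(n-1), where r = exp (-\<kappa>
  y^2). With x = \<kappa> n y^2 / 2 this is a multiple of x^2 exp (-x) / n, and x^2 exp (-x) \<le>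
  2.\<close>

lemma cf_cubic_cf_power:
  assumes y: "\<bar>y\<bar> \<le> \<delta>" and n: "2 \<le> n"
  shows "norm (cf y ^ n - cubic_cf y ^ n) \<le> 8 * C1 / \<kappa>\<^sup>2 / real n"
proof -
  define r where "r = exp (- (\<kappa> * y\<^sup>2))"
  have "\<kappa> * y\<^sup>2 \<le> \<epsilon> / (4 * \<delta>\<^sup>2) * y\<^sup>2" by (intro mult_right_mono) (auto simp: \<kappa>_def)
  then have a: "norm (cf y) \<le> r" using cf_near[OF y] unfolding r_def
    by (meson exp_le_cancel_iff le_imp_neg_le order_trans)
  have "\<kappa> * y\<^sup>2 \<le> s2 / 2 * y\<^sup>2"
    using s2_bounds(1) by (intro mult_right_mono) (auto simp: \<kappa>_def min_def)
  then have b: "norm (cubic_cf y) \<le> r" unfolding cubic_cf_def r_def by simp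
  obtain k where k: "n = Suc k" using n by (cases n) auto
  have "norm (cf y ^ n - cubic_cf y ^ n) \<le> real n * norm (cf y - cubic_cf y) * r ^ k"
    unfolding k by (rule norm_power_diff_le[OF a b])
  also have "\<dots> \<le> real n * (C1 * y ^ 4) * exp (- (\<kappa> * real n * y\<^sup>2 / 2))"
  proof (intro mult_mono mult_left_mono cf_cubic_cf y)
    \<comment> \<open>One of the n factors is used up by the difference; n \<ge> 2 ensures that at
      least half of them remain.\<close>
    have "real n / 2 \<le> real k" using n k by simp
    then have "real n / 2 * (\<kappa> * y\<^sup>2) \<le> real k * (\<kappa> * y\<^sup>2)"
      using const_nonneg(3) by (intro mult_right_mono) auto
    then show "r ^ k \<le> exp (- (\<kappa> * real n * y\<^sup>2 / 2))"
      unfolding r_def by (simp add: exp_of_nat_mult[symmetric] mult_ac)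
  qed (use const_nonneg in \<open>auto simp: r_def\<close>)
  also have "\<dots> = C1 / real n * ((2 / \<kappa>)\<^sup>2 * ((\<kappa> * real n * y\<^sup>2 / 2)\<^sup>2 * exp (- (\<kappa> * real n * y\<^sup>2 / 2))))"
    using n const_nonneg(3) by (simp add: field_simps power2_eq_square eval_nat_numeral)
  also have "\<dots> \<le> C1 / real n * ((2 / \<kappa>)\<^sup>2 * 2)"
  proof (intro mult_left_mono)
    let ?x = "\<kappa> * real n * y\<^sup>2 / 2"
    have "?x\<^sup>2 \<le> fact 2 * exp ?x" using const_nonneg(3) by (intro power_le_fact_exp) auto
    then have "?x\<^sup>2 * exp (- ?x) \<le> (fact 2 * exp ?x) * exp (- ?x)" by (intro mult_right_mono) auto
    also have "\<dots> = 2" by (simp add: mult.assoc flip: exp_add)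
    finally show "?x\<^sup>2 * exp (- ?x) \<le> 2" .
  qed (use const_nonneg in auto)
  also have "\<dots> = 8 * C1 / \<kappa>\<^sup>2 / real n" by (simp add: power_divide mult_ac)
  finally show ?thesis .
qed

definition sig :: real where "sig = sqrt s2"
text \<open>This is the \<phi> of the theorem: at the saddle point h'' = s2 and h''' = - mu3, hence
  d_2 = mu3 / (6 s2).\<close>

definition phi :: "nat \<Rightarrow> real" where "phi n = mu3 / (6 * s2) / (sig * sqrt (real n))"

lemma sig_bounds: "0 < sig" "sig\<^sup>2 = s2" "sqrt (\<sigma>\<^sub>0 / 2) \<le> sig"
  using s2_bounds by (auto simp: sig_def)

lemma phi_bound:
  assumes n: "1 \<le> n"
  shows "\<bar>phi n\<bar> \<le> C\<phi> / sqrt (real n)" "\<bar>phi n\<bar> \<le> C\<phi>" "(phi n)\<^sup>2 \<le> C\<phi>\<^sup>2 / real n"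
proof -
  have "\<bar>mu3 / (6 * s2)\<bar> / sig \<le> (2 * mom_bound 3) / (6 * (\<sigma>\<^sub>0 / 2)) / sqrt (\<sigma>\<^sub>0 / 2)"
    unfolding abs_divide using mu3_bound s2_bounds sig_bounds sigma0_pos mom_bound_nonneg[of 3]
    by (intro frac_le) auto
  also have "\<dots> = C\<phi>" by (simp add: C\<phi>_def)
  finally have *: "\<bar>mu3 / (6 * s2)\<bar> / sig \<le> C\<phi>" .
  have "\<bar>phi n\<bar> = (\<bar>mu3 / (6 * s2)\<bar> / sig) / sqrt (real n)"
    using sig_bounds by (simp add: phi_def abs_mult)
  also have "\<dots> \<le> C\<phi> / sqrt (real n)" using * by (intro divide_right_mono) auto
  finally show 1: "\<bar>phi n\<bar> \<le> C\<phi> / sqrt (real n)" .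
  also have "\<dots> \<le> C\<phi> / 1" using n const_nonneg by (intro divide_left_mono) auto
  finally show "\<bar>phi n\<bar> \<le> C\<phi>" by simp
  have "\<bar>phi n\<bar>\<^sup>2 \<le> (C\<phi> / sqrt (real n))\<^sup>2" using 1 by (intro power_mono) auto
  then show "(phi n)\<^sup>2 \<le> C\<phi>\<^sup>2 / real n" by (simp add: power_divide)
qed

text \<open>The scale normalises the quadratic part to t^2 / 2 and leaves exactly
  \<open>phi n * t ^ 3\<close> as phase.\<close>

lemma cubic_cf_power:
  assumes n: "1 \<le> n"
  shows "cubic_cf (t / (sig * sqrt (real n))) ^ n = of_real (exp (- t\<^sup>2 / 2)) * iexp (- (phi n * t ^ 3))"
proof -
  let ?y = "t / (sig * sqrt (real n))"
  have sn: "sqrt (real n) > 0" using n by simp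
  have y2: "real n * (s2 * ?y\<^sup>2 / 2) = t\<^sup>2 / 2"
    using n sig_bounds s2_bounds(3) by (simp add: power_divide power_mult_distrib)
  have y3: "real n * (mu3 * ?y ^ 3 / 6) = phi n * t ^ 3"
  proof -
    have "real n * (mu3 * ?y ^ 3 / 6) = mu3 * t ^ 3 * (real n / (6 * (sig * sqrt (real n)) ^ 3))"
      by (simp add: power_divide mult_ac)
    also have "(sig * sqrt (real n)) ^ 3 = s2 * real n * (sig * sqrt (real n))"
      using sig_bounds(2) by (simp add: power3_eq_cube power2_eq_square power_mult_distrib mult_ac)
    also have "mu3 * t ^ 3 * (real n / (6 * (s2 * real n * (sig * sqrt (real n))))) = phi n * t ^ 3"
      using n by (simp add: phi_def field_simps)
    finally show ?thesis .
  qed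
  have "cubic_cf ?y ^ n = exp (of_nat n * (- of_real (s2 * ?y\<^sup>2 / 2) - \<i> * of_real (mu3 * ?y ^ 3 / 6)))"
    by (simp add: cubic_cf_def exp_of_nat_mult)
  moreover have "of_nat n * (- of_real (s2 * ?y\<^sup>2 / 2) - \<i> * of_real (mu3 * ?y ^ 3 / 6)) =
      - complex_of_real (real n * (s2 * ?y\<^sup>2 / 2)) - \<i> * of_real (real n * (mu3 * ?y ^ 3 / 6))"
    by (simp add: algebra_simps)
  ultimately have "cubic_cf ?y ^ n = exp (complex_of_real (- t\<^sup>2 / 2) + \<i> * of_real (- (phi n * t ^ 3)))"
    unfolding y2 y3 by simp
  then show ?thesis by (simp only: exp_add exp_of_real)
qed

text \<open>Low frequencies use the cubic model and then the first order of its phase. At high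
  frequencies the two terms are small separately: the power is at most exp (-\<epsilon> n), and t^2
  is at least a multiple of n.\<close>

lemma cf_scaled:
  assumes n: "2 \<le> n"
  shows "norm (cf (t / (sig * sqrt (real n))) ^ n - of_real (exp (- t\<^sup>2 / 2)) * (1 - \<i> * of_real (phi n * t ^ 3))) \<le> C2 / real n"
proof -
  let ?y = "t / (sig * sqrt (real n))" and ?E = "exp (- t\<^sup>2 / 2)"
  let ?L = "complex_of_real ?E * (1 - \<i> * of_real (phi n * t ^ 3))"
  have n1: "1 \<le> n" and n0: "0 < real n" using n by auto
  note ph = phi_bound[OF n1]
  have parts: "0 \<le> 8 * C1 / \<kappa>\<^sup>2" "0 \<le> 24 * C\<phi>\<^sup>2" "0 \<le> 1 / \<epsilon>" "0 \<le> (4 + 100 * C\<phi>) / (\<sigma>\<^sub>0 * \<delta>\<^sup>2)"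
    using const_nonneg \<epsilon> \<delta> sigma0_pos by auto
  show ?thesis
  proof (cases "\<bar>?y\<bar> \<le> \<delta>")
    case True
    have "norm (cubic_cf ?y ^ n - ?L) = ?E * norm (iexp (- (phi n * t ^ 3)) - (\<Sum>k\<le>1. (\<i> * of_real (- (phi n * t ^ 3))) ^ k / fact k))"
      unfolding cubic_cf_power[OF n1] by (simp add: norm_mult flip: right_diff_distrib)
    also have "\<dots> \<le> ?E * (\<bar>- (phi n * t ^ 3)\<bar> ^ Suc 1 / fact (Suc 1))"
      by (intro mult_left_mono iexp_approx1) auto
    also have "\<dots> = (phi n)\<^sup>2 / 2 * (t ^ 6 * ?E)"
      by (simp add: power2_eq_square abs_mult_self_eq eval_nat_numeral)
    also have "\<dots> \<le> (C\<phi>\<^sup>2 / real n) / 2 * 48"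
      using ph(3) gauss_power_le(3)[of t] by (intro mult_mono divide_right_mono) auto
    finally have "norm (cubic_cf ?y ^ n - ?L) \<le> 24 * C\<phi>\<^sup>2 / real n" by simp
    moreover have "norm (cf ?y ^ n - cubic_cf ?y ^ n) \<le> 8 * C1 / \<kappa>\<^sup>2 / real n" by (rule cf_cubic_cf_power[OF True n])
    moreover have "norm (cf ?y ^ n - ?L) \<le> norm (cf ?y ^ n - cubic_cf ?y ^ n) + norm (cubic_cf ?y ^ n - ?L)"
      using norm_triangle_ineq[of "cf ?y ^ n - cubic_cf ?y ^ n" "cubic_cf ?y ^ n - ?L"] by simp
    ultimately have "norm (cf ?y ^ n - ?L) \<le> (8 * C1 / \<kappa>\<^sup>2 + 24 * C\<phi>\<^sup>2) / real n"
      by (simp add: add_divide_distrib)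
    also have "\<dots> \<le> C2 / real n"
      using parts n0 by (intro divide_right_mono) (auto simp: C2_def)
    finally show ?thesis .
  next
    case False
    then have y: "\<bar>?y\<bar> > \<delta>" by simp
    have cf: "norm (cf ?y ^ n) \<le> 1 / \<epsilon> / real n"
    proof -
      have "norm (cf ?y) \<le> 1 + - \<epsilon>" using cf_far[OF y] by simp
      also have "\<dots> \<le> exp (- \<epsilon>)" by (rule exp_ge_add_one_self)
      finally have "norm (cf ?y ^ n) \<le> exp (- \<epsilon>) ^ n" unfolding norm_power by (intro power_mono) auto
      also have "\<dots> = 1 / exp (\<epsilon> * real n)"
        by (simp add: exp_of_nat_mult[symmetric] exp_minus field_simps)
      also have "\<dots> \<le> 1 / (\<epsilon> * real n)"
      proof (intro divide_left_mono)
        show "\<epsilon> * real n \<le> exp (\<epsilon> * real n)"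
          using exp_ge_add_one_self[of "\<epsilon> * real n"] by linarith
      qed (use \<epsilon> n0 in auto)
      finally show ?thesis by simp
    qed
    have "\<delta>\<^sup>2 \<le> ?y\<^sup>2" using y \<delta> by (metis abs_le_square_iff abs_of_pos less_imp_le)
    then have "\<delta>\<^sup>2 * (s2 * real n) \<le> t\<^sup>2"
      using n0 sig_bounds s2_bounds(3) by (simp add: power_divide power_mult_distrib field_simps)
    moreover have "\<delta>\<^sup>2 * (\<sigma>\<^sub>0 / 2 * real n) \<le> \<delta>\<^sup>2 * (s2 * real n)"
      using s2_bounds(1) by (intro mult_left_mono mult_right_mono) auto
    ultimately have t2: "\<sigma>\<^sub>0 * \<delta>\<^sup>2 / 2 * real n \<le> t\<^sup>2" by (simp add: mult_ac)
    have pos: "0 < \<sigma>\<^sub>0 * \<delta>\<^sup>2 / 2 * real n" using sigma0_pos \<delta> n0 by simp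
    then have t2p: "0 < t\<^sup>2" using t2 by linarith
    have "norm ?L \<le> ?E * (1 + \<bar>phi n\<bar> * \<bar>t\<bar> ^ 3)"
    proof -
      have "norm (1 - \<i> * complex_of_real (phi n * t ^ 3)) \<le> 1 + \<bar>phi n\<bar> * \<bar>t\<bar> ^ 3"
        using norm_triangle_ineq4[of 1 "\<i> * complex_of_real (phi n * t ^ 3)"] by (simp add: norm_mult norm_power)
      then show ?thesis by (simp add: norm_mult)
    qed
    \<comment> \<open>Multiplying and dividing by t^2 turns bounded products of powers and Gaussian
      factors into 1 / n.\<close>
    also have "\<dots> = (t\<^sup>2 * ?E + \<bar>phi n\<bar> * (\<bar>t\<bar> ^ 5 * ?E)) / t\<^sup>2"
    proof -
      have "\<bar>t\<bar> ^ 5 = \<bar>t\<bar> ^ 3 * t\<^sup>2" by (simp add: eval_nat_numeral)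
      then show ?thesis using t2p by (simp add: field_simps)
    qed
    also have "\<dots> \<le> (2 + C\<phi> * 50) / (\<sigma>\<^sub>0 * \<delta>\<^sup>2 / 2 * real n)"
      using gauss_power_le(4,5)[of t] ph(2) const_nonneg(4) pos t2 t2p
      by (intro frac_le add_mono mult_mono) auto
    also have "\<dots> = (4 + 100 * C\<phi>) / (\<sigma>\<^sub>0 * \<delta>\<^sup>2) / real n" by (simp add: field_simps)
    finally have L: "norm ?L \<le> (4 + 100 * C\<phi>) / (\<sigma>\<^sub>0 * \<delta>\<^sup>2) / real n" .
    have "norm (cf ?y ^ n - ?L) \<le> norm (cf ?y ^ n) + norm ?L" by (rule norm_triangle_ineq4)
    also have "\<dots> \<le> (1 / \<epsilon> + (4 + 100 * C\<phi>) / (\<sigma>\<^sub>0 * \<delta>\<^sup>2)) / real n"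
      using cf L by (simp only: add_divide_distrib)
    also have "\<dots> \<le> C2 / real n"
      using parts n0 by (intro divide_right_mono) (auto simp: C2_def)
    finally show ?thesis .
  qed
qed

section \<open>The transform at the saddle point and its n-th power\<close>

definition bet :: "nat \<Rightarrow> real" where "bet n = \<theta> * sig * sqrt (real n)"
definition Bn :: "nat \<Rightarrow> real" where "Bn n = bet n / (1 + bet n * phi n)"

text \<open>In these constants \<open>a2\<close> stands for an upper bound of \<theta> sqrt n;
  \<open>ca\<close> bounds 1 / m - 1 by a multiple of \<theta>^2, and \<open>bmax\<close> bounds
  \<open>bet n\<close>.\<close>

definition ca :: real where "ca = mom_bound 2 + mom_bound 3 / 3 + mom_bound 4 / 12"
definition bmax :: "real \<Rightarrow> real" where "bmax a2 = a2 * sqrt (2 * mom_bound 2)"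
definition C3 :: "real \<Rightarrow> real" where
  "C3 a2 = 2 * ca\<^sup>2 * a2 ^ 4 + mom_bound 4 / 12 * a2 ^ 4 + 8 * bmax a2 ^ 4 * C\<phi>\<^sup>2"

lemma mom_0_0: "mom \<rho> 0 0 = 1" by (simp add: mom_def prob_space)

text \<open>The moment generating function is expanded around \<theta> and evaluated at 0, where it
  is 1. This yields 1 / m in terms of moments at the saddle point, without a linear term.\<close>

lemma inverse_m_taylor:
  obtains R where "1 / m = 1 + (s2 * \<theta>\<^sup>2 / 2 - mu3 * \<theta> ^ 3 / 6 + R)" "\<bar>R\<bar> \<le> mom_bound 4 / 12 * \<theta> ^ 4"
proof -
  have "\<exists>t. 0 < t \<and> t < \<theta> \<and> mom \<rho> 0 0 = (\<Sum>k<4. (mom \<rho> k \<theta> / fact k) * (0 - \<theta>) ^ k) + (mom \<rho> 4 t / fact 4) * (0 - \<theta>) ^ 4"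
    using \<theta> \<theta>_bounds
    by (intro Taylor_down[where b = \<theta>]) (auto intro!: mom_has_real_derivative[OF \<rho>'])
  then obtain t where t: "0 < t" "t < \<theta>"
    and eq: "mom \<rho> 0 0 = (\<Sum>k<4. (mom \<rho> k \<theta> / fact k) * (0 - \<theta>) ^ k) + (mom \<rho> 4 t / fact 4) * (0 - \<theta>) ^ 4"
    by blast
  have sum4: "(\<Sum>k<4. f k) = f 0 + f 1 + f 2 + f 3" for f :: "nat \<Rightarrow> real"
    by (simp add: eval_nat_numeral)
  have "1 = m + mom \<rho> 2 \<theta> * \<theta>\<^sup>2 / 2 - mom \<rho> 3 \<theta> * \<theta> ^ 3 / 6 + mom \<rho> 4 t * \<theta> ^ 4 / 24"
    using eq unfolding sum4 saddle mom_0_0 by (simp add: m_def fact_numeral)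
  then have "1 / m = (m + mom \<rho> 2 \<theta> * \<theta>\<^sup>2 / 2 - mom \<rho> 3 \<theta> * \<theta> ^ 3 / 6 + mom \<rho> 4 t * \<theta> ^ 4 / 24) / m"
    by simp
  also have "\<dots> = 1 + (s2 * \<theta>\<^sup>2 / 2 - mu3 * \<theta> ^ 3 / 6 + mom \<rho> 4 t / m * \<theta> ^ 4 / 24)"
    using m_pos by (simp add: s2_def mu3_def add_divide_distrib diff_divide_distrib)
  finally have 1: "1 / m = 1 + (s2 * \<theta>\<^sup>2 / 2 - mu3 * \<theta> ^ 3 / 6 + mom \<rho> 4 t / m * \<theta> ^ 4 / 24)" .
  have "\<bar>mom \<rho> 4 t / m\<bar> \<le> 2 * mom_bound 4"
    using abs_divide_m_le[of "mom \<rho> 4 t"] abs_mom(4)[OF \<rho>', of t 4] t \<theta>_bounds by auto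
  then have "\<bar>mom \<rho> 4 t / m\<bar> * \<theta> ^ 4 / 24 \<le> 2 * mom_bound 4 * \<theta> ^ 4 / 24"
    by (intro divide_right_mono mult_right_mono) auto
  then have "\<bar>mom \<rho> 4 t / m * \<theta> ^ 4 / 24\<bar> \<le> mom_bound 4 / 12 * \<theta> ^ 4"
    by (simp add: abs_mult power_even_abs mult.commute)
  with 1 show thesis by (rule that)
qed

text \<open>n ln m equals - \<beta>^2 / 2 + \<phi> \<beta>^3 up to O(1/n), and so does - B^2 / 2 for
  B = \<beta> / (1 + \<beta> \<phi>). The choice of B thus also absorbs the cubic correction at t =
  0, not only the one along the line.\<close>

lemma m_power:
  assumes n: "1 \<le> n" and a2: "\<theta> \<le> a2 / sqrt (real n)"
    and small: "ca * a2\<^sup>2 \<le> real n / 2" "bmax a2 * C\<phi> \<le> sqrt (real n) / 2"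
  shows "\<bar>m ^ n - exp (- (Bn n)\<^sup>2 / 2)\<bar> \<le> C3 a2 / real n" "\<bar>bet n * phi n\<bar> \<le> 1 / 2"
proof -
  have n0: "0 < real n" "0 < sqrt (real n)" using n by auto
  have "0 < a2 / sqrt (real n)" using a2 \<theta> by linarith
  then have a2p: "0 < a2" using n0 by (simp add: zero_less_divide_iff)
  have ca: "0 \<le> ca" using mom_bound_nonneg[of 2] mom_bound_nonneg[of 3] mom_bound_nonneg[of 4] by (simp add: ca_def)
  have "\<theta>\<^sup>2 \<le> (a2 / sqrt (real n))\<^sup>2" using a2 \<theta> by (intro power_mono) auto
  then have th2: "\<theta>\<^sup>2 \<le> a2\<^sup>2 / real n" by (simp add: power_divide)
  have "\<theta> ^ 4 \<le> (a2 / sqrt (real n)) ^ 4" using a2 \<theta> by (intro power_mono) auto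
  also have "\<dots> = a2 ^ 4 / (real n)\<^sup>2"
  proof -
    have "sqrt (real n) ^ 4 = (real n)\<^sup>2" using power_mult[of "sqrt (real n)" 2 2] by simp
    then show ?thesis by (simp add: power_divide)
  qed
  finally have "real n * \<theta> ^ 4 \<le> real n * (a2 ^ 4 / (real n)\<^sup>2)" by (intro mult_left_mono) auto
  then have th4: "real n * \<theta> ^ 4 \<le> a2 ^ 4 / real n" using n0 by (simp add: power2_eq_square)
  obtain R where R: "1 / m = 1 + (s2 * \<theta>\<^sup>2 / 2 - mu3 * \<theta> ^ 3 / 6 + R)" "\<bar>R\<bar> \<le> mom_bound 4 / 12 * \<theta> ^ 4"
    by (rule inverse_m_taylor)
  define a where "a = s2 * \<theta>\<^sup>2 / 2 - mu3 * \<theta> ^ 3 / 6 + R"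
  have a_bound: "\<bar>a\<bar> \<le> ca * \<theta>\<^sup>2"
  proof -
    have th1: "\<theta> \<le> 1" using \<theta> delta1_bounds by simp
    have "\<bar>s2 * \<theta>\<^sup>2 / 2\<bar> \<le> mom_bound 2 * \<theta>\<^sup>2"
      using s2_bounds mult_right_mono[OF s2_bounds(2), of "\<theta>\<^sup>2"] by (simp add: abs_mult)
    moreover have "\<bar>mu3 * \<theta> ^ 3 / 6\<bar> \<le> mom_bound 3 / 3 * \<theta>\<^sup>2"
    proof -
      have "\<bar>mu3 * \<theta> ^ 3 / 6\<bar> = \<bar>mu3\<bar> * (\<theta> * \<theta>\<^sup>2) / 6" using \<theta> by (simp add: abs_mult power3_eq_cube power2_eq_square)
      also have "\<dots> \<le> (2 * mom_bound 3) * (1 * \<theta>\<^sup>2) / 6"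
        using mu3_bound th1 \<theta> mom_bound_nonneg[of 3] by (intro divide_right_mono mult_mono) auto
      finally show ?thesis by (simp add: mult.commute)
    qed
    moreover have "\<bar>R\<bar> \<le> mom_bound 4 / 12 * \<theta>\<^sup>2"
    proof -
      have "\<theta> ^ 4 \<le> \<theta>\<^sup>2" using th1 \<theta> by (intro power_decreasing) auto
      then have "mom_bound 4 / 12 * \<theta> ^ 4 \<le> mom_bound 4 / 12 * \<theta>\<^sup>2"
        using mom_bound_nonneg[of 4] by (intro mult_left_mono) auto
      then show ?thesis using R(2) by linarith
    qed
    ultimately have "\<bar>a\<bar> \<le> mom_bound 2 * \<theta>\<^sup>2 + mom_bound 3 / 3 * \<theta>\<^sup>2 + mom_bound 4 / 12 * \<theta>\<^sup>2"
      unfolding a_def by linarith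
    then show ?thesis by (simp add: ca_def distrib_right)
  qed
  also have "\<dots> \<le> ca * (a2\<^sup>2 / real n)" using th2 ca by (intro mult_left_mono)
  also have "\<dots> \<le> 1 / 2" using small(1) n0 by (simp add: field_simps)
  finally have a_half: "\<bar>a\<bar> \<le> 1 / 2" .
  have ln_m: "ln m = - ln (1 + a)"
  proof -
    have "ln (1 + a) = ln (1 / m)" using R(1) by (simp add: a_def)
    then show ?thesis using m_pos by (simp add: ln_div)
  qed
  have e1: "\<bar>real n * ln m + real n * a\<bar> \<le> 2 * ca\<^sup>2 * a2 ^ 4 / real n"
  proof -
    have "\<bar>ln (1 + a) - a\<bar> \<le> 2 * a\<^sup>2" by (rule abs_ln_one_plus_x_minus_x_bound[OF a_half])
    also have "\<dots> \<le> 2 * (ca * \<theta>\<^sup>2)\<^sup>2"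
      using power_mono[OF a_bound, of 2] by simp
    also have "\<dots> = 2 * ca\<^sup>2 * \<theta> ^ 4" by (simp add: power_mult_distrib flip: power_mult)
    finally have "real n * \<bar>ln (1 + a) - a\<bar> \<le> real n * (2 * ca\<^sup>2 * \<theta> ^ 4)" by (intro mult_left_mono) auto
    also have "\<dots> = 2 * ca\<^sup>2 * (real n * \<theta> ^ 4)" by simp
    also have "\<dots> \<le> 2 * ca\<^sup>2 * (a2 ^ 4 / real n)" using th4 by (intro mult_left_mono) auto
    also have "real n * \<bar>ln (1 + a) - a\<bar> = \<bar>real n * ln m + real n * a\<bar>"
    proof -
      have "real n * ln m + real n * a = - (real n * (ln (1 + a) - a))" by (simp add: ln_m algebra_simps)
      then show ?thesis by (simp only: abs_minus_cancel abs_mult abs_of_nat)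
    qed
    finally show ?thesis by simp
  qed
  have b2: "real n * (s2 * \<theta>\<^sup>2 / 2) = (bet n)\<^sup>2 / 2"
    using sig_bounds(2) by (simp add: bet_def power_mult_distrib)
  have b3: "real n * (mu3 * \<theta> ^ 3 / 6) = phi n * bet n ^ 3"
  proof -
    have "bet n ^ 3 = \<theta> ^ 3 * (sig\<^sup>2 * sig) * ((sqrt (real n))\<^sup>2 * sqrt (real n))"
      by (simp add: bet_def power_mult_distrib power3_eq_cube power2_eq_square)
    then have "bet n ^ 3 = \<theta> ^ 3 * (s2 * sig) * (real n * sqrt (real n))" by (simp add: sig_bounds(2))
    then show ?thesis using sig_bounds(1) s2_bounds(3) n0 by (simp add: phi_def)
  qed
  have "real n * a = (bet n)\<^sup>2 / 2 - phi n * bet n ^ 3 + real n * R"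
    unfolding a_def distrib_left right_diff_distrib b2 b3 ..
  moreover have "\<bar>real n * R\<bar> \<le> mom_bound 4 / 12 * a2 ^ 4 / real n"
  proof -
    have "\<bar>real n * R\<bar> \<le> real n * (mom_bound 4 / 12 * \<theta> ^ 4)"
      unfolding abs_mult abs_of_nat using R(2) by (intro mult_left_mono) auto
    also have "\<dots> = mom_bound 4 / 12 * (real n * \<theta> ^ 4)" by simp
    also have "\<dots> \<le> mom_bound 4 / 12 * (a2 ^ 4 / real n)"
      using th4 mom_bound_nonneg[of 4] by (intro mult_left_mono) auto
    finally show ?thesis by simp
  qed
  ultimately have e2: "\<bar>real n * a - ((bet n)\<^sup>2 / 2 - phi n * bet n ^ 3)\<bar> \<le> mom_bound 4 / 12 * a2 ^ 4 / real n"
    by simp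
  have bet0: "0 \<le> bet n" using \<theta> sig_bounds by (simp add: bet_def)
  have sig_le: "sig \<le> sqrt (2 * mom_bound 2)" using s2_bounds by (simp add: sig_def)
  have bet_le: "bet n \<le> bmax a2"
  proof -
    have "bet n = (\<theta> * sqrt (real n)) * sig" by (simp add: bet_def)
    also have "\<dots> \<le> a2 * sqrt (2 * mom_bound 2)"
      using a2 n0 a2p sig_le sig_bounds \<theta> by (intro mult_mono) (auto simp: field_simps)
    finally show ?thesis by (simp add: bmax_def)
  qed
  note ph = phi_bound[OF n]
  define x where "x = bet n * phi n"
  have "\<bar>x\<bar> \<le> bmax a2 * (C\<phi> / sqrt (real n))"
    unfolding x_def abs_mult using bet_le bet0 ph(1) by (intro mult_mono) auto
  also have "\<dots> \<le> 1 / 2" using small(2) n0 by (simp add: field_simps)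
  finally have x_half: "\<bar>x\<bar> \<le> 1 / 2" .
  then show "\<bar>bet n * phi n\<bar> \<le> 1 / 2" by (simp add: x_def)
  \<comment> \<open>With x = \<beta> \<phi>, the expansion of (1 + x)^(-2) is 1 - 2 x up to a
    remainder of order x^2, which is O(1/n).\<close>
  have e3: "\<bar>(Bn n)\<^sup>2 / 2 - ((bet n)\<^sup>2 / 2 - phi n * bet n ^ 3)\<bar> \<le> 8 * bmax a2 ^ 4 * C\<phi>\<^sup>2 / real n"
  proof -
    have x1: "1 / 2 \<le> 1 + x" using x_half by (auto simp: abs_le_iff)
    have "(Bn n)\<^sup>2 / 2 - ((bet n)\<^sup>2 / 2 - phi n * bet n ^ 3) = (bet n)\<^sup>2 / 2 * (1 / (1 + x)\<^sup>2 - 1 + 2 * x)"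
      by (simp add: Bn_def x_def power_divide algebra_simps power2_eq_square power3_eq_cube)
    also have "1 / (1 + x)\<^sup>2 - 1 + 2 * x = x\<^sup>2 * (3 + 2 * x) / (1 + x)\<^sup>2"
      using x1 by (simp add: divide_simps) (simp add: power2_eq_square algebra_simps)
    finally have "\<bar>(Bn n)\<^sup>2 / 2 - ((bet n)\<^sup>2 / 2 - phi n * bet n ^ 3)\<bar> = (bet n)\<^sup>2 / 2 * (x\<^sup>2 * \<bar>3 + 2 * x\<bar> / (1 + x)\<^sup>2)"
      by (simp add: abs_mult)
    also have "\<dots> \<le> (bet n)\<^sup>2 / 2 * (x\<^sup>2 * 4 / (1 / 2)\<^sup>2)"
    proof (intro mult_left_mono frac_le)
      show "\<bar>3 + 2 * x\<bar> \<le> 4" using x_half by (auto simp: abs_le_iff)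
      show "(1 / 2)\<^sup>2 \<le> (1 + x)\<^sup>2" using x1 by (intro power_mono) auto
    qed auto
    also have "\<dots> = 8 * (bet n ^ 4 * (phi n)\<^sup>2)"
      by (simp add: x_def power_mult_distrib power2_eq_square eval_nat_numeral)
    also have "\<dots> \<le> 8 * (bmax a2 ^ 4 * (C\<phi>\<^sup>2 / real n))"
      using bet_le bet0 ph(3) by (intro mult_left_mono mult_mono power_mono) auto
    finally show ?thesis by simp
  qed
  have "\<bar>real n * ln m - (- (Bn n)\<^sup>2 / 2)\<bar> \<le> 2 * ca\<^sup>2 * a2 ^ 4 / real n + mom_bound 4 / 12 * a2 ^ 4 / real n + 8 * bmax a2 ^ 4 * C\<phi>\<^sup>2 / real n"
    using e1 e2 e3 by linarith
  also have "\<dots> = C3 a2 / real n" by (simp add: C3_def add_divide_distrib)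
  finally have e: "\<bar>real n * ln m - (- (Bn n)\<^sup>2 / 2)\<bar> \<le> C3 a2 / real n" .
  have exp_lip: "\<bar>exp p - exp q\<bar> \<le> \<bar>p - q\<bar>" if "p \<le> 0" "q \<le> 0" for p q :: real
  proof -
    have "exp p - exp q \<le> \<bar>p - q\<bar>" if "p \<le> 0" for p q :: real
    proof -
      have "exp p * (1 + (q - p)) \<le> exp p * exp (q - p)" by (intro mult_left_mono exp_ge_add_one_self) auto
      then have "exp p - exp q \<le> exp p * (p - q)" by (simp add: algebra_simps flip: exp_add)
      also have "\<dots> \<le> exp p * \<bar>p - q\<bar>" by (intro mult_left_mono) auto
      also have "\<dots> \<le> 1 * \<bar>p - q\<bar>" using that by (intro mult_right_mono) auto
      finally show ?thesis by simp
    qed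
    from this[of p q] this[of q p] that show ?thesis by (auto simp: abs_le_iff)
  qed
  have "m ^ n = exp (real n * ln m)" using m_pos by (simp add: exp_of_nat_mult)
  moreover have "\<bar>exp (real n * ln m) - exp (- (Bn n)\<^sup>2 / 2)\<bar> \<le> \<bar>real n * ln m - (- (Bn n)\<^sup>2 / 2)\<bar>"
    using m_bounds m_pos by (intro exp_lip) (auto simp: mult_nonneg_nonpos)
  ultimately show "\<bar>m ^ n - exp (- (Bn n)\<^sup>2 / 2)\<bar> \<le> C3 a2 / real n" using e by simp
qed

definition C4 :: "real \<Rightarrow> real" where "C4 a2 = C2 + C3 a2 * (1 + 9 * C\<phi>)"

text \<open>The height exp (-B^2 / 2) from the saddle point and the shape exp (-t^2 / 2) along the
  line multiply to \<open>gauss_tilt\<close>. This is the input that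
  \<open>transform_perturbation_bound\<close> asks for, with e of order 1 / n.\<close>

lemma psi_power:
  assumes n: "2 \<le> n" and a2: "\<theta> \<le> a2 / sqrt (real n)"
    and small: "ca * a2\<^sup>2 \<le> real n / 2" "bmax a2 * C\<phi> \<le> sqrt (real n) / 2"
  shows "norm (psi M V U \<rho> (Complex \<theta> (t / (sig * sqrt (real n)))) ^ n
      - of_real (gauss_tilt (Bn n) t) * (1 - \<i> * of_real (phi n * t ^ 3))) \<le> C4 a2 / real n"
proof -
  have n1: "1 \<le> n" using n by simp
  let ?y = "t / (sig * sqrt (real n))" and ?E = "exp (- t\<^sup>2 / 2)"
  let ?F = "1 - \<i> * complex_of_real (phi n * t ^ 3)"
  let ?q = "exp (- (Bn n)\<^sup>2 / 2)"
  note mp = m_power[OF n1 a2 small]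
  have F: "norm (of_real ?E * ?F) \<le> 1 + 9 * C\<phi>"
  proof -
    have "norm ?F \<le> 1 + \<bar>phi n\<bar> * \<bar>t\<bar> ^ 3"
      using norm_triangle_ineq4[of 1 "\<i> * complex_of_real (phi n * t ^ 3)"] by (simp add: norm_mult norm_power)
    then have "norm (of_real ?E * ?F) \<le> ?E * (1 + \<bar>phi n\<bar> * \<bar>t\<bar> ^ 3)" by (simp add: norm_mult)
    also have "\<dots> = ?E + \<bar>phi n\<bar> * (\<bar>t\<bar> ^ 3 * ?E)" by (simp add: algebra_simps)
    also have "\<dots> \<le> 1 + C\<phi> * 9"
      using phi_bound(2)[OF n1] gauss_power_le(1)[of t] const_nonneg(4) by (intro add_mono mult_mono) auto
    finally show ?thesis by simp
  qed
  have psi_cf: "psi M V U \<rho> (Complex \<theta> ?y) = of_real m * cf ?y" using m_pos by (simp add: cf_def)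
  have gt: "gauss_tilt (Bn n) t = ?q * ?E" by (simp add: gauss_tilt_def flip: exp_add)
  have split: "psi M V U \<rho> (Complex \<theta> ?y) ^ n - of_real (gauss_tilt (Bn n) t) * ?F =
      of_real (m ^ n) * (cf ?y ^ n - of_real ?E * ?F) + of_real (m ^ n - ?q) * (of_real ?E * ?F)"
    unfolding psi_cf gt by (simp add: power_mult_distrib algebra_simps)
  have "norm (psi M V U \<rho> (Complex \<theta> ?y) ^ n - of_real (gauss_tilt (Bn n) t) * ?F)
      \<le> \<bar>m ^ n\<bar> * norm (cf ?y ^ n - of_real ?E * ?F) + \<bar>m ^ n - ?q\<bar> * norm (of_real ?E * ?F)"
    unfolding split by (rule order_trans[OF norm_triangle_ineq]) (simp only: norm_mult norm_of_real order_refl)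
  also have "\<dots> \<le> 1 * (C2 / real n) + C3 a2 / real n * (1 + 9 * C\<phi>)"
  proof (intro add_mono mult_mono)
    show "\<bar>m ^ n\<bar> \<le> 1" using m_bounds m_pos by (simp add: power_le_one)
    show "0 \<le> C3 a2 / real n" using mp(1) abs_ge_zero order_trans by blast
  qed (use cf_scaled[OF n, of t] mp F in auto)
  also have "\<dots> = C4 a2 / real n" by (simp add: C4_def add_divide_distrib)
  finally show ?thesis .
qed

end

section \<open>Comparison of Laplace transforms\<close>

lemma higher_deriv_bound:
  assumes f: "f holomorphic_on ball 0 r" and r: "0 < r" and le: "\<And>z. norm z < r \<Longrightarrow> norm (f z) \<le> e"
  shows "norm ((deriv ^^ k) f 0) \<le> fact k * e / (r / 2) ^ k"
proof (rule Cauchy_inequality)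
  show "f holomorphic_on ball 0 (r / 2)" by (rule holomorphic_on_subset[OF f]) (use r in auto)
  show "continuous_on (cball 0 (r / 2)) f"
    by (rule continuous_on_subset[OF holomorphic_on_imp_continuous_on[OF f]]) (use r in auto)
  show "norm (f x) \<le> e" if "norm (0 - x) = r / 2" for x
    using that r by (intro le) auto
qed (use r in simp)

text \<open>The theorem differentiates on the real line, Cauchy's estimates in the complex plane. A
  holomorphic function with real values on the axis has real derivatives there, so the two
  agree.\<close>

lemma higher_deriv_of_real:
  fixes f :: "real \<Rightarrow> real"
  assumes F: "F holomorphic_on ball 0 r" and eq: "\<And>x. \<bar>x\<bar> < r \<Longrightarrow> of_real (f x) = F (of_real x)"
    and x: "\<bar>x\<bar> < r"
  shows "of_real ((deriv ^^ k) f x) = (deriv ^^ k) F (of_real x)"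
  using x
proof (induction k arbitrary: x)
  case 0
  then show ?case using eq by simp
next
  case (Suc k)
  let ?g = "(deriv ^^ k) f" and ?G = "(deriv ^^ k) F"
  let ?D = "deriv ?G (of_real x)"
  have "?G holomorphic_on ball 0 r" by (rule holomorphic_higher_deriv[OF F]) auto
  then have "(?G has_field_derivative ?D) (at (of_real x))"
    by (rule holomorphic_derivI) (use Suc.prems in auto)
  then have "((\<lambda>x. ?G (of_real x)) has_vector_derivative ?D) (at x)"
    by (rule has_vector_derivative_real_field)
  then have vd: "((\<lambda>x. complex_of_real (?g x)) has_vector_derivative ?D) (at x)"
    by (rule has_vector_derivative_transform_within_open[where S = "ball 0 r"]) (use Suc in auto)
  have "((\<lambda>x. Re (complex_of_real (?g x))) has_vector_derivative Re ?D) (at x)"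
    by (rule bounded_linear.has_vector_derivative[OF bounded_linear_Re vd])
  then have re: "(?g has_real_derivative Re ?D) (at x)"
    by (simp add: has_real_derivative_iff_has_vector_derivative)
  have "((\<lambda>x. Im (complex_of_real (?g x))) has_vector_derivative Im ?D) (at x)"
    by (rule bounded_linear.has_vector_derivative[OF bounded_linear_Im vd])
  then have "((\<lambda>x. 0) has_vector_derivative Im ?D) (at x)" by simp
  then have "Im ?D = 0"
    using vector_derivative_unique_at[OF _ has_vector_derivative_const] by blast
  then show ?case using DERIV_imp_deriv[OF re] by (simp add: complex_eq_iff)
qed

text \<open>In Leibniz's rule at 0 only the first derivative of the factor s survives. For k = 0 the
  truncated \<open>k - 1\<close> does no harm because of the factor k.\<close>

lemma higher_deriv_ident_mult:
  fixes f :: "complex \<Rightarrow> complex"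
  assumes f: "f holomorphic_on S" and S: "open S" "0 \<in> S"
  shows "(deriv ^^ k) (\<lambda>s. s * f s) 0 = of_nat k * (deriv ^^ (k - 1)) f 0"
proof -
  have "(deriv ^^ k) (\<lambda>s. s * f s) 0 =
      (\<Sum>i = 0..k. of_nat (k choose i) * (deriv ^^ i) (\<lambda>s. s) 0 * (deriv ^^ (k - i)) f 0)"
    by (rule higher_deriv_mult[OF _ f S]) (rule holomorphic_on_ident)
  also have "\<dots> = (\<Sum>i = 0..k. if i = 1 then of_nat k * (deriv ^^ (k - 1)) f 0 else 0)"
    by (intro sum.cong refl) auto
  also have "\<dots> = of_nat k * (deriv ^^ (k - 1)) f 0"
    by (cases k) auto
  finally show ?thesis .
qed

lemma norm_exp_minus_1_le:
  fixes w :: complex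
  assumes "norm w \<le> 1"
  shows "norm (exp w - 1) \<le> 4 * norm w"
proof -
  have "exp (norm w) \<le> 3" using assms exp_le by (meson exp_le_cancel_iff order_trans)
  then have "(norm w)\<^sup>2 * exp (norm w) \<le> norm w * 3"
    using assms by (intro mult_mono) (auto simp: power2_eq_square mult_left_le)
  then have "norm (exp w - 1 - w) \<le> 3 * norm w" using norm_exp_minus_linear_le[of w] by linarith
  then show ?thesis using norm_triangle_ineq[of "exp w - 1 - w" w] by simp
qed

text \<open>The moment at rate B itself comes from the theory of stationary waiting times. Its bound
  decreases in B, hence is uniform over all B above a positive constant.\<close>

lemma gauss_exp_integrable:
  assumes "0 < B"
  shows "exp_integrable (gauss_max_law B) (\<lambda>x. x) (\<lambda>x. x) B"
    and "(\<integral>x. exp (B * x) \<partial>gauss_max_law B) \<le> 1 / (1 - exp (- B\<^sup>2 / 2))"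
proof -
  interpret stationary_wait "shifted_normal B" "gauss_max_law B" B by (rule stationary_wait_gauss[OF assms])
  note [measurable_cong] = sets_w
  have ae: "AE x in gauss_max_law B. exp (B * max 0 x) = exp (B * x)"
    using w_nonneg by eventually_elim simp
  have int: "integrable (gauss_max_law B) (\<lambda>x. exp (B * max 0 x))" using exp_law_w by (simp add: exp_law_def)
  show "exp_integrable (gauss_max_law B) (\<lambda>x. x) (\<lambda>x. x) B"
  proof
    show "AE x in gauss_max_law B. \<bar>x\<bar> \<le> x" using w_nonneg by eventually_elim simp
    show "integrable (gauss_max_law B) (\<lambda>x. exp (B * x))"
      by (rule integrable_cong_AE_imp[OF int _ ae]) measurable
  qed (use assms in \<open>auto\<close>)
  have "(\<integral>x. exp (B * x) \<partial>gauss_max_law B) = (\<integral>x. exp (B * max 0 x) \<partial>gauss_max_law B)"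
    by (rule integral_cong_AE[OF _ _ ae, symmetric]) measurable
  also have "\<dots> \<le> 1 / (1 - q)" by (rule exp_moment_w)
  also have "q = exp (- B\<^sup>2 / 2)" by (simp add: q_def integral_exp_shifted_normal)
  finally show "(\<integral>x. exp (B * x) \<partial>gauss_max_law B) \<le> 1 / (1 - exp (- B\<^sup>2 / 2))" .
qed

definition gauss_mgf :: "nat \<Rightarrow> real \<Rightarrow> complex \<Rightarrow> complex" where
  "gauss_mgf j B = exp_integrable.exp_mom (gauss_max_law B) (\<lambda>x. x) j"

lemma gauss_mgf_eq: "0 < B \<Longrightarrow> gauss_mgf j B u = (\<integral>x. of_real (x ^ j) * exp (u * of_real x) \<partial>gauss_max_law B)"
  unfolding gauss_mgf_def by (subst exp_integrable.exp_mom_def[OF gauss_exp_integrable(1)]) auto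

text \<open>The function R of the theorem at complex arguments.\<close>

definition rate_map :: "real \<Rightarrow> real \<Rightarrow> complex \<Rightarrow> complex" where
  "rate_map \<beta> \<phi> s = s / ((1 + of_real (\<beta> * \<phi>)) * (1 + (s + of_real \<beta>) * of_real \<phi>))"

text \<open>This explains the form of R: the map a \<mapsto> a / (1 + \<phi> a) takes \<beta> to B,
  and R(s) is the difference between the images of \<beta> + s and \<beta>.\<close>

lemma rate_map_mobius:
  assumes "1 + of_real \<phi> * (of_real \<beta> + s) \<noteq> 0" "1 + \<beta> * \<phi> \<noteq> 0"
  shows "of_real (\<beta> / (1 + \<beta> * \<phi>)) + rate_map \<beta> \<phi> s = (of_real \<beta> + s) / (1 + of_real \<phi> * (of_real \<beta> + s))"
proof -
  have ne: "1 + complex_of_real \<beta> * of_real \<phi> \<noteq> 0"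
    using assms(2) by (metis of_real_1 of_real_add of_real_eq_0_iff of_real_mult)
  have eq: "b / P + s / (P * Q) = (b + s) / Q" if "P = 1 + b * f" "Q = 1 + f * (b + s)" "P \<noteq> 0" "Q \<noteq> 0" for b f P Q :: complex
  proof -
    have "b / P + s / (P * Q) = (b * Q + s) / (P * Q)" using that(3,4) by (simp add: field_simps)
    also have "b * Q + s = (b + s) * P" by (simp add: that(1,2) algebra_simps)
    finally show ?thesis using that(3,4) by simp
  qed
  show ?thesis
    using eq[OF refl refl ne assms(1)] by (simp add: rate_map_def mult.commute add.commute)
qed

context tilted_walk
begin

text \<open>With c = \<open>bet n\<close> and scale sqrt n / sig, a single sample is tilted by
  exactly \<theta>. An additive error in the exponent is a relative error of the transform, hence
  the norm of the Gaussian transform as a factor in the bound.\<close>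

lemma laplace_comparison:
  assumes n: "2 \<le> n" and a2: "\<theta> \<le> a2 / sqrt (real n)"
    and small: "ca * a2\<^sup>2 \<le> real n / 2" "bmax a2 * C\<phi> \<le> sqrt (real n) / 2"
    and b1: "0 < b1" "bet n \<in> {b1..b2}"
    and pert: "transform_perturbation_bound b1 b2 \<eta> K"
    and eta: "\<bar>phi n\<bar> \<le> \<eta>" "C4 a2 / real n \<le> \<eta>"
    and K: "K * (C4 a2 / real n + (phi n)\<^sup>2) \<le> 1"
    and drift: "m ^ n < 1"
    and W: "steady_state_waiting_time (distr M borel V) (distr M borel U) n \<rho> N W"
    and s: "norm s \<le> b1 / 2" and re: "Re (- rate_map (bet n) (phi n) s) < Bn n"
    and ne: "1 + of_real (phi n) * (of_real (bet n) + s) \<noteq> 0"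
  shows "norm ((\<integral>\<omega>. exp (- s * of_real (sqrt (real n) / sig * W \<omega>)) \<partial>N) - gauss_mgf 0 (Bn n) (- rate_map (bet n) (phi n) s))
    \<le> 4 * norm (gauss_mgf 0 (Bn n) (- rate_map (bet n) (phi n) s)) * (K * (C4 a2 / real n + (phi n)\<^sup>2))"
    and "integrable N (\<lambda>\<omega>. exp (bet n * (sqrt (real n) / sig * W \<omega>)))"
proof -
  define c where "c = bet n"
  define u where "u = - s"
  let ?sc = "sqrt (real n) / sig"
  have n1: "1 \<le> n" and n0: "0 < real n" using n by auto
  have c0: "0 < c" using b1 by (simp add: c_def)
  have u: "Re u < c"
  proof -
    have "Re u \<le> norm s" using complex_Re_le_cmod[of u] by (simp add: u_def)
    then show ?thesis using s b1 by (simp add: c_def)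
  qed
  have csn: "c * ?sc / real n = \<theta>"
    using n0 sig_bounds(1) by (simp add: c_def bet_def real_sqrt_mult_self mult.assoc)
  have le: "c * ?sc / real n \<le> \<delta>\<^sub>0"
    unfolding csn using \<theta> delta1_bounds(2) r0_pos by (simp add: r\<^sub>0_def)
  have dr: "mgf \<rho> (c * ?sc / real n) ^ n < 1"
    unfolding csn mgf_mom using drift by (simp add: m_def)
  have sc0: "0 < ?sc" using n0 sig_bounds(1) by simp
  have \<rho>0: "0 < \<rho>" using \<rho> by simp
  define z where "z = (\<lambda>t. psi M V U \<rho> ((of_real c + \<i> * of_real t) * of_real ?sc / of_nat n) ^ n)"
  note wt = wait_transform[OF n1 \<rho>0 sc0 c0 le dr W u, folded z_def]
  have z_eq: "z t = psi M V U \<rho> (Complex \<theta> (t / (sig * sqrt (real n)))) ^ n" for t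
  proof -
    have "t * ?sc / real n = t / (sig * sqrt (real n))"
      using n0 sig_bounds(1) by (simp add: field_simps)
    moreover have "(of_real c + \<i> * of_real t) * of_real ?sc / of_nat n = Complex (c * ?sc / real n) (t * ?sc / real n)"
      by (simp add: complex_eq_iff)
    ultimately show ?thesis unfolding z_def csn by (simp only: csn)
  qed
  have near: "norm (z t - of_real (gauss_tilt (c / (1 + c * phi n)) t) * (1 - \<i> * of_real (phi n * t ^ 3))) \<le> C4 a2 / real n" for t
    using psi_power[OF n a2 small, of t] unfolding z_eq by (simp only: Bn_def c_def)
  have C4n: "0 \<le> C4 a2 / real n" using near[of 0] norm_ge_zero order_trans by blast
  have zm: "z \<in> borel_measurable borel" by (rule wt(4))
  define a where "a = of_real c - u"
  have a_near: "norm (a - of_real c) \<le> b1 / 2" using s by (simp add: a_def u_def)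
  define B where "B = Bn n"
  have B_eq: "B = c / (1 + c * phi n)" by (simp add: B_def Bn_def c_def)
  have half: "\<bar>bet n * phi n\<bar> \<le> 1 / 2" by (rule m_power(2)[OF n1 a2 small])
  have den: "1 / 2 \<le> 1 + c * phi n" using half by (auto simp: c_def abs_le_iff)
  have B0: "0 < B" unfolding B_eq using c0 den by simp
  define w1 where "w1 = (\<integral>t. - Ln (1 - z t) * resolvent_diff a (of_real c) t \<partial>lborel)"
  define w2 where "w2 = (\<integral>t. of_real (gauss_log B t) * resolvent_diff (a / (1 + of_real (phi n) * a)) (of_real B) t \<partial>lborel)"
  have diff: "norm (w1 - w2) \<le> K * (C4 a2 / real n + (phi n)\<^sup>2)"
    unfolding w1_def w2_def B_eq
    by (rule pert[unfolded transform_perturbation_bound_def, rule_format, OF _ eta(1) C4n eta(2) zm near a_near])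
      (use b1 in \<open>simp add: c_def\<close>)
  have F: "(\<integral>\<omega>. exp (- s * of_real (?sc * W \<omega>)) \<partial>N) = exp (w1 / (2 * pi))"
    unfolding w1_def a_def u_def z_def by (rule wt(1)[unfolded u_def z_def])
  have shift: "of_real B - (- rate_map (bet n) (phi n) s) = a / (1 + of_real (phi n) * a)"
    using rate_map_mobius[OF ne] den by (simp add: B_eq a_def u_def c_def)
  have logs: "- Ln (1 - of_real (exp (- B\<^sup>2 / 2 - t\<^sup>2 / 2))) = of_real (gauss_log B t)" for t
    using gauss_log_bounds(4)[OF B0 order_refl, of t] by (simp only: gauss_tilt_def)
  have G: "gauss_mgf 0 B (- rate_map (bet n) (phi n) s) = exp (w2 / (2 * pi))"
  proof -
    have "gauss_mgf 0 B (- rate_map (bet n) (phi n) s) = (\<integral>x. exp (- rate_map (bet n) (phi n) s * of_real x) \<partial>gauss_max_law B)"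
      by (simp add: gauss_mgf_eq[OF B0])
    also have "\<dots> = exp (w2 / (2 * pi))"
      unfolding w2_def gauss_max_transform[OF B0 re[folded B_def]] logs shift ..
    finally show ?thesis .
  qed
  define v where "v = (w1 - w2) / (2 * pi)"
  have nv: "norm v \<le> K * (C4 a2 / real n + (phi n)\<^sup>2)"
  proof -
    have "norm v = norm (w1 - w2) / (2 * pi)" by (simp add: v_def norm_divide)
    also have "\<dots> \<le> norm (w1 - w2) / 1" using pi_ge_two by (intro divide_left_mono) auto
    finally show ?thesis using diff by simp
  qed
  have "exp (w1 / (2 * pi)) = exp (w2 / (2 * pi)) * exp v"
    by (simp add: v_def diff_divide_distrib flip: exp_add)
  then have "(\<integral>\<omega>. exp (- s * of_real (?sc * W \<omega>)) \<partial>N) - gauss_mgf 0 B (- rate_map (bet n) (phi n) s)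
      = gauss_mgf 0 B (- rate_map (bet n) (phi n) s) * (exp v - 1)"
    unfolding F G by (simp add: algebra_simps)
  then have "norm ((\<integral>\<omega>. exp (- s * of_real (?sc * W \<omega>)) \<partial>N) - gauss_mgf 0 B (- rate_map (bet n) (phi n) s))
      = norm (gauss_mgf 0 B (- rate_map (bet n) (phi n) s)) * norm (exp v - 1)" by (simp only: norm_mult)
  also have "\<dots> \<le> norm (gauss_mgf 0 B (- rate_map (bet n) (phi n) s)) * (4 * (K * (C4 a2 / real n + (phi n)\<^sup>2)))"
    using norm_exp_minus_1_le[of v] nv K by (intro mult_left_mono) auto
  finally show "norm ((\<integral>\<omega>. exp (- s * of_real (?sc * W \<omega>)) \<partial>N) - gauss_mgf 0 (Bn n) (- rate_map (bet n) (phi n) s))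
    \<le> 4 * norm (gauss_mgf 0 (Bn n) (- rate_map (bet n) (phi n) s)) * (K * (C4 a2 / real n + (phi n)\<^sup>2))"
    by (simp only: B_def mult.assoc mult.left_commute[of "norm (gauss_mgf 0 (Bn n) (- rate_map (bet n) (phi n) s))" 4])
  show "integrable N (\<lambda>\<omega>. exp (bet n * (?sc * W \<omega>)))" using wt(2) by (simp add: c_def)
qed

end

section \<open>Comparison of moments\<close>

context exp_integrable
begin

lemma exp_mom_holomorphic: "exp_mom j holomorphic_on ball 0 r"
  unfolding holomorphic_on_open[OF open_ball]
  using exp_mom_has_field_derivative[where 'b = complex] by (metis mem_ball_0)

lemma exp_mom_scaled:
  assumes x: "\<bar>x\<bar> * R < r" "0 < R"
  shows "(\<lambda>s. exp_mom j (of_real x * s :: complex)) holomorphic_on ball 0 R"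
    and "(deriv ^^ k) (\<lambda>s. exp_mom j (of_real x * s :: complex)) 0 = of_real (x ^ k * (\<integral>\<omega>. X \<omega> ^ (j + k) \<partial>M))"
proof -
  have img: "of_real x * s \<in> ball 0 r" if "s \<in> ball 0 R" for s :: complex
  proof -
    have "norm (of_real x * s) \<le> \<bar>x\<bar> * R" using that by (simp add: norm_mult mult_left_mono)
    then show ?thesis using x by simp
  qed
  show "(\<lambda>s. exp_mom j (of_real x * s :: complex)) holomorphic_on ball 0 R"
    using holomorphic_on_compose_gen[OF holomorphic_on_linear exp_mom_holomorphic image_subsetI[OF img]]
    by (simp only: comp_def)
  have "(deriv ^^ k) (\<lambda>s. exp_mom j (of_real x * s :: complex)) 0 = of_real x ^ k * (deriv ^^ k) (exp_mom j) (of_real x * 0)"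
    by (rule higher_deriv_compose_linear[OF exp_mom_holomorphic open_ball[of 0 R] open_ball]) (use img x in auto)
  then show "(deriv ^^ k) (\<lambda>s. exp_mom j (of_real x * s :: complex)) 0 = of_real (x ^ k * (\<integral>\<omega>. X \<omega> ^ (j + k) \<partial>M))"
    using r_pos by (simp add: higher_deriv_exp_mom exp_mom_0)
qed

end

lemma gauss_mgf_scaled_higher_deriv:
  assumes B: "0 < B" and x: "\<bar>x\<bar> * r < B" "0 < r"
  shows "(\<lambda>s. gauss_mgf j B (of_real x * s)) holomorphic_on ball 0 r"
    and "(deriv ^^ k) (\<lambda>s. gauss_mgf j B (of_real x * s)) 0 = of_real (x ^ k * gauss_max_moment (j + k) B)"
proof -
  interpret exp_integrable "gauss_max_law B" "\<lambda>x. x" "\<lambda>x. x" B by (rule gauss_exp_integrable[OF B])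
  show "(\<lambda>s. gauss_mgf j B (of_real x * s)) holomorphic_on ball 0 r"
    unfolding gauss_mgf_def by (rule exp_mom_scaled(1)[OF x])
  show "(deriv ^^ k) (\<lambda>s. gauss_mgf j B (of_real x * s)) 0 = of_real (x ^ k * gauss_max_moment (j + k) B)"
    unfolding gauss_mgf_def gauss_max_integrals by (rule exp_mom_scaled(2)[OF x])
qed

text \<open>Taylor expansion to first order in \<open>\<phi>\<close>: with \<open>c = 1 / (1 + \<beta> \<phi>)\<close> the rate is \<open>R(s) = c\<^sup>2 s / (1 + c \<phi> s)\<close>.\<close>

definition gauss_rate_approx :: "real \<Rightarrow> real \<Rightarrow> complex \<Rightarrow> complex" where
  "gauss_rate_approx \<beta> \<phi> s = (let c = 1 / (1 + \<beta> * \<phi>); B = \<beta> * c in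
     gauss_mgf 0 B (of_real (- c\<^sup>2) * s) + of_real (c ^ 3 * \<phi>) * (s * (s * gauss_mgf 1 B (of_real (- c\<^sup>2) * s))))"

text \<open>The factor s^2 consumes two derivatives and yields k (k - 1), while
  \<open>gauss_mgf 1\<close> raises the moment index k - 2 back to k - 1. For k = 1 the truncated
  \<open>k - 2\<close> is masked by the factor k - 1 = 0.\<close>

lemma gauss_rate_approx_higher_deriv:
  assumes \<beta>: "0 < \<beta>" and \<phi>: "\<bar>\<beta> * \<phi>\<bar> \<le> 1 / 2" and r: "0 < r" "r \<le> \<beta> / 20" and k: "1 \<le> k"
  defines "B \<equiv> \<beta> / (1 + \<beta> * \<phi>)"
  shows "gauss_rate_approx \<beta> \<phi> holomorphic_on ball 0 r"
    and "(- 1) ^ k * (deriv ^^ k) (gauss_rate_approx \<beta> \<phi>) 0 =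
      of_real (gauss_max_moment k B / (1 + \<beta> * \<phi>) ^ (2 * k)
        + real k * (real k - 1) * gauss_max_moment (k - 1) B * \<phi> / (1 + \<beta> * \<phi>) ^ (2 * k - 1))"
proof -
  define c where "c = 1 / (1 + \<beta> * \<phi>)"
  have d: "1 / 2 \<le> 1 + \<beta> * \<phi>" using \<phi> by (auto simp: abs_le_iff)
  have c: "0 < c" "c \<le> 2" using d by (auto simp: c_def field_simps)
  have B_eq: "B = \<beta> * c" by (simp add: B_def c_def)
  have B: "0 < B" using c \<beta> by (simp add: B_eq)
  have "c * (c * r) \<le> c * (2 * (\<beta> / 20))" using c r \<beta> by (intro mult_left_mono mult_mono) auto
  also have "\<dots> < c * \<beta>" using c \<beta> by simp
  finally have x: "\<bar>- c\<^sup>2\<bar> * r < B" by (simp add: B_eq power2_eq_square mult_ac)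
  define g0 where "g0 = (\<lambda>s. gauss_mgf 0 B (of_real (- c\<^sup>2) * s))"
  define g1 where "g1 = (\<lambda>s. gauss_mgf 1 B (of_real (- c\<^sup>2) * s))"
  note h0 = gauss_mgf_scaled_higher_deriv[OF B x r(1), where j = 0, folded g0_def]
  note h1 = gauss_mgf_scaled_higher_deriv[OF B x r(1), where j = 1, folded g1_def]
  have eq: "gauss_rate_approx \<beta> \<phi> = (\<lambda>s. g0 s + of_real (c ^ 3 * \<phi>) * (s * (s * g1 s)))"
    by (rule ext) (simp add: gauss_rate_approx_def Let_def g0_def g1_def B_eq c_def)
  have hol1: "(\<lambda>s. s * g1 s) holomorphic_on ball 0 r" and hol2: "(\<lambda>s. s * (s * g1 s)) holomorphic_on ball 0 r"
    using h1(1) by (auto intro!: holomorphic_intros)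
  have hol3: "(\<lambda>s. of_real (c ^ 3 * \<phi>) * (s * (s * g1 s))) holomorphic_on ball 0 r"
    by (rule holomorphic_on_mult[OF holomorphic_on_const hol2])
  show "gauss_rate_approx \<beta> \<phi> holomorphic_on ball 0 r"
    unfolding eq by (intro holomorphic_on_add h0(1) hol3)
  have z: "0 \<in> ball (0::complex) r" using r by simp
  have d3: "(deriv ^^ k) (\<lambda>s. of_real (c ^ 3 * \<phi>) * (s * (s * g1 s))) 0 =
      of_real (c ^ 3 * \<phi>) * (of_nat k * (of_nat (k - 1) * of_real ((- c\<^sup>2) ^ (k - 2) * gauss_max_moment (1 + (k - 2)) B)))"
    unfolding higher_deriv_cmult[OF hol2 z open_ball]
      higher_deriv_ident_mult[OF hol1 open_ball z] higher_deriv_ident_mult[OF h1(1) open_ball z] h1(2)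
    by (simp add: numeral_2_eq_2)
  have "(deriv ^^ k) (gauss_rate_approx \<beta> \<phi>) 0 = of_real ((- c\<^sup>2) ^ k * gauss_max_moment k B)
      + of_real (c ^ 3 * \<phi>) * (of_nat k * (of_nat (k - 1) * of_real ((- c\<^sup>2) ^ (k - 2) * gauss_max_moment (1 + (k - 2)) B)))"
    unfolding eq higher_deriv_add[OF h0(1) hol3 open_ball z] d3 h0(2) by simp
  also have "\<dots> = of_real ((- c\<^sup>2) ^ k * gauss_max_moment k B
      + c ^ 3 * \<phi> * (real k * (real (k - 1) * ((- c\<^sup>2) ^ (k - 2) * gauss_max_moment (1 + (k - 2)) B))))"
    by simp
  finally have D: "(- 1) ^ k * (deriv ^^ k) (gauss_rate_approx \<beta> \<phi>) 0 = of_real ((- 1) ^ k * ((- c\<^sup>2) ^ k * gauss_max_moment k B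
      + c ^ 3 * \<phi> * (real k * (real (k - 1) * ((- c\<^sup>2) ^ (k - 2) * gauss_max_moment (1 + (k - 2)) B)))))"
    by simp
  have p: "c ^ j = 1 / (1 + \<beta> * \<phi>) ^ j" for j by (simp add: c_def power_divide)
  have "(- 1) ^ k * ((- c\<^sup>2) ^ k * gauss_max_moment k B
      + c ^ 3 * \<phi> * (real k * (real (k - 1) * ((- c\<^sup>2) ^ (k - 2) * gauss_max_moment (1 + (k - 2)) B)))) =
      c ^ (2 * k) * gauss_max_moment k B + real k * (real k - 1) * gauss_max_moment (k - 1) B * \<phi> * c ^ (2 * k - 1)"
  proof (cases "k = 1")
    case False
    then obtain j where j: "k = Suc (Suc j)" using k by (metis One_nat_def Suc_le_D old.nat.exhaust)
    have sgn: "(- 1) ^ i * (- c\<^sup>2) ^ i = c ^ (2 * i)" for i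
      by (metis mult_minus1 minus_minus power_mult power_mult_distrib)
    have "(- 1) ^ k * (c ^ 3 * \<phi> * (real k * (real (k - 1) * ((- c\<^sup>2) ^ (k - 2) * gauss_max_moment (1 + (k - 2)) B)))) =
        c ^ 3 * ((- 1) ^ j * (- c\<^sup>2) ^ j) * \<phi> * real k * (real k - 1) * gauss_max_moment (k - 1) B"
      by (simp add: j mult_ac)
    also have "c ^ 3 * ((- 1) ^ j * (- c\<^sup>2) ^ j) = c ^ (2 * k - 1)"
      unfolding sgn by (simp add: j power3_eq_cube mult.assoc)
    finally show ?thesis using sgn[of k] by (simp add: distrib_left mult_ac)
  qed (simp add: power2_eq_square)
  then show "(- 1) ^ k * (deriv ^^ k) (gauss_rate_approx \<beta> \<phi>) 0 =
      of_real (gauss_max_moment k B / (1 + \<beta> * \<phi>) ^ (2 * k)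
        + real k * (real k - 1) * gauss_max_moment (k - 1) B * \<phi> / (1 + \<beta> * \<phi>) ^ (2 * k - 1))"
    unfolding D p by simp
qed

text \<open>The rate is c^2 s / (1 + e) with c = 1 / (1 + \<beta> \<phi>) and e = c \<phi> s. The
  radius b1 / 20 gives |e| \<le> 1 / 20, and the estimates are those of the first terms of a
  geometric series in e.\<close>

lemma rate_map_bounds:
  assumes b1: "0 < b1" "b1 \<le> \<beta>" and \<phi>: "\<bar>\<beta> * \<phi>\<bar> \<le> 1 / 2" and s: "norm s < b1 / 20"
  shows "norm (rate_map \<beta> \<phi> s) \<le> b1 / 4" "1 + of_real \<phi> * (of_real \<beta> + s) \<noteq> 0" "b1 / 2 \<le> \<beta> / (1 + \<beta> * \<phi>)"
    and "norm (of_real (- (1 / (1 + \<beta> * \<phi>))\<^sup>2) * s) + norm (- rate_map \<beta> \<phi> s - of_real (- (1 / (1 + \<beta> * \<phi>))\<^sup>2) * s) \<le> b1 / 4"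
    and "norm (- rate_map \<beta> \<phi> s - of_real (- (1 / (1 + \<beta> * \<phi>))\<^sup>2) * s) \<le> b1\<^sup>2 * \<bar>\<phi>\<bar>"
    and "norm (- rate_map \<beta> \<phi> s - of_real (- (1 / (1 + \<beta> * \<phi>))\<^sup>2) * s - of_real ((1 / (1 + \<beta> * \<phi>)) ^ 3 * \<phi>) * s\<^sup>2) \<le> b1 ^ 3 * \<phi>\<^sup>2"
proof -
  define d where "d = 1 + \<beta> * \<phi>"
  define c where "c = 1 / d"
  have d: "1 / 2 \<le> d" "d \<le> 3 / 2" using \<phi> by (auto simp: abs_le_iff d_def)
  have c: "0 < c" "c \<le> 2" "2 / 3 \<le> c" using d by (auto simp: c_def field_simps)
  have "\<beta> * 2 / 3 \<le> \<beta> / d" using c b1 by (simp add: c_def field_simps)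
  then show "b1 / 2 \<le> \<beta> / (1 + \<beta> * \<phi>)" using b1 by (simp add: d_def)
  let ?p = "complex_of_real \<phi>" and ?c = "complex_of_real c"
  define e where "e = ?c * ?p * s"
  have "\<bar>\<phi>\<bar> * norm s \<le> \<bar>\<phi>\<bar> * (\<beta> / 20)" using s b1 by (intro mult_left_mono) auto
  also have "\<dots> \<le> 1 / 40" using \<phi> b1 by (simp add: abs_mult mult.commute)
  finally have ps: "\<bar>\<phi>\<bar> * norm s \<le> 1 / 40" .
  have "norm e = c * (\<bar>\<phi>\<bar> * norm s)" using c by (simp add: e_def norm_mult)
  also have "\<dots> \<le> 2 * (1 / 40)" using ps c by (intro mult_mono) auto
  finally have e: "norm e \<le> 1 / 20" by simp
  have e1: "19 / 20 \<le> norm (1 + e)" using norm_diff_ineq[of 1 e] e by simp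
  then have e0: "1 + e \<noteq> 0" by auto
  have dd: "1 + ?p * (of_real \<beta> + s) = of_real d * (1 + e)"
  proof -
    have "complex_of_real d \<noteq> 0" using d by auto
    then have "of_real d * (1 + e) = of_real d + ?p * s" by (simp add: e_def c_def distrib_left)
    then show ?thesis by (simp add: d_def algebra_simps)
  qed
  then show "1 + of_real \<phi> * (of_real \<beta> + s) \<noteq> 0" using e0 d by auto
  have "rate_map \<beta> \<phi> s = s / (of_real d * (1 + ?p * (of_real \<beta> + s)))"
    by (simp add: rate_map_def d_def mult_ac add_ac)
  then have R: "rate_map \<beta> \<phi> s = of_real (c\<^sup>2) * s / (1 + e)"
    unfolding dd using d by (simp add: c_def power2_eq_square field_simps)
  have c2: "c\<^sup>2 \<le> 4" using power_mono[OF c(2), of 2] c(1) by simp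
  have c3: "c ^ 3 \<le> 8" using power_mono[OF c(2), of 3] c(1) by simp
  have c4: "c ^ 4 \<le> 16" using power_mono[OF c(2), of 4] c(1) by simp
  have ns: "c\<^sup>2 * norm s \<le> b1 / 5"
  proof -
    have "c\<^sup>2 * norm s \<le> 4 * (b1 / 20)" using c2 s by (intro mult_mono) auto
    then show ?thesis by simp
  qed
  have "norm (rate_map \<beta> \<phi> s) = c\<^sup>2 * norm s / norm (1 + e)" by (simp add: R norm_divide norm_mult norm_power)
  also have "\<dots> \<le> (b1 / 5) / (19 / 20)" using ns e1 b1 by (intro frac_le) auto
  finally show "norm (rate_map \<beta> \<phi> s) \<le> b1 / 4" using b1 by simp
  define h where "h = - rate_map \<beta> \<phi> s - of_real (- c\<^sup>2) * s"
  have h: "h = of_real (c ^ 3) * ?p * s\<^sup>2 / (1 + e)"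
    unfolding h_def R using e0 by (simp add: field_simps) (simp add: e_def power2_eq_square power3_eq_cube algebra_simps)
  have h2: "norm h \<le> b1 / 20"
  proof -
    have "norm h = norm e * (c\<^sup>2 * norm s) / norm (1 + e)"
      using c by (simp add: h e_def norm_divide norm_mult norm_power power2_eq_square power3_eq_cube)
    also have "\<dots> \<le> (1 / 20 * (b1 / 5)) / (19 / 20)" using ns e e1 b1 by (intro frac_le mult_mono) auto
    finally show ?thesis using b1 by simp
  qed
  have cd: "1 / (1 + \<beta> * \<phi>) = c" by (simp add: c_def d_def)
  show "norm (of_real (- (1 / (1 + \<beta> * \<phi>))\<^sup>2) * s) + norm (- rate_map \<beta> \<phi> s - of_real (- (1 / (1 + \<beta> * \<phi>))\<^sup>2) * s) \<le> b1 / 4"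
    unfolding cd h_def[symmetric] using h2 ns by (simp add: norm_mult norm_power)
  have "norm h = c ^ 3 * \<bar>\<phi>\<bar> * (norm s)\<^sup>2 / norm (1 + e)"
    using c by (simp add: h norm_divide norm_mult norm_power)
  also have "\<dots> \<le> 8 * \<bar>\<phi>\<bar> * (b1 / 20)\<^sup>2 / (19 / 20)"
    using c3 s e1 b1 c by (intro frac_le mult_mono power_mono) auto
  also have "\<dots> = b1\<^sup>2 * \<bar>\<phi>\<bar> * (2 / 95)" by (simp add: power2_eq_square)
  also have "\<dots> \<le> b1\<^sup>2 * \<bar>\<phi>\<bar>" by (rule mult_left_le) auto
  finally show "norm (- rate_map \<beta> \<phi> s - of_real (- (1 / (1 + \<beta> * \<phi>))\<^sup>2) * s) \<le> b1\<^sup>2 * \<bar>\<phi>\<bar>"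
    unfolding cd h_def[symmetric] .
  have "h - of_real (c ^ 3 * \<phi>) * s\<^sup>2 = - of_real (c ^ 4) * ?p\<^sup>2 * s ^ 3 / (1 + e)"
    unfolding h using e0 by (simp add: field_simps) (simp add: e_def power2_eq_square power3_eq_cube power4_eq_xxxx algebra_simps)
  then have "norm (h - of_real (c ^ 3 * \<phi>) * s\<^sup>2) = c ^ 4 * \<phi>\<^sup>2 * norm s ^ 3 / norm (1 + e)"
    using c by (simp add: norm_divide norm_mult norm_power)
  also have "\<dots> \<le> 16 * \<phi>\<^sup>2 * (b1 / 20) ^ 3 / (19 / 20)"
    using c4 s e1 b1 c by (intro frac_le mult_mono power_mono order_refl zero_le_power2) auto
  also have "\<dots> = b1 ^ 3 * \<phi>\<^sup>2 * (1 / 475)" by (simp add: power_divide)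
  also have "\<dots> \<le> b1 ^ 3 * \<phi>\<^sup>2" using b1 by (intro mult_left_le) auto
  finally show "norm (- rate_map \<beta> \<phi> s - of_real (- (1 / (1 + \<beta> * \<phi>))\<^sup>2) * s - of_real ((1 / (1 + \<beta> * \<phi>)) ^ 3 * \<phi>) * s\<^sup>2) \<le> b1 ^ 3 * \<phi>\<^sup>2"
    unfolding cd h_def[symmetric] .
qed

text \<open>Write - R(s) = u + h with u = - c^2 s. Then h is O(\<phi>) and equals c^3 \<phi> s^2 up
  to O(\<phi>^2), so a first-order expansion of the transform at u leaves O(\<phi>^2). The constant
  is uniform because arguments stay within b1 / 4 while the transform of the maximum exists up to B
  \<ge> b1 / 2.\<close>

lemma gauss_rate_expansion:
  assumes b1: "0 < b1"
  obtains K where "0 \<le> K"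
    and "\<And>\<beta> \<phi> s. \<lbrakk>b1 \<le> \<beta>; \<bar>\<beta> * \<phi>\<bar> \<le> 1 / 2; norm s < b1 / 20\<rbrakk> \<Longrightarrow>
      norm (gauss_mgf 0 (\<beta> / (1 + \<beta> * \<phi>)) (- rate_map \<beta> \<phi> s)) \<le> K \<and>
      norm (gauss_mgf 0 (\<beta> / (1 + \<beta> * \<phi>)) (- rate_map \<beta> \<phi> s) - gauss_rate_approx \<beta> \<phi> s) \<le> K * \<phi>\<^sup>2"
proof -
  define A where "A = 1 / (1 - exp (- (b1 / 2)\<^sup>2 / 2))"
  have A: "0 \<le> A" using b1 by (simp add: A_def)
  define K1 where "K1 = 2 / (b1 / 4)\<^sup>2 * A"
  define K2 where "K2 = 1 / (b1 / 4) * A"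
  have K12: "0 \<le> K1" "0 \<le> K2" using A b1 by (auto simp: K1_def K2_def)
  define K where "K = A + (b1\<^sup>2)\<^sup>2 * K1 + b1 ^ 3 * K2"
  have K: "0 \<le> K" "A \<le> K" "(b1\<^sup>2)\<^sup>2 * K1 + b1 ^ 3 * K2 \<le> K" using K12 A b1 by (auto simp: K_def)
  show ?thesis
  proof (rule that[OF K(1)])
    fix \<beta> \<phi> :: real and s :: complex
    assume \<beta>: "b1 \<le> \<beta>" and \<phi>: "\<bar>\<beta> * \<phi>\<bar> \<le> 1 / 2" and s: "norm s < b1 / 20"
    note rb = rate_map_bounds[OF b1 \<beta> \<phi> s]
    define c where "c = 1 / (1 + \<beta> * \<phi>)"
    define B where "B = \<beta> / (1 + \<beta> * \<phi>)"
    define u where "u = of_real (- c\<^sup>2) * s"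
    define h where "h = - rate_map \<beta> \<phi> s - u"
    have B_le: "b1 / 2 \<le> B" using rb(3) by (simp only: B_def)
    then have B: "0 < B" using b1 by linarith
    interpret exp_integrable "gauss_max_law B" "\<lambda>x. x" "\<lambda>x. x" B by (rule gauss_exp_integrable[OF B])
    define I where "I = (\<integral>x. exp (B * x) \<partial>gauss_max_law B)"
    have I0: "0 \<le> I" unfolding I_def by (rule integral_nonneg_AE) auto
    have "I \<le> 1 / (1 - exp (- B\<^sup>2 / 2))" unfolding I_def by (rule gauss_exp_integrable(2)[OF B])
    also have "\<dots> \<le> A" unfolding A_def
    proof (rule divide_left_mono)
      have "(b1 / 2)\<^sup>2 \<le> B\<^sup>2" using B_le b1 by (intro power_mono) auto
      then show "1 - exp (- (b1 / 2)\<^sup>2 / 2) \<le> 1 - exp (- B\<^sup>2 / 2)" by simp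
    qed (use b1 B in auto)
    finally have I: "I \<le> A" .
    have lt: "b1 / 4 < B" using B_le b1 by simp
    have gap: "b1 / 4 \<le> B - b1 / 4" using B_le by simp
    have uh: "norm u + norm h \<le> b1 / 4" using rb(4) by (simp only: u_def h_def c_def)
    have "norm (gauss_mgf 0 B (- rate_map \<beta> \<phi> s)) \<le> fact 0 / (B - b1 / 4) ^ 0 * I"
      unfolding gauss_mgf_def I_def by (rule norm_exp_mom_le[OF _ lt]) (use rb(1) in simp)
    then have first: "norm (gauss_mgf 0 B (- rate_map \<beta> \<phi> s)) \<le> K" using I K by simp
    have "norm (gauss_mgf 0 B (u + h) - gauss_mgf 0 B u - h * gauss_mgf (Suc 0) B u)
        \<le> (norm h)\<^sup>2 * (fact (0 + 2) / (B - b1 / 4) ^ (0 + 2) * I)"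
      unfolding gauss_mgf_def I_def by (rule exp_mom_second_order[OF uh lt])
    also have "\<dots> \<le> (b1\<^sup>2 * \<bar>\<phi>\<bar>)\<^sup>2 * (2 / (b1 / 4)\<^sup>2 * A)"
      using rb(5)[folded c_def, folded u_def, folded h_def] gap b1 I I0
      by (intro mult_mono power_mono frac_le) (auto simp: fact_numeral numeral_2_eq_2 simp del: power_Suc intro: power_mono)
    finally have t1: "norm (gauss_mgf 0 B (u + h) - gauss_mgf 0 B u - h * gauss_mgf 1 B u) \<le> (b1\<^sup>2)\<^sup>2 * K1 * \<phi>\<^sup>2"
      by (simp add: K1_def power_mult_distrib mult_ac)
    have "norm (gauss_mgf 1 B u) \<le> fact 1 / (B - b1 / 4) ^ 1 * I"
      unfolding gauss_mgf_def I_def by (rule norm_exp_mom_le[OF _ lt]) (use uh norm_ge_zero[of h] in linarith)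
    also have "\<dots> \<le> 1 / (b1 / 4) * A" using gap b1 I I0 by (intro mult_mono frac_le) auto
    finally have g1: "norm (gauss_mgf 1 B u) \<le> K2" by (simp add: K2_def)
    have "norm ((h - of_real (c ^ 3 * \<phi>) * s\<^sup>2) * gauss_mgf 1 B u) \<le> (b1 ^ 3 * \<phi>\<^sup>2) * K2"
      unfolding norm_mult
      using rb(6)[folded c_def, folded u_def, folded h_def] g1 b1 by (intro mult_mono) auto
    then have t2: "norm ((h - of_real (c ^ 3 * \<phi>) * s\<^sup>2) * gauss_mgf 1 B u) \<le> b1 ^ 3 * K2 * \<phi>\<^sup>2" by (simp only: mult_ac)
    have ap: "gauss_rate_approx \<beta> \<phi> s = gauss_mgf 0 B u + of_real (c ^ 3 * \<phi>) * (s * (s * gauss_mgf 1 B u))"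
      by (simp add: gauss_rate_approx_def Let_def u_def c_def B_def)
    have uh': "- rate_map \<beta> \<phi> s = u + h" by (simp add: h_def)
    have "gauss_mgf 0 B (- rate_map \<beta> \<phi> s) - gauss_rate_approx \<beta> \<phi> s =
        (gauss_mgf 0 B (u + h) - gauss_mgf 0 B u - h * gauss_mgf 1 B u) + (h - of_real (c ^ 3 * \<phi>) * s\<^sup>2) * gauss_mgf 1 B u"
      unfolding ap uh' by (simp add: algebra_simps power2_eq_square)
    then have "norm (gauss_mgf 0 B (- rate_map \<beta> \<phi> s) - gauss_rate_approx \<beta> \<phi> s) \<le> (b1\<^sup>2)\<^sup>2 * K1 * \<phi>\<^sup>2 + b1 ^ 3 * K2 * \<phi>\<^sup>2"
      using norm_triangle_le[OF add_mono[OF t1 t2]] by (simp only:)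
    also have "\<dots> = ((b1\<^sup>2)\<^sup>2 * K1 + b1 ^ 3 * K2) * \<phi>\<^sup>2" by (simp only: distrib_right)
    also have "\<dots> \<le> K * \<phi>\<^sup>2" using K(3) by (intro mult_right_mono) auto
    finally have "norm (gauss_mgf 0 B (- rate_map \<beta> \<phi> s) - gauss_rate_approx \<beta> \<phi> s) \<le> K * \<phi>\<^sup>2" .
    with first show "norm (gauss_mgf 0 (\<beta> / (1 + \<beta> * \<phi>)) (- rate_map \<beta> \<phi> s)) \<le> K \<and>
      norm (gauss_mgf 0 (\<beta> / (1 + \<beta> * \<phi>)) (- rate_map \<beta> \<phi> s) - gauss_rate_approx \<beta> \<phi> s) \<le> K * \<phi>\<^sup>2"
      unfolding B_def by blast
  qed
qed

lemma gauss_rate_holomorphic: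
  assumes b1: "0 < b1" and \<beta>: "b1 \<le> \<beta>" and \<phi>: "\<bar>\<beta> * \<phi>\<bar> \<le> 1 / 2"
  shows "(\<lambda>s. gauss_mgf 0 (\<beta> / (1 + \<beta> * \<phi>)) (- rate_map \<beta> \<phi> s)) holomorphic_on ball 0 (b1 / 20)"
proof -
  define B where "B = \<beta> / (1 + \<beta> * \<phi>)"
  note rb = rate_map_bounds[OF b1 \<beta> \<phi>]
  have B: "b1 / 2 \<le> B" using rb(3)[of 0] b1 by (simp add: B_def)
  interpret exp_integrable "gauss_max_law B" "\<lambda>x. x" "\<lambda>x. x" B by (rule gauss_exp_integrable) (use B b1 in linarith)
  have d: "1 / 2 \<le> 1 + \<beta> * \<phi>" using \<phi> by (auto simp: abs_le_iff)
  then have d': "1 + complex_of_real (\<beta> * \<phi>) \<noteq> 0" by (metis of_real_0 of_real_1 of_real_add of_real_eq_iff not_one_le_zero divide_le_0_1_iff zero_neq_numeral linorder_not_le zero_less_numeral)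
  have "(1 + complex_of_real (\<beta> * \<phi>)) * (1 + (s + complex_of_real \<beta>) * of_real \<phi>) \<noteq> 0" if "s \<in> ball 0 (b1 / 20)" for s
    using rb(2)[of s] that d' by (simp add: mult.commute add.commute)
  then have "(\<lambda>s. - rate_map \<beta> \<phi> s) holomorphic_on ball 0 (b1 / 20)"
    unfolding rate_map_def by (intro holomorphic_intros) auto
  moreover have "- rate_map \<beta> \<phi> s \<in> ball 0 B" if "s \<in> ball 0 (b1 / 20)" for s
    using rb(1)[of s] that B b1 by auto
  ultimately show ?thesis
    unfolding B_def[symmetric] gauss_mgf_def
    using holomorphic_on_compose_gen[OF _ exp_mom_holomorphic image_subsetI] by (simp only: comp_def)
qed

lemma gauss_rate_of_real:
  assumes "0 < B"
  shows "of_real (gauss_max_laplace B (x / ((1 + \<beta> * \<phi>) * (1 + (x + \<beta>) * \<phi>)))) = gauss_mgf 0 B (- rate_map \<beta> \<phi> (of_real x))"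
proof -
  have "rate_map \<beta> \<phi> (of_real x) = of_real (x / ((1 + \<beta> * \<phi>) * (1 + (x + \<beta>) * \<phi>)))"
    by (simp add: rate_map_def)
  then show ?thesis
    unfolding gauss_mgf_eq[OF assms] gauss_max_integrals
    by (subst integral_complex_of_real[symmetric]) (simp flip: exp_of_real)
qed

context tilted_walk
begin

text \<open>Cauchy's estimate on the circle of radius b1 / 40 turns uniform closeness of the
  transforms on the disc of radius b1 / 20 into closeness of their k-th derivatives at 0. The radius
  does not depend on n.\<close>

lemma moment_comparison:
  assumes n: "2 \<le> n" and a2: "\<theta> \<le> a2 / sqrt (real n)"
    and small: "ca * a2\<^sup>2 \<le> real n / 2" "bmax a2 * C\<phi> \<le> sqrt (real n) / 2"
    and b1: "0 < b1" "bet n \<in> {b1..b2}"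
    and pert: "transform_perturbation_bound b1 b2 \<eta> K"
    and eta: "\<bar>phi n\<bar> \<le> \<eta>" "C4 a2 / real n \<le> \<eta>"
    and K: "0 \<le> K" "0 \<le> C4 a2" "K * (C4 a2 / real n + (phi n)\<^sup>2) \<le> 1"
    and drift: "m ^ n < 1"
    and W: "steady_state_waiting_time (distr M borel V) (distr M borel U) n \<rho> N W"
    and K': "0 \<le> K'"
      "\<And>\<beta> \<phi> s. \<lbrakk>b1 \<le> \<beta>; \<bar>\<beta> * \<phi>\<bar> \<le> 1 / 2; norm s < b1 / 20\<rbrakk> \<Longrightarrow>
      norm (gauss_mgf 0 (\<beta> / (1 + \<beta> * \<phi>)) (- rate_map \<beta> \<phi> s)) \<le> K' \<and>
      norm (gauss_mgf 0 (\<beta> / (1 + \<beta> * \<phi>)) (- rate_map \<beta> \<phi> s) - gauss_rate_approx \<beta> \<phi> s) \<le> K' * \<phi>\<^sup>2"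
    and k: "1 \<le> k"
  defines "D \<equiv> (- 1) ^ k * (deriv ^^ k) (\<lambda>s. gauss_max_laplace (Bn n) (s / ((1 + bet n * phi n) * (1 + (s + bet n) * phi n)))) 0"
  shows "\<bar>(\<integral>\<omega>. (sqrt (real n) / sig * W \<omega>) ^ k \<partial>N) - D\<bar> \<le> fact k * (4 * K' * (K * (C4 a2 / real n + (phi n)\<^sup>2))) / (b1 / 20 / 2) ^ k"
    and "\<bar>D - (gauss_max_moment k (Bn n) / (1 + bet n * phi n) ^ (2 * k)
        + real k * (real k - 1) * gauss_max_moment (k - 1) (Bn n) * phi n / (1 + bet n * phi n) ^ (2 * k - 1))\<bar>
      \<le> fact k * (K' * (phi n)\<^sup>2) / (b1 / 20 / 2) ^ k"
proof -
  let ?Z = "\<lambda>\<omega>. sqrt (real n) / sig * W \<omega>"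
  define r where "r = b1 / 20"
  have r: "0 < r" using b1 by (simp add: r_def)
  have z: "0 \<in> ball (0::complex) r" using r by simp
  have \<beta>: "b1 \<le> bet n" using b1 by simp
  have half: "\<bar>bet n * phi n\<bar> \<le> 1 / 2" by (rule m_power(2)[OF _ a2 small]) (use n in simp)
  note rb = rate_map_bounds[OF b1(1) \<beta> half, folded Bn_def]
  note K'' = K'(2)[OF \<beta> half, folded r_def Bn_def]
  have B: "b1 / 2 \<le> Bn n" using rb(3)[of 0] b1 by simp
  have Bpos: "0 < Bn n" using B b1 by linarith
  have lc: "norm ((\<integral>\<omega>. exp (- s * of_real (?Z \<omega>)) \<partial>N) - gauss_mgf 0 (Bn n) (- rate_map (bet n) (phi n) s))
      \<le> 4 * norm (gauss_mgf 0 (Bn n) (- rate_map (bet n) (phi n) s)) * (K * (C4 a2 / real n + (phi n)\<^sup>2))"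
    "integrable N (\<lambda>\<omega>. exp (bet n * ?Z \<omega>))" if "norm s < r" for s
  proof -
    have "Re (- rate_map (bet n) (phi n) s) < Bn n"
      using complex_Re_le_cmod[of "- rate_map (bet n) (phi n) s"] rb(1)[of s] that B b1 by (simp add: r_def)
    note * = laplace_comparison[OF n a2 small b1 pert eta K(3) drift W _ this rb(2)]
    show "norm ((\<integral>\<omega>. exp (- s * of_real (?Z \<omega>)) \<partial>N) - gauss_mgf 0 (Bn n) (- rate_map (bet n) (phi n) s))
      \<le> 4 * norm (gauss_mgf 0 (Bn n) (- rate_map (bet n) (phi n) s)) * (K * (C4 a2 / real n + (phi n)\<^sup>2))"
      by (rule *(1)) (use that b1 in \<open>auto simp: r_def\<close>)
    show "integrable N (\<lambda>\<omega>. exp (bet n * ?Z \<omega>))"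
      by (rule *(2)) (use that b1 in \<open>auto simp: r_def\<close>)
  qed
  interpret Z: exp_integrable N ?Z ?Z "bet n"
  proof
    show "?Z \<in> borel_measurable N" using W by (auto simp: steady_state_waiting_time_def)
    have "AE \<omega> in N. 0 \<le> W \<omega>" using W by (simp add: steady_state_waiting_time_def)
    then show "AE \<omega> in N. \<bar>?Z \<omega>\<bar> \<le> ?Z \<omega>"
      by eventually_elim (use sig_bounds(1) in \<open>simp add: abs_mult\<close>)
    show "integrable N (\<lambda>\<omega>. exp (bet n * ?Z \<omega>))" using lc(2)[of 0] r by simp
  qed (use \<beta> b1 in linarith)
  \<comment> \<open>The argument is scaled by -1, which makes F a Laplace transform; its k-th
    derivative at 0 carries the sign (-1)^k.\<close>
  define F where "F = (\<lambda>s. Z.exp_mom 0 (of_real (- 1) * s :: complex))"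
  define \<Phi> where "\<Phi> = (\<lambda>s. gauss_mgf 0 (Bn n) (- rate_map (bet n) (phi n) s))"
  have lt: "\<bar>- 1\<bar> * r < bet n" using b1 \<beta> by (simp add: r_def)
  note F_hol = Z.exp_mom_scaled(1)[OF lt r, of 0, folded F_def]
  have F_deriv: "(deriv ^^ k) F 0 = of_real ((- 1) ^ k * (\<integral>\<omega>. ?Z \<omega> ^ k \<partial>N))"
    unfolding F_def Z.exp_mom_scaled(2)[OF lt r] by simp
  have \<Phi>_hol: "\<Phi> holomorphic_on ball 0 r"
    unfolding \<Phi>_def r_def Bn_def by (rule gauss_rate_holomorphic[OF b1(1) \<beta> half])
  have sq: "(- 1) ^ k * (- 1) ^ k = (1::real)" by (simp flip: power_mult_distrib)
  have D: "complex_of_real D = (- 1) ^ k * (deriv ^^ k) \<Phi> 0"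
    unfolding D_def of_real_mult
    using higher_deriv_of_real[OF \<Phi>_hol, of "\<lambda>x. gauss_max_laplace (Bn n) (x / ((1 + bet n * phi n) * (1 + (x + bet n) * phi n)))" 0 k]
      gauss_rate_of_real[OF Bpos] r by (simp add: \<Phi>_def)
  let ?e1 = "4 * K' * (K * (C4 a2 / real n + (phi n)\<^sup>2))"
  have "norm ((deriv ^^ k) (\<lambda>s. F s - \<Phi> s) 0) \<le> fact k * ?e1 / (r / 2) ^ k"
  proof (rule higher_deriv_bound[OF holomorphic_on_diff[OF F_hol \<Phi>_hol] r])
    fix s :: complex assume s: "norm s < r"
    have "norm (F s - \<Phi> s) \<le> 4 * norm (\<Phi> s) * (K * (C4 a2 / real n + (phi n)\<^sup>2))"
      using lc(1)[OF s] unfolding F_def \<Phi>_def Z.exp_mom_def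
      by (simp only: power_0 of_real_1 mult_1_left of_real_minus mult_minus1)
    also have "\<dots> \<le> ?e1"
      using K'' [OF s] K(1,2) by (intro mult_right_mono) (auto simp: \<Phi>_def)
    finally show "norm (F s - \<Phi> s) \<le> ?e1" .
  qed
  then have 1: "norm (of_real ((- 1) ^ k * (\<integral>\<omega>. ?Z \<omega> ^ k \<partial>N)) - (deriv ^^ k) \<Phi> 0) \<le> fact k * ?e1 / (r / 2) ^ k"
    unfolding higher_deriv_diff[OF F_hol \<Phi>_hol open_ball z] F_deriv .
  have "complex_of_real ((\<integral>\<omega>. ?Z \<omega> ^ k \<partial>N) - D) = (- 1) ^ k * (of_real ((- 1) ^ k * (\<integral>\<omega>. ?Z \<omega> ^ k \<partial>N)) - (deriv ^^ k) \<Phi> 0)"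
    unfolding of_real_diff D right_diff_distrib by (simp flip: mult.assoc power_mult_distrib)
  then have "norm (complex_of_real ((\<integral>\<omega>. ?Z \<omega> ^ k \<partial>N) - D)) = norm (of_real ((- 1) ^ k * (\<integral>\<omega>. ?Z \<omega> ^ k \<partial>N)) - (deriv ^^ k) \<Phi> 0)"
    by (simp only: norm_mult norm_power norm_minus_cancel norm_one power_one mult_1_left)
  with 1 show "\<bar>(\<integral>\<omega>. ?Z \<omega> ^ k \<partial>N) - D\<bar> \<le> fact k * ?e1 / (b1 / 20 / 2) ^ k"
    unfolding norm_of_real r_def by simp
  have r20: "r \<le> bet n / 20" using \<beta> by (simp add: r_def)
  have "0 < bet n" using \<beta> b1 by linarith
  note ap = gauss_rate_approx_higher_deriv[OF this half r r20 k, folded Bn_def]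
  let ?E = "gauss_max_moment k (Bn n) / (1 + bet n * phi n) ^ (2 * k)
        + real k * (real k - 1) * gauss_max_moment (k - 1) (Bn n) * phi n / (1 + bet n * phi n) ^ (2 * k - 1)"
  have "norm ((deriv ^^ k) (\<lambda>s. \<Phi> s - gauss_rate_approx (bet n) (phi n) s) 0) \<le> fact k * (K' * (phi n)\<^sup>2) / (r / 2) ^ k"
    by (rule higher_deriv_bound[OF holomorphic_on_diff[OF \<Phi>_hol ap(1)] r]) (use K'' in \<open>simp add: \<Phi>_def\<close>)
  then have 2: "norm ((deriv ^^ k) \<Phi> 0 - (deriv ^^ k) (gauss_rate_approx (bet n) (phi n)) 0) \<le> fact k * (K' * (phi n)\<^sup>2) / (r / 2) ^ k"
    unfolding higher_deriv_diff[OF \<Phi>_hol ap(1) open_ball z] .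
  have "complex_of_real D - complex_of_real ?E = (- 1) ^ k * ((deriv ^^ k) \<Phi> 0 - (deriv ^^ k) (gauss_rate_approx (bet n) (phi n)) 0)"
    unfolding D ap(2)[symmetric] by (rule right_diff_distrib[symmetric])
  then have "complex_of_real (D - ?E) = (- 1) ^ k * ((deriv ^^ k) \<Phi> 0 - (deriv ^^ k) (gauss_rate_approx (bet n) (phi n)) 0)"
    by (simp only: of_real_diff)
  then have "norm (complex_of_real (D - ?E)) = norm ((deriv ^^ k) \<Phi> 0 - (deriv ^^ k) (gauss_rate_approx (bet n) (phi n)) 0)"
    by (simp only: norm_mult norm_power norm_minus_cancel norm_one power_one mult_1_left)
  with 2 show "\<bar>D - ?E\<bar> \<le> fact k * (K' * (phi n)\<^sup>2) / (b1 / 20 / 2) ^ k"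
    unfolding norm_of_real r_def by simp
qed

end

section \<open>Heavy traffic, choice of constants and assembly\<close>

lemma eventually_real_bounds:
  fixes c e :: real
  shows "0 < e \<Longrightarrow> \<forall>\<^sub>F n in sequentially. c / real n \<le> e"
    and "0 < e \<Longrightarrow> \<forall>\<^sub>F n in sequentially. c / sqrt (real n) \<le> e"
    and "\<forall>\<^sub>F n in sequentially. c \<le> real n / 2"
    and "\<forall>\<^sub>F n in sequentially. c \<le> sqrt (real n) / 2"
proof -
  have s: "filterlim (\<lambda>n. sqrt (real n)) at_top sequentially"
    by (rule filterlim_compose[OF sqrt_at_top filterlim_real_sequentially])
  have 1: "((\<lambda>n. c / real n) \<longlongrightarrow> 0) sequentially" and 2: "((\<lambda>n. c / sqrt (real n)) \<longlongrightarrow> 0) sequentially"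
    by (rule tendsto_divide_0[OF tendsto_const] filterlim_at_top_imp_at_infinity filterlim_real_sequentially s)+
  show "\<forall>\<^sub>F n in sequentially. c / real n \<le> e" if "0 < e"
    using order_tendstoD(2)[OF 1 that] by (rule eventually_mono) simp
  show "\<forall>\<^sub>F n in sequentially. c / sqrt (real n) \<le> e" if "0 < e"
    using order_tendstoD(2)[OF 2 that] by (rule eventually_mono) simp
  show "\<forall>\<^sub>F n in sequentially. c \<le> real n / 2"
    using filterlim_real_sequentially[unfolded filterlim_at_top, rule_format, of "2 * c"] by (rule eventually_mono) simp
  show "\<forall>\<^sub>F n in sequentially. c \<le> sqrt (real n) / 2"
    using s[unfolded filterlim_at_top, rule_format, of "2 * c"] by (rule eventually_mono) simp
qed

lemma heavy_traffic_ratio: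
  assumes "\<rho> \<in> {1/2..<1::real}" and "(1 - \<rho>) * sqrt (real n) \<in> {\<beta>\<^sub>1..\<beta>\<^sub>2}" and "1 \<le> n"
  shows "\<beta>\<^sub>1 / sqrt (real n) \<le> 1 / \<rho> - 1" "1 / \<rho> - 1 \<le> 2 * \<beta>\<^sub>2 / sqrt (real n)"
proof -
  have n: "0 < sqrt (real n)" using assms by simp
  have b: "\<beta>\<^sub>1 / sqrt (real n) \<le> 1 - \<rho>" "1 - \<rho> \<le> \<beta>\<^sub>2 / sqrt (real n)"
    using assms(2) n by (auto simp: field_simps)
  have eq: "1 / \<rho> - 1 = (1 - \<rho>) / \<rho>" using assms(1) by (simp add: field_simps)
  have "(1 - \<rho>) / 1 \<le> (1 - \<rho>) / \<rho>" using assms(1) by (intro divide_left_mono) auto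
  then show "\<beta>\<^sub>1 / sqrt (real n) \<le> 1 / \<rho> - 1" using b(1) unfolding eq by simp
  have "(1 - \<rho>) / \<rho> \<le> (1 - \<rho>) / (1/2)" using assms(1) by (intro divide_left_mono) auto
  then show "1 / \<rho> - 1 \<le> 2 * \<beta>\<^sub>2 / sqrt (real n)" using b(2) unfolding eq by simp
qed

context queue_input
begin

lemma mom_bound_2_pos: "0 < mom_bound 2"
  using mom_2_0[of 1] abs_mom(4)[of 1 0 2] sigma0_pos r0_pos by (auto simp: abs_le_iff)

text \<open>The queue changes with n, so \<open>tilted_walk\<close> is interpreted afresh for each
  large n. Its constants are fixed beforehand as functions of M, V, U,
  \<open>\<delta>\<^sub>0\<close>, \<delta>, \<epsilon> and a2, which is what makes the O(1/n)
  uniform.\<close>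

lemma saddle_moments:
  fixes \<rho> \<theta> \<sigma> \<phi> :: "nat \<Rightarrow> real" and N :: "nat \<Rightarrow> 'c measure"
  assumes \<delta>: "0 < \<delta>" and \<epsilon>: "0 < \<epsilon>" and \<beta>\<^sub>1: "0 < \<beta>\<^sub>1"
    and sep: "\<And>\<rho> \<theta> y. \<lbrakk>\<rho> \<in> {1/2..<1}; 0 < \<theta>; \<theta> \<le> \<delta>; \<bar>y\<bar> > \<delta>\<rbrakk> \<Longrightarrow> cmod (psi M V U \<rho> (Complex \<theta> y)) < mom \<rho> 0 \<theta> - \<epsilon>"
    and k: "1 \<le> k"
    and traffic: "\<forall>\<^sub>F n in sequentially. \<rho> n \<in> {1/2..<1} \<and> (1 - \<rho> n) * sqrt (real n) \<in> {\<beta>\<^sub>1..\<beta>\<^sub>2} \<and>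
      steady_state_waiting_time (distr M borel V) (distr M borel U) n (\<rho> n) (N n) (W n)"
    and saddle: "\<forall>\<^sub>F n in sequentially. 0 \<le> \<theta> n \<and> \<theta> n \<le> \<delta>\<^sub>1 \<and> \<theta> n \<le> \<delta> \<and> mom (\<rho> n) 1 (\<theta> n) = 0 \<and>
      \<sigma> n = sqrt (mom (\<rho> n) 2 (\<theta> n) / mom (\<rho> n) 0 (\<theta> n)) \<and>
      \<phi> n = mom (\<rho> n) 3 (\<theta> n) / mom (\<rho> n) 0 (\<theta> n) / (6 * (mom (\<rho> n) 2 (\<theta> n) / mom (\<rho> n) 0 (\<theta> n)))
        / (\<sigma> n * sqrt (real n))"
  defines "\<beta> \<equiv> \<lambda>n. \<theta> n * \<sigma> n * sqrt (real n)"
  defines "B \<equiv> \<lambda>n. \<beta> n / (1 + \<beta> n * \<phi> n)"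
  defines "E \<equiv> \<lambda>n. \<integral>\<omega>. (sqrt (real n) / \<sigma> n * W n \<omega>) ^ k \<partial>N n"
    and "D \<equiv> \<lambda>n. (- 1) ^ k * (deriv ^^ k) (\<lambda>s. gauss_max_laplace (B n) (s / ((1 + \<beta> n * \<phi> n) * (1 + (s + \<beta> n) * \<phi> n)))) 0"
    and "G \<equiv> \<lambda>n. gauss_max_moment k (B n) / (1 + \<beta> n * \<phi> n) ^ (2 * k)
      + real k * (real k - 1) * gauss_max_moment (k - 1) (B n) * \<phi> n / (1 + \<beta> n * \<phi> n) ^ (2 * k - 1)"
  shows "(\<lambda>n. E n - D n) \<in> O(\<lambda>n. 1 / real n)" and "(\<lambda>n. E n - G n) \<in> O(\<lambda>n. 1 / real n)"
proof -
  \<comment> \<open>From \<open>\<sigma>\<^sub>0 / 2 * \<theta> \<le> 1 / \<rho> - 1\<close> and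
    \<open>1 / \<rho> - 1 \<le> 2 * \<beta>\<^sub>2 / sqrt n\<close>. The lower bound
    \<open>b1\<close> combines \<theta> sqrt n \<ge> \<open>\<beta>\<^sub>1 / mom_bound 2\<close>
    with sig \<ge> \<open>sqrt (\<sigma>\<^sub>0 / 2)\<close>; the maximum in \<open>b2\<close>
    secures b1 \<le> b2 before any n is chosen.\<close>
  define a2 where "a2 = 4 * \<beta>\<^sub>2 / \<sigma>\<^sub>0"
  define b1 where "b1 = \<beta>\<^sub>1 / mom_bound 2 * sqrt (\<sigma>\<^sub>0 / 2)"
  define b2 where "b2 = max b1 (a2 * sqrt (2 * mom_bound 2))"
  define ca where "ca = tilted_walk.ca M V U \<delta>\<^sub>0"
  define bm where "bm = tilted_walk.bmax M V U \<delta>\<^sub>0 a2"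
  define C\<phi> where "C\<phi> = tilted_walk.C\<phi> M V U \<delta>\<^sub>0"
  define C3 where "C3 = tilted_walk.C3 M V U \<delta>\<^sub>0 a2"
  define C4 where "C4 = tilted_walk.C4 M V U \<delta>\<^sub>0 \<delta> \<epsilon> a2"
  have b1: "0 < b1" using \<beta>\<^sub>1 mom_bound_2_pos sigma0_pos by (simp add: b1_def)
  have b12: "b1 \<le> b2" by (simp add: b2_def)
  obtain K \<eta> where \<eta>: "0 < \<eta>" and K: "0 \<le> K" and
    pert: "transform_perturbation_bound b1 b2 \<eta> K"
    by (rule transform_perturbation[OF b1 b12])
  obtain K' where K': "0 \<le> K'"
    "\<And>\<beta> \<phi> s. \<lbrakk>b1 \<le> \<beta>; \<bar>\<beta> * \<phi>\<bar> \<le> 1 / 2; norm s < b1 / 20\<rbrakk> \<Longrightarrow>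
      norm (gauss_mgf 0 (\<beta> / (1 + \<beta> * \<phi>)) (- rate_map \<beta> \<phi> s)) \<le> K' \<and>
      norm (gauss_mgf 0 (\<beta> / (1 + \<beta> * \<phi>)) (- rate_map \<beta> \<phi> s) - gauss_rate_approx \<beta> \<phi> s) \<le> K' * \<phi>\<^sup>2"
    by (rule gauss_rate_expansion[OF b1]) blast
  \<comment> \<open>An upper bound for exp (-B^2 / 2), since B \<ge> b1 / 2. Allowing m^n an error
    of (1 - Q) / 2 keeps it at most (1 + Q) / 2 < 1, the drift condition of the rescaled
    queue.\<close>
  define Q where "Q = exp (- (b1 / 2)\<^sup>2 / 2)"
  have Q: "Q < 1" using b1 by (simp add: Q_def)
  define T where "T = fact k / (b1 / 20 / 2) ^ k"
  have T: "0 \<le> T" using b1 by (simp add: T_def)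
  define C where "C = T * (4 * K' * (K * (C4 + C\<phi>\<^sup>2))) + T * (K' * C\<phi>\<^sup>2)"
  have "\<forall>\<^sub>F n in sequentially. 2 \<le> n \<and> ca * a2\<^sup>2 \<le> real n / 2 \<and> bm * C\<phi> \<le> sqrt (real n) / 2 \<and>
      C\<phi> / sqrt (real n) \<le> \<eta> \<and> C4 / real n \<le> \<eta> \<and> K * (C4 + C\<phi>\<^sup>2) / real n \<le> 1 \<and> C3 / real n \<le> (1 - Q) / 2"
    using \<eta> Q by (intro eventually_conj eventually_real_bounds eventually_ge_at_top) auto
  then have main: "\<forall>\<^sub>F n in sequentially. \<bar>E n - D n\<bar> \<le> C / real n \<and> \<bar>D n - G n\<bar> \<le> C / real n"
    using traffic saddle
  proof eventually_elim
    case (elim n)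
    note * = elim(1)
    have \<rho>: "\<rho> n \<in> {1/2..<1}" and traffic: "(1 - \<rho> n) * sqrt (real n) \<in> {\<beta>\<^sub>1..\<beta>\<^sub>2}"
      and W: "steady_state_waiting_time (distr M borel V) (distr M borel U) n (\<rho> n) (N n) (W n)"
      using elim(2) by auto
    have \<theta>: "0 \<le> \<theta> n" "\<theta> n \<le> \<delta>\<^sub>1" "\<theta> n \<le> \<delta>" and saddle: "mom (\<rho> n) 1 (\<theta> n) = 0"
      and \<sigma>: "\<sigma> n = sqrt (mom (\<rho> n) 2 (\<theta> n) / mom (\<rho> n) 0 (\<theta> n))"
      and \<phi>: "\<phi> n = mom (\<rho> n) 3 (\<theta> n) / mom (\<rho> n) 0 (\<theta> n) / (6 * (mom (\<rho> n) 2 (\<theta> n) / mom (\<rho> n) 0 (\<theta> n)))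
        / (\<sigma> n * sqrt (real n))"
      using elim(3) by blast+
    note sb = saddle_bounds[OF \<rho> \<theta>(1,2) saddle]
    interpret tw: tilted_walk M V U \<delta>\<^sub>0 "\<rho> n" "\<theta> n" \<delta> \<epsilon>
      by standard (use \<rho> sb(1) \<theta> saddle \<delta> \<epsilon> sep in auto)
    have n: "2 \<le> n" "1 \<le> n" and n0: "0 < real n" and sn: "0 < sqrt (real n)" using * by auto
    have \<sigma>': "\<sigma> n = tw.sig" by (simp add: \<sigma> tw.sig_def tw.s2_def tw.m_def)
    have \<beta>': "\<beta> n = tw.bet n" by (simp add: \<beta>_def \<sigma>' tw.bet_def)
    have \<phi>': "\<phi> n = tw.phi n" by (simp add: \<phi> \<sigma>' tw.phi_def tw.mu3_def tw.s2_def tw.m_def)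
    have B': "B n = tw.Bn n" by (simp add: B_def \<beta>' \<phi>' tw.Bn_def)
    note ht = heavy_traffic_ratio[OF \<rho> traffic n(2)]
    have "\<sigma>\<^sub>0 / 2 * \<theta> n \<le> 2 * \<beta>\<^sub>2 / sqrt (real n)" using sb(2) ht(2) by linarith
    then have up: "\<theta> n \<le> a2 / sqrt (real n)" using sn sigma0_pos by (simp add: a2_def field_simps)
    have "\<beta>\<^sub>1 / sqrt (real n) \<le> mom_bound 2 * \<theta> n" using sb(3) ht(1) by linarith
    then have low: "\<beta>\<^sub>1 / mom_bound 2 \<le> \<theta> n * sqrt (real n)" using sn mom_bound_2_pos by (simp add: field_simps)
    have up': "\<theta> n * sqrt (real n) \<le> a2" using up sn by (simp add: field_simps)
    have bet: "tw.bet n = (\<theta> n * sqrt (real n)) * tw.sig" by (simp add: tw.bet_def)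
    have "tw.sig \<le> sqrt (2 * mom_bound 2)" using tw.s2_bounds(2) by (simp add: tw.sig_def)
    then have "tw.bet n \<le> a2 * sqrt (2 * mom_bound 2)"
      unfolding bet using up' tw.sig_bounds(1) \<theta> sn order_trans[OF mult_nonneg_nonneg[of "\<theta> n" "sqrt (real n)"] up']
      by (intro mult_mono) auto
    moreover have "b1 \<le> tw.bet n"
      unfolding bet b1_def using low tw.sig_bounds \<theta> sn sigma0_pos by (intro mult_mono) auto
    ultimately have bet_in: "tw.bet n \<in> {b1..b2}" by (auto simp: b2_def)
    have small: "tw.ca * a2\<^sup>2 \<le> real n / 2" "tw.bmax a2 * tw.C\<phi> \<le> sqrt (real n) / 2"
      using * by (auto simp: ca_def bm_def C\<phi>_def)
    note ph = tw.phi_bound[OF n(2)]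
    have eta: "\<bar>tw.phi n\<bar> \<le> \<eta>" "tw.C4 a2 / real n \<le> \<eta>" using ph(1) * by (auto simp: C\<phi>_def C4_def)
    have "0 \<le> tw.C3 a2 / real n" using tw.m_power(1)[OF n(2) up small] abs_ge_zero order_trans by blast
    then have "0 \<le> tw.C3 a2" using n0 by (simp add: zero_le_divide_iff)
    then have C4: "0 \<le> tw.C4 a2" using tw.const_nonneg by (simp add: tw.C4_def)
    have sum: "tw.C4 a2 / real n + (tw.phi n)\<^sup>2 \<le> (C4 + C\<phi>\<^sup>2) / real n"
      using ph(3) by (simp add: C4_def C\<phi>_def add_divide_distrib)
    then have Ksum: "K * (tw.C4 a2 / real n + (tw.phi n)\<^sup>2) \<le> K * (C4 + C\<phi>\<^sup>2) / real n"
      using mult_left_mono[OF sum K] by simp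
    have half: "\<bar>tw.bet n * tw.phi n\<bar> \<le> 1 / 2" by (rule tw.m_power(2)[OF n(2) up small])
    have "b1 \<le> tw.bet n" using bet_in by simp
    from rate_map_bounds(3)[OF b1 this half, of 0] have Bn: "b1 / 2 \<le> tw.Bn n" using b1 by (simp add: tw.Bn_def)
    have "(b1 / 2)\<^sup>2 \<le> (tw.Bn n)\<^sup>2" using Bn b1 by (intro power_mono) auto
    then have "exp (- (tw.Bn n)\<^sup>2 / 2) \<le> Q" by (simp add: Q_def)
    then have drift: "tw.m ^ n < 1"
    proof -
      have "\<bar>tw.m ^ n - exp (- (tw.Bn n)\<^sup>2 / 2)\<bar> \<le> (1 - Q) / 2"
        using tw.m_power(1)[OF n(2) up small] * unfolding C3_def by linarith
      then have "tw.m ^ n \<le> exp (- (tw.Bn n)\<^sup>2 / 2) + (1 - Q) / 2" by (simp only: abs_le_iff diff_le_eq add.commute)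
      also have "\<dots> \<le> Q + (1 - Q) / 2" by (rule add_right_mono) fact
      also have "\<dots> = (Q + 1) / 2" by (simp add: field_simps)
      also have "\<dots> < 1" using Q by (simp add: field_simps)
      finally show ?thesis .
    qed
    note mc = tw.moment_comparison[OF n(1) up small b1 bet_in pert eta K C4 order_trans[OF Ksum] drift W K' k]
    have le1: "\<bar>E n - D n\<bar> \<le> fact k * (4 * K' * (K * (tw.C4 a2 / real n + (tw.phi n)\<^sup>2))) / (b1 / 20 / 2) ^ k"
      unfolding E_def D_def \<sigma>' \<beta>' \<phi>' B' by (rule mc(1)) (use * in auto)
    have le2: "\<bar>D n - G n\<bar> \<le> fact k * (K' * (tw.phi n)\<^sup>2) / (b1 / 20 / 2) ^ k"
      unfolding D_def G_def \<beta>' \<phi>' B' by (rule mc(2)) (use * in auto)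
    have n1: "0 \<le> T * (4 * K' * (K * (C4 + C\<phi>\<^sup>2)))" "0 \<le> T * (K' * C\<phi>\<^sup>2)"
      using T K K' C4 by (auto simp: C4_def)
    have "fact k * (4 * K' * (K * (tw.C4 a2 / real n + (tw.phi n)\<^sup>2))) / (b1 / 20 / 2) ^ k
        = T * (4 * K' * (K * (tw.C4 a2 / real n + (tw.phi n)\<^sup>2)))" by (simp add: T_def)
    also have "\<dots> \<le> T * (4 * K' * (K * (C4 + C\<phi>\<^sup>2) / real n))"
      using T K' by (intro mult_left_mono Ksum) auto
    also have "\<dots> = T * (4 * K' * (K * (C4 + C\<phi>\<^sup>2))) / real n" by simp
    also have "\<dots> \<le> C / real n" using n1 n0 by (intro divide_right_mono) (auto simp: C_def)
    finally have e1: "fact k * (4 * K' * (K * (tw.C4 a2 / real n + (tw.phi n)\<^sup>2))) / (b1 / 20 / 2) ^ k \<le> C / real n" .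
    have "fact k * (K' * (tw.phi n)\<^sup>2) / (b1 / 20 / 2) ^ k = T * (K' * (tw.phi n)\<^sup>2)" by (simp add: T_def)
    also have "\<dots> \<le> T * (K' * (C\<phi>\<^sup>2 / real n))"
      using T K' ph(3) by (intro mult_left_mono) (auto simp: C\<phi>_def)
    also have "\<dots> = T * (K' * C\<phi>\<^sup>2) / real n" by simp
    also have "\<dots> \<le> C / real n" using n1 n0 by (intro divide_right_mono) (auto simp: C_def)
    finally have e2: "fact k * (K' * (tw.phi n)\<^sup>2) / (b1 / 20 / 2) ^ k \<le> C / real n" .
    show ?case using order_trans[OF le1 e1] order_trans[OF le2 e2] by blast
  qed
  show ED: "(\<lambda>n. E n - D n) \<in> O(\<lambda>n. 1 / real n)"
    by (rule bigoI[of _ C], rule eventually_mono[OF main]) auto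
  have "(\<lambda>n. D n - G n) \<in> O(\<lambda>n. 1 / real n)"
    by (rule bigoI[of _ C], rule eventually_mono[OF main]) auto
  then have "(\<lambda>n. (E n - D n) + (D n - G n)) \<in> O(\<lambda>n. 1 / real n)" by (rule sum_in_bigo[OF ED])
  then show "(\<lambda>n. E n - G n) \<in> O(\<lambda>n. 1 / real n)" by simp
qed

end

theorem theorem5:
  fixes M :: "'a measure" and V U :: "'a \<Rightarrow> real"
    and \<delta>\<^sub>0 \<beta>\<^sub>1 \<beta>\<^sub>2 :: real and \<rho> :: "nat \<Rightarrow> real"
    and N :: "nat \<Rightarrow> 'b measure" and W :: "nat \<Rightarrow> 'b \<Rightarrow> real"
  assumes "prob_space M"
    and "prob_space.indep_var M borel V borel U"
    and "AE \<omega> in M. 0 \<le> V \<omega>" and "AE \<omega> in M. 0 \<le> U \<omega>"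
    and "prob_space.expectation M V = 1" and "prob_space.expectation M U = 1"
    and "integrable M (\<lambda>\<omega>. (V \<omega>)\<^sup>2)" and "integrable M (\<lambda>\<omega>. (U \<omega>)\<^sup>2)"
    and "0 < prob_space.variance M V + prob_space.variance M U"
    and "\<delta>\<^sub>0 > 0"
    and "mgf_analytic_on_strip M V \<delta>\<^sub>0" and "mgf_analytic_on_strip M U \<delta>\<^sub>0"
    and "separation_assumption M V U"
    and "\<And>n. n \<ge> 1 \<Longrightarrow> \<rho> n \<in> {0<..<1}"
    and "0 < \<beta>\<^sub>1" and "\<beta>\<^sub>1 \<le> \<beta>\<^sub>2"
    and "\<And>n. n \<ge> 1 \<Longrightarrow> (1 - \<rho> n) * sqrt (real n) \<in> {\<beta>\<^sub>1..\<beta>\<^sub>2}"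
    and "\<And>n. n \<ge> 1 \<Longrightarrow>
           steady_state_waiting_time (distr M borel V) (distr M borel U) n (\<rho> n) (N n) (W n)"
  shows "\<exists>\<delta>\<^sub>1>0. \<forall>\<delta>'. 0 < \<delta>' \<and> \<delta>' \<le> \<delta>\<^sub>1 \<longrightarrow>
    (\<forall>\<^sub>F n in sequentially. \<exists>!\<zeta>. is_saddle_point (log_psi M V U (\<rho> n)) \<delta>' \<zeta>) \<and>
    (\<forall>\<zeta>\<^sub>s\<^sub>p :: nat \<Rightarrow> real.
      (\<forall>\<^sub>F n in sequentially. is_saddle_point (log_psi M V U (\<rho> n)) \<delta>' (\<zeta>\<^sub>s\<^sub>p n)) \<longrightarrow>
      (let h = (\<lambda>n. log_psi M V U (\<rho> n));
           \<sigma> = (\<lambda>n. sqrt ((deriv ^^ 2) (h n) (\<zeta>\<^sub>s\<^sub>p n)));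
           \<beta> = (\<lambda>n. - \<zeta>\<^sub>s\<^sub>p n * \<sigma> n * sqrt (real n));
           d\<^sub>2 = (\<lambda>n. - (deriv ^^ 3) (h n) (\<zeta>\<^sub>s\<^sub>p n) / (6 * (deriv ^^ 2) (h n) (\<zeta>\<^sub>s\<^sub>p n)));
           \<phi> = (\<lambda>n. d\<^sub>2 n / (\<sigma> n * sqrt (real n)));
           B = (\<lambda>n. \<beta> n / (1 + \<beta> n * \<phi> n));
           R = (\<lambda>n s. s / ((1 + \<beta> n * \<phi> n) * (1 + (s + \<beta> n) * \<phi> n)));
           EW = (\<lambda>k n. \<integral>\<omega>. (sqrt (real n) / \<sigma> n * W n \<omega>) ^ k \<partial>N n)
       in \<forall>k\<ge>1.
         (\<lambda>n. EW k n - (- 1) ^ k * (deriv ^^ k) (\<lambda>s. gauss_max_laplace (B n) (R n s)) 0)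
           \<in> O(\<lambda>n. 1 / real n) \<and>
         (\<lambda>n. EW k n -
            (gauss_max_moment k (B n) / (1 + \<beta> n * \<phi> n) ^ (2 * k)
             + real k * (real k - 1) * gauss_max_moment (k - 1) (B n) * \<phi> n
               / (1 + \<beta> n * \<phi> n) ^ (2 * k - 1)))
           \<in> O(\<lambda>n. 1 / real n)))"
proof -
  interpret queue_input M V U \<delta>\<^sub>0
    by (intro queue_input.intro queue_input_axioms.intro assms)
  note \<rho>_range = assms(14) and \<beta>_pos = assms(15,16) and traffic = assms(17) and W = assms(18)
  obtain \<delta> \<epsilon> where \<delta>: "0 < \<delta>" and \<epsilon>: "0 < \<epsilon>" and
    *: "\<forall>\<rho>\<in>{1/2..<1}. \<forall>x\<in>{-\<delta>..<0}. \<forall>y::real. \<bar>y\<bar> > \<delta> \<longrightarrow>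
       cmod (psi M V U \<rho> (Complex (- x) y)) < Re (psi M V U \<rho> (of_real (- x))) - \<epsilon>"
    using assms(13) unfolding separation_assumption_def by blast
  have sep: "cmod (psi M V U \<rho> (Complex \<theta> y)) < mom \<rho> 0 \<theta> - \<epsilon>"
    if "\<rho> \<in> {1/2..<1}" "0 < \<theta>" "\<theta> \<le> \<delta>" "\<bar>y\<bar> > \<delta>" for \<rho> \<theta> y
  proof -
    have "- \<theta> \<in> {- \<delta>..<0}" using that by simp
    then have "cmod (psi M V U \<rho> (Complex (- (- \<theta>)) y)) < Re (psi M V U \<rho> (of_real (- (- \<theta>)))) - \<epsilon>"
      using * that by blast
    then show ?thesis by (simp only: psi_of_real mgf_mom minus_minus Re_complex_of_real)
  qed
  \<comment> \<open>Separation and the uniform moment bounds concern \<rho> \<ge> 1/2; heavy traffic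
    brings \<rho> into this range for large n.\<close>
  have range: "\<forall>\<^sub>F n in sequentially. 1 \<le> n \<and> \<rho> n \<in> {1/2..<1}"
    using eventually_real_bounds(2)[OF half_gt_zero[OF zero_less_one], of \<beta>\<^sub>2] eventually_ge_at_top[of 1]
  proof eventually_elim
    case (elim n)
    then have "(1 - \<rho> n) \<le> \<beta>\<^sub>2 / sqrt (real n)" using traffic[of n] by (simp add: field_simps)
    then have "1 - \<rho> n \<le> 1 / 2" using elim(1) by linarith
    then show ?case using elim \<rho>_range[of n] by auto
  qed
  show ?thesis
  \<comment> \<open>Up to \<open>\<delta>\<^sub>1\<close> the saddle point equation is monotone; up
    to \<delta> separation is available at the saddle point itself.\<close>
  proof (intro exI[of _ "min \<delta>\<^sub>1 \<delta>"] conjI allI impI)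
    show "0 < min \<delta>\<^sub>1 \<delta>" using delta1_bounds(1) \<delta> by simp
    fix \<delta>' assume "0 < \<delta>' \<and> \<delta>' \<le> min \<delta>\<^sub>1 \<delta>"
    then have \<delta>': "0 < \<delta>'" "\<delta>' \<le> \<delta>\<^sub>1" "\<delta>' \<le> \<delta>" by auto
    \<comment> \<open>Half of the threshold in \<open>saddle_unique_existence\<close>, since the
      eventual bound is weak and that lemma asks for a strict inequality.\<close>
    have "0 < \<sigma>\<^sub>0 / 2 * \<delta>' / 2" using sigma0_pos \<delta>' by simp
    from range eventually_real_bounds(2)[OF this, of "2 * \<beta>\<^sub>2"]
    show "\<forall>\<^sub>F n in sequentially. \<exists>!\<zeta>. is_saddle_point (log_psi M V U (\<rho> n)) \<delta>' \<zeta>"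
    proof eventually_elim
      case (elim n)
      then have \<rho>: "\<rho> n \<in> {1/2..<1}" "\<rho> n \<in> {1/2..1}" by auto
      have "1 / \<rho> n - 1 \<le> 2 * \<beta>\<^sub>2 / sqrt (real n)"
        using heavy_traffic_ratio(2)[OF \<rho>(1) traffic[of n]] elim by simp
      then have "1 / \<rho> n - 1 < \<sigma>\<^sub>0 / 2 * \<delta>'" using elim(2) \<open>0 < \<sigma>\<^sub>0 / 2 * \<delta>' / 2\<close> by linarith
      from saddle_unique_existence[OF \<rho>(1) \<delta>'(1,2) this]
      obtain \<theta> where \<theta>: "\<theta> \<in> {0..\<delta>'} \<and> mom (\<rho> n) 1 \<theta> = 0"
        and unique: "\<And>\<theta>'. \<theta>' \<in> {0..\<delta>'} \<and> mom (\<rho> n) 1 \<theta>' = 0 \<Longrightarrow> \<theta>' = \<theta>" by (auto elim!: ex1E)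
      show ?case unfolding is_saddle_point_iff[OF \<rho>(2) \<delta>'(2)]
      proof (rule ex1I[of _ "- \<theta>"])
        show "- (- \<theta>) \<in> {0..\<delta>'} \<and> mom (\<rho> n) 1 (- (- \<theta>)) = 0" using \<theta> by (simp only: minus_minus)
        fix \<zeta> assume "- \<zeta> \<in> {0..\<delta>'} \<and> mom (\<rho> n) 1 (- \<zeta>) = 0"
        from unique[OF this] show "\<zeta> = - \<theta>" by simp
      qed
    qed
    fix \<zeta>\<^sub>s\<^sub>p :: "nat \<Rightarrow> real"
    assume saddle: "\<forall>\<^sub>F n in sequentially. is_saddle_point (log_psi M V U (\<rho> n)) \<delta>' (\<zeta>\<^sub>s\<^sub>p n)"
    show "let h = (\<lambda>n. log_psi M V U (\<rho> n));
           \<sigma> = (\<lambda>n. sqrt ((deriv ^^ 2) (h n) (\<zeta>\<^sub>s\<^sub>p n)));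
           \<beta> = (\<lambda>n. - \<zeta>\<^sub>s\<^sub>p n * \<sigma> n * sqrt (real n));
           d\<^sub>2 = (\<lambda>n. - (deriv ^^ 3) (h n) (\<zeta>\<^sub>s\<^sub>p n) / (6 * (deriv ^^ 2) (h n) (\<zeta>\<^sub>s\<^sub>p n)));
           \<phi> = (\<lambda>n. d\<^sub>2 n / (\<sigma> n * sqrt (real n)));
           B = (\<lambda>n. \<beta> n / (1 + \<beta> n * \<phi> n));
           R = (\<lambda>n s. s / ((1 + \<beta> n * \<phi> n) * (1 + (s + \<beta> n) * \<phi> n)));
           EW = (\<lambda>k n. \<integral>\<omega>. (sqrt (real n) / \<sigma> n * W n \<omega>) ^ k \<partial>N n)
       in \<forall>k\<ge>1.
         (\<lambda>n. EW k n - (- 1) ^ k * (deriv ^^ k) (\<lambda>s. gauss_max_laplace (B n) (R n s)) 0)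
           \<in> O(\<lambda>n. 1 / real n) \<and>
         (\<lambda>n. EW k n -
            (gauss_max_moment k (B n) / (1 + \<beta> n * \<phi> n) ^ (2 * k)
             + real k * (real k - 1) * gauss_max_moment (k - 1) (B n) * \<phi> n
               / (1 + \<beta> n * \<phi> n) ^ (2 * k - 1)))
           \<in> O(\<lambda>n. 1 / real n)"
      unfolding Let_def
    proof (intro allI impI, goal_cases)
      case (1 k)
      then have k: "1 \<le> k" .
      define h where "h = (\<lambda>n. log_psi M V U (\<rho> n))"
      define \<sigma> where "\<sigma> = (\<lambda>n. sqrt ((deriv ^^ 2) (h n) (\<zeta>\<^sub>s\<^sub>p n)))"
      define \<phi> where "\<phi> = (\<lambda>n. - (deriv ^^ 3) (h n) (\<zeta>\<^sub>s\<^sub>p n) / (6 * (deriv ^^ 2) (h n) (\<zeta>\<^sub>s\<^sub>p n)) / (\<sigma> n * sqrt (real n)))"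
      have traffic': "\<forall>\<^sub>F n in sequentially. \<rho> n \<in> {1/2..<1} \<and> (1 - \<rho> n) * sqrt (real n) \<in> {\<beta>\<^sub>1..\<beta>\<^sub>2} \<and>
          steady_state_waiting_time (distr M borel V) (distr M borel U) n (\<rho> n) (N n) (W n)"
        using range by eventually_elim (use traffic W in blast)
      have "\<forall>\<^sub>F n in sequentially. 0 \<le> - \<zeta>\<^sub>s\<^sub>p n \<and> - \<zeta>\<^sub>s\<^sub>p n \<le> \<delta>\<^sub>1 \<and> - \<zeta>\<^sub>s\<^sub>p n \<le> \<delta> \<and> mom (\<rho> n) 1 (- \<zeta>\<^sub>s\<^sub>p n) = 0 \<and>
          \<sigma> n = sqrt (mom (\<rho> n) 2 (- \<zeta>\<^sub>s\<^sub>p n) / mom (\<rho> n) 0 (- \<zeta>\<^sub>s\<^sub>p n)) \<and>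
          \<phi> n = mom (\<rho> n) 3 (- \<zeta>\<^sub>s\<^sub>p n) / mom (\<rho> n) 0 (- \<zeta>\<^sub>s\<^sub>p n)
            / (6 * (mom (\<rho> n) 2 (- \<zeta>\<^sub>s\<^sub>p n) / mom (\<rho> n) 0 (- \<zeta>\<^sub>s\<^sub>p n))) / (\<sigma> n * sqrt (real n))"
        using range saddle
      proof eventually_elim
        case (elim n)
        then have \<rho>: "\<rho> n \<in> {1/2..1}" by auto
        have \<theta>: "- \<zeta>\<^sub>s\<^sub>p n \<in> {0..\<delta>'}" "mom (\<rho> n) 1 (- \<zeta>\<^sub>s\<^sub>p n) = 0"
          using elim(2) unfolding is_saddle_point_iff[OF \<rho> \<delta>'(2)] by auto
        then have "\<bar>\<zeta>\<^sub>s\<^sub>p n\<bar> < r\<^sub>0" using \<delta>' delta1_bounds by auto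
        note ld = log_psi_derivs(2,3)[OF \<rho> this \<theta>(2)]
        have "0 \<le> - \<zeta>\<^sub>s\<^sub>p n" "- \<zeta>\<^sub>s\<^sub>p n \<le> \<delta>\<^sub>1" "- \<zeta>\<^sub>s\<^sub>p n \<le> \<delta>" using \<theta>(1) \<delta>' by auto
        moreover have "\<sigma> n = sqrt (mom (\<rho> n) 2 (- \<zeta>\<^sub>s\<^sub>p n) / mom (\<rho> n) 0 (- \<zeta>\<^sub>s\<^sub>p n))"
          unfolding \<sigma>_def h_def ld(1) ..
        \<comment> \<open>Two signs cancel: the one in the definition of d_2 and the one that the
          third derivative acquires from \<zeta> = - \<theta>.\<close>
        moreover have "- (- a / b) = a / b" for a b :: real by simp
        then have "\<phi> n = mom (\<rho> n) 3 (- \<zeta>\<^sub>s\<^sub>p n) / mom (\<rho> n) 0 (- \<zeta>\<^sub>s\<^sub>p n)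
            / (6 * (mom (\<rho> n) 2 (- \<zeta>\<^sub>s\<^sub>p n) / mom (\<rho> n) 0 (- \<zeta>\<^sub>s\<^sub>p n))) / (\<sigma> n * sqrt (real n))"
          unfolding \<phi>_def h_def ld by (simp only:)
        ultimately show ?case using \<theta>(2) by blast
      qed
      note sm = saddle_moments[OF \<delta> \<epsilon> \<beta>_pos(1) sep k traffic' this]
      show ?case
        using sm unfolding \<phi>_def \<sigma>_def h_def by (rule conjI)
    qed
  qed
qed

end
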